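(* Let $(I_1,\dots,I_N,L_1,\dots,L_N)\in\Omega_N$ and for $n=1,\dots,2N$ set $$j_{2n}=\sum_{j=1}^N2^{-n}I_j^n\Big(1-\frac{L_j}{I_j}\Big)\prod_{k\ne j}\frac{L_k-I_j}{I_k-I_j}.$$ Then $\mathbf T:=\mathbf T(I_1,\dots,I_N,L_1,\dots,L_N)$ is exactly the set of solutions $u\in H^{1/2}_+$ of the minimization problem $$\inf\{M(u):\ u\in H^{1/2}_+,\ J_{2n}(u)=j_{2n},\ n=1,\dots,2N\}.$$ Consequently $\mathbf T$ is stable under the cubic Szegő flow: for every $\varepsilon>0$ there is $\delta>0$ such that if $\inf_{v\in\mathbf T}\|u_0-v\|_{H^{1/2}}\le\delta$, then the solution $u$ of $i\partial_tu=\Pi(|u|^2u)$ with $u(0)=u_0$ satisfies $\sup_{t\in\mathbb R}\inf_{v\in\mathbf T}\|u(t)-v\|_{H^{1/2}}\le\varepsilon$.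
   Context: $L^2_+$ is the Hardy space of the circle, $(u|v)=\int u\bar v\frac{d\theta}{2\pi}$, $H^{1/2}_+=H^{1/2}\cap L^2_+$, $\Pi$ the Szegő projector; the equation $i\partial_tu=\Pi(|u|^2u)$ is globally well-posed on $H^{1/2}_+$. $H_u(h)=\Pi(u\bar h)$ (antilinear Hankel operator), $K_u=H_uT_z$ with $T_z$ multiplication by $z$. $J_{2n}(u)=(H_u^{2n}(1)|1)$ and $M(u)=(-i\partial_\theta u|u)=\sum_{k\ge0}k|\hat u(k)|^2$. $\Omega_N=\{(I,L)\in\mathbb R^{2N}: I_1>L_1>I_2>\dots>I_N>L_N>0\}$. $\mathcal M(N)$: rational $u=A/B$ with $A\in\mathbb C_{N-1}[z]$, $B\in\mathbb C_N[z]$, $B(0)=1$, $\deg A=N-1$ or $\deg B=N$, coprime, $B\ne0$ on the closed unit disc. $\mathcal M(N)_{\rm gen}$: those $u\in\mathcal M(N)$ with $1\notin\mathrm{Ran}H_u$ and $H_u^{2k}(1)$, $k=1..N$, independent; for such $u$, $H_u^2$ and $K_u^2$ each have $N$ simple positive eigenvalues $\lambda_1^2>\dots>\lambda_N^2$, $\mu_1^2>\dots>\mu_N^2$, orthonormal bases $H_ue_j=\lambda_je_j$, $K_uf_m=\mu_mf_m$ of $\mathrm{Ran}H_u$, angles $\varphi_j=\arg(1|e_j)^2$, $\theta_m=\arg(u|f_m)^2$, and $\chi_N(u)=(2\lambda_j^2,2\mu_m^2;\varphi_j,\theta_m)\in\Omega_N\times\mathbb T^{2N}$ (a bijection). $\mathbf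 T(I,L):=\chi_N^{-1}(\{(I,L)\}\times\mathbb T^{2N})$. *)

theory Defs
  imports "HOL-Analysis.Analysis" "HOL-Computational_Algebra.Computational_Algebra"
begin

text \<open>Elements of the Hardy space L2_+ are represented by their sequence of
Fourier coefficients u k = hat u(k), k >= 0 (Parseval identification).\<close>

definition l2p :: "(nat \<Rightarrow> complex) \<Rightarrow> bool" where
  "l2p u \<longleftrightarrow> summable (\<lambda>k. (cmod (u k))\<^sup>2)"

definition H12 :: "(nat \<Rightarrow> complex) \<Rightarrow> bool" where
  "H12 u \<longleftrightarrow> summable (\<lambda>k. (1 + real k) * (cmod (u k))\<^sup>2)"

definition h12norm :: "(nat \<Rightarrow> complex) \<Rightarrow> real" where
  "h12norm u = sqrt (\<Sum>k. (1 + real k) * (cmod (u k))\<^sup>2)"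

text \<open>M(u) = (-i d/dtheta u | u) = sum k |hat u(k)|^2\<close>
definition Mfun :: "(nat \<Rightarrow> complex) \<Rightarrow> real" where
  "Mfun u = (\<Sum>k. real k * (cmod (u k))\<^sup>2)"

definition one_seq :: "nat \<Rightarrow> complex" where
  "one_seq k = (if k = 0 then 1 else 0)"

text \<open>Hankel operator H_u h = Pi(u conj h): coefficient n is sum_k hat u(n+k) conj(hat h(k))\<close>
definition Hank :: "(nat \<Rightarrow> complex) \<Rightarrow> (nat \<Rightarrow> complex) \<Rightarrow> (nat \<Rightarrow> complex)" where
  "Hank u h = (\<lambda>n. \<Sum>k. u (n + k) * cnj (h k))"

definition Tz :: "(nat \<Rightarrow> complex) \<Rightarrow> (nat \<Rightarrow> complex)" where
  "Tz h = (\<lambda>k. if k = 0 then 0 else h (k - 1))"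

definition Kank :: "(nat \<Rightarrow> complex) \<Rightarrow> (nat \<Rightarrow> complex) \<Rightarrow> (nat \<Rightarrow> complex)" where
  "Kank u h = Hank u (Tz h)"

text \<open>J_{2n}(u) = (H_u^{2n}(1) | 1) = zeroth coefficient of H_u^{2n}(1)\<close>
definition Jfun :: "nat \<Rightarrow> (nat \<Rightarrow> complex) \<Rightarrow> complex" where
  "Jfun n u = ((Hank u ^^ (2 * n)) one_seq) 0"

text \<open>M(N): rational functions A/B as in the paper (the Fourier coefficients of
u are the Taylor coefficients of A/B at 0).\<close>
definition inM :: "nat \<Rightarrow> (nat \<Rightarrow> complex) \<Rightarrow> bool" where
  "inM N u \<longleftrightarrow> (\<exists>A B :: complex poly.
      degree A \<le> N - 1 \<and> degree B \<le> N \<and> poly B 0 = 1 \<and>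
      ((A \<noteq> 0 \<and> degree A = N - 1) \<or> degree B = N) \<and>
      coprime A B \<and> (\<forall>z. cmod z \<le> 1 \<longrightarrow> poly B z \<noteq> 0) \<and>
      Abs_fps u * fps_of_poly B = fps_of_poly A)"

definition RanH :: "(nat \<Rightarrow> complex) \<Rightarrow> (nat \<Rightarrow> complex) set" where
  "RanH u = {Hank u h | h. l2p h}"

definition inMgen :: "nat \<Rightarrow> (nat \<Rightarrow> complex) \<Rightarrow> bool" where
  "inMgen N u \<longleftrightarrow> inM N u \<and> one_seq \<notin> RanH u \<and>
     (\<forall>c :: nat \<Rightarrow> complex.
        (\<lambda>m. \<Sum>k=1..N. c k * (Hank u ^^ (2 * k)) one_seq m) = (\<lambda>m. 0)
        \<longrightarrow> (\<forall>k\<in>{1..N}. c k = 0))"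

definition posEigH2 :: "(nat \<Rightarrow> complex) \<Rightarrow> real set" where
  "posEigH2 u = {\<sigma>. \<sigma> > 0 \<and> (\<exists>h. l2p h \<and> h \<noteq> (\<lambda>k. 0) \<and>
       Hank u (Hank u h) = (\<lambda>k. complex_of_real \<sigma> * h k))}"

definition posEigK2 :: "(nat \<Rightarrow> complex) \<Rightarrow> real set" where
  "posEigK2 u = {\<sigma>. \<sigma> > 0 \<and> (\<exists>h. l2p h \<and> h \<noteq> (\<lambda>k. 0) \<and>
       Kank u (Kank u h) = (\<lambda>k. complex_of_real \<sigma> * h k))}"

definition OmegaN :: "nat \<Rightarrow> (nat \<Rightarrow> real) \<Rightarrow> (nat \<Rightarrow> real) \<Rightarrow> bool" where
  "OmegaN N I L \<longleftrightarrow> (\<forall>j\<in>{1..N}. I j > L j \<and> L j > 0) \<and>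
                     (\<forall>j\<in>{1..<N}. L j > I (j + 1))"

text \<open>T(I,L) = chi_N^{-1}({(I,L)} x T^{2N}): the u in M(N)_gen with
2 lambda_j^2 = I_j and 2 mu_m^2 = L_m (eigenvalues are simple, so as sets).\<close>
definition Tset :: "nat \<Rightarrow> (nat \<Rightarrow> real) \<Rightarrow> (nat \<Rightarrow> real) \<Rightarrow> (nat \<Rightarrow> complex) set" where
  "Tset N I L = {u. inMgen N u \<and>
      posEigH2 u = (\<lambda>j. I j / 2) ` {1..N} \<and> posEigK2 u = (\<lambda>m. L m / 2) ` {1..N}}"

definition jval :: "nat \<Rightarrow> (nat \<Rightarrow> real) \<Rightarrow> (nat \<Rightarrow> real) \<Rightarrow> nat \<Rightarrow> real" where
  "jval N I L n = (\<Sum>j=1..N. (1/2)^n * I j ^ n * (1 - L j / I j) *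
       (\<Prod>k\<in>{1..N} - {j}. (L k - I j) / (I k - I j)))"

text \<open>Fourier coefficients of Pi(|u|^2 u)\<close>
definition cubic :: "(nat \<Rightarrow> complex) \<Rightarrow> (nat \<Rightarrow> complex)" where
  "cubic u = (\<lambda>n. \<Sum>\<^sub>\<infinity>(k,l,m)\<in>{(k,l,m). k + m = l + n}. u k * cnj (u l) * u m)"

definition szego_sol :: "(real \<Rightarrow> nat \<Rightarrow> complex) \<Rightarrow> bool" where
  "szego_sol (u :: real \<Rightarrow> nat \<Rightarrow> complex) \<longleftrightarrow> (\<forall>t. H12 (u t)) \<and>
     (\<forall>t. ((\<lambda>s. h12norm (u s - u t)) \<longlongrightarrow> 0) (at t)) \<and>
     (\<forall>t n. ((\<lambda>s. u s n) has_vector_derivative (- \<i> * cubic (u t) n)) (at t))"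

end

theory Submission
  imports Defs "HOL-Library.Diagonal_Subsequence" "HOL-Real_Asymp.Real_Asymp"
begin

text \<open>The numbers \<open>J\<^sub>2\<^sub>n(u)\<close>, \<open>n \<le> 2N\<close>, are the Gram data of \<open>u, H\<^sub>u\<^sup>2u, \<dots>, H\<^sub>u\<^sup>2\<^sup>N\<^sup>-\<^sup>2u\<close>, so Lagrange
  interpolation in \<open>H\<^sub>u\<^sup>2\<close> yields an orthonormal family of \<open>N\<close> vectors in the range of \<open>H\<^sub>u\<close>. The
  momentum \<open>M(u)\<close> is the squared Hilbert-Schmidt norm of \<open>K\<^sub>u\<close>, and Bessel's inequality for the rows of \<open>K\<^sub>u\<close>
  bounds it below by a constant depending only on \<open>(I, L)\<close>. Equality forces every backward shift of \<open>u\<close> into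
  an \<open>N\<close>-dimensional space, i.e. \<open>u\<close> is rational with the prescribed spectral data. The bound is attained by
  an explicit realisation of the spectral data by real symmetric matrices.

  Along the flow the Lax identity conserves \<open>J\<^sub>2\<^sub>n\<close>. For stability it is enough that the
  momentum does not increase, which follows by testing the equation with logarithmically cut off weights.
  Sequences that are asymptotically admissible and minimising converge strongly along a subsequence in \<open>H\<^sup>1\<^sup>/\<^sup>2\<close>, because
  the \<open>J\<^sub>2\<^sub>n\<close> are weakly continuous and the norms converge.\<close>

section \<open>Weighted sequence spaces and Hankel operators\<close>

text \<open>The spectral part rests on K_u^2 = H_u^2 - (. | u) u. In an eigenbasis e_j of H_u^2 the
  eigenvalues of K_u^2 are the roots s of sum_j nu_j / (x_j - s) = 1 with nu_j = |(u | e_j)|^2, so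
  (x, y) and (x, nu) determine each other, and for u in the torus J_{2n} is the moment sum_j nu_j
  x_j^(n-1). The moments up to n = 2N are exactly those occurring in the Gram matrix of N Krylov
  vectors and in the matrix of H_u^2 on them. A minimiser is built backwards: with H = diag(sqrt x)
  and K the positive root of diag(x) - a a^T, where a_j^2 = nu_j, the matrix H^(-1) K has to be the
  compression of multiplication by z, and its powers give the Fourier coefficients. The obstacle in
  the dynamical part is low regularity. Functions in H^{1/2} need not be bounded, the time
  derivative of u is only known to be in L^2, and M(u) cannot be differentiated term by term. J_{2n}
  still can: the vectors H_u^q(1) lie in H^{1/4}, products of two such functions are in L^2, and the
  derivative of u is tested only against such products.\<close>

definition wsq :: "real \<Rightarrow> (nat \<Rightarrow> complex) \<Rightarrow> real" where
  "wsq s f = (\<Sum>k. (1 + real k) powr s * (cmod (f k))\<^sup>2)"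

text \<open>The Sobolev index is half the exponent: \<open>inW 0\<close> is L^2,
  \<open>inW (1/2)\<close> is H^{1/4} and \<open>inW 1\<close> is H^{1/2}. Since \<open>wsq\<close>
  is an unguarded series, its value is meaningful only together with \<open>inW\<close>.\<close>

definition inW :: "real \<Rightarrow> (nat \<Rightarrow> complex) \<Rightarrow> bool" where
  "inW s f \<longleftrightarrow> summable (\<lambda>k. (1 + real k) powr s * (cmod (f k))\<^sup>2)"

definition wn :: "real \<Rightarrow> (nat \<Rightarrow> complex) \<Rightarrow> real" where
  "wn s f = sqrt (wsq s f)"

lemma inW_0: "inW 0 f \<longleftrightarrow> l2p f"
  by (simp add: inW_def l2p_def)

lemma inW_1: "inW 1 f \<longleftrightarrow> H12 f"
  by (simp add: inW_def H12_def)

lemma wn_1: "wn 1 f = h12norm f"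
  by (simp add: wn_def wsq_def h12norm_def)

lemma wsq_nonneg: "inW s f \<Longrightarrow> 0 \<le> wsq s f"
  unfolding wsq_def inW_def by (rule suminf_nonneg) auto

lemma wn_nonneg: "inW s f \<Longrightarrow> 0 \<le> wn s f"
  by (simp add: wn_def wsq_nonneg)

lemma wn_sq: "inW s f \<Longrightarrow> (wn s f)\<^sup>2 = wsq s f"
  by (simp add: wn_def wsq_nonneg)

lemma wn_partial:
  assumes "inW s f" "finite A"
  shows "(\<Sum>k\<in>A. (1 + real k) powr s * (cmod (f k))\<^sup>2) \<le> (wn s f)\<^sup>2"
  unfolding wn_sq[OF assms(1)] wsq_def
  by (rule sum_le_suminf) (use assms in \<open>auto simp: inW_def\<close>)

text \<open>Membership and norm bound both follow from a uniform bound on finite sums. Many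
  estimates below are therefore proved for truncated sums, where rearrangement is free.\<close>

lemma inWI:
  assumes "\<And>n. (\<Sum>k<n. (1 + real k) powr s * (cmod (f k))\<^sup>2) \<le> C\<^sup>2" "0 \<le> C"
  shows "inW s f" "wn s f \<le> C"
proof -
  show *: "inW s f"
    unfolding inW_def by (rule summableI_nonneg_bounded[where x="C\<^sup>2"]) (use assms in auto)
  have "wsq s f \<le> C\<^sup>2"
    unfolding wsq_def by (rule suminf_le_const) (use * assms in \<open>auto simp: inW_def\<close>)
  then show "wn s f \<le> C"
    unfolding wn_def using assms(2) by (simp add: real_le_lsqrt)
qed

lemma wn_L2_set:
  assumes "inW s f" "finite A"
  shows "L2_set (\<lambda>k. sqrt ((1 + real k) powr s) * cmod (f k)) A \<le> wn s f"
  unfolding L2_set_def using wn_partial[OF assms] wn_nonneg[OF assms(1)]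
  by (simp add: power_mult_distrib real_le_lsqrt)

lemma L2_set_wsum:
  "(\<Sum>k\<in>A. (1 + real k) powr s * (cmod (f k))\<^sup>2) = (L2_set (\<lambda>k. sqrt ((1 + real k) powr s) * cmod (f k)) A)\<^sup>2"
  unfolding L2_set_def by (simp add: power_mult_distrib sum_nonneg)

lemma inW_add_aux:
  assumes "inW s f" "inW s g"
  shows "inW s (\<lambda>k. f k + g k) \<and> wn s (\<lambda>k. f k + g k) \<le> wn s f + wn s g"
proof -
  let ?w = "\<lambda>k. sqrt ((1 + real k) powr s)"
  have "(\<Sum>k<n. (1 + real k) powr s * (cmod (f k + g k))\<^sup>2) \<le> (wn s f + wn s g)\<^sup>2" for n
  proof -
    have "L2_set (\<lambda>k. ?w k * cmod (f k + g k)) {..<n}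
        \<le> L2_set (\<lambda>k. ?w k * cmod (f k) + ?w k * cmod (g k)) {..<n}"
      by (rule L2_set_mono)
        (auto simp: distrib_left[symmetric] intro!: mult_left_mono norm_triangle_ineq)
    also have "\<dots> \<le> L2_set (\<lambda>k. ?w k * cmod (f k)) {..<n} + L2_set (\<lambda>k. ?w k * cmod (g k)) {..<n}"
      by (rule L2_set_triangle_ineq)
    also have "\<dots> \<le> wn s f + wn s g"
      using assms by (intro add_mono wn_L2_set) auto
    finally show ?thesis
      unfolding L2_set_wsum[where f="\<lambda>k. f k + g k"] by (rule power_mono) simp
  qed
  then show ?thesis
    using inWI[of s "\<lambda>k. f k + g k" "wn s f + wn s g"] wn_nonneg[OF assms(1)] wn_nonneg[OF assms(2)]
    by auto
qed

lemma inW_add: "inW s f \<Longrightarrow> inW s g \<Longrightarrow> inW s (\<lambda>k. f k + g k)"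
  and wn_add: "inW s f \<Longrightarrow> inW s g \<Longrightarrow> wn s (\<lambda>k. f k + g k) \<le> wn s f + wn s g"
  using inW_add_aux by auto

lemma inW_scale: "inW s f \<Longrightarrow> inW s (\<lambda>k. c * f k)"
proof -
  assume "inW s f"
  then have "summable (\<lambda>k. (cmod c)\<^sup>2 * ((1 + real k) powr s * (cmod (f k))\<^sup>2))"
    unfolding inW_def by (rule summable_mult)
  then show ?thesis
    unfolding inW_def by (simp add: norm_mult power_mult_distrib mult_ac)
qed

lemma wn_scale: "inW s f \<Longrightarrow> wn s (\<lambda>k. c * f k) = cmod c * wn s f"
proof -
  assume "inW s f"
  then have "(\<Sum>k. (cmod c)\<^sup>2 * ((1 + real k) powr s * (cmod (f k))\<^sup>2)) = (cmod c)\<^sup>2 * wsq s f"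
    unfolding inW_def wsq_def by (rule suminf_mult)
  then have "wsq s (\<lambda>k. c * f k) = (cmod c)\<^sup>2 * wsq s f"
    unfolding wsq_def by (simp add: norm_mult power_mult_distrib mult_ac)
  then show ?thesis unfolding wn_def by (simp add: real_sqrt_mult)
qed

lemma inW_uminus: "inW s f \<Longrightarrow> inW s (\<lambda>k. - f k)"
  using inW_scale[of s f "-1"] by simp

lemma inW_diff: "inW s f \<Longrightarrow> inW s g \<Longrightarrow> inW s (\<lambda>k. f k - g k)"
  using inW_add[of s f "\<lambda>k. - g k"] inW_uminus by simp

lemma wn_commute: "wn s (\<lambda>k. f k - g k) = wn s (\<lambda>k. g k - f k)"
  by (simp add: wn_def wsq_def norm_minus_commute)

lemma wn_diff_triangle:
  assumes "inW s f" "inW s g"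
  shows "\<bar>wn s f - wn s g\<bar> \<le> wn s (\<lambda>k. f k - g k)"
proof -
  have "wn s f \<le> wn s (\<lambda>k. f k - g k) + wn s g"
    using wn_add[OF inW_diff[OF assms] assms(2)] by simp
  moreover have "wn s g \<le> wn s (\<lambda>k. g k - f k) + wn s f"
    using wn_add[OF inW_diff[OF assms(2,1)] assms(1)] by simp
  ultimately show ?thesis using wn_commute[of s f g] by linarith
qed

lemma inW_0const: "inW s (\<lambda>k. 0)" by (simp add: inW_def)

lemma wn_0const: "wn s (\<lambda>k. 0) = 0" by (simp add: wn_def wsq_def)

lemma inW_sum: "finite A \<Longrightarrow> (\<And>i. i \<in> A \<Longrightarrow> inW s (f i)) \<Longrightarrow> inW s (\<lambda>k. \<Sum>i\<in>A. f i k)"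
proof (induction rule: finite_induct)
  case (insert x F)
  have "inW s (\<lambda>k. f x k + (\<Sum>i\<in>F. f i k))"
    by (rule inW_add) (use insert in auto)
  then show ?case using insert by simp
qed (simp add: inW_0const)

lemma inW_mono_aux:
  assumes "inW t f" "s \<le> t"
  shows "inW s f \<and> wn s f \<le> wn t f"
proof -
  have "(\<Sum>k<n. (1 + real k) powr s * (cmod (f k))\<^sup>2) \<le> (wn t f)\<^sup>2" for n
  proof -
    have "(\<Sum>k<n. (1 + real k) powr s * (cmod (f k))\<^sup>2) \<le> (\<Sum>k<n. (1 + real k) powr t * (cmod (f k))\<^sup>2)"
      by (intro sum_mono mult_right_mono powr_mono assms) auto
    then show ?thesis using wn_partial[OF assms(1), of "{..<n}"] by simp
  qed
  then show ?thesis using inWI[of s f "wn t f"] wn_nonneg[OF assms(1)] by auto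
qed

lemma inW_mono: "inW t f \<Longrightarrow> s \<le> t \<Longrightarrow> inW s f"
  and wn_mono: "inW t f \<Longrightarrow> s \<le> t \<Longrightarrow> wn s f \<le> wn t f"
  using inW_mono_aux by auto

lemma inW_10: "inW 1 f \<Longrightarrow> inW 0 f"
  by (erule inW_mono) simp

lemma coeff_le_wn: "inW s f \<Longrightarrow> 0 \<le> s \<Longrightarrow> cmod (f k) \<le> wn s f"
proof -
  assume a: "inW s f" "0 \<le> s"
  have "(cmod (f k))\<^sup>2 \<le> (wn 0 f)\<^sup>2"
    using wn_partial[OF inW_mono[OF a], of "{k}"] by simp
  then have "cmod (f k) \<le> wn 0 f"
    using wn_nonneg[OF inW_mono[OF a]] power2_le_imp_le by blast
  then show ?thesis using wn_mono[OF a] by linarith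
qed

lemma wn_eq_0: "inW s f \<Longrightarrow> wn s f = 0 \<Longrightarrow> f k = 0"
proof -
  assume a: "inW s f" "wn s f = 0"
  have "(1 + real k) powr s * (cmod (f k))\<^sup>2 \<le> 0"
    using wn_partial[OF a(1), of "{k}"] a(2) by simp
  moreover have "(1 + real k) powr s > 0" by simp
  ultimately show ?thesis by (simp add: mult_le_0_iff)
qed

lemma CS_fin:
  assumes "inW 0 f" "inW 0 g" "finite A"
  shows "(\<Sum>k\<in>A. cmod (f k) * cmod (g k)) \<le> wn 0 f * wn 0 g"
proof -
  have "(\<Sum>k\<in>A. cmod (f k) * cmod (g k)) \<le> L2_set (\<lambda>k. cmod (f k)) A * L2_set (\<lambda>k. cmod (g k)) A"
    using L2_set_mult_ineq[of "\<lambda>k. cmod (f k)" "\<lambda>k. cmod (g k)" A] by simp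
  also have "\<dots> \<le> wn 0 f * wn 0 g"
    using wn_L2_set[OF assms(1,3)] wn_L2_set[OF assms(2,3)] wn_nonneg[OF assms(1)]
    by (intro mult_mono) (auto simp: L2_set_nonneg)
  finally show ?thesis .
qed

lemma CS_summable:
  assumes "inW 0 f" "inW 0 g"
  shows "summable (\<lambda>k. cmod (f k) * cmod (g k))"
  by (rule summableI_nonneg_bounded[where x="wn 0 f * wn 0 g"])
    (use CS_fin[OF assms] in auto)

section \<open>Inner product of square-summable sequences\<close>

definition ip :: "(nat \<Rightarrow> complex) \<Rightarrow> (nat \<Rightarrow> complex) \<Rightarrow> complex" where
  "ip f g = (\<Sum>k. f k * cnj (g k))"

lemma ip_summable_norm:
  "inW 0 f \<Longrightarrow> inW 0 g \<Longrightarrow> summable (\<lambda>k. norm (f k * cnj (g k)))"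
  using CS_summable by (simp add: norm_mult)

lemma ip_summable: "inW 0 f \<Longrightarrow> inW 0 g \<Longrightarrow> summable (\<lambda>k. f k * cnj (g k))"
  by (rule summable_norm_cancel[OF ip_summable_norm])

lemma ip_bound: "inW 0 f \<Longrightarrow> inW 0 g \<Longrightarrow> cmod (ip f g) \<le> wn 0 f * wn 0 g"
proof -
  assume a: "inW 0 f" "inW 0 g"
  have "cmod (ip f g) \<le> (\<Sum>k. norm (f k * cnj (g k)))"
    unfolding ip_def by (rule summable_norm[OF ip_summable_norm[OF a]])
  also have "\<dots> \<le> wn 0 f * wn 0 g"
    using CS_fin[OF a] by (intro suminf_le_const[OF ip_summable_norm[OF a]]) (simp add: norm_mult)
  finally show ?thesis .
qed

lemma ip_self: "inW 0 f \<Longrightarrow> ip f f = of_real ((wn 0 f)\<^sup>2)"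
proof -
  assume a: "inW 0 f"
  have "(\<lambda>k. complex_of_real ((cmod (f k))\<^sup>2)) sums of_real (wsq 0 f)"
    using a unfolding inW_def wsq_def by (intro sums_of_real) (auto simp: summable_sums)
  moreover have "f k * cnj (f k) = complex_of_real ((cmod (f k))\<^sup>2)" for k
    by (simp add: complex_norm_square[symmetric])
  ultimately show ?thesis
    unfolding ip_def wn_sq[OF a] by (simp add: sums_unique[symmetric])
qed

lemma ip_cnj: "inW 0 f \<Longrightarrow> inW 0 g \<Longrightarrow> cnj (ip f g) = ip g f"
proof -
  assume a: "inW 0 f" "inW 0 g"
  have "(\<lambda>k. cnj (f k * cnj (g k))) sums cnj (ip f g)"
    unfolding ip_def sums_cnj by (rule summable_sums[OF ip_summable[OF a]])
  then show ?thesis unfolding ip_def by (simp add: sums_iff mult.commute)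
qed

lemma ip_add_left: "inW 0 f \<Longrightarrow> inW 0 g \<Longrightarrow> inW 0 h \<Longrightarrow> ip (\<lambda>k. f k + g k) h = ip f h + ip g h"
  unfolding ip_def by (simp add: distrib_right suminf_add ip_summable)

lemma ip_scale_left: "inW 0 f \<Longrightarrow> inW 0 h \<Longrightarrow> ip (\<lambda>k. c * f k) h = c * ip f h"
  unfolding ip_def using suminf_mult[OF ip_summable, of f h c] by (simp add: mult_ac)

lemma ip_diff_left: "inW 0 f \<Longrightarrow> inW 0 g \<Longrightarrow> inW 0 h \<Longrightarrow> ip (\<lambda>k. f k - g k) h = ip f h - ip g h"
  unfolding ip_def by (simp add: left_diff_distrib suminf_diff ip_summable)

lemma ip_0_left: "ip (\<lambda>k. 0) h = 0"
  by (simp add: ip_def)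

lemma ip_sum_left:
  "finite A \<Longrightarrow> (\<And>i. i \<in> A \<Longrightarrow> inW 0 (f i)) \<Longrightarrow> inW 0 h \<Longrightarrow>
     ip (\<lambda>k. \<Sum>i\<in>A. f i k) h = (\<Sum>i\<in>A. ip (f i) h)"
proof (induction rule: finite_induct)
  case (insert x F)
  have "ip (\<lambda>k. f x k + (\<Sum>i\<in>F. f i k)) h = ip (f x) h + ip (\<lambda>k. \<Sum>i\<in>F. f i k) h"
    by (rule ip_add_left) (use insert.prems insert.hyps in \<open>auto intro!: inW_sum\<close>)
  then show ?case using insert by simp
qed (simp add: ip_0_left)

lemma ip_lincomb_left:
  "finite A \<Longrightarrow> (\<And>i. i \<in> A \<Longrightarrow> inW 0 (f i)) \<Longrightarrow> inW 0 h \<Longrightarrow>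
     ip (\<lambda>k. \<Sum>i\<in>A. c i * f i k) h = (\<Sum>i\<in>A. c i * ip (f i) h)"
  using ip_sum_left[of A "\<lambda>i k. c i * f i k" h] by (simp add: inW_scale ip_scale_left)

lemma ip_diff_right:
  assumes "inW 0 f" "inW 0 g" "inW 0 h"
  shows "ip h (\<lambda>k. f k - g k) = ip h f - ip h g"
  using arg_cong[OF ip_diff_left[OF assms], of cnj]
  by (simp add: ip_cnj assms inW_diff[OF assms(1,2)])

lemma ip_scale_right:
  assumes "inW 0 f" "inW 0 h"
  shows "ip h (\<lambda>k. c * f k) = cnj c * ip h f"
  using arg_cong[OF ip_scale_left[OF assms, of c], of cnj]
  by (simp add: ip_cnj assms inW_scale[OF assms(1)])

lemma ip_lincomb_right:
  assumes "finite A" "\<And>i. i \<in> A \<Longrightarrow> inW 0 (f i)" "inW 0 h"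
  shows "ip h (\<lambda>k. \<Sum>i\<in>A. c i * f i k) = (\<Sum>i\<in>A. cnj (c i) * ip h (f i))"
proof -
  have "inW 0 (\<lambda>k. \<Sum>i\<in>A. c i * f i k)" using assms by (intro inW_sum inW_scale) auto
  then have "cnj (ip (\<lambda>k. \<Sum>i\<in>A. c i * f i k) h) = ip h (\<lambda>k. \<Sum>i\<in>A. c i * f i k)"
    using assms(3) by (rule ip_cnj)
  then have "ip h (\<lambda>k. \<Sum>i\<in>A. c i * f i k) = cnj (\<Sum>i\<in>A. c i * ip (f i) h)"
    by (subst (asm) ip_lincomb_left) (use assms in auto)
  also have "\<dots> = (\<Sum>i\<in>A. cnj (c i) * ip h (f i))"
    using assms by (auto simp: ip_cnj intro!: sum.cong)
  finally show ?thesis .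
qed

lemma inW_one: "inW s one_seq"
  unfolding inW_def by (rule summable_finite[of "{0}"]) (auto simp: one_seq_def)

lemma ip_one_right: "ip f one_seq = f 0"
proof -
  have "(\<lambda>k. f k * cnj (one_seq k)) sums (\<Sum>k\<in>{0}. f k * cnj (one_seq k))"
    by (rule sums_finite) (auto simp: one_seq_def)
  then show ?thesis unfolding ip_def by (simp add: sums_iff one_seq_def)
qed

section \<open>Hankel operators and their rows\<close>

definition sh :: "nat \<Rightarrow> (nat \<Rightarrow> complex) \<Rightarrow> nat \<Rightarrow> complex" where
  "sh n u = (\<lambda>k. u (n + k))"

lemma Hank_ip: "Hank u h n = ip (sh n u) h"
  by (simp add: Hank_def ip_def sh_def)

lemma sh_0 [simp]: "sh 0 u = u" by (simp add: sh_def)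

lemma inW_sh: "inW 0 u \<Longrightarrow> inW 0 (sh n u)"
  unfolding inW_def sh_def
  using summable_iff_shift[of "\<lambda>k. (cmod (u k))\<^sup>2" n] by (simp add: add.commute)

lemma wn0_sums: "inW 0 f \<Longrightarrow> (\<lambda>k. (cmod (f k))\<^sup>2) sums (wn 0 f)\<^sup>2"
  using wn_sq[of 0 f] unfolding inW_def wsq_def by (simp add: summable_sums)

text \<open>The shifts \<open>sh n u\<close> are the rows of the Hankel matrix. The entry
  \<open>u j\<close> fills an antidiagonal of j + 1 places, which produces the weight 1 + j: the
  norm \<open>wn 1 u\<close> is the Hilbert-Schmidt norm of H_u.\<close>

lemma shift_rect_sum:
  assumes "inW 1 u"
  shows "(\<Sum>n<R. (wn 0 (sh n u))\<^sup>2) \<le> (wn 1 u)\<^sup>2"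
proof -
  have u0: "inW 0 u" by (rule inW_10[OF assms])
  have fin: "(\<Sum>n<R. \<Sum>k<K. (cmod (u (n+k)))\<^sup>2) \<le> (wn 1 u)\<^sup>2" for K
  proof -
    have "(\<Sum>n<R. \<Sum>k<K. (cmod (u (n+k)))\<^sup>2) = (\<Sum>(n,k)\<in>{..<R}\<times>{..<K}. (cmod (u (n+k)))\<^sup>2)"
      by (simp add: sum.cartesian_product)
    also have "\<dots> = (\<Sum>(j,n)\<in>(\<lambda>(n,k). (n+k,n)) ` ({..<R}\<times>{..<K}). (cmod (u j))\<^sup>2)"
      by (subst sum.reindex) (auto simp: inj_on_def case_prod_unfold)
    also have "\<dots> \<le> (\<Sum>(j,n)\<in>(SIGMA j:{..<R+K}. {..j}). (cmod (u j))\<^sup>2)"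
      by (rule sum_mono2) auto
    also have "\<dots> = (\<Sum>j<R+K. \<Sum>n\<le>j. (cmod (u j))\<^sup>2)"
      by (subst sum.Sigma) auto
    also have "\<dots> = (\<Sum>j<R+K. (1 + real j) powr 1 * (cmod (u j))\<^sup>2)"
      by (simp add: algebra_simps)
    also have "\<dots> \<le> (wn 1 u)\<^sup>2" by (rule wn_partial[OF assms]) auto
    finally show ?thesis .
  qed
  have "(\<lambda>K. \<Sum>n<R. \<Sum>k<K. (cmod (u (n+k)))\<^sup>2) \<longlonglongrightarrow> (\<Sum>n<R. (wn 0 (sh n u))\<^sup>2)"
  proof (intro tendsto_sum)
    fix n
    have "(\<lambda>k. (cmod (u (n+k)))\<^sup>2) sums (wn 0 (sh n u))\<^sup>2"
      using wn0_sums[OF inW_sh[OF u0, of n]] by (simp add: sh_def)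
    then show "(\<lambda>K. \<Sum>k<K. (cmod (u (n+k)))\<^sup>2) \<longlonglongrightarrow> (wn 0 (sh n u))\<^sup>2"
      by (simp add: sums_def)
  qed
  then show ?thesis by (rule LIMSEQ_le_const2) (use fin in auto)
qed

text \<open>Cauchy-Schwarz in each row: the operator norm is at most the Hilbert-Schmidt
  norm.\<close>

lemma Hank_bound:
  assumes "inW 1 u" "inW 0 h"
  shows "inW 0 (Hank u h)" "wn 0 (Hank u h) \<le> wn 1 u * wn 0 h"
proof -
  have u0: "inW 0 u" by (rule inW_10[OF assms(1)])
  have "(\<Sum>n<R. (1 + real n) powr 0 * (cmod (Hank u h n))\<^sup>2) \<le> (wn 1 u * wn 0 h)\<^sup>2" for R
  proof -
    have "(\<Sum>n<R. (cmod (Hank u h n))\<^sup>2) \<le> (\<Sum>n<R. (wn 0 (sh n u) * wn 0 h)\<^sup>2)"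
      unfolding Hank_ip by (intro sum_mono power_mono ip_bound inW_sh u0 assms) auto
    also have "\<dots> = (\<Sum>n<R. (wn 0 (sh n u))\<^sup>2) * (wn 0 h)\<^sup>2"
      by (simp add: power_mult_distrib sum_distrib_right)
    also have "\<dots> \<le> (wn 1 u)\<^sup>2 * (wn 0 h)\<^sup>2"
      by (intro mult_right_mono shift_rect_sum assms) auto
    finally show ?thesis by (simp add: power_mult_distrib)
  qed
  then show "inW 0 (Hank u h)" "wn 0 (Hank u h) \<le> wn 1 u * wn 0 h"
    using inWI[of 0 "Hank u h" "wn 1 u * wn 0 h"] wn_nonneg[OF assms(1)] wn_nonneg[OF assms(2)]
    by auto
qed

lemma suminf_eq_infsum:
  fixes f :: "nat \<Rightarrow> 'a::banach"
  assumes "summable (\<lambda>n. norm (f n))"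
  shows "(\<Sum>n. f n) = (\<Sum>\<^sub>\<infinity>n. f n)"
  using norm_summable_imp_has_sum[OF assms summable_sums[OF summable_norm_cancel[OF assms]]]
  by (simp add: infsumI)

lemma abs_summable_natI:
  fixes f :: "nat \<times> nat \<Rightarrow> complex"
  assumes "\<And>R K. (\<Sum>n<R. \<Sum>k<K. norm (f (n,k))) \<le> C"
  shows "(\<lambda>x. norm (f x)) summable_on UNIV"
proof (rule nonneg_bdd_above_summable_on)
  show "bdd_above (sum (\<lambda>x. norm (f x)) ` {F. F \<subseteq> UNIV \<and> finite F})"
  proof (rule bdd_aboveI2[where M=C])
    fix F :: "(nat \<times> nat) set" assume "F \<in> {F. F \<subseteq> UNIV \<and> finite F}"
    then have F: "finite F" by simp
    obtain R where R: "fst ` F \<subseteq> {..<R}" using F finite_nat_iff_bounded[of "fst ` F"] by auto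
    obtain K where K: "snd ` F \<subseteq> {..<K}" using F finite_nat_iff_bounded[of "snd ` F"] by auto
    have "(\<Sum>x\<in>F. norm (f x)) \<le> (\<Sum>x\<in>{..<R}\<times>{..<K}. norm (f x))"
      by (rule sum_mono2) (use R K in \<open>force+\<close>)
    also have "\<dots> = (\<Sum>n<R. \<Sum>k<K. norm (f (n,k)))"
      by (simp add: sum.cartesian_product)
    finally show "(\<Sum>x\<in>F. norm (f x)) \<le> C" using assms[of K R] by linarith
  qed
qed auto

text \<open>Absolute convergence of the double series of (H_u h | g), which licenses exchanges of
  summation in it.\<close>

lemma Hank_abs_summable:
  assumes "inW 1 u" "inW 0 h" "inW 0 g"
  shows "(\<lambda>x. norm (case x of (n,k) \<Rightarrow> u (n+k) * cnj (h k) * cnj (g n))) summable_on UNIV"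
proof (rule abs_summable_natI)
  have u0: "inW 0 u" by (rule inW_10[OF assms(1)])
  \<comment> \<open>The row norms form a sequence in L^2 by \<open>shift_rect_sum\<close>, so the
    remaining sum over n is again a Cauchy-Schwarz pairing.\<close>
  define \<tau> where "\<tau> n = complex_of_real (wn 0 (sh n u))" for n
  have \<tau>: "inW 0 \<tau>" "wn 0 \<tau> \<le> wn 1 u"
    using inWI[of 0 \<tau> "wn 1 u"] shift_rect_sum[OF assms(1)] wn_nonneg[OF assms(1)]
    by (auto simp: \<tau>_def)
  fix R K
  have "(\<Sum>n<R. \<Sum>k<K. norm (case (n,k) of (n,k) \<Rightarrow> u (n+k) * cnj (h k) * cnj (g n)))
      = (\<Sum>n<R. (\<Sum>k<K. cmod (sh n u k) * cmod (h k)) * cmod (g n))"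
    by (simp add: norm_mult sh_def sum_distrib_right)
  also have "\<dots> \<le> (\<Sum>n<R. (wn 0 (sh n u) * wn 0 h) * cmod (g n))"
    by (intro sum_mono mult_right_mono CS_fin inW_sh u0 assms) auto
  also have "\<dots> = wn 0 h * (\<Sum>n<R. cmod (\<tau> n) * cmod (g n))"
    by (simp add: sum_distrib_left \<tau>_def mult_ac wn_nonneg[OF inW_sh[OF u0]])
  also have "\<dots> \<le> wn 0 h * (wn 0 \<tau> * wn 0 g)"
    by (intro mult_left_mono CS_fin \<tau> assms wn_nonneg) auto
  also have "\<dots> \<le> wn 0 h * (wn 1 u * wn 0 g)"
    by (intro mult_left_mono mult_right_mono wn_nonneg assms \<tau>)
  finally show "(\<Sum>n<R. \<Sum>k<K. norm (case (n,k) of (n,k) \<Rightarrow> u (n+k) * cnj (h k) * cnj (g n)))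
      \<le> wn 0 h * (wn 1 u * wn 0 g)" .
qed

lemma ip_infsum: "inW 0 f \<Longrightarrow> inW 0 g \<Longrightarrow> ip f g = (\<Sum>\<^sub>\<infinity>k. f k * cnj (g k))"
  unfolding ip_def by (rule suminf_eq_infsum[OF ip_summable_norm])

lemma ip_Hank_infsum:
  assumes "inW 1 u" "inW 0 h" "inW 0 g"
  shows "ip (Hank u h) g = (\<Sum>\<^sub>\<infinity>(n,k). u (n+k) * cnj (h k) * cnj (g n))"
proof -
  have u0: "inW 0 u" by (rule inW_10[OF assms(1)])
  have s: "(\<lambda>(n,k). u (n+k) * cnj (h k) * cnj (g n)) summable_on UNIV"
    by (rule abs_summable_summable[OF Hank_abs_summable[OF assms]])
  have "ip (Hank u h) g = (\<Sum>\<^sub>\<infinity>n. Hank u h n * cnj (g n))"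
    by (rule ip_infsum[OF Hank_bound(1)]) (use assms in auto)
  also have "\<dots> = (\<Sum>\<^sub>\<infinity>n. \<Sum>\<^sub>\<infinity>k. u (n+k) * cnj (h k) * cnj (g n))"
  proof (rule infsum_cong)
    fix n
    have "Hank u h n * cnj (g n) = (\<Sum>\<^sub>\<infinity>k. u (n+k) * cnj (h k)) * cnj (g n)"
      unfolding Hank_ip ip_infsum[OF inW_sh[OF u0] assms(2)] by (simp add: sh_def)
    also have "\<dots> = (\<Sum>\<^sub>\<infinity>k. u (n+k) * cnj (h k) * cnj (g n))"
      by (rule infsum_cmult_left'[symmetric])
    finally show "Hank u h n * cnj (g n) = (\<Sum>\<^sub>\<infinity>k. u (n+k) * cnj (h k) * cnj (g n))" .
  qed
  also have "\<dots> = (\<Sum>\<^sub>\<infinity>(n,k)\<in>UNIV \<times> UNIV. u (n+k) * cnj (h k) * cnj (g n))"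
    by (rule infsum_Sigma'_banach) (use s in simp)
  finally show ?thesis by simp
qed

text \<open>The matrix u(n+k) is symmetric and H_u is antilinear, so symmetry takes the form (H_u h
  | g) = (H_u g | h). Selfadjointness in the usual sense holds for the even powers.\<close>

lemma ip_Hank_sym:
  assumes "inW 1 u" "inW 0 h" "inW 0 g"
  shows "ip (Hank u h) g = ip (Hank u g) h"
proof -
  have "(\<Sum>\<^sub>\<infinity>(n,k). u (n+k) * cnj (h k) * cnj (g n)) = (\<Sum>\<^sub>\<infinity>(n,k). u (n+k) * cnj (g k) * cnj (h n))"
    by (rule infsum_reindex_bij_witness[of _ prod.swap prod.swap]) (auto simp: add.commute mult_ac)
  then show ?thesis by (simp add: ip_Hank_infsum assms)
qed

lemma Hank_one: "Hank u one_seq = u"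
  by (rule ext) (simp add: Hank_ip ip_one_right sh_def)

lemma Hank_diff_right:
  "inW 1 u \<Longrightarrow> inW 0 f \<Longrightarrow> inW 0 g \<Longrightarrow> Hank u (\<lambda>k. f k - g k) = (\<lambda>n. Hank u f n - Hank u g n)"
  by (rule ext) (simp add: Hank_ip ip_diff_right inW_sh inW_10)

lemma Hank_lincomb:
  "finite A \<Longrightarrow> (\<And>i. i \<in> A \<Longrightarrow> inW 0 (f i)) \<Longrightarrow> inW 1 u \<Longrightarrow>
     Hank u (\<lambda>k. \<Sum>i\<in>A. c i * f i k) = (\<lambda>n. \<Sum>i\<in>A. cnj (c i) * Hank u (f i) n)"
  by (rule ext) (simp add: Hank_ip ip_lincomb_right inW_sh inW_10)

lemma Hank_scale:
  "inW 0 f \<Longrightarrow> inW 1 u \<Longrightarrow> Hank u (\<lambda>k. c * f k) = (\<lambda>n. cnj c * Hank u f n)"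
  by (rule ext) (simp add: Hank_ip ip_scale_right inW_sh inW_10)

lemma Hank_diff_left:
  "inW 1 u \<Longrightarrow> inW 1 v \<Longrightarrow> inW 0 h \<Longrightarrow> Hank (\<lambda>k. u k - v k) h = (\<lambda>n. Hank u h n - Hank v h n)"
proof (rule ext)
  fix n assume a: "inW 1 u" "inW 1 v" "inW 0 h"
  have "sh n (\<lambda>k. u k - v k) = (\<lambda>k. sh n u k - sh n v k)" by (simp add: sh_def)
  then show "Hank (\<lambda>k. u k - v k) h n = Hank u h n - Hank v h n"
    unfolding Hank_ip using a by (simp add: ip_diff_left inW_sh inW_10)
qed

lemma Hank_pow_inW: "inW 1 u \<Longrightarrow> inW 0 f \<Longrightarrow> inW 0 ((Hank u ^^ n) f)"
  by (induction n) (auto simp: Hank_bound(1))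

lemma Hank2_sym:
  assumes "inW 1 u" "inW 0 f" "inW 0 g"
  shows "ip (Hank u (Hank u f)) g = ip f (Hank u (Hank u g))"
proof -
  have "ip (Hank u (Hank u f)) g = ip (Hank u g) (Hank u f)"
    by (rule ip_Hank_sym) (use assms Hank_bound in auto)
  also have "\<dots> = cnj (ip (Hank u f) (Hank u g))"
    by (rule ip_cnj[symmetric]) (use assms Hank_bound in auto)
  also have "\<dots> = cnj (ip (Hank u (Hank u g)) f)"
    by (subst ip_Hank_sym[OF assms(1,2)]) (use assms Hank_bound in auto)
  also have "\<dots> = ip f (Hank u (Hank u g))"
    by (rule ip_cnj) (use assms Hank_bound in auto)
  finally show ?thesis .
qed

lemma Hank_even_sym:
  assumes "inW 1 u" "inW 0 f" "inW 0 g"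
  shows "ip ((Hank u ^^ (2*n)) f) g = ip f ((Hank u ^^ (2*n)) g)"
  using assms(3)
proof (induction n arbitrary: g)
  case (Suc n)
  have "ip ((Hank u ^^ (2 * Suc n)) f) g = ip ((Hank u ^^ (2*n)) f) (Hank u (Hank u g))"
    using Hank2_sym[OF assms(1) Hank_pow_inW[OF assms(1,2), of "2*n"] Suc.prems] by simp
  also have "\<dots> = ip f ((Hank u ^^ (2*n)) (Hank u (Hank u g)))"
    by (rule Suc.IH) (use assms Hank_bound Suc.prems in auto)
  finally show ?case by (simp add: funpow_swap1)
qed simp

lemma Jfun_ip: "Jfun n u = ip ((Hank u ^^ (2*n)) one_seq) one_seq"
  by (simp add: Jfun_def ip_one_right)

text \<open>Even powers are moved to one side, and each of the two factors u is H_u(1); these two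
  further applications of H_u account for the \<open>Suc\<close>.\<close>

lemma J_gram:
  assumes "inW 1 u"
  shows "ip ((Hank u ^^ (2*a)) u) ((Hank u ^^ (2*b)) u) = Jfun (Suc (a+b)) u"
proof -
  have u0: "inW 0 u" by (rule inW_10[OF assms])
  have "ip ((Hank u ^^ (2*a)) u) ((Hank u ^^ (2*b)) u) = ip ((Hank u ^^ (2*b)) ((Hank u ^^ (2*a)) u)) u"
    by (subst Hank_even_sym[OF assms]) (use assms u0 Hank_pow_inW in auto)
  also have "(Hank u ^^ (2*b)) ((Hank u ^^ (2*a)) u) = (Hank u ^^ (2*(a+b))) u"
    by (simp add: funpow_add distrib_left add.commute[of "2*a"])
  also have "ip \<dots> u = ip \<dots> (Hank u one_seq)" by (simp add: Hank_one)
  also have "\<dots> = cnj (ip (Hank u one_seq) ((Hank u ^^ (2*(a+b))) u))"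
    by (rule ip_cnj[symmetric]) (use assms u0 Hank_pow_inW in \<open>auto simp: Hank_one\<close>)
  also have "ip (Hank u one_seq) ((Hank u ^^ (2*(a+b))) u) = ip (Hank u ((Hank u ^^ (2*(a+b))) u)) one_seq"
    by (rule ip_Hank_sym) (use assms u0 Hank_pow_inW inW_one in auto)
  also have "Hank u ((Hank u ^^ (2*(a+b))) u) = (Hank u ^^ (2*(Suc (a+b)))) one_seq"
  proof -
    have "(Hank u ^^ (2*(Suc (a+b)))) one_seq = (Hank u ^^ (Suc (2*(a+b)))) (Hank u one_seq)"
      by (simp add: funpow_swap1)
    then show ?thesis by (simp add: Hank_one)
  qed
  also have "cnj (ip \<dots> one_seq) = ip one_seq ((Hank u ^^ (2*(Suc (a+b)))) one_seq)"
    by (rule ip_cnj) (use assms Hank_pow_inW inW_one in blast)+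
  also have "\<dots> = ip ((Hank u ^^ (2*(Suc (a+b)))) one_seq) one_seq"
    by (rule Hank_even_sym[symmetric]) (use assms inW_one in auto)
  finally show ?thesis by (simp add: Jfun_ip)
qed

section \<open>Interlacing sequences and Lagrange interpolation\<close>

lemma poly_sum_lessThan:
  fixes p :: "'a::comm_semiring_1 poly"
  assumes "degree p < n"
  shows "poly p x = (\<Sum>a<n. coeff p a * x ^ a)"
proof -
  have "(\<Sum>a\<le>degree p. coeff p a * x ^ a) = (\<Sum>a<n. coeff p a * x ^ a)"
    by (rule sum.mono_neutral_left) (use assms in \<open>auto intro: le_degree simp: not_le coeff_eq_0\<close>)
  then show ?thesis by (simp add: poly_altdef)
qed

text \<open>Here x_j stands for lambda_j^2 = I_j / 2 and y_j for mu_j^2 = L_j / 2.\<close>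

locale interlaced =
  fixes N :: nat and x y :: "nat \<Rightarrow> real"
  assumes N1: "1 \<le> N"
    and xy: "\<And>j. j \<in> {1..N} \<Longrightarrow> y j < x j"
    and y0: "\<And>j. j \<in> {1..N} \<Longrightarrow> 0 < y j"
    and yx: "\<And>j. j \<in> {1..<N} \<Longrightarrow> x (Suc j) < y j"
begin

text \<open>The residue at x_j of prod (X - y_m) / prod (X - x_k). For u in the torus it is the mass
  |(u | e_j)|^2 of u on the j-th eigenvector of H_u^2.\<close>

definition nu :: "nat \<Rightarrow> real" where
  "nu j = (\<Prod>m\<in>{1..N}. x j - y m) / (\<Prod>k\<in>{1..N} - {j}. x j - x k)"

text \<open>The trace of K_u^2 = H_u^2 - (. | u) u if H_u^2 has eigenvalues x_j and u has masses
  nu_j; it turns out to be the minimal momentum. Comparing coefficients of X^(N-1) in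
  \<open>partial_fraction\<close> shows that it equals the sum of the y_j.\<close>

definition m0 :: real where
  "m0 = (\<Sum>j=1..N. x j - nu j)"

lemma x0: "j \<in> {1..N} \<Longrightarrow> 0 < x j"
  using xy y0 by fastforce

lemma x_less: "1 \<le> i \<Longrightarrow> i < j \<Longrightarrow> j \<le> N \<Longrightarrow> x j < y i"
proof (induction j)
  case (Suc j)
  show ?case
  proof (cases "i = j")
    case True then show ?thesis using yx[of j] Suc.prems by simp
  next
    case False
    then have "x j < y i" using Suc by simp
    moreover have "x (Suc j) < y j" "y j < x j" using yx[of j] xy[of j] Suc.prems by simp_all
    ultimately show ?thesis by simp
  qed
qed simp

lemma x_decr: "1 \<le> i \<Longrightarrow> i < j \<Longrightarrow> j \<le> N \<Longrightarrow> x j < x i"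
  using x_less[of i j] xy[of i] by simp

lemma y_less: "1 \<le> i \<Longrightarrow> i \<le> j \<Longrightarrow> j \<le> N \<Longrightarrow> y j < x i"
  using x_decr[of i j] xy[of j] by (cases "i = j") fastforce+

lemma y_decr: "1 \<le> i \<Longrightarrow> i < j \<Longrightarrow> j \<le> N \<Longrightarrow> y j < y i"
  using x_less[of i j] xy[of j] by fastforce

lemma x_neq: "i \<in> {1..N} \<Longrightarrow> j \<in> {1..N} \<Longrightarrow> i \<noteq> j \<Longrightarrow> x i \<noteq> x j"
  using x_decr[of i j] x_decr[of j i] by (auto simp: neq_iff)

lemma y_neq: "i \<in> {1..N} \<Longrightarrow> j \<in> {1..N} \<Longrightarrow> i \<noteq> j \<Longrightarrow> y i \<noteq> y j"
  using y_decr[of i j] y_decr[of j i] by (auto simp: neq_iff)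

lemma xy_neq: "i \<in> {1..N} \<Longrightarrow> j \<in> {1..N} \<Longrightarrow> x i \<noteq> y j"
  using x_less[of j i] y_less[of i j] by (cases "j < i") auto

lemma inj_x: "inj_on x {1..N}"
  by (rule inj_onI) (metis x_neq)

lemma inj_y: "inj_on y {1..N}"
  by (rule inj_onI) (metis y_neq)

lemma nu_alt:
  assumes "j \<in> {1..N}"
  shows "nu j = (x j - y j) * (\<Prod>k\<in>{1..N} - {j}. (x j - y k) / (x j - x k))"
  using prod.remove[OF _ assms, of "\<lambda>m. x j - y m"]
  by (simp add: nu_def prod_dividef)

text \<open>By interlacing, the numerator and denominator of every factor (x_j - y_k) / (x_j - x_k)
  have the same sign.\<close>

lemma nu_pos:
  assumes "j \<in> {1..N}"
  shows "0 < nu j"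
proof -
  have "0 < (x j - y k) / (x j - x k)" if "k \<in> {1..N} - {j}" for k
  proof (cases "k < j")
    case True
    then show ?thesis using x_less[of k j] x_decr[of k j] assms that by (simp add: divide_neg_neg)
  next
    case False
    then show ?thesis using y_less[of j k] x_decr[of j k] assms that by auto
  qed
  then have "0 < (\<Prod>k\<in>{1..N} - {j}. (x j - y k) / (x j - x k))"
    by (intro prod_pos) auto
  then show ?thesis unfolding nu_alt[OF assms] using xy[OF assms] by simp
qed

text \<open>The factor 1 - L_j / I_j turns one power of x_j into x_j - y_j, which completes the
  product to \<open>nu j\<close>. Hence the exponent n - 1.\<close>

lemma jval_nu:
  assumes "1 \<le> n"
  shows "jval N (\<lambda>j. 2 * x j) (\<lambda>j. 2 * y j) n = (\<Sum>j=1..N. nu j * x j ^ (n - 1))"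
  unfolding jval_def
proof (rule sum.cong[OF refl])
  fix j assume j: "j \<in> {1..N}"
  have "(2 * y k - 2 * x j) / (2 * x k - 2 * x j) = (x j - y k) / (x j - x k)" for k
  proof -
    have "(2 * y k - 2 * x j) / (2 * x k - 2 * x j) = (-2 * (x j - y k)) / (-2 * (x j - x k))"
      by (simp add: algebra_simps)
    then show ?thesis by (simp only: mult_divide_mult_cancel_left_if) simp
  qed
  moreover obtain n' where n': "n = Suc n'" using assms by (cases n) auto
  have "(1/2)^n * (2 * x j)^n * (1 - (2 * y j) / (2 * x j)) = (x j)^(n-1) * (x j - y j)"
    using x0[OF j] unfolding n' by (simp add: power_mult_distrib power_divide field_simps)
  ultimately show "(1/2)^n * (2 * x j)^n * (1 - (2 * y j) / (2 * x j)) *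
      (\<Prod>k\<in>{1..N} - {j}. (2 * y k - 2 * x j) / (2 * x k - 2 * x j)) = nu j * x j ^ (n - 1)"
    unfolding nu_alt[OF j] by simp
qed

definition lagr :: "nat \<Rightarrow> real poly" where
  "lagr j = (\<Prod>k\<in>{1..N} - {j}. [: - x k / (x j - x k), 1 / (x j - x k) :])"

lemma degree_lagr:
  assumes "j \<in> {1..N}"
  shows "degree (lagr j) < N"
proof -
  have "degree (lagr j) \<le> (\<Sum>k\<in>{1..N} - {j}. degree [: - x k / (x j - x k), 1 / (x j - x k) :])"
    unfolding lagr_def by (rule degree_prod_sum_le[unfolded o_def]) simp
  also have "\<dots> \<le> (\<Sum>k\<in>{1..N} - {j}. 1)" by (intro sum_mono) simp
  also have "\<dots> < N" using assms N1 by simp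
  finally show ?thesis .
qed

lemma poly_lagr:
  assumes "j \<in> {1..N}" "i \<in> {1..N}"
  shows "poly (lagr j) (x i) = (if i = j then 1 else 0)"
proof -
  have e: "poly (lagr j) (x i) = (\<Prod>k\<in>{1..N} - {j}. (x i - x k) / (x j - x k))"
    unfolding lagr_def poly_prod by (intro prod.cong) (auto simp: diff_divide_distrib)
  show ?thesis
  proof (cases "i = j")
    case True
    have "(x j - x k) / (x j - x k) = 1" if "k \<in> {1..N} - {j}" for k
      using x_neq[of j k] assms that by auto
    then show ?thesis unfolding e using True by simp
  next
    case False
    then show ?thesis unfolding e using assms by (auto intro!: prod_zero)
  qed
qed

lemma poly_eq_on_x:
  fixes p q :: "real poly"
  assumes "degree p < N" "degree q < N" "\<And>j. j \<in> {1..N} \<Longrightarrow> poly p (x j) = poly q (x j)"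
  shows "p = q"
proof (rule poly_eqI_degree[where A="x ` {1..N}"])
  have "card (x ` {1..N}) = N" using card_image[OF inj_x] by simp
  then show "degree p < card (x ` {1..N})" "degree q < card (x ` {1..N})" using assms by simp_all
qed (use assms in auto)

lemma poly_zero_on_y:
  fixes p :: "real poly"
  assumes "degree p < N" "\<And>m. m \<in> {1..N} \<Longrightarrow> poly p (y m) = 0"
  shows "p = 0"
proof (rule poly_eqI_degree[where A="y ` {1..N}"])
  have "card (y ` {1..N}) = N" using card_image[OF inj_y] by simp
  then show "degree p < card (y ` {1..N})" "degree 0 < card (y ` {1..N})" using assms N1 by simp_all
qed (use assms in auto)

lemma degree_prod_lin: "finite A \<Longrightarrow> degree (\<Prod>k\<in>A. [: - a k, 1::real :]) = card A"
  by (subst degree_prod_eq_sum_degree) auto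

lemma prod_x_neq_0:
  assumes "i \<in> {1..N}"
  shows "(\<Prod>k\<in>{1..N} - {i}. x i - x k) \<noteq> 0"
proof -
  have "x i - x k \<noteq> 0" if "k \<in> {1..N} - {i}" for k using x_neq[of i k] assms that by auto
  then show ?thesis by (simp only: prod_zero_iff finite_atLeastAtMost finite_Diff) blast
qed

text \<open>The two full products are monic of degree N, so their difference has degree below N and
  is determined by its values at the x_i, where a single summand survives.\<close>

lemma partial_fraction:
  "(\<Prod>m\<in>{1..N}. X - y m) = (\<Prod>j\<in>{1..N}. X - x j) + (\<Sum>j=1..N. nu j * (\<Prod>k\<in>{1..N} - {j}. X - x k))"
proof -
  define P where "P = (\<Prod>m\<in>{1..N}. [: - y m, 1 :])"
  define Q where "Q = (\<Prod>m\<in>{1..N}. [: - x m, 1 :])"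
  define S where "S = (\<Sum>j=1..N. smult (nu j) (\<Prod>k\<in>{1..N} - {j}. [: - x k, 1 :]))"
  have mon: "lead_coeff P = 1" "lead_coeff Q = 1"
    unfolding P_def Q_def by (simp_all add: lead_coeff_prod del: One_nat_def)
  have deg: "degree P = N" "degree Q = N" unfolding P_def Q_def by (simp_all add: degree_prod_lin)
  have dPQ: "degree (P - Q) < N"
  proof (cases "P = Q")
    case False
    have "degree (P - Q) \<le> N" using deg degree_diff_le_max[of P Q] by simp
    moreover have "coeff (P - Q) N = 0" using mon deg by simp
    ultimately show ?thesis
      using False leading_coeff_0_iff[of "P - Q"] by (metis diff_eq_diff_eq le_neq_implies_less right_minus_eq)
  qed (use N1 in simp)
  have "degree S \<le> N - 1"
    unfolding S_def
  proof (rule degree_sum_le)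
    fix j assume "j \<in> {1..N}"
    then show "degree (smult (nu j) (\<Prod>k\<in>{1..N} - {j}. [: - x k, 1 :])) \<le> N - 1"
      using degree_smult_le[of "nu j" "\<Prod>k\<in>{1..N} - {j}. [: - x k, 1 :]"] by (simp add: degree_prod_lin)
  qed simp
  then have dS: "degree S < N" using N1 by simp
  have "P - Q = S"
  proof (rule poly_eq_on_x[OF dPQ dS])
    fix i assume i: "i \<in> {1..N}"
    have Q0: "poly Q (x i) = 0"
      unfolding Q_def poly_prod using i by (auto intro!: prod_zero)
    have "poly S (x i) = (\<Sum>j=1..N. if j = i then nu i * (\<Prod>k\<in>{1..N} - {i}. x i - x k) else 0)"
      unfolding S_def poly_sum
    proof (rule sum.cong[OF refl])
      fix j assume j: "j \<in> {1..N}"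
      have "(\<Prod>k\<in>{1..N} - {j}. x i - x k) = 0" if "j \<noteq> i"
        using that i by (auto intro!: prod_zero)
      then show "poly (smult (nu j) (\<Prod>k\<in>{1..N} - {j}. [: - x k, 1 :])) (x i)
        = (if j = i then nu i * (\<Prod>k\<in>{1..N} - {i}. x i - x k) else 0)"
        by (auto simp: poly_prod)
    qed
    also have "\<dots> = nu i * (\<Prod>k\<in>{1..N} - {i}. x i - x k)" using i by simp
    also have "\<dots> = (\<Prod>m\<in>{1..N}. x i - y m)"
    proof -
      have "(\<Prod>k\<in>{1..N} - {i}. x i - x k) \<noteq> 0" by (rule prod_x_neq_0[OF i])
      then show ?thesis unfolding nu_def by simp
    qed
    also have "\<dots> = poly (P - Q) (x i)" unfolding poly_diff Q0 by (simp add: P_def poly_prod)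
    finally show "poly (P - Q) (x i) = poly S (x i)" by simp
  qed
  then have "poly P X = poly Q X + poly S X" by (metis diff_add_cancel add.commute poly_add)
  then show ?thesis
    by (simp add: P_def Q_def S_def poly_prod poly_sum)
qed

lemma prod_x_ratio:
  assumes "\<And>j. j \<in> {1..N} \<Longrightarrow> \<sigma> \<noteq> x j"
  shows "(\<Prod>m\<in>{1..N}. \<sigma> - y m) = (\<Prod>j\<in>{1..N}. \<sigma> - x j) * (1 - (\<Sum>j=1..N. nu j / (x j - \<sigma>)))"
proof -
  have "nu j * (\<Prod>k\<in>{1..N} - {j}. \<sigma> - x k) = - ((\<Prod>j\<in>{1..N}. \<sigma> - x j) * (nu j / (x j - \<sigma>)))"
    if j: "j \<in> {1..N}" for j
  proof -
    have "(\<Prod>j\<in>{1..N}. \<sigma> - x j) = (\<sigma> - x j) * (\<Prod>k\<in>{1..N} - {j}. \<sigma> - x k)"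
      using prod.remove[OF _ j, of "\<lambda>j. \<sigma> - x j"] by simp
    then have "(\<Prod>j\<in>{1..N}. \<sigma> - x j) * (nu j / (x j - \<sigma>))
        = (\<Prod>k\<in>{1..N} - {j}. \<sigma> - x k) * ((\<sigma> - x j) * (nu j / (x j - \<sigma>)))"
      by (simp only: mult_ac)
    also have "(\<sigma> - x j) * (nu j / (x j - \<sigma>)) = - nu j"
      using assms[OF j] by (simp add: divide_simps) (simp add: algebra_simps)
    finally show ?thesis by simp
  qed
  then have "(\<Sum>j=1..N. nu j * (\<Prod>k\<in>{1..N} - {j}. \<sigma> - x k))
      = - ((\<Prod>j\<in>{1..N}. \<sigma> - x j) * (\<Sum>j=1..N. nu j / (x j - \<sigma>)))"
    by (simp add: sum_distrib_left sum_negf)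
  then show ?thesis unfolding partial_fraction by (simp add: algebra_simps)
qed

text \<open>By \<open>prod_x_ratio\<close>, one minus the sum is prod (s - y_m) / prod (s - x_j).
  This is the secular equation of a rank-one perturbation of diag(x).\<close>

lemma secular_iff:
  assumes "\<And>j. j \<in> {1..N} \<Longrightarrow> \<sigma> \<noteq> x j"
  shows "(\<Sum>j=1..N. nu j / (x j - \<sigma>)) = 1 \<longleftrightarrow> \<sigma> \<in> y ` {1..N}"
proof -
  have "(\<Prod>j\<in>{1..N}. \<sigma> - x j) \<noteq> 0" using assms by auto
  then have "(\<Sum>j=1..N. nu j / (x j - \<sigma>)) = 1 \<longleftrightarrow> (\<Prod>m\<in>{1..N}. \<sigma> - y m) = 0"
    using prod_x_ratio[of \<sigma>, OF assms] by (simp only: mult_eq_0_iff) (auto simp del: One_nat_def)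
  moreover have "(\<Prod>m\<in>{1..N}. \<sigma> - y m) = 0 \<longleftrightarrow> \<sigma> \<in> y ` {1..N}" by auto
  ultimately show ?thesis by blast
qed

lemma secular_y: "m \<in> {1..N} \<Longrightarrow> (\<Sum>j=1..N. nu j / (x j - y m)) = 1"
  using secular_iff[of "y m"] xy_neq[of _ m] by (metis imageI)

text \<open>At s = 0, \<open>prod_x_ratio\<close> says that one minus the sum is prod y / prod x >
  0. The strict inequality is what keeps the constant 1 out of the range of H_u.\<close>

lemma sum_nu_over_x: "(\<Sum>j=1..N. nu j / x j) < 1"
proof -
  have "0 \<noteq> x j" if "j \<in> {1..N}" for j using x0[OF that] by simp
  from prod_x_ratio[of 0, OF this]
  have e: "(\<Prod>m\<in>{1..N}. - y m) = (\<Prod>j\<in>{1..N}. - x j) * (1 - (\<Sum>j=1..N. nu j / x j))"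
    by simp
  have "(\<Prod>m\<in>{1..N}. - a m) = (-1)^N * (\<Prod>m\<in>{1..N}. a m)" for a :: "nat \<Rightarrow> real"
    by (simp add: prod_uminus)
  with e have "(\<Prod>m\<in>{1..N}. y m) = (\<Prod>j\<in>{1..N}. x j) * (1 - (\<Sum>j=1..N. nu j / x j))"
    by (simp add: mult.assoc)
  moreover have "(\<Prod>m\<in>{1..N}. y m) > 0" "(\<Prod>m\<in>{1..N}. x m) > 0"
    by (auto intro!: prod_pos simp: y0 x0)
  ultimately show ?thesis by (simp add: zero_less_mult_iff)
qed

text \<open>Invertibility of the Cauchy matrix 1 / (x_j - y_m): clearing denominators leaves a
  polynomial of degree below N with the N roots y_m.\<close>

lemma cauchy_unique:
  assumes "\<And>m. m \<in> {1..N} \<Longrightarrow> (\<Sum>j=1..N. d j / (x j - y m)) = 0" "i \<in> {1..N}"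
  shows "d i = 0"
proof -
  define P where "P = (\<Sum>j=1..N. smult (d j) (\<Prod>k\<in>{1..N} - {j}. [: - x k, 1 :]))"
  have "degree P \<le> N - 1"
    unfolding P_def
  proof (rule degree_sum_le)
    fix j assume "j \<in> {1..N}"
    then show "degree (smult (d j) (\<Prod>k\<in>{1..N} - {j}. [: - x k, 1 :])) \<le> N - 1"
      using degree_smult_le[of "d j" "\<Prod>k\<in>{1..N} - {j}. [: - x k, 1 :]"] by (simp add: degree_prod_lin)
  qed simp
  then have dP: "degree P < N" using N1 by simp
  have "P = 0"
  proof (rule poly_zero_on_y[OF dP])
    fix m assume m: "m \<in> {1..N}"
    have "d j * (\<Prod>k\<in>{1..N} - {j}. y m - x k) = - ((\<Prod>j\<in>{1..N}. y m - x j) * (d j / (x j - y m)))"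
      if j: "j \<in> {1..N}" for j
    proof -
      have "(\<Prod>j\<in>{1..N}. y m - x j) = (y m - x j) * (\<Prod>k\<in>{1..N} - {j}. y m - x k)"
        using prod.remove[OF _ j, of "\<lambda>j. y m - x j"] by simp
      then have "(\<Prod>j\<in>{1..N}. y m - x j) * (d j / (x j - y m))
          = (\<Prod>k\<in>{1..N} - {j}. y m - x k) * ((y m - x j) * (d j / (x j - y m)))"
        by (simp only: mult_ac)
      also have "(y m - x j) * (d j / (x j - y m)) = - d j"
        using xy_neq[OF j m] by (simp add: divide_simps) (simp add: algebra_simps)
      finally show ?thesis by simp
    qed
    then have "poly P (y m) = - ((\<Prod>j\<in>{1..N}. y m - x j) * (\<Sum>j=1..N. d j / (x j - y m)))"
      unfolding P_def by (simp add: poly_sum poly_prod sum_distrib_left sum_negf)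
    then show "poly P (y m) = 0" using assms(1)[OF m] by simp
  qed
  then have "0 = poly P (x i)" by simp
  also have "\<dots> = (\<Sum>j=1..N. if j = i then d i * (\<Prod>k\<in>{1..N} - {i}. x i - x k) else 0)"
    unfolding P_def poly_sum
  proof (rule sum.cong[OF refl])
    fix j assume j: "j \<in> {1..N}"
    have "(\<Prod>k\<in>{1..N} - {j}. x i - x k) = 0" if "j \<noteq> i"
      using that assms(2) by (auto intro!: prod_zero)
    then show "poly (smult (d j) (\<Prod>k\<in>{1..N} - {j}. [: - x k, 1 :])) (x i)
      = (if j = i then d i * (\<Prod>k\<in>{1..N} - {i}. x i - x k) else 0)"
      by (auto simp: poly_prod)
  qed
  also have "\<dots> = d i * (\<Prod>k\<in>{1..N} - {i}. x i - x k)" using assms(2) by simp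
  finally have "d i * (\<Prod>k\<in>{1..N} - {i}. x i - x k) = 0" by simp
  moreover have "(\<Prod>k\<in>{1..N} - {i}. x i - x k) \<noteq> 0" by (rule prod_x_neq_0[OF assms(2)])
  ultimately show ?thesis by (simp only: mult_eq_0_iff) blast
qed

end

section \<open>The lower bound for the momentum\<close>

definition onf :: "nat \<Rightarrow> (nat \<Rightarrow> nat \<Rightarrow> complex) \<Rightarrow> bool" where
  "onf N E \<longleftrightarrow> (\<forall>j\<in>{1..N}. inW 0 (E j)) \<and>
     (\<forall>i\<in>{1..N}. \<forall>j\<in>{1..N}. ip (E i) (E j) = (if i = j then 1 else 0))"

text \<open>Membership in the span is encoded as being fixed by the orthogonal projection, so that
  the coordinates are inner products. This reading presupposes that \<open>E\<close> is
  orthonormal.\<close>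

definition inspan :: "nat \<Rightarrow> (nat \<Rightarrow> nat \<Rightarrow> complex) \<Rightarrow> (nat \<Rightarrow> complex) \<Rightarrow> bool" where
  "inspan N E f \<longleftrightarrow> f = (\<lambda>k. \<Sum>j=1..N. ip f (E j) * E j k)"

lemma onfD: "onf N E \<Longrightarrow> j \<in> {1..N} \<Longrightarrow> inW 0 (E j)"
  and onf_ip: "onf N E \<Longrightarrow> i \<in> {1..N} \<Longrightarrow> j \<in> {1..N} \<Longrightarrow> ip (E i) (E j) = (if i = j then 1 else 0)"
  by (auto simp: onf_def)

lemma onf_coord:
  assumes "onf N E" "i \<in> {1..N}"
  shows "ip (\<lambda>k. \<Sum>j=1..N. c j * E j k) (E i) = c i"
proof -
  have "ip (\<lambda>k. \<Sum>j=1..N. c j * E j k) (E i) = (\<Sum>j=1..N. c j * ip (E j) (E i))"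
    by (rule ip_lincomb_left) (use assms(2-) onfD[OF assms(1)] in auto)
  also have "\<dots> = (\<Sum>j=1..N. if j = i then c i else 0)"
    by (rule sum.cong) (use assms(2-) onf_ip[OF assms(1)] in auto)
  finally show ?thesis using assms by simp
qed

lemma inspanI:
  assumes "onf N E" "f = (\<lambda>k. \<Sum>j=1..N. c j * E j k)"
  shows "inspan N E f"
proof -
  have "ip f (E j) = c j" if "j \<in> {1..N}" for j
    unfolding assms(2) by (rule onf_coord[OF assms(1) that])
  then have "(\<Sum>j=1..N. c j * E j k) = (\<Sum>j=1..N. ip f (E j) * E j k)" for k
    by (intro sum.cong) auto
  then have "(\<lambda>k. \<Sum>j=1..N. c j * E j k) = (\<lambda>k. \<Sum>j=1..N. ip f (E j) * E j k)" by (rule ext)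
  then show ?thesis unfolding inspan_def by (rule trans[OF assms(2)])
qed

lemma onf_ip_sum:
  assumes "onf N E" "inspan N E f" "inW 0 g"
  shows "ip f g = (\<Sum>j=1..N. ip f (E j) * cnj (ip g (E j)))"
proof -
  have "ip f g = ip (\<lambda>k. \<Sum>j=1..N. ip f (E j) * E j k) g"
    using assms(2) unfolding inspan_def by (rule arg_cong)
  also have "\<dots> = (\<Sum>j=1..N. ip f (E j) * ip (E j) g)"
    by (rule ip_lincomb_left) (use assms(2-) onfD[OF assms(1)] in auto)
  also have "\<dots> = (\<Sum>j=1..N. ip f (E j) * cnj (ip g (E j)))"
    by (rule sum.cong) (use ip_cnj[OF assms(3) onfD[OF assms(1)]] in auto)
  finally show ?thesis .
qed

text \<open>The remainder \<open>g\<close> of the projection has squared norm |f|^2 minus the sum,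
  which yields the inequality and its equality case together.\<close>

lemma bessel:
  assumes "onf N E" "inW 0 f"
  shows "(\<Sum>j=1..N. (cmod (ip f (E j)))\<^sup>2) \<le> (wn 0 f)\<^sup>2"
    and "(\<Sum>j=1..N. (cmod (ip f (E j)))\<^sup>2) = (wn 0 f)\<^sup>2 \<longleftrightarrow> inspan N E f"
proof -
  define P where "P = (\<lambda>k. \<Sum>j=1..N. ip f (E j) * E j k)"
  define g where "g = (\<lambda>k. f k - P k)"
  have P: "inW 0 P" unfolding P_def by (intro inW_sum inW_scale) (use assms(2-) onfD[OF assms(1)] in auto)
  have g: "inW 0 g" unfolding g_def by (rule inW_diff[OF assms(2) P])
  have Pf: "ip P f = (\<Sum>j=1..N. (cmod (ip f (E j)))\<^sup>2)"
  proof -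
    have "ip P f = (\<Sum>j=1..N. ip f (E j) * ip (E j) f)"
      unfolding P_def by (rule ip_lincomb_left) (use assms(2-) onfD[OF assms(1)] in auto)
    also have "\<dots> = (\<Sum>j=1..N. complex_of_real ((cmod (ip f (E j)))\<^sup>2))"
    proof (rule sum.cong[OF refl])
      fix j assume "j \<in> {1..N}"
      then have "ip (E j) f = cnj (ip f (E j))"
        using ip_cnj[OF assms(2) onfD[OF assms(1)]] by simp
      then show "ip f (E j) * ip (E j) f = complex_of_real ((cmod (ip f (E j)))\<^sup>2)"
        by (simp add: complex_norm_square[symmetric])
    qed
    finally show ?thesis by simp
  qed
  have PP: "ip P P = ip P f"
  proof -
    have sp: "inspan N E P" by (rule inspanI[OF assms(1)]) (rule P_def)
    have "ip P (E j) = ip f (E j)" if "j \<in> {1..N}" for j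
      unfolding P_def by (rule onf_coord[OF assms(1) that])
    then show ?thesis
      unfolding onf_ip_sum[OF assms(1) sp P] onf_ip_sum[OF assms(1) sp assms(2)]
      by (intro sum.cong) auto
  qed
  have fP: "ip f P = ip P f"
    using ip_cnj[OF P assms(2)] Pf by simp
  have "ip g g = ip f f - ip P f"
    unfolding g_def using PP fP P assms(2)
    by (simp add: ip_diff_left ip_diff_right inW_diff)
  then have "complex_of_real ((wn 0 g)\<^sup>2) = of_real ((wn 0 f)\<^sup>2 - (\<Sum>j=1..N. (cmod (ip f (E j)))\<^sup>2))"
    by (simp add: ip_self g assms(2) Pf del: of_real_power)
  then have e: "(wn 0 g)\<^sup>2 = (wn 0 f)\<^sup>2 - (\<Sum>j=1..N. (cmod (ip f (E j)))\<^sup>2)"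
    using of_real_eq_iff by blast
  then show "(\<Sum>j=1..N. (cmod (ip f (E j)))\<^sup>2) \<le> (wn 0 f)\<^sup>2"
    using zero_le_power2[of "wn 0 g"] by linarith
  have "inspan N E f \<longleftrightarrow> (\<forall>k. g k = 0)"
    unfolding inspan_def g_def P_def fun_eq_iff by simp
  also have "\<dots> \<longleftrightarrow> wn 0 g = 0"
  proof
    assume "\<forall>k. g k = 0"
    then have "g = (\<lambda>k. 0)" by auto
    then show "wn 0 g = 0" by (simp only: wn_0const)
  qed (use wn_eq_0[OF g] in auto)
  finally show "(\<Sum>j=1..N. (cmod (ip f (E j)))\<^sup>2) = (wn 0 f)\<^sup>2 \<longleftrightarrow> inspan N E f"
    using e by auto
qed

text \<open>H_u T_z is also the backward shift applied after H_u: K_u deletes the first row of the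
  Hankel matrix.\<close>

lemma Kank_eq:
  assumes "inW 1 u" "inW 0 h"
  shows "Kank u h n = Hank u h (Suc n)"
proof -
  have "(\<lambda>k. sh (Suc n) u k * cnj (h k)) sums Hank u h (Suc n)"
    unfolding Hank_ip ip_def
    by (rule summable_sums[OF ip_summable]) (use assms inW_sh inW_10 in auto)
  then have "(\<lambda>k. u (n + Suc k) * cnj (Tz h (Suc k))) sums Hank u h (Suc n)"
    by (simp add: sh_def Tz_def)
  then have "(\<lambda>k. u (n + k) * cnj (Tz h k)) sums (Hank u h (Suc n) + u (n + 0) * cnj (Tz h 0))"
    using sums_Suc[of "\<lambda>k. u (n + k) * cnj (Tz h k)"] by simp
  then show ?thesis by (simp add: Kank_def Hank_def Tz_def sums_iff)
qed

lemma inW_Tz: "inW 0 h \<Longrightarrow> inW 0 (Tz h)"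
proof -
  assume "inW 0 h"
  then have "summable (\<lambda>k. (cmod (Tz h (Suc k)))\<^sup>2)" by (simp add: inW_def Tz_def)
  then have "summable (\<lambda>k. (cmod (Tz h k))\<^sup>2)" by (subst (asm) summable_Suc_iff)
  then show ?thesis by (simp add: inW_def)
qed

lemma inW_Kank: "inW 1 u \<Longrightarrow> inW 0 h \<Longrightarrow> inW 0 (Kank u h)"
  unfolding Kank_def by (rule Hank_bound(1)[OF _ inW_Tz])

text \<open>The deleted coefficient (H_u h)(0) contributes its conjugate times u to H_u(H_u h), and
  that conjugate is (h | u). So K_u^2 is a rank-one perturbation of H_u^2.\<close>

lemma Kank2_eq:
  assumes "inW 1 u" "inW 0 h"
  shows "Kank u (Kank u h) = (\<lambda>n. Hank u (Hank u h) n - ip h u * u n)"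
proof
  fix n
  have H: "inW 0 (Hank u h)" by (rule Hank_bound(1)[OF assms])
  have c: "cnj (Hank u h 0) = ip h u"
    unfolding Hank_ip sh_0 by (rule ip_cnj) (use assms inW_10 in auto)
  have "(\<lambda>k. u (n + k) * cnj (Hank u h k)) sums Hank u (Hank u h) n"
    unfolding Hank_ip[of _ "Hank u h"] ip_def sh_def[symmetric]
    using summable_sums[OF ip_summable[OF inW_sh[OF inW_10[OF assms(1)], of n] H]] by (simp add: sh_def)
  then have "(\<lambda>k. u (n + Suc k) * cnj (Hank u h (Suc k))) sums (Hank u (Hank u h) n - u (n + 0) * cnj (Hank u h 0))"
    using sums_Suc_iff[of "\<lambda>k. u (n + k) * cnj (Hank u h k)"] by simp
  moreover have "Kank u (Kank u h) n = (\<Sum>k. u (n + Suc k) * cnj (Hank u h (Suc k)))"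
    unfolding Kank_eq[OF assms(1) inW_Kank[OF assms]] by (simp add: Hank_def Kank_eq[OF assms])
  ultimately show "Kank u (Kank u h) n = Hank u (Hank u h) n - ip h u * u n"
    by (simp add: sums_iff c mult.commute)
qed

lemma Mfun_summable: "inW 1 u \<Longrightarrow> summable (\<lambda>k. real k * (cmod (u k))\<^sup>2)"
  unfolding inW_def by (rule summable_comparison_test'[of _ 0]) (auto simp: distrib_right)

lemma Mfun_wn: "inW 1 u \<Longrightarrow> (wn 1 u)\<^sup>2 = Mfun u + (wn 0 u)\<^sup>2"
proof -
  assume a: "inW 1 u"
  have "(\<lambda>k. real k * (cmod (u k))\<^sup>2 + (cmod (u k))\<^sup>2) sums (Mfun u + (wn 0 u)\<^sup>2)"
    by (rule sums_add[OF _ wn0_sums[OF inW_10[OF a]]])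
      (use Mfun_summable[OF a] in \<open>simp add: Mfun_def summable_sums\<close>)
  then show ?thesis unfolding wn_sq[OF a] wsq_def by (simp add: sums_iff algebra_simps)
qed

text \<open>The coefficient \<open>u j\<close> occurs in exactly j of the rows
  \<open>sh (Suc n) u\<close>, namely for n < j; the momentum is summed by rows instead of
  antidiagonals.\<close>

lemma Mfun_rows:
  assumes "inW 1 u"
  shows "(\<lambda>n. (wn 0 (sh (Suc n) u))\<^sup>2) sums Mfun u"
proof -
  let ?f = "\<lambda>(n,k). (cmod (u (Suc n + k)))\<^sup>2"
  have u0: "inW 0 u" by (rule inW_10[OF assms])
  have row: "((\<lambda>k. ?f (n,k)) has_sum (wn 0 (sh (Suc n) u))\<^sup>2) UNIV" for n
    using norm_summable_imp_has_sum[of "\<lambda>k. (cmod (u (Suc n + k)))\<^sup>2" "(wn 0 (sh (Suc n) u))\<^sup>2"]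
      wn0_sums[OF inW_sh[OF u0, of "Suc n"]] by (auto simp: sh_def sums_iff)
  have M: "((\<lambda>k. real k * (cmod (u k))\<^sup>2) has_sum Mfun u) UNIV"
    using norm_summable_imp_has_sum[of "\<lambda>k. real k * (cmod (u k))\<^sup>2" "Mfun u"]
      Mfun_summable[OF assms] by (auto simp: Mfun_def summable_sums)
  have "((\<lambda>(j,n). (cmod (u j))\<^sup>2) has_sum Mfun u) (SIGMA j:UNIV. {..<j})"
  proof (rule has_sum_SigmaI[OF _ M])
    have fin: "((\<lambda>n. (cmod (u j))\<^sup>2) has_sum (real j * (cmod (u j))\<^sup>2)) {..<j}" for j
      by (rule has_sum_finiteI) simp_all
    then show "((\<lambda>n. case (j, n) of (j, n) \<Rightarrow> (cmod (u j))\<^sup>2) has_sum real j * (cmod (u j))\<^sup>2) {..<j}" for j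
      by simp
    show "(\<lambda>(j,n). (cmod (u j))\<^sup>2) summable_on (SIGMA j:UNIV. {..<j})"
      by (rule summable_on_SigmaI[OF _ has_sum_imp_summable[OF M]]) (use fin in auto)
  qed
  then have "(?f has_sum Mfun u) UNIV"
    by (rule has_sum_reindex_bij_witness[of _ "\<lambda>(n,k). (Suc n + k, n)" "\<lambda>(j,n). (n, j - Suc n)", THEN iffD1, rotated -1]) auto
  then have "((\<lambda>n. (wn 0 (sh (Suc n) u))\<^sup>2) has_sum Mfun u) UNIV"
    using has_sum_SigmaD[of ?f UNIV "\<lambda>_. UNIV" "Mfun u" "\<lambda>n. (wn 0 (sh (Suc n) u))\<^sup>2"] row by auto
  then show ?thesis by (rule has_sum_imp_sums)
qed

lemma Hank_norm_ip:
  assumes "inW 1 u" "inW 0 h"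
  shows "complex_of_real ((wn 0 (Hank u h))\<^sup>2) = ip (Hank u (Hank u h)) h"
  using ip_Hank_sym[OF assms(1) Hank_bound(1)[OF assms] assms(2)] ip_self[OF Hank_bound(1)[OF assms]]
  by simp

text \<open>Since (sh n u | E_j) is the coefficient n of H_u E_j, summing Bessel's bound over the
  rows n >= 1 gives |H_u E_j|^2 without its zeroth term |(u | E_j)|^2. Equality of the sums forces
  equality in every row.\<close>

lemma trace_ineq:
  assumes "inW 1 u" "onf N E"
  shows "(\<Sum>j=1..N. (wn 0 (Hank u (E j)))\<^sup>2 - (cmod (ip u (E j)))\<^sup>2) \<le> Mfun u"
    and "(\<Sum>j=1..N. (wn 0 (Hank u (E j)))\<^sup>2 - (cmod (ip u (E j)))\<^sup>2) = Mfun u \<longleftrightarrow>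
      (\<forall>n. inspan N E (sh (Suc n) u))"
proof -
  have u0: "inW 0 u" by (rule inW_10[OF assms(1)])
  let ?s = "\<lambda>n. \<Sum>j=1..N. (cmod (ip (sh (Suc n) u) (E j)))\<^sup>2"
  let ?T = "\<Sum>j=1..N. (wn 0 (Hank u (E j)))\<^sup>2 - (cmod (ip u (E j)))\<^sup>2"
  have S: "?s sums ?T"
  proof (rule sums_sum)
    fix j assume "j \<in> {1..N}"
    then have "inW 0 (Hank u (E j))" using Hank_bound(1)[OF assms(1) onfD[OF assms(2)]] by simp
    from wn0_sums[OF this]
    have "(\<lambda>n. (cmod (Hank u (E j) (Suc n)))\<^sup>2) sums ((wn 0 (Hank u (E j)))\<^sup>2 - (cmod (Hank u (E j) 0))\<^sup>2)"
      using sums_Suc_iff[of "\<lambda>n. (cmod (Hank u (E j) n))\<^sup>2"] by simp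
    then show "(\<lambda>n. (cmod (ip (sh (Suc n) u) (E j)))\<^sup>2) sums ((wn 0 (Hank u (E j)))\<^sup>2 - (cmod (ip u (E j)))\<^sup>2)"
      by (simp add: Hank_ip)
  qed
  have D: "(\<lambda>n. (wn 0 (sh (Suc n) u))\<^sup>2 - ?s n) sums (Mfun u - ?T)"
    by (rule sums_diff[OF Mfun_rows[OF assms(1)] S])
  have nn: "0 \<le> (wn 0 (sh (Suc n) u))\<^sup>2 - ?s n" for n
    using bessel(1)[OF assms(2) inW_sh[OF u0, of "Suc n"]] by simp
  have "0 \<le> (\<Sum>n. (wn 0 (sh (Suc n) u))\<^sup>2 - ?s n)"
    by (rule suminf_nonneg) (use D nn in \<open>auto simp: sums_iff\<close>)
  then have "0 \<le> Mfun u - ?T" using D by (simp add: sums_iff)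
  then show "?T \<le> Mfun u" by simp
  have "?T = Mfun u \<longleftrightarrow> (\<Sum>n. (wn 0 (sh (Suc n) u))\<^sup>2 - ?s n) = 0"
    using D by (auto simp: sums_iff)
  also have "\<dots> \<longleftrightarrow> (\<forall>n. (wn 0 (sh (Suc n) u))\<^sup>2 - ?s n = 0)"
    by (rule suminf_eq_zero_iff) (use D nn in \<open>auto simp: sums_iff\<close>)
  also have "\<dots> \<longleftrightarrow> (\<forall>n. inspan N E (sh (Suc n) u))"
    using bessel(2)[OF assms(2) inW_sh[OF u0]] by (metis eq_iff_diff_eq_0)
  finally show "?T = Mfun u \<longleftrightarrow> (\<forall>n. inspan N E (sh (Suc n) u))" .
qed

lemma Hank_span:
  assumes "inW 1 u" "onf N E" "\<And>n. inspan N E (sh n u)" "inW 0 h"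
  shows "inspan N E (Hank u h)"
proof (rule inspanI[OF assms(2)])
  have u0: "inW 0 u" by (rule inW_10[OF assms(1)])
  \<comment> \<open>The Hankel matrix is symmetric, so expanding the rows k gives an expansion of
    row n in which the \<open>E j\<close> carry the row index.\<close>
  have sym: "sh n u = (\<lambda>k. \<Sum>j=1..N. E j n * Hank u (E j) k)" for n
  proof
    fix k
    have "sh n u k = sh k u n" by (simp add: sh_def add.commute)
    also have "\<dots> = (\<Sum>j=1..N. ip (sh k u) (E j) * E j n)"
      using assms(3)[of k] unfolding inspan_def by (rule fun_cong)
    finally show "sh n u k = (\<Sum>j=1..N. E j n * Hank u (E j) k)"
      by (simp add: Hank_ip mult.commute)
  qed
  show "Hank u h = (\<lambda>k. \<Sum>j=1..N. ip (Hank u (E j)) h * E j k)"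
  proof
    fix n
    have "Hank u h n = ip (sh n u) h" by (rule Hank_ip)
    also have "\<dots> = ip (\<lambda>k. \<Sum>j=1..N. E j n * Hank u (E j) k) h"
      by (rule arg_cong[OF sym])
    also have "\<dots> = (\<Sum>j=1..N. E j n * ip (Hank u (E j)) h)"
      by (rule ip_lincomb_left) (use assms(4) Hank_bound(1)[OF assms(1) onfD[OF assms(2)]] in auto)
    finally show "Hank u h n = (\<Sum>j=1..N. ip (Hank u (E j)) h * E j n)"
      by (simp add: mult.commute)
  qed
qed

section \<open>Eigenframes of H_u^2 and the variational lower bound\<close>

context interlaced
begin

text \<open>The existence of such a frame characterises the torus (\<open>Tset_iff_spec\<close>).
  Asking for eigenvectors of the linear operator H_u^2 leaves the phases of the \<open>E j\<close>
  free.\<close>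

definition spec :: "(nat \<Rightarrow> complex) \<Rightarrow> (nat \<Rightarrow> nat \<Rightarrow> complex) \<Rightarrow> bool" where
  "spec u E \<longleftrightarrow> inW 1 u \<and> onf N E \<and> (\<forall>n. inspan N E (sh n u)) \<and>
     (\<forall>j\<in>{1..N}. Hank u (Hank u (E j)) = (\<lambda>k. complex_of_real (x j) * E j k)) \<and>
     (\<forall>j\<in>{1..N}. (cmod (ip u (E j)))\<^sup>2 = nu j)"

definition admissible :: "(nat \<Rightarrow> complex) \<Rightarrow> bool" where
  "admissible u \<longleftrightarrow> inW 1 u \<and> (\<forall>n\<in>{1..2*N}. Jfun n u = (\<Sum>j=1..N. nu j * x j ^ (n - 1)))"

lemma spec_H2:
  assumes "spec u E"
  shows "Hank u (Hank u (\<lambda>k. \<Sum>j=1..N. c j * E j k)) = (\<lambda>k. \<Sum>j=1..N. (complex_of_real (x j) * c j) * E j k)"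
proof -
  have u: "inW 1 u" and E: "onf N E"
    and eig: "\<And>j. j \<in> {1..N} \<Longrightarrow> Hank u (Hank u (E j)) = (\<lambda>k. complex_of_real (x j) * E j k)"
    using assms by (auto simp: spec_def)
  have 1: "Hank u (\<lambda>k. \<Sum>j=1..N. c j * E j k) = (\<lambda>n. \<Sum>j=1..N. cnj (c j) * Hank u (E j) n)"
    by (rule Hank_lincomb) (use u onfD[OF E] in auto)
  have 2: "Hank u (\<lambda>n. \<Sum>j=1..N. cnj (c j) * Hank u (E j) n)
    = (\<lambda>n. \<Sum>j=1..N. cnj (cnj (c j)) * Hank u (Hank u (E j)) n)"
    by (rule Hank_lincomb) (use u Hank_bound(1)[OF u onfD[OF E]] in auto)
  show ?thesis unfolding 1 2 by (rule ext, rule sum.cong) (use eig in auto)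
qed

lemma spec_pow:
  assumes "spec u E"
  shows "(Hank u ^^ (2*a)) (\<lambda>k. \<Sum>j=1..N. c j * E j k) = (\<lambda>k. \<Sum>j=1..N. (complex_of_real (x j) ^ a * c j) * E j k)"
proof (induction a)
  case (Suc a)
  have "(Hank u ^^ (2 * Suc a)) (\<lambda>k. \<Sum>j=1..N. c j * E j k)
    = Hank u (Hank u (\<lambda>k. \<Sum>j=1..N. (complex_of_real (x j) ^ a * c j) * E j k))"
    using Suc by simp
  also have "\<dots> = (\<lambda>k. \<Sum>j=1..N. (complex_of_real (x j) * (complex_of_real (x j) ^ a * c j)) * E j k)"
    by (rule spec_H2[OF assms])
  finally show ?case by (simp add: mult_ac)
qed simp

lemma spec_u:
  assumes "spec u E"
  shows "u = (\<lambda>k. \<Sum>j=1..N. ip u (E j) * E j k)"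
proof -
  have "inspan N E (sh 0 u)" using assms unfolding spec_def by blast
  then show ?thesis by (simp add: inspan_def)
qed

lemma spec_J:
  assumes "spec u E"
  shows "Jfun (Suc a) u = (\<Sum>j=1..N. nu j * x j ^ a)"
proof -
  have u: "inW 1 u" and E: "onf N E" and nu: "\<And>j. j \<in> {1..N} \<Longrightarrow> (cmod (ip u (E j)))\<^sup>2 = nu j"
    using assms by (auto simp: spec_def)
  have p: "(Hank u ^^ (2*a)) u = (\<lambda>k. \<Sum>j=1..N. (complex_of_real (x j) ^ a * ip u (E j)) * E j k)"
    using spec_pow[OF assms, of a "\<lambda>j. ip u (E j)"] spec_u[OF assms] by simp
  have "Jfun (Suc a) u = ip ((Hank u ^^ (2*a)) u) u" using J_gram[OF u, of a 0] by simp
  also have "\<dots> = (\<Sum>j=1..N. (complex_of_real (x j) ^ a * ip u (E j)) * cnj (ip u (E j)))"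
  proof -
    have "inspan N E ((Hank u ^^ (2*a)) u)" by (rule inspanI[OF E p])
    from onf_ip_sum[OF E this inW_10[OF u]]
    have "ip ((Hank u ^^ (2*a)) u) u = (\<Sum>j=1..N. ip ((Hank u ^^ (2*a)) u) (E j) * cnj (ip u (E j)))" .
    also have "\<dots> = (\<Sum>j=1..N. (complex_of_real (x j) ^ a * ip u (E j)) * cnj (ip u (E j)))"
      by (rule sum.cong[OF refl]) (simp only: p onf_coord[OF E])
    finally show ?thesis .
  qed
  also have "\<dots> = (\<Sum>j=1..N. complex_of_real (nu j * x j ^ a))"
  proof (rule sum.cong[OF refl])
    fix j assume "j \<in> {1..N}"
    have "ip u (E j) * cnj (ip u (E j)) = of_real ((cmod (ip u (E j)))\<^sup>2)"
      by (simp add: complex_norm_square[symmetric])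
    then show "(complex_of_real (x j) ^ a * ip u (E j)) * cnj (ip u (E j)) = complex_of_real (nu j * x j ^ a)"
      using nu[OF \<open>j \<in> {1..N}\<close>] by (simp add: mult_ac)
  qed
  finally show ?thesis by simp
qed

lemma spec_norm:
  assumes "spec u E" "j \<in> {1..N}"
  shows "(wn 0 (Hank u (E j)))\<^sup>2 = x j"
proof -
  have u: "inW 1 u" and E: "onf N E" and eig: "Hank u (Hank u (E j)) = (\<lambda>k. complex_of_real (x j) * E j k)"
    using assms by (auto simp: spec_def)
  have "complex_of_real ((wn 0 (Hank u (E j)))\<^sup>2) = complex_of_real (x j) * ip (E j) (E j)"
    unfolding Hank_norm_ip[OF u onfD[OF E assms(2)]] eig
    by (rule ip_scale_left) (use onfD[OF E assms(2)] in auto)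
  also have "\<dots> = of_real (x j)" using onf_ip[OF E assms(2,2)] by simp
  finally show ?thesis using of_real_eq_iff by blast
qed

lemma spec_M:
  assumes "spec u E"
  shows "Mfun u = m0"
proof -
  have u: "inW 1 u" and E: "onf N E" and sp: "\<And>n. inspan N E (sh n u)"
    and nu: "\<And>j. j \<in> {1..N} \<Longrightarrow> (cmod (ip u (E j)))\<^sup>2 = nu j"
    using assms by (auto simp: spec_def)
  have "Mfun u = (\<Sum>j=1..N. (wn 0 (Hank u (E j)))\<^sup>2 - (cmod (ip u (E j)))\<^sup>2)"
    using trace_ineq(2)[OF u E] sp by simp
  also have "\<dots> = m0" unfolding m0_def
    by (rule sum.cong) (use nu spec_norm[OF assms] in auto)
  finally show ?thesis .
qed

lemma spec_admissible: "spec u E \<Longrightarrow> admissible u"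
proof -
  assume a: "spec u E"
  have "Jfun n u = (\<Sum>j=1..N. nu j * x j ^ (n - 1))" if "n \<in> {1..2*N}" for n
    using spec_J[OF a, of "n - 1"] that by simp
  then show ?thesis using a by (simp add: admissible_def spec_def)
qed

text \<open>The frame consists of lagr_j(H_u^2) u / sqrt(nu_j). The constraints make p -> p(H_u^2) u
  an isometry from the polynomials of degree below N with the measure sum_r nu_r delta_{x_r}, for
  which the Lagrange polynomials are orthogonal. At this stage only the compression of H_u^2 to the
  span is known to be diagonal.\<close>

lemma admissible_frame:
  assumes "admissible u"
  obtains E where "onf N E" "inspan N E u"
    "\<And>i j. i \<in> {1..N} \<Longrightarrow> j \<in> {1..N} \<Longrightarrow> ip (Hank u (Hank u (E i))) (E j) = (if i = j then x i else 0)"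
    "\<And>j. j \<in> {1..N} \<Longrightarrow> (cmod (ip u (E j)))\<^sup>2 = nu j"
proof -
  have u: "inW 1 u" and J: "\<And>n. n \<in> {1..2*N} \<Longrightarrow> Jfun n u = (\<Sum>j=1..N. nu j * x j ^ (n - 1))"
    using assms by (auto simp: admissible_def)
  have u0: "inW 0 u" by (rule inW_10[OF u])
  define h where "h a = (Hank u ^^ (2*a)) u" for a
  have h0: "inW 0 (h a)" for a unfolding h_def by (rule Hank_pow_inW[OF u u0])
  define g where "g p = (\<lambda>k. \<Sum>a<N. complex_of_real (coeff p a) * h a k)" for p :: "real poly"
  have g0: "inW 0 (g p)" for p unfolding g_def by (intro inW_sum inW_scale h0) auto
  \<comment> \<open>The case s = 0 is the Gram matrix and s = 1 gives the matrix elements of H_u^2.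
    The values used are \<open>Jfun (Suc (a + b + s)) u\<close> with a, b < N, so the last index is
    2N.\<close>
  have gram: "ip (\<lambda>k. \<Sum>a<N. complex_of_real (coeff p a) * h (a + s) k) (g q)
      = of_real (\<Sum>r=1..N. nu r * x r ^ s * poly p (x r) * poly q (x r))"
    if "degree p < N" "degree q < N" "s \<le> 1" for p q s
  proof -
    have "ip (\<lambda>k. \<Sum>a<N. complex_of_real (coeff p a) * h (a + s) k) (g q)
      = (\<Sum>a<N. coeff p a * ip (h (a + s)) (g q))"
      by (rule ip_lincomb_left) (use h0 g0 in auto)
    also have "\<dots> = (\<Sum>a<N. coeff p a * (\<Sum>b<N. cnj (coeff q b) * ip (h (a + s)) (h b)))"
    proof -
      have "ip (h a) (g q) = (\<Sum>b<N. cnj (coeff q b) * ip (h a) (h b))" for a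
        unfolding g_def by (rule ip_lincomb_right) (use h0 in auto)
      then show ?thesis by simp
    qed
    also have "\<dots> = (\<Sum>a<N. coeff p a * (\<Sum>b<N. coeff q b * (\<Sum>r=1..N. nu r * x r ^ (a + s + b))))"
    proof -
      have "ip (h (a + s)) (h b) = of_real (\<Sum>r=1..N. nu r * x r ^ (a + s + b))" if "a < N" "b < N" for a b
        unfolding h_def J_gram[OF u] using J[of "Suc (a + s + b)"] that \<open>s \<le> 1\<close> by simp
      then show ?thesis by simp
    qed
    also have "\<dots> = of_real (\<Sum>a<N. \<Sum>b<N. \<Sum>r=1..N. nu r * x r ^ s * (coeff p a * x r ^ a) * (coeff q b * x r ^ b))"
      by (simp add: sum_distrib_left power_add mult_ac)
    also have "(\<Sum>a<N. \<Sum>b<N. \<Sum>r=1..N. nu r * x r ^ s * (coeff p a * x r ^ a) * (coeff q b * x r ^ b))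
       = (\<Sum>r=1..N. \<Sum>a<N. \<Sum>b<N. nu r * x r ^ s * (coeff p a * x r ^ a) * (coeff q b * x r ^ b))"
    proof -
      have "(\<Sum>a<N. \<Sum>b<N. \<Sum>r=1..N. nu r * x r ^ s * (coeff p a * x r ^ a) * (coeff q b * x r ^ b))
       = (\<Sum>a<N. \<Sum>r=1..N. \<Sum>b<N. nu r * x r ^ s * (coeff p a * x r ^ a) * (coeff q b * x r ^ b))"
        by (rule sum.cong[OF refl]) (rule sum.swap)
      also have "\<dots> = (\<Sum>r=1..N. \<Sum>a<N. \<Sum>b<N. nu r * x r ^ s * (coeff p a * x r ^ a) * (coeff q b * x r ^ b))"
        by (rule sum.swap)
      finally show ?thesis .
    qed
    also have "\<dots> = (\<Sum>r=1..N. nu r * x r ^ s * poly p (x r) * poly q (x r))"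
      unfolding poly_sum_lessThan[OF that(1)] poly_sum_lessThan[OF that(2)]
      by (simp add: sum_distrib_left sum_distrib_right mult_ac)
    finally show ?thesis .
  qed
  define E where "E j = (\<lambda>k. complex_of_real (1 / sqrt (nu j)) * g (lagr j) k)" for j
  have E0: "inW 0 (E j)" for j unfolding E_def by (intro inW_scale g0)
  have sq: "sqrt (nu j) * sqrt (nu j) = nu j" "sqrt (nu j) > 0" if "j \<in> {1..N}" for j
    using nu_pos[OF that] by simp_all
  have lag: "(\<Sum>r=1..N. nu r * x r ^ s * poly (lagr i) (x r) * poly (lagr j) (x r))
    = (if i = j then nu i * x i ^ s else 0)" if "i \<in> {1..N}" "j \<in> {1..N}" for i j s
  proof -
    have "(\<Sum>r=1..N. nu r * x r ^ s * poly (lagr i) (x r) * poly (lagr j) (x r))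
      = (\<Sum>r=1..N. if r = i then (if i = j then nu i * x i ^ s else 0) else 0)"
      by (rule sum.cong[OF refl]) (use poly_lagr that in auto)
    then show ?thesis using that by simp
  qed
  have scal: "ip (\<lambda>k. complex_of_real c * f k) (E j) = of_real (c / sqrt (nu j)) * ip f (g (lagr j))"
    if "inW 0 f" for c f j
  proof -
    have "ip f (E j) = cnj (complex_of_real (1 / sqrt (nu j))) * ip f (g (lagr j))"
      unfolding E_def by (rule ip_scale_right[OF g0 that])
    then show ?thesis using ip_scale_left[OF that E0[of j], of "complex_of_real c"] by simp
  qed
  have gs: "g p = (\<lambda>k. \<Sum>a<N. complex_of_real (coeff p a) * h (a + 0) k)" for p
    by (simp add: g_def)
  have on: "ip (E i) (E j) = (if i = j then 1 else 0)" if "i \<in> {1..N}" "j \<in> {1..N}" for i j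
  proof -
    have "ip (E i) (E j) = of_real (1 / sqrt (nu i) / sqrt (nu j)) * ip (g (lagr i)) (g (lagr j))"
      by (subst E_def) (rule scal[OF g0])
    also have "ip (g (lagr i)) (g (lagr j)) = of_real (if i = j then nu i else 0)"
      by (subst gs, subst gram) (use degree_lagr that lag[OF that, of 0] in \<open>simp_all del: of_real_sum One_nat_def\<close>)
    finally show ?thesis using sq[OF that(1)] nu_pos[OF that(1)] by (auto simp flip: of_real_mult)
  qed
  have onE: "onf N E" using on E0 by (simp add: onf_def)
  have H2: "Hank u (Hank u (g p)) = (\<lambda>k. \<Sum>a<N. complex_of_real (coeff p a) * h (a + 1) k)" for p
  proof -
    have "Hank u (g p) = (\<lambda>n. \<Sum>a<N. cnj (complex_of_real (coeff p a)) * Hank u (h a) n)"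
      unfolding g_def by (rule Hank_lincomb) (use h0 u in auto)
    then have "Hank u (Hank u (g p)) = (\<lambda>n. \<Sum>a<N. cnj (cnj (complex_of_real (coeff p a))) * Hank u (Hank u (h a)) n)"
      by (simp only:) (rule Hank_lincomb, use u Hank_bound(1)[OF u h0] in auto)
    then show ?thesis by (simp add: h_def)
  qed
  have eig: "ip (Hank u (Hank u (E i))) (E j) = (if i = j then x i else 0)" if "i \<in> {1..N}" "j \<in> {1..N}" for i j
  proof -
    have "Hank u (Hank u (E i)) = (\<lambda>k. complex_of_real (1 / sqrt (nu i)) * Hank u (Hank u (g (lagr i))) k)"
      unfolding E_def
      by (simp only: Hank_scale[OF g0 u] Hank_scale[OF Hank_bound(1)[OF u g0] u] complex_cnj_complex_of_real)
    then have "ip (Hank u (Hank u (E i))) (E j)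
        = of_real (1 / sqrt (nu i) / sqrt (nu j)) * ip (Hank u (Hank u (g (lagr i)))) (g (lagr j))"
      by (simp only:) (rule scal, intro Hank_bound(1) u g0)
    also have "ip (Hank u (Hank u (g (lagr i)))) (g (lagr j)) = of_real (if i = j then nu i * x i else 0)"
      by (subst H2, subst gram) (use degree_lagr that lag[OF that, of 1] in \<open>simp_all del: of_real_sum One_nat_def\<close>)
    also have "complex_of_real (1 / sqrt (nu i) / sqrt (nu j)) * of_real (if i = j then nu i * x i else 0)
        = of_real (if i = j then x i else 0)"
      unfolding of_real_mult[symmetric] of_real_eq_iff using nu_pos[OF that(1)] by (cases "i = j") auto
    finally show ?thesis by simp
  qed
  have ug: "u = g 1"
  proof
    fix k
    have "(\<Sum>a<N. complex_of_real (coeff (1::real poly) a) * h a k) = (\<Sum>a<N. if a = 0 then u k else 0)"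
      by (rule sum.cong) (auto simp: coeff_1 h_def)
    then show "u k = g 1 k" using N1 by (simp add: g_def)
  qed
  have uE: "ip u (E j) = of_real (sqrt (nu j))" if "j \<in> {1..N}" for j
  proof -
    have "ip u (E j) = of_real (1 / sqrt (nu j)) * ip (g 1) (g (lagr j))"
      using scal[OF u0, of 1 j] ug by simp
    also have "ip (g 1) (g (lagr j)) = of_real (\<Sum>r=1..N. nu r * poly (lagr j) (x r))"
      by (subst gs, subst gram) (use degree_lagr[OF that] N1 in \<open>simp_all del: of_real_sum One_nat_def\<close>)
    also have "(\<Sum>r=1..N. nu r * poly (lagr j) (x r)) = (\<Sum>r=1..N. if r = j then nu j else 0)"
      by (rule sum.cong) (use poly_lagr that in auto)
    also have "\<dots> = sqrt (nu j) * sqrt (nu j)" using that sq[OF that] by simp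
    finally show ?thesis
      using sq(2)[OF that] real_div_sqrt[OF less_imp_le[OF nu_pos[OF that]]]
      by (simp flip: of_real_mult of_real_divide)
  qed
  then have nuE: "(cmod (ip u (E j)))\<^sup>2 = nu j" if "j \<in> {1..N}" for j
    using that nu_pos[OF that] by simp
  \<comment> \<open>|u|^2 = J_2 is the total mass, all of which the frame captures; equality in
    Bessel's inequality then places u in the span.\<close>
  have "complex_of_real ((wn 0 u)\<^sup>2) = Jfun 1 u"
    using J_gram[OF u, of 0 0] ip_self[OF u0] by simp
  also have "\<dots> = of_real (\<Sum>j=1..N. nu j)" using J[of 1] N1 by simp
  finally have "(wn 0 u)\<^sup>2 = (\<Sum>j=1..N. nu j)" using of_real_eq_iff by blast
  also have "\<dots> = (\<Sum>j=1..N. (cmod (ip u (E j)))\<^sup>2)" by (rule sum.cong) (use nuE in auto)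
  finally have "inspan N E u" using bessel(2)[OF onE u0] by simp
  then show ?thesis using that onE eig nuE by blast
qed

text \<open>On the frame the left side of \<open>trace_ineq\<close> is \<open>m0\<close>. If the
  bound is attained, all rows lie in the span, \<open>Hank_span\<close> keeps H_u inside it, and the
  diagonal compression becomes a genuine eigenvector relation.\<close>

lemma admissible_lower:
  assumes "admissible u"
  shows "m0 \<le> Mfun u" and "Mfun u \<le> m0 \<Longrightarrow> \<exists>E. spec u E"
proof -
  have u: "inW 1 u" using assms by (simp add: admissible_def)
  obtain E where E: "onf N E" "inspan N E u"
    and eig: "\<And>i j. i \<in> {1..N} \<Longrightarrow> j \<in> {1..N} \<Longrightarrow> ip (Hank u (Hank u (E i))) (E j) = (if i = j then x i else 0)"
    and nu: "\<And>j. j \<in> {1..N} \<Longrightarrow> (cmod (ip u (E j)))\<^sup>2 = nu j"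
    using admissible_frame[OF assms] by blast
  have "complex_of_real ((wn 0 (Hank u (E j)))\<^sup>2) = of_real (x j)" if "j \<in> {1..N}" for j
    using Hank_norm_ip[OF u onfD[OF E(1) that]] eig[OF that that] by simp
  then have nrm: "(wn 0 (Hank u (E j)))\<^sup>2 = x j" if "j \<in> {1..N}" for j
    using that of_real_eq_iff by blast
  have T: "(\<Sum>j=1..N. (wn 0 (Hank u (E j)))\<^sup>2 - (cmod (ip u (E j)))\<^sup>2) = m0"
    unfolding m0_def by (rule sum.cong) (use nu nrm in auto)
  show "m0 \<le> Mfun u" using trace_ineq(1)[OF u E(1)] T by simp
  assume "Mfun u \<le> m0"
  then have "m0 = Mfun u" using \<open>m0 \<le> Mfun u\<close> by simp
  then have "inspan N E (sh (Suc n) u)" for n using trace_ineq(2)[OF u E(1)] T by simp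
  then have sp: "inspan N E (sh n u)" for n using E(2) by (cases n) auto
  have "Hank u (Hank u (E i)) = (\<lambda>k. complex_of_real (x i) * E i k)" if "i \<in> {1..N}" for i
  proof
    fix k
    have "inspan N E (Hank u (Hank u (E i)))"
      by (rule Hank_span[OF u E(1) sp Hank_bound(1)[OF u onfD[OF E(1) that]]])
    then have "Hank u (Hank u (E i)) k = (\<Sum>j=1..N. ip (Hank u (Hank u (E i))) (E j) * E j k)"
      unfolding inspan_def by (rule fun_cong)
    also have "\<dots> = (\<Sum>j=1..N. if j = i then complex_of_real (x i) * E i k else 0)"
      by (rule sum.cong) (use eig that in auto)
    finally show "Hank u (Hank u (E i)) k = complex_of_real (x i) * E i k" using that by simp
  qed
  then show "\<exists>E. spec u E" using u E sp nu unfolding spec_def by blast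
qed

end

section \<open>Existence of minimisers\<close>

text \<open>Diagonal extraction over the coefficient index; the limit is coefficientwise and carries
  no summability yet.\<close>

lemma pointwise_subseq:
  fixes f :: "nat \<Rightarrow> nat \<Rightarrow> complex"
  assumes "\<And>j k. cmod (f k j) \<le> B j"
  obtains r v where "strict_mono (r :: nat \<Rightarrow> nat)" "\<And>j. (\<lambda>k. f (r k) j) \<longlonglongrightarrow> v j"
proof -
  interpret subseqs "\<lambda>n s. convergent (\<lambda>k. f (s k) n)"
  proof
    fix n and s :: "nat \<Rightarrow> nat"
    have "bounded (range (\<lambda>k. f (s k) n))"
      using assms by (intro boundedI[of _ "B n"]) auto
    then obtain l r where "strict_mono r" "((\<lambda>k. f (s k) n) \<circ> r) \<longlonglongrightarrow> l"
      using bounded_imp_convergent_subsequence by blast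
    then show "\<exists>r. strict_mono r \<and> convergent (\<lambda>k. f ((s \<circ> r) k) n)"
      by (auto simp: o_def convergent_def)
  qed
  have "convergent (\<lambda>k. f (diagseq k) n)" for n
  proof -
    have "convergent (\<lambda>k. f ((diagseq \<circ> ((+) (Suc n))) k) n)"
    proof (rule diagseq_holds)
      fix r s :: "nat \<Rightarrow> nat" and m assume "strict_mono r" "convergent (\<lambda>k. f (s k) m)"
      then show "convergent (\<lambda>k. f ((s \<circ> r) k) m)"
        using convergent_subseq_convergent[of "\<lambda>k. f (s k) m" r] by (simp add: o_def)
    qed
    then have "convergent (\<lambda>k. f (diagseq (k + Suc n)) n)" by (simp add: o_def add.commute)
    then show ?thesis using convergent_ignore_initial_segment[of "\<lambda>k. f (diagseq k) n" "Suc n"] by simp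
  qed
  then have "\<forall>n. \<exists>l. (\<lambda>k. f (diagseq k) n) \<longlonglongrightarrow> l" by (simp add: convergent_def)
  then obtain v where "\<And>n. (\<lambda>k. f (diagseq k) n) \<longlonglongrightarrow> v n" by metis
  then show ?thesis using that[OF subseq_diagseq] by blast
qed

section \<open>Real symmetric realisation of the spectral data\<close>

context interlaced
begin

definition dot :: "(nat \<Rightarrow> real) \<Rightarrow> (nat \<Rightarrow> real) \<Rightarrow> real" where
  "dot v w = (\<Sum>j=1..N. v j * w j)"

definition av :: "nat \<Rightarrow> real" where "av j = sqrt (nu j)"

definition lam :: "nat \<Rightarrow> real" where "lam j = sqrt (x j)"

text \<open>The normalising factor of \<open>fv m\<close>. By \<open>dot_av_fv\<close> it is also
  the coordinate of \<open>av\<close> on that vector, the future |(u | f_m)|.\<close>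

definition kap :: "nat \<Rightarrow> real" where
  "kap m = 1 / sqrt (\<Sum>j=1..N. nu j / (x j - y m)\<^sup>2)"

text \<open>Unit eigenvector of diag(x) - a a^T for the eigenvalue y_m, where a is
  \<open>av\<close>: the eigenvector equation makes (x_j - y_m) f_j proportional to a_j.\<close>

definition fv :: "nat \<Rightarrow> nat \<Rightarrow> real" where
  "fv m j = kap m * av j / (x j - y m)"

text \<open>The positive square root of diag(x) - a a^T. It is to become the matrix of K_u in an
  eigenbasis in which H_u has the matrix diag(lam).\<close>

definition Kv :: "(nat \<Rightarrow> real) \<Rightarrow> nat \<Rightarrow> real" where
  "Kv v i = (\<Sum>m=1..N. sqrt (y m) * dot (fv m) v * fv m i)"

definition lform :: "(nat \<Rightarrow> real) \<Rightarrow> (nat \<Rightarrow> real) \<Rightarrow> real" where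
  "lform v w = (\<Sum>j=1..N. lam j * v j * w j)"

text \<open>H^(-1) K. For a Hankel operator the relation K_u = H_u T_z makes this the compression of
  multiplication by z to the range of H_u. It is symmetric for \<open>lform\<close>, the form of
  H.\<close>

definition Rv :: "(nat \<Rightarrow> real) \<Rightarrow> nat \<Rightarrow> real" where
  "Rv v i = Kv v i / lam i"

lemma av_pos: "j \<in> {1..N} \<Longrightarrow> 0 < av j" and av_sq: "j \<in> {1..N} \<Longrightarrow> av j * av j = nu j"
  using nu_pos by (auto simp: av_def less_imp_le)

lemma lam_pos: "j \<in> {1..N} \<Longrightarrow> 0 < lam j" and lam_sq: "j \<in> {1..N} \<Longrightarrow> lam j * lam j = x j"
  using x0 by (auto simp: lam_def less_imp_le)

lemma kap_sq: "m \<in> {1..N} \<Longrightarrow> 0 < kap m \<and> kap m * kap m * (\<Sum>j=1..N. nu j / (x j - y m)\<^sup>2) = 1"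
proof -
  assume m: "m \<in> {1..N}"
  have "0 < (\<Sum>j=1..N. nu j / (x j - y m)\<^sup>2)"
  proof (rule sum_pos)
    fix j assume "j \<in> {1..N}"
    then show "0 < nu j / (x j - y m)\<^sup>2" using nu_pos xy_neq[OF _ m] by simp
  qed (use N1 in auto)
  then show ?thesis by (simp add: kap_def del: One_nat_def)
qed

text \<open>For distinct m and m' the product 1 / ((x_j - y_m)(x_j - y_m')) splits into partial
  fractions, and the two secular sums, both equal to 1, cancel.\<close>

lemma fv_orth:
  assumes "m \<in> {1..N}" "m' \<in> {1..N}"
  shows "dot (fv m) (fv m') = (if m = m' then 1 else 0)"
proof -
  have e: "dot (fv m) (fv m') = kap m * kap m' * (\<Sum>j=1..N. nu j / ((x j - y m) * (x j - y m')))"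
    unfolding dot_def fv_def sum_distrib_left
    by (rule sum.cong[OF refl]) (simp add: av_sq[symmetric])
  show ?thesis
  proof (cases "m = m'")
    case True
    then show ?thesis using e kap_sq[OF assms(1)] by (simp add: power2_eq_square del: One_nat_def)
  next
    case False
    have "(\<Sum>j=1..N. nu j / ((x j - y m) * (x j - y m')))
      = (\<Sum>j=1..N. (1 / (y m - y m')) * (nu j / (x j - y m) - nu j / (x j - y m')))"
    proof (rule sum.cong[OF refl])
      fix j assume "j \<in> {1..N}"
      then have "x j - y m \<noteq> 0" "x j - y m' \<noteq> 0" "y m - y m' \<noteq> 0"
        using xy_neq assms y_neq[OF assms False] by auto
      then show "nu j / ((x j - y m) * (x j - y m')) = (1 / (y m - y m')) * (nu j / (x j - y m) - nu j / (x j - y m'))"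
        by (simp add: divide_simps) (simp add: algebra_simps)
    qed
    also have "\<dots> = (1 / (y m - y m')) * ((\<Sum>j=1..N. nu j / (x j - y m)) - (\<Sum>j=1..N. nu j / (x j - y m')))"
      by (simp only: sum_distrib_left[symmetric] sum_subtractf)
    also have "\<dots> = 0" by (simp only: secular_y assms diff_self mult_zero_right)
    finally show ?thesis using e False by simp
  qed
qed

lemma dot_av_fv: "m \<in> {1..N} \<Longrightarrow> dot (fv m) av = kap m"
proof -
  assume m: "m \<in> {1..N}"
  have "dot (fv m) av = kap m * (\<Sum>j=1..N. nu j / (x j - y m))"
    unfolding dot_def fv_def sum_distrib_left
    by (rule sum.cong[OF refl]) (simp add: av_sq[symmetric])
  then show ?thesis by (simp only: secular_y[OF m] mult_1_right)
qed

lemma fv_separates: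
  assumes "\<And>m. m \<in> {1..N} \<Longrightarrow> dot (fv m) d = 0" "i \<in> {1..N}"
  shows "d i = 0"
proof -
  have "(\<Sum>j=1..N. (av j * d j) / (x j - y m)) = 0" if "m \<in> {1..N}" for m
  proof -
    have "kap m * (\<Sum>j=1..N. (av j * d j) / (x j - y m)) = dot (fv m) d"
      unfolding dot_def fv_def sum_distrib_left by (rule sum.cong) auto
    then have "kap m * (\<Sum>j=1..N. (av j * d j) / (x j - y m)) = 0" using assms(1)[OF that] by simp
    then show ?thesis using conjunct1[OF kap_sq[OF that]] by simp
  qed
  from cauchy_unique[OF this assms(2)] have "av i * d i = 0" .
  then show ?thesis using av_pos[OF assms(2)] by simp
qed

lemma dot_lincomb: "dot v (\<lambda>i. \<Sum>m=1..N. c m * g m i) = (\<Sum>m=1..N. c m * dot v (g m))"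
proof -
  have "dot v (\<lambda>i. \<Sum>m=1..N. c m * g m i) = (\<Sum>j=1..N. \<Sum>m=1..N. c m * (v j * g m j))"
    unfolding dot_def sum_distrib_left by (intro sum.cong) (auto simp: mult_ac)
  also have "\<dots> = (\<Sum>m=1..N. \<Sum>j=1..N. c m * (v j * g m j))" by (rule sum.swap)
  finally show ?thesis by (simp add: dot_def sum_distrib_left)
qed

lemma dot_commute: "dot v w = dot w v"
  by (simp add: dot_def mult.commute)

lemma dot_fv_lincomb:
  assumes "m \<in> {1..N}"
  shows "dot (fv m) (\<lambda>i. \<Sum>m'=1..N. c m' * fv m' i) = c m"
proof -
  have "dot (fv m) (\<lambda>i. \<Sum>m'=1..N. c m' * fv m' i) = (\<Sum>m'=1..N. if m' = m then c m else 0)"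
    unfolding dot_lincomb by (rule sum.cong[OF refl]) (use fv_orth assms in auto)
  then show ?thesis using assms by simp
qed

lemma dot_fv_Kv: "m \<in> {1..N} \<Longrightarrow> dot (fv m) (Kv v) = sqrt (y m) * dot (fv m) v"
  using dot_fv_lincomb[of m "\<lambda>m. sqrt (y m) * dot (fv m) v"] by (simp add: Kv_def[abs_def])

lemma dot_add: "dot v (\<lambda>i. f i + g i) = dot v f + dot v g"
  by (simp add: dot_def distrib_left sum.distrib)

lemma dot_diff: "dot v (\<lambda>i. f i - g i) = dot v f - dot v g"
  by (simp add: dot_def right_diff_distrib sum_subtractf)

lemma dot_scale: "dot v (\<lambda>i. c * f i) = c * dot v f"
  by (simp add: dot_def sum_distrib_left mult_ac)

text \<open>Both sides have the same product with every eigenvector \<open>fv m\<close>, and by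
  \<open>fv_separates\<close> these products determine a vector.\<close>

lemma Kv_sq:
  assumes "i \<in> {1..N}"
  shows "Kv (Kv v) i = x i * v i - dot av v * av i"
proof -
  have "Kv (Kv v) i - (x i * v i - dot av v * av i) = 0"
  proof (rule fv_separates[of "\<lambda>i. Kv (Kv v) i - (x i * v i - dot av v * av i)", OF _ assms])
    fix m assume m: "m \<in> {1..N}"
    have "dot (fv m) (\<lambda>i. x i * v i) = y m * dot (fv m) v + kap m * dot av v"
      unfolding dot_def sum_distrib_left sum.distrib[symmetric]
    proof (rule sum.cong[OF refl])
      fix j assume "j \<in> {1..N}"
      then have "(x j - y m) * fv m j = kap m * av j" using xy_neq[OF _ m] by (simp add: fv_def)
      then have "fv m j * x j = y m * fv m j + kap m * av j" by (simp add: algebra_simps)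
      then show "fv m j * (x j * v j) = y m * (fv m j * v j) + kap m * (av j * v j)"
        by (simp add: distrib_right flip: mult.assoc)
    qed
    moreover have "sqrt (y m) * (sqrt (y m) * dot (fv m) v) = y m * dot (fv m) v"
      using y0[OF m] by (simp flip: mult.assoc)
    ultimately show "dot (fv m) (\<lambda>i. Kv (Kv v) i - (x i * v i - dot av v * av i)) = 0"
      by (simp only: dot_diff dot_fv_Kv[OF m] dot_scale dot_av_fv[OF m]) (simp add: mult_ac)
  qed
  then show ?thesis by simp
qed

lemma dot_Kv: "dot (Kv v) w = (\<Sum>m=1..N. sqrt (y m) * (dot (fv m) v * dot (fv m) w))"
proof -
  have "dot w (Kv v) = (\<Sum>m=1..N. (sqrt (y m) * dot (fv m) v) * dot w (fv m))"
    unfolding Kv_def[abs_def] by (rule dot_lincomb)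
  then show ?thesis by (simp add: dot_commute[of w] mult_ac)
qed

lemma Kv_sym: "dot (Kv v) w = dot v (Kv w)"
  unfolding dot_commute[of v] dot_Kv by (simp add: mult.commute)

lemma Kv_norm: "dot (Kv v) (Kv v) = (\<Sum>j=1..N. x j * (v j)\<^sup>2) - (dot av v)\<^sup>2"
proof -
  have "dot (Kv v) (Kv v) = dot v (Kv (Kv v))" by (rule Kv_sym)
  also have "\<dots> = dot v (\<lambda>i. x i * v i - dot av v * av i)"
    unfolding dot_def[of v] by (rule sum.cong[OF refl]) (simp only: Kv_sq)
  also have "\<dots> = dot v (\<lambda>i. x i * v i) - dot av v * dot av v"
    by (simp only: dot_diff dot_scale dot_commute[of v av])
  finally show ?thesis by (simp add: dot_def power2_eq_square mult_ac)
qed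

lemma Kv_CS: "(dot (Kv v) w)\<^sup>2 \<le> dot (Kv v) v * dot (Kv w) w"
proof -
  let ?s = "\<lambda>m. sqrt (sqrt (y m))"
  have s: "?s m * ?s m = sqrt (y m)" if "m \<in> {1..N}" for m
    using y0[OF that] by (simp add: less_imp_le)
  have e: "dot (Kv v) w = (\<Sum>m=1..N. (?s m * dot (fv m) v) * (?s m * dot (fv m) w))" for v w
  proof -
    have t: "(?s m * dot (fv m) v) * (?s m * dot (fv m) w) = sqrt (y m) * (dot (fv m) v * dot (fv m) w)"
      if "m \<in> {1..N}" for m
    proof -
      have "(?s m * dot (fv m) v) * (?s m * dot (fv m) w) = (?s m * ?s m) * (dot (fv m) v * dot (fv m) w)"
        by (simp only: mult_ac)
      then show ?thesis by (simp only: s[OF that])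
    qed
    show ?thesis unfolding dot_Kv by (rule sum.cong[OF refl]) (rule t[symmetric])
  qed
  show ?thesis unfolding e
    using Cauchy_Schwarz_ineq_sum[of "\<lambda>m. ?s m * dot (fv m) v" "\<lambda>m. ?s m * dot (fv m) w" "{1..N}"]
    by (simp add: power2_eq_square)
qed

lemma Kv_nonneg: "0 \<le> dot (Kv v) v"
  unfolding dot_Kv
proof (rule sum_nonneg)
  fix m assume "m \<in> {1..N}"
  then have "0 \<le> sqrt (y m)" using y0 by (simp add: less_imp_le)
  then show "0 \<le> sqrt (y m) * (dot (fv m) v * dot (fv m) v)" by (rule mult_nonneg_nonneg) simp
qed

lemma lform_nonneg: "0 \<le> lform v v"
  unfolding lform_def by (intro sum_nonneg) (use lam_pos in \<open>auto simp: mult.assoc less_imp_le\<close>)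

lemma lform_Rv: "lform (Rv v) w = dot (Kv v) w"
  unfolding lform_def dot_def Rv_def
proof (rule sum.cong[OF refl])
  fix j assume "j \<in> {1..N}"
  then show "lam j * (Kv v j / lam j) * w j = Kv v j * w j" using lam_pos[of j] by simp
qed

lemma lform_commute: "lform v w = lform w v"
  by (simp add: lform_def mult_ac)

lemma lform_Rv_sym: "lform (Rv v) w = lform v (Rv w)"
  using Kv_sym[of v w] by (simp only: lform_commute[of v "Rv w"] lform_Rv dot_commute[of v "Kv w"])

lemma lform_pow_sym: "lform ((Rv ^^ k) v) w = lform v ((Rv ^^ k) w)"
proof (induction k arbitrary: w)
  case (Suc k)
  have "lform ((Rv ^^ Suc k) v) w = lform ((Rv ^^ k) v) (Rv w)" by (simp add: lform_Rv_sym)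
  also have "\<dots> = lform v ((Rv ^^ k) (Rv w))" by (rule Suc)
  finally show ?case by (simp add: funpow_swap1)
qed simp

text \<open>A vector on which the two forms coincide would generate a subspace that is invariant under
  the diagonal operator and orthogonal to \<^term>\<open>av\<close>, which has no zero entry.\<close>

lemma no_common_vector:
  assumes "\<And>i. i \<in> {1..N} \<Longrightarrow> Kv v i = lam i * v i" "i \<in> {1..N}"
  shows "v i = 0"
proof -
  have orth: "dot av w = 0" if "\<And>i. i \<in> {1..N} \<Longrightarrow> Kv w i = lam i * w i" for w
  proof -
    \<comment> \<open>Here |K w|^2 is the full sum of x_j w_j^2, so \<open>Kv_norm\<close> leaves (a
      | w)^2 = 0.\<close>
    have "dot (Kv w) (Kv w) = (\<Sum>j=1..N. x j * (w j)\<^sup>2)"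
      unfolding dot_def by (rule sum.cong[OF refl]) (simp add: that lam_sq[symmetric] power2_eq_square)
    then show ?thesis using Kv_norm[of w] by simp
  qed
  have step: "Kv (\<lambda>i. x i * w i) i = lam i * (x i * w i)"
    if w: "\<And>i. i \<in> {1..N} \<Longrightarrow> Kv w i = lam i * w i" and i: "i \<in> {1..N}" for w i
  proof -
    have cong: "Kv f i = Kv g i" if "\<And>i. i \<in> {1..N} \<Longrightarrow> f i = g i" for f g i
    proof -
      have "dot (fv m) f = dot (fv m) g" for m
        unfolding dot_def by (rule sum.cong[OF refl]) (simp add: that)
      then show ?thesis by (simp add: Kv_def)
    qed
    have K2: "Kv (Kv w) i = x i * w i" if "i \<in> {1..N}" for i
      using Kv_sq[OF that, of w] orth[OF w] by simp
    have "Kv (\<lambda>i. x i * w i) i = Kv (Kv (Kv w)) i" by (rule cong) (simp add: K2)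
    also have "\<dots> = x i * Kv w i - dot av (Kv w) * av i" by (rule Kv_sq[OF i])
    also have "dot av (Kv w) = 0"
    proof (rule orth)
      fix i assume i: "i \<in> {1..N}"
      show "Kv (Kv w) i = lam i * Kv w i" using K2[OF i] w[OF i] lam_sq[OF i] by (simp add: mult.assoc[symmetric])
    qed
    finally show ?thesis using w[OF i] by simp
  qed
  have pow: "Kv (\<lambda>i. x i ^ n * v i) i = lam i * (x i ^ n * v i)" if "i \<in> {1..N}" for n i
    using that
  proof (induction n arbitrary: i)
    case (Suc n)
    then show ?case using step[of "\<lambda>i. x i ^ n * v i" i] by (simp add: mult.assoc)
  qed (simp add: assms)
  have z: "(\<Sum>j=1..N. av j * v j * x j ^ n) = 0" for n
    using orth[OF pow, of n] by (simp add: dot_def mult_ac)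
  \<comment> \<open>All power moments of the numbers av_j v_j at the nodes x_j vanish, and a
    Lagrange polynomial isolates a single one of them.\<close>
  have "(\<Sum>j=1..N. av j * v j * poly (lagr i) (x j)) = (\<Sum>j=1..N. \<Sum>n<N. coeff (lagr i) n * (av j * v j * x j ^ n))"
    unfolding poly_sum_lessThan[OF degree_lagr[OF assms(2)]] by (simp add: sum_distrib_left mult_ac)
  also have "\<dots> = (\<Sum>n<N. \<Sum>j=1..N. coeff (lagr i) n * (av j * v j * x j ^ n))" by (rule sum.swap)
  also have "\<dots> = 0" by (simp only: sum_distrib_left[symmetric] z) simp
  finally have "(\<Sum>j=1..N. av j * v j * poly (lagr i) (x j)) = 0" .
  moreover have "(\<Sum>j=1..N. av j * v j * poly (lagr i) (x j)) = (\<Sum>j=1..N. if j = i then av i * v i else 0)"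
    by (rule sum.cong[OF refl]) (use poly_lagr assms(2) in auto)
  ultimately show ?thesis using av_pos[OF assms(2)] assms(2) by simp
qed

text \<open>The Rayleigh quotient of K against H attains its maximum, by compactness of the unit
  sphere of \<open>lform\<close>; homogeneity extends the bound to all vectors.\<close>

lemma form_maximiser:
  obtains v c where "lform v v = 1" "dot (Kv v) v = c" "\<And>w. dot (Kv w) w \<le> c * lform w w"
proof -
  define T where "T = {v. (\<forall>i. i \<notin> {1..N} \<longrightarrow> v i = 0) \<and> lform v v = 1}"
  define q where "q v = dot (Kv v) v" for v
  define B where "B j = 1 / sqrt (lam j)" for j
  have bnd: "\<bar>v j\<bar> \<le> B j" if "v \<in> T" "j \<in> {1..N}" for v j
  proof -
    have "lam j * v j * v j \<le> lform v v"
      unfolding lform_def by (rule member_le_sum[OF that(2)]) (use lam_pos in \<open>auto simp: mult.assoc less_imp_le\<close>)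
    then have "(v j)\<^sup>2 \<le> 1 / lam j"
      using that lam_pos[OF that(2)] by (simp add: T_def field_simps power2_eq_square)
    then have "\<bar>v j\<bar> \<le> sqrt (1 / lam j)" using real_le_rsqrt by (metis power2_abs)
    then show ?thesis by (simp add: B_def real_sqrt_divide)
  qed
  define e1 where "e1 j = (if j = 1 then B 1 else 0)" for j :: nat
  have e1: "e1 \<in> T"
  proof -
    have 1: "1 \<in> {1..N}" using N1 by simp
    have "lform e1 e1 = (\<Sum>j=1..N. if j = 1 then lam 1 * B 1 * B 1 else 0)"
      unfolding lform_def by (rule sum.cong) (auto simp: e1_def)
    also have "\<dots> = 1" using lam_pos[OF 1] 1 by (simp add: B_def)
    finally show ?thesis using 1 by (auto simp: T_def e1_def)
  qed
  have "q v \<le> (\<Sum>m=1..N. sqrt (y m) * (\<Sum>j=1..N. \<bar>fv m j\<bar> * B j)\<^sup>2)" if "v \<in> T" for v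
    unfolding q_def dot_Kv
  proof (intro sum_mono mult_left_mono)
    fix m assume "m \<in> {1..N}"
    have "\<bar>dot (fv m) v\<bar> \<le> (\<Sum>j=1..N. \<bar>fv m j\<bar> * \<bar>v j\<bar>)"
      unfolding dot_def by (rule order_trans[OF sum_abs]) (simp add: abs_mult)
    also have "\<dots> \<le> (\<Sum>j=1..N. \<bar>fv m j\<bar> * B j)"
      by (intro sum_mono mult_left_mono) (use bnd[OF that] in auto)
    finally have "\<bar>dot (fv m) v\<bar> \<le> (\<Sum>j=1..N. \<bar>fv m j\<bar> * B j)" .
    then have "\<bar>dot (fv m) v\<bar>\<^sup>2 \<le> (\<Sum>j=1..N. \<bar>fv m j\<bar> * B j)\<^sup>2" by (rule power_mono) simp
    then show "dot (fv m) v * dot (fv m) v \<le> (\<Sum>j=1..N. \<bar>fv m j\<bar> * B j)\<^sup>2"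
      by (simp add: power2_eq_square)
  qed (use y0 in \<open>auto intro: less_imp_le\<close>)
  then have bdd: "bdd_above (q ` T)" by (intro bdd_aboveI2)
  define c where "c = Sup (q ` T)"
  have ub: "q v \<le> c" if "v \<in> T" for v unfolding c_def by (rule cSUP_upper[OF that bdd])
  have "\<exists>v\<in>T. c - 1 / real (Suc k) < q v" for k
    using less_cSUP_iff[OF _ bdd, of "c - 1 / real (Suc k)"] e1 by (auto simp: c_def)
  then obtain V where V: "\<And>k. V k \<in> T" "\<And>k. c - 1 / real (Suc k) < q (V k)" by metis
  have "cmod (complex_of_real (V k j)) \<le> \<bar>B j\<bar>" for j k
  proof (cases "j \<in> {1..N}")
    case True then show ?thesis using bnd[OF V(1) True, of k] by simp
  next
    case False then show ?thesis using V(1)[of k] by (simp add: T_def del: One_nat_def)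
  qed
  then obtain r w where r: "strict_mono r" "\<And>j. (\<lambda>k. complex_of_real (V (r k) j)) \<longlonglongrightarrow> w j"
    using pointwise_subseq[of "\<lambda>k j. complex_of_real (V k j)" "\<lambda>j. \<bar>B j\<bar>"] by blast
  define v where "v j = Re (w j)" for j
  have lim: "(\<lambda>k. V (r k) j) \<longlonglongrightarrow> v j" for j
    using tendsto_Re[OF r(2)[of j]] by (simp add: v_def)
  have "(\<lambda>k. lform (V (r k)) (V (r k))) \<longlonglongrightarrow> lform v v"
    unfolding lform_def by (intro tendsto_intros lim)
  moreover have "lform (V (r k)) (V (r k)) = 1" for k using V(1) by (simp add: T_def)
  ultimately have l1: "lform v v = 1" by (simp add: LIMSEQ_const_iff)
  have ql: "(\<lambda>k. q (V (r k))) \<longlonglongrightarrow> q v"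
    unfolding q_def dot_Kv unfolding dot_def by (intro tendsto_intros lim)
  have "(\<lambda>k. c - 1 / real (Suc k)) \<longlonglongrightarrow> c - 0"
    by (intro tendsto_diff tendsto_const LIMSEQ_Suc[OF lim_inverse_n', unfolded o_def])
  then have "(\<lambda>k. c - 1 / real (Suc (r k))) \<longlonglongrightarrow> c"
    using LIMSEQ_subseq_LIMSEQ[OF _ r(1), of "\<lambda>k. c - 1 / real (Suc k)"] by (simp add: o_def)
  then have "c \<le> q v" by (rule LIMSEQ_le[OF _ ql]) (use V(2) in \<open>auto intro: less_imp_le\<close>)
  have scale: "q w \<le> c * lform w w" for w
  proof (cases "lform w w = 0")
    case True
    have "w j = 0" if "j \<in> {1..N}" for j
    proof -
      have "lam j * w j * w j = 0"
        using True that sum_nonneg_eq_0_iff[of "{1..N}" "\<lambda>j. lam j * w j * w j"] lam_pos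
        by (auto simp: lform_def mult.assoc less_imp_le simp del: One_nat_def)
      then show ?thesis using lam_pos[OF that] by simp
    qed
    then have "dot f w = 0" for f unfolding dot_def by (intro sum.neutral) auto
    then show ?thesis unfolding q_def using True by simp
  next
    case False
    define s where "s = 1 / sqrt (lform w w)"
    have s: "s * s * lform w w = 1" "s * s > 0" using False lform_nonneg[of w] by (simp_all add: s_def)
    define z where "z j = (if j \<in> {1..N} then s * w j else 0)" for j
    have dz: "dot f z = s * dot f w" for f
      unfolding dot_def sum_distrib_left by (rule sum.cong) (auto simp: z_def)
    have "lform z z = s * s * lform w w"
      unfolding lform_def sum_distrib_left by (rule sum.cong) (auto simp: z_def)
    then have "z \<in> T" using s by (auto simp: T_def z_def)
    then have "q z \<le> c" by (rule ub)
    moreover have "q z = s * s * q w"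
      unfolding q_def dot_Kv dz sum_distrib_left by (rule sum.cong) (auto simp: mult_ac)
    ultimately have "s * s * q w \<le> s * s * (c * lform w w)" using s by (simp add: mult_ac)
    then show ?thesis using s(2) by (simp add: mult_le_cancel_left)
  qed
  have "q v = c" using scale[of v] \<open>c \<le> q v\<close> l1 by simp
  then show ?thesis using that[OF l1] scale by (simp add: q_def)
qed

text \<open>A maximiser satisfies K v = c H v. With X = sum x_j v_j^2 > 0, \<open>Kv_norm\<close>
  gives c^2 X = X - (a | v)^2, hence c <= 1; the value c = 1 is excluded by
  \<open>no_common_vector\<close>.\<close>

lemma strict_contraction:
  obtains c where "0 \<le> c" "c < 1" "\<And>w. dot (Kv w) w \<le> c * lform w w"
proof -
  obtain v c where v: "lform v v = 1" "dot (Kv v) v = c" and ub: "\<And>w. dot (Kv w) w \<le> c * lform w w"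
    using form_maximiser by blast
  have c0: "0 \<le> c" using Kv_nonneg[of v] v by simp
  have eig: "Kv v i = c * lam i * v i" if i: "i \<in> {1..N}" for i
  proof -
    define d where "d j = (if j = i then 1 else 0::real)" for j
    have dd: "dot f d = f i" "lform f d = lam i * f i" for f
    proof -
      have "dot f d = (\<Sum>j=1..N. if j = i then f i else 0)"
        unfolding dot_def by (rule sum.cong) (auto simp: d_def)
      then show "dot f d = f i" using i by simp
      have "lform f d = (\<Sum>j=1..N. if j = i then lam i * f i else 0)"
        unfolding lform_def by (rule sum.cong) (auto simp: d_def)
      then show "lform f d = lam i * f i" using i by simp
    qed
    define b where "b = c * lam i * v i - Kv v i"
    define A where "A = c * lam i - Kv d i"
    have quad: "0 \<le> 2 * t * b + t * t * A" for t
    proof -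
      have e1: "lform (\<lambda>j. v j + t * d j) (\<lambda>j. v j + t * d j) = lform v v + 2 * t * lform v d + t * t * lform d d"
        unfolding lform_def sum_distrib_left sum.distrib[symmetric] by (rule sum.cong) (auto simp: algebra_simps)
      have "dot f (\<lambda>j. v j + t * d j) = dot f v + t * dot f d" for f
        by (simp only: dot_add dot_scale)
      then have "dot (Kv (\<lambda>j. v j + t * d j)) (\<lambda>j. v j + t * d j)
          = (\<Sum>m=1..N. sqrt (y m) * ((dot (fv m) v + t * dot (fv m) d) * (dot (fv m) v + t * dot (fv m) d)))"
        unfolding dot_Kv by simp
      also have "\<dots> = dot (Kv v) v + 2 * t * dot (Kv v) d + t * t * dot (Kv d) d"
        unfolding dot_Kv sum_distrib_left sum.distrib[symmetric] by (rule sum.cong) (auto simp: algebra_simps)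
      finally have e2: "dot (Kv (\<lambda>j. v j + t * d j)) (\<lambda>j. v j + t * d j)
        = dot (Kv v) v + 2 * t * dot (Kv v) d + t * t * dot (Kv d) d" .
      show ?thesis using ub[of "\<lambda>j. v j + t * d j"] v unfolding e1 e2 dd
        by (simp add: b_def A_def d_def algebra_simps)
    qed
    have "b = 0"
    proof (rule ccontr)
      assume "b \<noteq> 0"
      \<comment> \<open>Near 0 the quadratic 2 t b + t^2 A follows its linear term. This t is small
        enough for either sign of A, and the added 1 covers A = 0.\<close>
      define t where "t = - b / (\<bar>A\<bar> + 1)"
      have p: "\<bar>A\<bar> + 1 > 0" by simp
      have "2 * t * b + t * t * A = (b * b) * (A - 2 * (\<bar>A\<bar> + 1)) / ((\<bar>A\<bar> + 1) * (\<bar>A\<bar> + 1))"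
        using p by (simp add: t_def divide_simps) (simp add: algebra_simps)
      moreover have "0 < b * b" using \<open>b \<noteq> 0\<close> by (auto simp: zero_less_mult_iff)
      then have "(b * b) * (A - 2 * (\<bar>A\<bar> + 1)) / ((\<bar>A\<bar> + 1) * (\<bar>A\<bar> + 1)) < 0"
        using p by (intro divide_neg_pos mult_pos_neg) auto
      ultimately show False using quad[of t] by linarith
    qed
    then show ?thesis by (simp add: b_def)
  qed
  have X: "0 < (\<Sum>j=1..N. x j * (v j)\<^sup>2)"
  proof (rule ccontr)
    assume "\<not> 0 < (\<Sum>j=1..N. x j * (v j)\<^sup>2)"
    moreover have nn: "\<And>j. j \<in> {1..N} \<Longrightarrow> 0 \<le> x j * (v j)\<^sup>2" using x0 by (simp add: less_imp_le)
    ultimately have z0: "(\<Sum>j=1..N. x j * (v j)\<^sup>2) = 0" using sum_nonneg[of "{1..N}" "\<lambda>j. x j * (v j)\<^sup>2"] by fastforce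
    have "x j * (v j)\<^sup>2 = 0" if "j \<in> {1..N}" for j
      by (rule sum_nonneg_0[OF finite_atLeastAtMost _ z0 that]) (rule nn)
    then have "v j = 0" if "j \<in> {1..N}" for j using x0[OF that] that by fastforce
    then have "lform v v = 0" unfolding lform_def by (intro sum.neutral) auto
    then show False using v by simp
  qed
  have "dot (Kv v) (Kv v) = c * c * (\<Sum>j=1..N. x j * (v j)\<^sup>2)"
    unfolding dot_def sum_distrib_left
    by (rule sum.cong[OF refl]) (simp add: eig lam_sq[symmetric] power2_eq_square)
  then have id: "c * c * (\<Sum>j=1..N. x j * (v j)\<^sup>2) = (\<Sum>j=1..N. x j * (v j)\<^sup>2) - (dot av v)\<^sup>2"
    using Kv_norm[of v] by simp
  have "c < 1"
  proof (rule ccontr)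
    assume "\<not> c < 1"
    moreover have "c * c * (\<Sum>j=1..N. x j * (v j)\<^sup>2) \<le> 1 * (\<Sum>j=1..N. x j * (v j)\<^sup>2)"
      using id by simp
    then have "c * c \<le> 1" using X mult_le_cancel_right_pos by blast
    ultimately have "c = 1" using c0 mult_mono[of 1 c c c] by (smt (verit) mult_cancel_left1 mult_less_cancel_right2)
    then have "Kv v i = lam i * v i" if "i \<in> {1..N}" for i using eig[OF that] by simp
    then have "v i = 0" if "i \<in> {1..N}" for i using no_common_vector that by blast
    then have "lform v v = 0" unfolding lform_def by (intro sum.neutral) auto
    then show False using v by simp
  qed
  then show ?thesis using that c0 ub by blast
qed

end

context interlaced
begin

text \<open>Intended as the eigenbasis coordinates of the projection of z^k onto the range of H_u:
  those of the constant 1 are H^(-1) a because H_u(1) = u, and multiplication by z acts as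
  \<open>Rv\<close>.\<close>

definition pv :: "nat \<Rightarrow> nat \<Rightarrow> real" where
  "pv k = (Rv ^^ k) (\<lambda>j. av j / lam j)"

lemma lform_pv0: "lform (pv 0) v = dot av v"
  unfolding lform_def dot_def
proof (rule sum.cong[OF refl])
  fix j assume "j \<in> {1..N}"
  then show "lam j * pv 0 j * v j = av j * v j" using lam_pos[of j] by (simp add: pv_def)
qed

lemma pv_add: "pv (k + l) = (Rv ^^ k) (pv l)"
  by (simp add: pv_def funpow_add)

text \<open>Since R is symmetric for \<open>lform\<close>, the pairing depends on k + l only. This
  is the Hankel structure that turns (a | pv k) into the coefficients of a symbol.\<close>

lemma lform_pv: "lform (pv k) (pv l) = dot av (pv (k + l))"
proof -
  have "lform (pv k) (pv l) = lform ((Rv ^^ k) (pv 0)) (pv l)" by (simp add: pv_def)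
  also have "\<dots> = lform (pv 0) (pv (k + l))" by (simp add: lform_pow_sym pv_add)
  finally show ?thesis by (simp add: lform_pv0)
qed

lemma lform_CS: "(lform v w)\<^sup>2 \<le> lform v v * lform w w"
proof -
  let ?s = "\<lambda>j. sqrt (lam j)"
  have e: "lform v w = (\<Sum>j=1..N. (?s j * v j) * (?s j * w j))" for v w
    unfolding lform_def
  proof (rule sum.cong[OF refl])
    fix j assume "j \<in> {1..N}"
    then have "?s j * ?s j = lam j" using lam_pos[of j] by simp
    then show "lam j * v j * w j = (?s j * v j) * (?s j * w j)" by (metis mult.assoc mult.commute)
  qed
  show ?thesis unfolding e
    using Cauchy_Schwarz_ineq_sum[of "\<lambda>j. ?s j * v j" "\<lambda>j. ?s j * w j" "{1..N}"]
    by (simp add: power2_eq_square)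
qed

text \<open>In \<open>lform\<close> the squared norm of R v equals (K v | R v). Cauchy-Schwarz for
  the form of K, followed by K <= c H in both factors, contracts it by c^2.\<close>

lemma Rv_decay:
  obtains c where "0 \<le> c" "c < 1" "\<And>k v. lform ((Rv ^^ k) v) ((Rv ^^ k) v) \<le> c ^ (2 * k) * lform v v"
proof -
  obtain c where c: "0 \<le> c" "c < 1" and ub: "\<And>w. dot (Kv w) w \<le> c * lform w w"
    using strict_contraction by blast
  have one: "lform (Rv v) (Rv v) \<le> c * c * lform v v" for v
  proof -
    let ?b = "lform (Rv v) (Rv v)"
    have "?b\<^sup>2 = (dot (Kv v) (Rv v))\<^sup>2" by (simp only: lform_Rv)
    also have "\<dots> \<le> dot (Kv v) v * dot (Kv (Rv v)) (Rv v)" by (rule Kv_CS)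
    also have "\<dots> \<le> (c * lform v v) * (c * ?b)"
      by (intro mult_mono ub Kv_nonneg mult_nonneg_nonneg c lform_nonneg)
    finally have "?b * ?b \<le> (c * c * lform v v) * ?b" by (simp add: power2_eq_square mult_ac)
    then show ?thesis
      using lform_nonneg[of "Rv v"] lform_nonneg[of v] c
      by (cases "?b = 0") (auto simp: mult_le_cancel_right)
  qed
  have "lform ((Rv ^^ k) v) ((Rv ^^ k) v) \<le> c ^ (2 * k) * lform v v" for k v
  proof (induction k)
    case (Suc k)
    have "lform ((Rv ^^ Suc k) v) ((Rv ^^ Suc k) v) \<le> c * c * lform ((Rv ^^ k) v) ((Rv ^^ k) v)"
      using one[of "(Rv ^^ k) v"] by simp
    also have "\<dots> \<le> c * c * (c ^ (2 * k) * lform v v)" using Suc c by (intro mult_left_mono) auto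
    finally show ?case by (simp add: mult.assoc)
  qed simp
  then show ?thesis using that c by blast
qed

text \<open>A telescoping sum: with X w = sum x_j w_j^2, \<open>Kv_norm\<close> reads X w - X (R w)
  = (a | w)^2. For w = R^k v the right side is the k-th term, and X (R^n v) tends to 0 by
  \<open>Rv_decay\<close>.\<close>

lemma pv_parseval: "(\<lambda>k. (\<Sum>j=1..N. lam j * v j * pv k j)\<^sup>2) sums (\<Sum>j=1..N. x j * (v j)\<^sup>2)"
proof -
  obtain c where c: "0 \<le> c" "c < 1"
    and dec: "\<And>k v. lform ((Rv ^^ k) v) ((Rv ^^ k) v) \<le> c ^ (2 * k) * lform v v"
    using Rv_decay by blast
  define X where "X v = (\<Sum>j=1..N. x j * (v j)\<^sup>2)" for v
  have coef: "(\<Sum>j=1..N. lam j * v j * pv k j) = dot av ((Rv ^^ k) v)" for k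
  proof -
    have "(\<Sum>j=1..N. lam j * v j * pv k j) = lform (pv k) v" by (simp add: lform_def mult_ac)
    also have "\<dots> = lform (pv 0) ((Rv ^^ k) v)" using lform_pow_sym[of k "pv 0" v] by (simp add: pv_def)
    finally show ?thesis by (simp add: lform_pv0)
  qed
  have step: "X w - X (Rv w) = (dot av w)\<^sup>2" for w
  proof -
    have "X (Rv w) = dot (Kv w) (Kv w)"
      unfolding X_def dot_def
    proof (rule sum.cong[OF refl])
      fix j assume j: "j \<in> {1..N}"
      then show "x j * (Rv w j)\<^sup>2 = Kv w j * Kv w j"
        using lam_pos[OF j] by (simp add: Rv_def lam_sq[symmetric] power2_eq_square)
    qed
    then show ?thesis using Kv_norm[of w] by (simp add: X_def)
  qed
  have part: "(\<Sum>k<n. (\<Sum>j=1..N. lam j * v j * pv k j)\<^sup>2) = X v - X ((Rv ^^ n) v)" for n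
  proof (induction n)
    case (Suc n)
    then show ?case using step[of "(Rv ^^ n) v"] by (simp add: coef del: One_nat_def)
  qed simp
  have Xb: "X w \<le> (\<Sum>i=1..N. lam i) * lform w w" for w
  proof -
    have "X w = (\<Sum>j=1..N. lam j * (lam j * w j * w j))"
      unfolding X_def by (rule sum.cong[OF refl]) (simp add: lam_sq[symmetric] power2_eq_square)
    also have "\<dots> \<le> (\<Sum>j=1..N. (\<Sum>i=1..N. lam i) * (lam j * w j * w j))"
    proof (intro sum_mono mult_right_mono)
      fix j assume j: "j \<in> {1..N}"
      then show "lam j \<le> (\<Sum>i=1..N. lam i)"
        by (rule member_le_sum) (use lam_pos in \<open>auto simp: less_imp_le\<close>)
      show "0 \<le> lam j * w j * w j" using lam_pos[OF j] by (simp add: mult.assoc)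
    qed
    finally show ?thesis by (simp add: lform_def sum_distrib_left)
  qed
  have X0: "0 \<le> X w" for w unfolding X_def by (intro sum_nonneg) (use x0 in \<open>auto simp: less_imp_le\<close>)
  have S0: "0 \<le> (\<Sum>i=1..N. lam i)" by (intro sum_nonneg) (use lam_pos in \<open>auto simp: less_imp_le\<close>)
  have "(\<lambda>n. X ((Rv ^^ n) v)) \<longlonglongrightarrow> 0"
  proof (rule tendsto_sandwich[OF _ _ tendsto_const])
    show "\<forall>\<^sub>F n in sequentially. X ((Rv ^^ n) v) \<le> (\<Sum>i=1..N. lam i) * (lform v v * (c\<^sup>2) ^ n)"
    proof (rule always_eventually, rule allI)
      fix n
      have "X ((Rv ^^ n) v) \<le> (\<Sum>i=1..N. lam i) * lform ((Rv ^^ n) v) ((Rv ^^ n) v)" by (rule Xb)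
      also have "\<dots> \<le> (\<Sum>i=1..N. lam i) * (c ^ (2 * n) * lform v v)"
        by (intro mult_left_mono dec S0)
      finally show "X ((Rv ^^ n) v) \<le> (\<Sum>i=1..N. lam i) * (lform v v * (c\<^sup>2) ^ n)"
        unfolding power_mult by (simp add: mult_ac)
    qed
    have "(\<lambda>n. (c\<^sup>2) ^ n) \<longlonglongrightarrow> 0" by (rule LIMSEQ_realpow_zero) (use c in \<open>auto simp: power_less_one_iff\<close>)
    then show "(\<lambda>n. (\<Sum>i=1..N. lam i) * (lform v v * (c\<^sup>2) ^ n)) \<longlonglongrightarrow> 0"
      by (intro tendsto_mult_right_zero)
  qed (use X0 in auto)
  then have "(\<lambda>n. X v - X ((Rv ^^ n) v)) \<longlonglongrightarrow> X v - 0" by (intro tendsto_diff tendsto_const)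
  then show ?thesis unfolding sums_def part by (simp add: X_def)
qed

text \<open>Polarisation of \<open>pv_parseval\<close>; the division by \<open>lam l\<close> in the
  test vector cancels the weights x_l.\<close>

lemma pv_orthonormal:
  assumes "i \<in> {1..N}" "j \<in> {1..N}"
  shows "(\<lambda>k. pv k i * pv k j) sums (if i = j then 1 else 0)"
proof -
  have gen: "(\<lambda>k. (s * pv k i + t * pv k j)\<^sup>2) sums (s\<^sup>2 + t\<^sup>2)" if "i \<noteq> j \<or> t = 0" for s t
  proof -
    define v where "v l = ((if l = i then s else 0) + (if l = j then t else 0)) / lam l" for l
    have "(\<Sum>l=1..N. lam l * v l * pv k l) = s * pv k i + t * pv k j" for k
    proof -
      have "(\<Sum>l=1..N. lam l * v l * pv k l)
        = (\<Sum>l=1..N. (if l = i then s * pv k i else 0) + (if l = j then t * pv k j else 0))"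
      proof (rule sum.cong[OF refl])
        fix l assume "l \<in> {1..N}"
        then have "lam l \<noteq> 0" using lam_pos[of l] by simp
        then show "lam l * v l * pv k l = (if l = i then s * pv k i else 0) + (if l = j then t * pv k j else 0)"
          by (simp add: v_def distrib_right)
      qed
      then show ?thesis using assms by (simp add: sum.distrib)
    qed
    moreover have "(\<Sum>l=1..N. x l * (v l)\<^sup>2) = s\<^sup>2 + t\<^sup>2"
    proof -
      have "(\<Sum>l=1..N. x l * (v l)\<^sup>2) = (\<Sum>l=1..N. (if l = i then s\<^sup>2 else 0) + (if l = j then t\<^sup>2 else 0))"
      proof (rule sum.cong[OF refl])
        fix l assume l: "l \<in> {1..N}"
        have "x l * (v l)\<^sup>2 = ((if l = i then s else 0) + (if l = j then t else 0))\<^sup>2"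
          using lam_pos[OF l] by (simp add: v_def lam_sq[OF l, symmetric] power2_eq_square)
        then show "x l * (v l)\<^sup>2 = (if l = i then s\<^sup>2 else 0) + (if l = j then t\<^sup>2 else 0)"
          using that by auto
      qed
      then show ?thesis using assms by (simp add: sum.distrib)
    qed
    ultimately show ?thesis using pv_parseval[of v] by simp
  qed
  show ?thesis
  proof (cases "i = j")
    case True
    then show ?thesis using gen[of 0 1] by (simp add: power2_eq_square)
  next
    case False
    have "(\<lambda>k. ((1 * pv k i + 1 * pv k j)\<^sup>2 - (1 * pv k i + 0 * pv k j)\<^sup>2 - (0 * pv k i + 1 * pv k j)\<^sup>2) / 2)
        sums ((1\<^sup>2 + 1\<^sup>2 - (1\<^sup>2 + 0\<^sup>2) - (0\<^sup>2 + 1\<^sup>2)) / 2)"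
      by (intro sums_divide sums_diff gen) (use False in auto)
    moreover have "((1 * pv k i + 1 * pv k j)\<^sup>2 - (1 * pv k i + 0 * pv k j)\<^sup>2 - (0 * pv k i + 1 * pv k j)\<^sup>2) / 2
      = pv k i * pv k j" for k
      by (simp add: power2_eq_square algebra_simps)
    ultimately show ?thesis using False by simp
  qed
qed

text \<open>By \<open>lform_pv\<close> the rows of the symbol (a | pv k) have the coordinates lam_j
  (pv n)_j in the family \<open>E\<close>, which gives H_u E_j = lam_j E_j; geometric decay puts u
  in H^{1/2}.\<close>

theorem spec_exists: "\<exists>u E. spec u E"
proof -
  define E where "E j k = complex_of_real (pv k j)" for j k
  define u where "u k = complex_of_real (dot av (pv k))" for k
  obtain c where c: "0 \<le> c" "c < 1"
    and dec: "\<And>k v. lform ((Rv ^^ k) v) ((Rv ^^ k) v) \<le> c ^ (2 * k) * lform v v"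
    using Rv_decay by blast
  have u1: "inW 1 u"
  proof -
    define C where "C = lform (pv 0) (pv 0)"
    have C0: "0 \<le> C" unfolding C_def by (rule lform_nonneg)
    have "(cmod (u k))\<^sup>2 \<le> C * C * (c\<^sup>2) ^ k" for k
    proof -
      have "(cmod (u k))\<^sup>2 = (lform (pv 0) (pv k))\<^sup>2" by (simp add: u_def lform_pv0)
      also have "\<dots> \<le> C * lform (pv k) (pv k)" unfolding C_def by (rule lform_CS)
      also have "\<dots> \<le> C * (c ^ (2 * k) * C)"
        using dec[of k "pv 0"] C0 by (intro mult_left_mono) (simp_all add: C_def pv_def)
      finally show ?thesis unfolding power_mult by (simp add: mult_ac)
    qed
    then have b: "norm ((1 + real k) powr 1 * (cmod (u k))\<^sup>2) \<le> C * C * (of_nat (Suc k) * (c\<^sup>2) ^ k)" for k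
      using mult_left_mono[of "(cmod (u k))\<^sup>2" "C * C * (c\<^sup>2) ^ k" "1 + real k"]
      by (simp add: abs_mult mult_ac add.commute)
    have "summable (\<lambda>k. of_nat (Suc k) * (c\<^sup>2) ^ k)"
      using geometric_deriv_sums[of "c\<^sup>2"] c by (auto simp: sums_iff power_less_one_iff abs_square_less_1)
    then have "summable (\<lambda>k. C * C * (of_nat (Suc k) * (c\<^sup>2) ^ k))" by (rule summable_mult)
    then show ?thesis unfolding inW_def by (rule summable_comparison_test'[of _ 0]) (use b in blast)
  qed
  have E0: "inW 0 (E j)" if "j \<in> {1..N}" for j
    using pv_orthonormal[OF that that] by (simp add: inW_def E_def sums_iff power2_eq_square)
  have on: "ip (E i) (E j) = (if i = j then 1 else 0)" if "i \<in> {1..N}" "j \<in> {1..N}" for i j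
  proof -
    have "(\<lambda>k. complex_of_real (pv k i * pv k j)) sums of_real (if i = j then 1 else 0)"
      by (rule sums_of_real[OF pv_orthonormal[OF that]])
    then show ?thesis by (simp add: ip_def E_def sums_iff)
  qed
  have onE: "onf N E" using E0 on by (simp add: onf_def)
  have sh: "sh n u = (\<lambda>k. \<Sum>j=1..N. complex_of_real (lam j * pv n j) * E j k)" for n
  proof
    fix k
    have "sh n u k = complex_of_real (lform (pv n) (pv k))" by (simp add: sh_def u_def lform_pv)
    then show "sh n u k = (\<Sum>j=1..N. complex_of_real (lam j * pv n j) * E j k)"
      by (simp add: lform_def E_def)
  qed
  have HE: "Hank u (E j) = (\<lambda>n. complex_of_real (lam j) * E j n)" if "j \<in> {1..N}" for j
  proof
    fix n
    have "Hank u (E j) n = complex_of_real (lam j * pv n j)"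
      unfolding Hank_ip sh by (rule onf_coord[OF onE that])
    then show "Hank u (E j) n = complex_of_real (lam j) * E j n" by (simp add: E_def)
  qed
  have "Hank u (Hank u (E j)) = (\<lambda>k. complex_of_real (x j) * E j k)" if "j \<in> {1..N}" for j
  proof -
    have "Hank u (Hank u (E j)) = (\<lambda>n. cnj (complex_of_real (lam j)) * Hank u (E j) n)"
      using HE[OF that] Hank_scale[OF E0[OF that] u1, of "complex_of_real (lam j)"] by (simp only:)
    then show ?thesis using HE[OF that] lam_sq[OF that] by (simp flip: mult.assoc of_real_mult)
  qed
  moreover have "(cmod (ip u (E j)))\<^sup>2 = nu j" if "j \<in> {1..N}" for j
  proof -
    have "ip u (E j) = complex_of_real (lam j * pv 0 j)"
      using onf_coord[OF onE that, of "\<lambda>j. complex_of_real (lam j * pv 0 j)"] sh[of 0] by simp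
    also have "lam j * pv 0 j = av j" using lam_pos[OF that] by (simp add: pv_def)
    finally show ?thesis using av_sq[OF that] by (simp add: power2_eq_square flip: of_real_mult)
  qed
  moreover have "inspan N E (sh n u)" for n by (rule inspanI[OF onE sh])
  ultimately show ?thesis unfolding spec_def using u1 onE by blast
qed

end

section \<open>The torus as the set of minimisers\<close>

lemma underdetermined:
  fixes A :: "nat \<Rightarrow> 'j \<Rightarrow> complex"
  assumes "finite J" "d < card J"
  shows "\<exists>v. (\<exists>j\<in>J. v j \<noteq> 0) \<and> (\<forall>i<d. (\<Sum>j\<in>J. A i j * v j) = 0)"
  using assms
proof (induction d arbitrary: J A)
  case 0
  then obtain j where "j \<in> J" by fastforce
  then show ?case by (intro exI[of _ "\<lambda>_. 1"]) auto
next
  case (Suc d)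
  show ?case
  proof (cases "\<exists>j0\<in>J. A d j0 \<noteq> 0")
    case False
    obtain v where "\<exists>j\<in>J. v j \<noteq> 0" "\<forall>i<d. (\<Sum>j\<in>J. A i j * v j) = 0"
      using Suc.IH[of J A] Suc.prems by auto
    then show ?thesis using False by (intro exI[of _ v]) (auto simp: less_Suc_eq)
  next
    case True
    then obtain j0 where j0: "j0 \<in> J" "A d j0 \<noteq> 0" by blast
    have "d < card (J - {j0})" using Suc.prems j0 by (simp add: less_diff_conv)
    then obtain v where v: "\<exists>j\<in>J - {j0}. v j \<noteq> 0"
      "\<forall>i<d. (\<Sum>j\<in>J - {j0}. (A i j - A i j0 * A d j / A d j0) * v j) = 0"
      using Suc.IH[of "J - {j0}" "\<lambda>i j. A i j - A i j0 * A d j / A d j0"] Suc.prems(1) by auto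
    \<comment> \<open>Gaussian elimination: the pivot unknown j0 is solved from equation d, after
      having been removed from the other equations.\<close>
    define t where "t = - (\<Sum>j\<in>J - {j0}. A d j * v j) / A d j0"
    define w where "w j = (if j = j0 then t else v j)" for j
    have sw: "(\<Sum>j\<in>J. A i j * w j) = A i j0 * t + (\<Sum>j\<in>J - {j0}. A i j * v j)" for i
    proof -
      have "(\<Sum>j\<in>J. A i j * w j) = A i j0 * w j0 + (\<Sum>j\<in>J - {j0}. A i j * w j)"
        by (rule sum.remove[OF Suc.prems(1) j0(1)])
      also have "(\<Sum>j\<in>J - {j0}. A i j * w j) = (\<Sum>j\<in>J - {j0}. A i j * v j)"
        by (rule sum.cong) (auto simp: w_def)
      finally show ?thesis by (simp add: w_def)
    qed
    have "(\<Sum>j\<in>J. A i j * w j) = 0" if "i < Suc d" for i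
    proof (cases "i = d")
      case True then show ?thesis using j0 unfolding sw by (simp add: t_def)
    next
      case False
      then have "0 = (\<Sum>j\<in>J - {j0}. (A i j - A i j0 * A d j / A d j0) * v j)" using v(2) that by simp
      also have "\<dots> = (\<Sum>j\<in>J - {j0}. A i j * v j - A i j0 / A d j0 * (A d j * v j))"
        by (rule sum.cong) (auto simp: left_diff_distrib)
      also have "\<dots> = (\<Sum>j\<in>J - {j0}. A i j * v j) + A i j0 * t"
        by (simp add: sum_subtractf sum_distrib_left sum_divide_distrib t_def)
      finally show ?thesis unfolding sw by (simp add: add.commute)
    qed
    moreover have "\<exists>j\<in>J. w j \<noteq> 0" using v(1) by (auto simp: w_def)
    ultimately show ?thesis by blast
  qed
qed

text \<open>Rationality in the form in which it is used. The condition \<open>b d \<noteq> 0\<close>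
  expresses every row from d on by earlier ones; lower coefficients may vanish.\<close>

definition recur :: "nat \<Rightarrow> (nat \<Rightarrow> complex) \<Rightarrow> bool" where
  "recur d u \<longleftrightarrow> (\<exists>b. b d \<noteq> 0 \<and> (\<forall>n. (\<Sum>i\<le>d. b i * u (n + i)) = 0))"

text \<open>Every later row is a combination of the d preceding ones, so d linear conditions suffice
  to put a vector into the kernel of H_u.\<close>

lemma recur_orth:
  assumes "recur d u" "inW 0 u" "inW 0 v" "\<And>i. i < d \<Longrightarrow> ip (sh i u) v = 0"
  shows "ip (sh n u) v = 0"
proof (induction n rule: less_induct)
  case (less n)
  obtain b where b: "b d \<noteq> 0" "\<And>n. (\<Sum>i\<le>d. b i * u (n + i)) = 0"
    using assms(1) by (auto simp: recur_def)
  show ?case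
  proof (cases "n < d")
    case False
    define m where "m = n - d"
    have n: "n = m + d" using False by (simp add: m_def)
    have "(\<lambda>k. \<Sum>i\<le>d. b i * sh (m + i) u k) = (\<lambda>k. 0)"
      using b(2)[of "m + _"] by (auto simp: sh_def add_ac)
    then have "0 = ip (\<lambda>k. \<Sum>i\<le>d. b i * sh (m + i) u k) v" by (simp add: ip_0_left)
    also have "\<dots> = (\<Sum>i\<le>d. b i * ip (sh (m + i) u) v)"
      by (rule ip_lincomb_left) (use inW_sh[OF assms(2)] assms(3) in auto)
    also have "\<dots> = (\<Sum>i\<le>d. if i = d then b d * ip (sh n u) v else 0)"
      by (rule sum.cong[OF refl]) (use less n in auto)
    also have "\<dots> = b d * ip (sh n u) v" by simp
    finally show ?thesis using b(1) by simp
  qed (use assms in auto)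
qed

lemma fps_poly_coeff:
  fixes u :: "nat \<Rightarrow> complex"
  assumes "degree B \<le> d" "d \<le> n"
  shows "(Abs_fps u * fps_of_poly B) $ n = (\<Sum>i\<le>d. coeff B (d - i) * u (n - d + i))"
proof -
  have "(Abs_fps u * fps_of_poly B) $ n = (\<Sum>k=0..n. coeff B k * u (n - k))"
    by (subst mult.commute) (simp add: fps_mult_nth)
  also have "\<dots> = (\<Sum>k\<in>{0..d}. coeff B k * u (n - k))"
    by (rule sum.mono_neutral_right) (use assms in \<open>auto intro: coeff_eq_0\<close>)
  also have "\<dots> = (\<Sum>i\<le>d. coeff B (d - i) * u (n - d + i))"
    by (rule sum.reindex_bij_witness[of _ "\<lambda>i. d - i" "\<lambda>k. d - k"]) (use assms in auto)
  finally show ?thesis .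
qed

text \<open>The recurrence carries the coefficients of B in reverse order, so its leading
  coefficient is B(0).\<close>

lemma rational_recur:
  assumes "Abs_fps u * fps_of_poly B = fps_of_poly A" "degree B \<le> d" "coeff B 0 \<noteq> 0"
    "\<And>n. d \<le> n \<Longrightarrow> coeff A n = 0"
  shows "recur d u"
  unfolding recur_def
proof (intro exI[of _ "\<lambda>i. coeff B (d - i)"] conjI allI)
  show "coeff B (d - d) \<noteq> 0" using assms by simp
  fix n
  have "(\<Sum>i\<le>d. coeff B (d - i) * u (n + d - d + i)) = (Abs_fps u * fps_of_poly B) $ (n + d)"
    by (rule fps_poly_coeff[symmetric]) (use assms in auto)
  also have "\<dots> = 0" using assms(1,4) by simp
  finally show "(\<Sum>i\<le>d. coeff B (d - i) * u (n + i)) = 0" by simp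
qed

text \<open>Induction on the degree of B, dividing out one root z0 at a time. As |z0| > 1, the
  coefficients of a / (X - z0) obey a recursion with factor 1 / |z0| < 1.\<close>

lemma geometric_divide:
  fixes u a :: "nat \<Rightarrow> complex"
  assumes "Abs_fps u * fps_of_poly B = Abs_fps a" "B \<noteq> 0" "\<And>z. cmod z \<le> 1 \<Longrightarrow> poly B z \<noteq> 0"
    "\<And>n. cmod (a n) \<le> C * r ^ n" "0 < r" "r < 1"
  shows "\<exists>C r. 0 < r \<and> r < 1 \<and> (\<forall>n. cmod (u n) \<le> C * r ^ n)"
  using assms
proof (induction "degree B" arbitrary: B a C r)
  case 0
  then obtain c where c: "B = [:c:]" "c \<noteq> 0" using degree_eq_zeroE by (metis pCons_0_0)
  have "u n * c = a n" for n
  proof -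
    have "(Abs_fps u * fps_of_poly B) $ n = a n" using 0 by simp
    then show ?thesis by (simp add: c fps_of_poly_const)
  qed
  then have "cmod (u n) * cmod c = cmod (a n)" for n by (metis norm_mult)
  then have "cmod (u n) \<le> (C / cmod c) * r ^ n" for n
    using 0(5)[of n] c(2) by (simp add: field_simps)
  then show ?case using 0 by blast
next
  case (Suc d)
  have "\<not> constant (poly B)" using Suc.hyps(2) by (simp add: constant_degree)
  then obtain z0 where z0: "poly B z0 = 0" using fundamental_theorem_of_algebra by blast
  then obtain B' where B: "B = [:- z0, 1:] * B'" by (metis dvdE poly_eq_0_iff_dvd)
  have z1: "1 < cmod z0" using Suc.prems(3)[of z0] z0 by fastforce
  have B'0: "B' \<noteq> 0" using B Suc.prems(2) by auto
  have dB': "d = degree B'" using Suc.hyps(2) B'0 unfolding B by (subst (asm) degree_mult_eq) auto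
  have rB': "poly B' z \<noteq> 0" if "cmod z \<le> 1" for z using Suc.prems(3)[OF that] by (auto simp: B)
  define v where "v n = (Abs_fps u * fps_of_poly B') $ n" for n
  have v: "Abs_fps u * fps_of_poly B' = Abs_fps v" by (rule fps_ext) (simp add: v_def)
  have "Abs_fps v * fps_of_poly [:- z0, 1:] = Abs_fps a"
    using Suc.prems(1) unfolding B fps_of_poly_mult v[symmetric] by (simp add: mult_ac)
  then have vr: "fps_of_poly [:- z0, 1:] * Abs_fps v = Abs_fps a" by (simp only: mult.commute)
  have e0: "- z0 * v 0 = a 0"
    using arg_cong[OF vr, of "\<lambda>f. fps_nth f 0"] by (simp add: fps_mult_nth)
  have eS: "- z0 * v (Suc n) + v n = a (Suc n)" for n
  proof -
    have "a (Suc n) = (\<Sum>k=0..Suc n. coeff [:- z0, 1:] k * v (Suc n - k))"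
      using arg_cong[OF vr, of "\<lambda>f. fps_nth f (Suc n)"] by (simp add: fps_mult_nth)
    also have "\<dots> = (\<Sum>k\<in>{0,1}. coeff [:- z0, 1:] k * v (Suc n - k))"
      by (rule sum.mono_neutral_right) (auto simp: coeff_eq_0 coeff_pCons split: nat.splits)
    finally show ?thesis by simp
  qed
  define q where "q = 1 / cmod z0"
  have q: "0 < q" "q < 1" using z1 by (auto simp: q_def divide_less_eq)
  \<comment> \<open>A common rate below 1: at least r, to dominate the data, and strictly above q,
    to keep 1 - q / \<rho> positive.\<close>
  define \<rho> where "\<rho> = max r ((1 + q) / 2)"
  have \<rho>: "0 < \<rho>" "\<rho> < 1" "r \<le> \<rho>" "q < \<rho>"
    using q Suc.prems(5,6) by (auto simp: \<rho>_def less_max_iff_disj)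
  have C0: "0 \<le> C" using Suc.prems(4)[of 0] norm_ge_zero[of "a 0"] by (simp del: norm_ge_zero)
  \<comment> \<open>The fixed point of C' = q (C' / \<rho> + C), which is the bound reproduced by
    the recursion.\<close>
  define C' where "C' = q * C / (1 - q / \<rho>)"
  have qr: "0 < 1 - q / \<rho>" "1 - q / \<rho> \<le> 1" using q \<rho> by (auto simp: field_simps)
  have C'0: "0 \<le> C'" unfolding C'_def using q C0 qr by simp
  have C'e: "q * (C' / \<rho> + C) = C'"
  proof -
    have "C' * (1 - q / \<rho>) = q * C" unfolding C'_def using qr \<rho>(1,4) by simp
    then show ?thesis by (simp add: algebra_simps)
  qed
  have C'ge: "q * C \<le> C'"
    using C'e q C'0 \<rho> by (smt (verit) mult_left_mono divide_nonneg_pos)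
  have vb: "cmod (v n) \<le> C' * \<rho> ^ n" for n
  proof (induction n)
    case 0
    have "cmod z0 * cmod (v 0) = cmod (a 0)" using arg_cong[OF e0, of cmod] by (simp add: norm_mult)
    moreover have "0 < cmod z0" using z1 by linarith
    ultimately have "cmod (v 0) = q * cmod (a 0)"
      by (simp add: q_def eq_divide_eq mult.commute del: zero_less_norm_iff) simp
    also have "\<dots> \<le> q * C" using Suc.prems(4)[of 0] q by simp
    finally show ?case using C'ge by simp
  next
    case (Suc n)
    have "z0 * v (Suc n) = v n - a (Suc n)" using eS[of n] by (simp add: algebra_simps)
    then have "cmod z0 * cmod (v (Suc n)) \<le> cmod (v n) + cmod (a (Suc n))"
      by (metis norm_mult norm_triangle_ineq4)
    moreover have "0 < cmod z0" using z1 by linarith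
    ultimately have "cmod (v (Suc n)) \<le> q * (cmod (v n) + cmod (a (Suc n)))"
      by (simp add: q_def pos_le_divide_eq mult.commute del: zero_less_norm_iff)
    also have "\<dots> \<le> q * (C' * \<rho> ^ n + C * \<rho> ^ Suc n)"
    proof (intro mult_left_mono add_mono Suc.IH)
      have "C * r ^ Suc n \<le> C * \<rho> ^ Suc n" using \<rho> C0 Suc.prems \<open>0 < r\<close> by (intro mult_left_mono power_mono) auto
      then show "cmod (a (Suc n)) \<le> C * \<rho> ^ Suc n" using \<open>\<And>n. cmod (a n) \<le> C * r ^ n\<close>[of "Suc n"] by linarith
    qed (use q in auto)
    also have "\<dots> = (q * (C' / \<rho> + C)) * \<rho> ^ Suc n" using \<rho> by (simp add: field_simps)
    finally show ?case unfolding C'e .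
  qed
  show ?case by (rule Suc.hyps(1)[OF dB' v B'0 rB' vb \<rho>(1,2)])
qed

lemma inM_inW:
  assumes "inM N u"
  shows "inW 1 u"
proof -
  obtain A B :: "complex poly" where AB: "poly B 0 = 1" "\<forall>z. cmod z \<le> 1 \<longrightarrow> poly B z \<noteq> 0"
    "Abs_fps u * fps_of_poly B = fps_of_poly A"
    using assms by (auto simp: inM_def)
  have e1: "Abs_fps u * fps_of_poly B = Abs_fps (coeff A)" unfolding AB(3) by (rule fps_ext) simp
  have e2: "B \<noteq> 0" using AB by auto
  \<comment> \<open>A finitely supported sequence decays at every geometric rate; 1/2 is an
    arbitrary choice.\<close>
  define C where "C = (\<Sum>n\<le>degree A. cmod (coeff A n) * 2 ^ n)"
  have e4: "cmod (coeff A n) \<le> C * (1/2) ^ n" for n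
  proof (cases "n \<le> degree A")
    case True
    then have "cmod (coeff A n) * 2 ^ n \<le> C" unfolding C_def by (intro member_le_sum) auto
    then show ?thesis by (simp add: field_simps power_divide)
  next
    case False
    have "0 \<le> C" unfolding C_def by (intro sum_nonneg) auto
    then show ?thesis using False by (simp add: coeff_eq_0)
  qed
  have "\<exists>K r. 0 < r \<and> r < 1 \<and> (\<forall>n. cmod (u n) \<le> K * r ^ n)"
    by (rule geometric_divide[OF e1 e2 _ e4]) (use AB(2) in auto)
  then obtain K r where r: "0 < r" "r < 1" "\<And>n. cmod (u n) \<le> K * r ^ n" by blast
  have b: "norm ((1 + real k) powr 1 * (cmod (u k))\<^sup>2) \<le> K\<^sup>2 * (of_nat (Suc k) * (r\<^sup>2) ^ k)" for k
  proof -
    have "(cmod (u k))\<^sup>2 \<le> (K * r ^ k)\<^sup>2" by (rule power_mono[OF r(3)]) simp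
    also have "\<dots> = K\<^sup>2 * (r\<^sup>2) ^ k" by (simp add: power_mult_distrib flip: power_mult) (simp add: mult.commute)
    finally show ?thesis using mult_left_mono[of "(cmod (u k))\<^sup>2" "K\<^sup>2 * (r\<^sup>2) ^ k" "1 + real k"]
      by (simp add: abs_mult mult_ac add.commute)
  qed
  have "summable (\<lambda>k. of_nat (Suc k) * (r\<^sup>2) ^ k)"
    using geometric_deriv_sums[of "r\<^sup>2"] r by (auto simp: sums_iff power_less_one_iff abs_square_less_1)
  then have "summable (\<lambda>k. K\<^sup>2 * (of_nat (Suc k) * (r\<^sup>2) ^ k))" by (rule summable_mult)
  then show ?thesis unfolding inW_def by (rule summable_comparison_test'[of _ 0]) (rule b)
qed

text \<open>Along a radius towards a zero of the denominator, the \<open>\<ell>\<^sup>2\<close> bound only allows \<open>u\<close> to grow like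
  \<open>(1 - r)\<^sup>-\<^sup>1\<^sup>/\<^sup>2\<close>, which is slower than a pole.\<close>

lemma l2_no_pole:
  assumes "inW 0 u" "Abs_fps u * fps_of_poly B = fps_of_poly A" "coprime A B" "cmod z \<le> 1"
  shows "poly B z \<noteq> 0"
proof
  assume z: "poly B z = 0"
  then obtain Q where Q: "B = [:- z, 1:] * Q" by (metis dvdE poly_eq_0_iff_dvd)
  have Az: "poly A z \<noteq> 0" using coprime_poly_0[OF assms(3), of z] z by simp
  have "bounded (poly Q ` cball 0 1)"
    by (intro compact_imp_bounded compact_continuous_image continuous_intros compact_cball)
  then obtain K where "0 < K" "\<forall>x\<in>poly Q ` cball 0 1. norm x \<le> K" unfolding bounded_pos by blast
  then have K: "\<And>w. cmod w \<le> 1 \<Longrightarrow> cmod (poly Q w) \<le> K" "0 < K" by auto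
  have rad: "1 \<le> fps_conv_radius (Abs_fps u)"
    unfolding fps_conv_radius_def
  proof (rule conv_radius_geI_ex')
    fix r :: real assume r: "0 < r" "ereal r < 1"
    then have r1: "r < 1" by (simp add: one_ereal_def)
    have "summable (\<lambda>n. wn 0 u * r ^ n)" using r r1 by (intro summable_mult summable_geometric) auto
    then show "summable (\<lambda>n. fps_nth (Abs_fps u) n * of_real r ^ n)"
      by (rule summable_comparison_test'[of _ 0])
        (use coeff_le_wn[OF assms(1)] r in \<open>auto simp: norm_mult norm_power intro!: mult_right_mono\<close>)
  qed
  have est: "cmod (poly A (of_real r * z)) \<le> wn 0 u * K * sqrt (1 - r)" if r: "0 \<le> r" "r < 1" for r
  proof -
    let ?w = "of_real r * z"
    have w: "cmod ?w \<le> r" using r assms(4) by (simp add: norm_mult mult_left_le)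
    have w1: "ereal (cmod ?w) < fps_conv_radius (Abs_fps u)"
      using w r rad by (metis ereal_less(3) le_less_trans less_le_trans ereal_less_eq(3) one_ereal_def)
    have ev: "poly A ?w = eval_fps (Abs_fps u) ?w * poly B ?w"
      using eval_fps_mult[of ?w "Abs_fps u" "fps_of_poly B"] w1 assms(2) by simp
    \<comment> \<open>The comparison sequence for Cauchy-Schwarz along the radius. Its norm is of
      order (1 - r)^(-1/2), whereas the vanishing factor of B contributes 1 - r.\<close>
    have g: "inW 0 (\<lambda>n. complex_of_real (r ^ n))" "wn 0 (\<lambda>n. complex_of_real (r ^ n)) = 1 / sqrt (1 - r\<^sup>2)"
    proof -
      have "(\<lambda>n. (r\<^sup>2) ^ n) sums (1 / (1 - r\<^sup>2))"
        by (rule geometric_sums) (use r in \<open>auto simp: abs_square_less_1\<close>)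
      then have s: "(\<lambda>n. (cmod (complex_of_real (r ^ n)))\<^sup>2) sums (1 / (1 - r\<^sup>2))"
        using r by (simp add: norm_power power2_eq_square power_mult_distrib)
      then show "inW 0 (\<lambda>n. complex_of_real (r ^ n))" by (simp add: inW_def sums_iff)
      show "wn 0 (\<lambda>n. complex_of_real (r ^ n)) = 1 / sqrt (1 - r\<^sup>2)"
        using s by (simp add: wn_def wsq_def sums_iff real_sqrt_divide)
    qed
    have "cmod (eval_fps (Abs_fps u) ?w) \<le> (\<Sum>n. cmod (u n * ?w ^ n))"
      unfolding eval_fps_def using norm_summable_fps[OF w1] by (auto intro: summable_norm)
    also have "\<dots> \<le> wn 0 u * (1 / sqrt (1 - r\<^sup>2))"
    proof (rule suminf_le_const)
      show "summable (\<lambda>n. cmod (u n * ?w ^ n))" using norm_summable_fps[OF w1] by simp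
      fix n
      have "(\<Sum>k<n. cmod (u k * ?w ^ k)) \<le> (\<Sum>k<n. cmod (u k) * cmod (complex_of_real (r ^ k)))"
        using w r by (intro sum_mono) (auto simp: norm_mult norm_power intro!: mult_left_mono power_mono)
      also have "\<dots> \<le> wn 0 u * wn 0 (\<lambda>n. complex_of_real (r ^ n))"
        by (rule CS_fin[OF assms(1) g(1)]) simp
      finally show "(\<Sum>k<n. cmod (u k * ?w ^ k)) \<le> wn 0 u * (1 / sqrt (1 - r\<^sup>2))" unfolding g(2) .
    qed
    also have "\<dots> \<le> wn 0 u * (1 / sqrt (1 - r))"
    proof (intro mult_left_mono wn_nonneg assms(1) divide_left_mono)
      have "r\<^sup>2 \<le> r" using r by (simp add: power2_eq_square mult_left_le)
      then show "sqrt (1 - r) \<le> sqrt (1 - r\<^sup>2)" by simp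
      show "0 < sqrt (1 - r\<^sup>2) * sqrt (1 - r)" using r by (simp add: abs_square_less_1)
    qed simp
    finally have U: "cmod (eval_fps (Abs_fps u) ?w) \<le> wn 0 u * (1 / sqrt (1 - r))" .
    have "poly B ?w = (?w - z) * poly Q ?w" by (simp add: Q algebra_simps)
    moreover have "cmod (?w - z) \<le> 1 - r"
    proof -
      have "?w - z = of_real (r - 1) * z" by (simp add: algebra_simps)
      then have "cmod (?w - z) = (1 - r) * cmod z" using r by (simp only: norm_mult norm_of_real) simp
      then show ?thesis using r assms(4) by (simp add: mult_left_le)
    qed
    ultimately have Bw: "cmod (poly B ?w) \<le> (1 - r) * K"
      using K(1)[of ?w] w r by (auto simp: norm_mult intro!: mult_mono)
    have "cmod (poly A ?w) \<le> (wn 0 u * (1 / sqrt (1 - r))) * ((1 - r) * K)"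
      unfolding ev norm_mult using r by (intro mult_mono U Bw) (auto simp: wn_nonneg[OF assms(1)])
    also have "\<dots> = wn 0 u * K * ((1 - r) / sqrt (1 - r))" by simp
    also have "(1 - r) / sqrt (1 - r) = sqrt (1 - r)" using r by (simp add: real_div_sqrt)
    finally show ?thesis .
  qed
  have s0: "(\<lambda>n. 1 / real (Suc n)) \<longlonglongrightarrow> 0" by (rule LIMSEQ_Suc[OF lim_1_over_n])
  have "(\<lambda>n. cmod (poly A (of_real (1 - 1 / real (Suc n)) * z))) \<longlonglongrightarrow> cmod (poly A (of_real (1 - 0) * z))"
    by (intro tendsto_intros s0)
  moreover have "(\<lambda>n. wn 0 u * K * sqrt (1 - (1 - 1 / real (Suc n)))) \<longlonglongrightarrow> wn 0 u * K * sqrt (1 - (1 - 0))"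
    by (intro tendsto_intros s0)
  ultimately have "cmod (poly A (of_real (1 - 0) * z)) \<le> wn 0 u * K * sqrt (1 - (1 - 0))"
    by (rule LIMSEQ_le) (use est[of "1 - 1 / real (Suc _)"] in auto)
  then show False using Az by simp
qed

lemma inspan_lin:
  assumes "onf N E" "inspan N E f" "inspan N E g"
  shows "inspan N E (\<lambda>k. a * f k + b * g k)"
proof (rule inspanI[OF assms(1)])
  show "(\<lambda>k. a * f k + b * g k) = (\<lambda>k. \<Sum>j=1..N. (a * ip f (E j) + b * ip g (E j)) * E j k)"
  proof
    fix k
    have "f k = (\<Sum>j=1..N. ip f (E j) * E j k)"
      using assms(2) unfolding inspan_def by (rule fun_cong)
    moreover have "g k = (\<Sum>j=1..N. ip g (E j) * E j k)"
      using assms(3) unfolding inspan_def by (rule fun_cong)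
    ultimately have "a * f k + b * g k = a * (\<Sum>j=1..N. ip f (E j) * E j k) + b * (\<Sum>j=1..N. ip g (E j) * E j k)"
      by (simp only:)
    then show "a * f k + b * g k = (\<Sum>j=1..N. (a * ip f (E j) + b * ip g (E j)) * E j k)"
      by (simp only: sum_distrib_left sum.distrib distrib_right mult.assoc)
  qed
qed

lemma inspan_inW: "onf N E \<Longrightarrow> inspan N E f \<Longrightarrow> inW 0 f"
proof -
  assume a: "onf N E" "inspan N E f"
  have "inW 0 (\<lambda>k. \<Sum>j=1..N. ip f (E j) * E j k)"
    by (intro inW_sum inW_scale) (use onfD[OF a(1)] in auto)
  then show ?thesis using a(2) unfolding inspan_def by (rule ssubst[rotated])
qed

lemma inspan_nonzero:
  assumes "onf N E" "inspan N E f" "f \<noteq> (\<lambda>k. 0)"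
  shows "\<exists>j\<in>{1..N}. ip f (E j) \<noteq> 0"
proof (rule ccontr)
  assume a: "\<not> ?thesis"
  have "f k = 0" for k
  proof -
    have "f k = (\<Sum>j=1..N. ip f (E j) * E j k)"
      using assms(2) unfolding inspan_def by (rule fun_cong)
    also have "\<dots> = 0" by (rule sum.neutral) (use a in auto)
    finally show ?thesis .
  qed
  then show False using assms(3) by auto
qed

section \<open>Spectral characterisation of the torus\<close>

context interlaced
begin

text \<open>\<open>spec\<close> without the masses: what the spectrum of H_u^2 yields for u in M(N).
  The masses are recovered afterwards from the spectrum of K_u^2.\<close>

definition eigb :: "(nat \<Rightarrow> complex) \<Rightarrow> (nat \<Rightarrow> nat \<Rightarrow> complex) \<Rightarrow> bool" where
  "eigb u E \<longleftrightarrow> inW 1 u \<and> onf N E \<and> (\<forall>n. inspan N E (sh n u)) \<and>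
     (\<forall>j\<in>{1..N}. Hank u (Hank u (E j)) = (\<lambda>k. complex_of_real (x j) * E j k))"

lemma spec_eigb: "spec u E \<longleftrightarrow> eigb u E \<and> (\<forall>j\<in>{1..N}. (cmod (ip u (E j)))\<^sup>2 = nu j)"
  by (auto simp: spec_def eigb_def)

lemma eigb_coord:
  assumes "eigb u E" "inW 0 h" "j \<in> {1..N}"
  shows "ip (Hank u (Hank u h)) (E j) = complex_of_real (x j) * ip h (E j)"
proof -
  have u: "inW 1 u" and E: "onf N E" and eig: "Hank u (Hank u (E j)) = (\<lambda>k. complex_of_real (x j) * E j k)"
    using assms by (auto simp: eigb_def)
  have "ip (Hank u (Hank u h)) (E j) = ip h (Hank u (Hank u (E j)))"
    by (rule Hank2_sym[OF u assms(2) onfD[OF E assms(3)]])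
  then show ?thesis
    unfolding eig using ip_scale_right[OF onfD[OF E assms(3)] assms(2), of "complex_of_real (x j)"] by simp
qed

lemma eigb_Kcoord:
  assumes "eigb u E" "inW 0 h" "j \<in> {1..N}"
  shows "ip (Kank u (Kank u h)) (E j) = complex_of_real (x j) * ip h (E j) - ip h u * ip u (E j)"
proof -
  have u: "inW 1 u" and E: "inW 0 (E j)"
    using assms onfD by (auto simp: eigb_def)
  have "ip (Kank u (Kank u h)) (E j) = ip (Hank u (Hank u h)) (E j) - ip (\<lambda>n. ip h u * u n) (E j)"
    unfolding Kank2_eq[OF u assms(2)]
    by (rule ip_diff_left) (intro Hank_bound(1) inW_scale u inW_10[OF u] E assms(2))+
  then show ?thesis
    using eigb_coord[OF assms] ip_scale_left[OF inW_10[OF u] E] by simp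
qed

lemma eigb_Kspan:
  assumes "eigb u E" "inW 0 h"
  shows "inspan N E (Kank u (Kank u h))"
proof -
  have u: "inW 1 u" and E: "onf N E" and sp: "\<And>n. inspan N E (sh n u)"
    using assms by (auto simp: eigb_def)
  have "inspan N E (\<lambda>n. 1 * Hank u (Hank u h) n + (- ip h u) * u n)"
    using sp[of 0] by (intro inspan_lin[OF E] Hank_span[OF u E sp] Hank_bound(1)[OF u assms(2)]) simp
  then show ?thesis unfolding Kank2_eq[OF u assms(2)] by simp
qed

lemma inspan_eigen:
  assumes "onf N E" "inspan N E (\<lambda>k. complex_of_real \<sigma> * h k)" "\<sigma> \<noteq> 0"
  shows "inspan N E h"
  using inspan_lin[OF assms(1) assms(2) assms(2), of "1 / complex_of_real \<sigma>" 0] assms(3) by simp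

text \<open>An eigenvector h satisfies (x_j - s) (h | E_j) = (h | u) (u | E_j). Inserting this into
  the expansion of (h | u) and cancelling that number, which is nonzero because h is, gives the
  secular equation for the masses of u.\<close>

lemma K_eigen_relation:
  assumes "eigb u E" "inW 0 h" "h \<noteq> (\<lambda>k. 0)" "0 < \<sigma>"
    "Kank u (Kank u h) = (\<lambda>k. complex_of_real \<sigma> * h k)" "\<And>j. j \<in> {1..N} \<Longrightarrow> \<sigma> \<noteq> x j"
  shows "(\<Sum>j=1..N. (cmod (ip u (E j)))\<^sup>2 / (x j - \<sigma>)) = 1"
proof -
  have u: "inW 1 u" and E: "onf N E" using assms by (auto simp: eigb_def)
  have sp: "inspan N E h"
    using eigb_Kspan[OF assms(1,2)] inspan_eigen[OF E] assms(4,5) by simp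
  define s where "s = ip h u"
  have rel: "ip h (E j) = s * ip u (E j) / complex_of_real (x j - \<sigma>)" if j: "j \<in> {1..N}" for j
  proof -
    have "complex_of_real \<sigma> * ip h (E j) = complex_of_real (x j) * ip h (E j) - s * ip u (E j)"
      using eigb_Kcoord[OF assms(1,2) j] ip_scale_left[OF assms(2) onfD[OF E j], of "complex_of_real \<sigma>"]
      unfolding assms(5) s_def by simp
    then have "ip h (E j) * complex_of_real (x j - \<sigma>) = s * ip u (E j)" by (simp add: algebra_simps)
    moreover have "complex_of_real (x j - \<sigma>) \<noteq> 0" using assms(6)[OF j] by simp
    ultimately show ?thesis by (simp add: eq_divide_eq)
  qed
  have s0: "s \<noteq> 0" using inspan_nonzero[OF E sp assms(3)] rel by fastforce
  have "s = (\<Sum>j=1..N. ip h (E j) * cnj (ip u (E j)))"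
    unfolding s_def by (rule onf_ip_sum[OF E sp inW_10[OF u]])
  also have "\<dots> = (\<Sum>j=1..N. s * complex_of_real ((cmod (ip u (E j)))\<^sup>2 / (x j - \<sigma>)))"
  proof (rule sum.cong[OF refl])
    fix j assume j: "j \<in> {1..N}"
    have "ip u (E j) * cnj (ip u (E j)) = complex_of_real ((cmod (ip u (E j)))\<^sup>2)"
      by (simp add: complex_norm_square[symmetric])
    then show "ip h (E j) * cnj (ip u (E j)) = s * complex_of_real ((cmod (ip u (E j)))\<^sup>2 / (x j - \<sigma>))"
      unfolding rel[OF j] by (simp add: mult.assoc)
  qed
  also have "\<dots> = s * complex_of_real (\<Sum>j=1..N. (cmod (ip u (E j)))\<^sup>2 / (x j - \<sigma>))"
    by (simp only: sum_distrib_left of_real_sum)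
  finally have "complex_of_real (\<Sum>j=1..N. (cmod (ip u (E j)))\<^sup>2 / (x j - \<sigma>)) = of_real 1"
    using s0 by (simp only: mult_cancel_left1) simp
  then show ?thesis using of_real_eq_iff by blast
qed

lemma eigb_posEigH2:
  assumes "eigb u E"
  shows "posEigH2 u = x ` {1..N}"
proof (intro equalityI subsetI)
  have u: "inW 1 u" and E: "onf N E" and sp: "\<And>n. inspan N E (sh n u)"
    and eig: "\<And>j. j \<in> {1..N} \<Longrightarrow> Hank u (Hank u (E j)) = (\<lambda>k. complex_of_real (x j) * E j k)"
    using assms by (auto simp: eigb_def)
  {
    fix \<sigma> assume "\<sigma> \<in> posEigH2 u"
    then obtain h where h: "0 < \<sigma>" "inW 0 h" "h \<noteq> (\<lambda>k. 0)"
      "Hank u (Hank u h) = (\<lambda>k. complex_of_real \<sigma> * h k)"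
      by (auto simp: posEigH2_def inW_0)
    have "inspan N E h"
      using Hank_span[OF u E sp Hank_bound(1)[OF u h(2)]] inspan_eigen[OF E] h by simp
    then obtain j where j: "j \<in> {1..N}" "ip h (E j) \<noteq> 0" using inspan_nonzero[OF E _ h(3)] by blast
    have "complex_of_real \<sigma> * ip h (E j) = complex_of_real (x j) * ip h (E j)"
      using eigb_coord[OF assms h(2) j(1)] ip_scale_left[OF h(2) onfD[OF E j(1)], of "complex_of_real \<sigma>"]
      unfolding h(4) by simp
    then show "\<sigma> \<in> x ` {1..N}" using j by auto
  next
    fix \<sigma> assume "\<sigma> \<in> x ` {1..N}"
    then obtain j where j: "j \<in> {1..N}" "\<sigma> = x j" by blast
    have "E j \<noteq> (\<lambda>k. 0)" using onf_ip[OF E j(1) j(1)] ip_0_left[of "E j"] by auto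
    then show "\<sigma> \<in> posEigH2 u"
      unfolding posEigH2_def using j x0[OF j(1)] eig[OF j(1)] onfD[OF E j(1)] by (auto simp: inW_0)
  }
qed

lemma spec_posEigK2:
  assumes "spec u E"
  shows "posEigK2 u = y ` {1..N}"
proof (intro equalityI subsetI)
  have eb: "eigb u E" and nu: "\<And>j. j \<in> {1..N} \<Longrightarrow> (cmod (ip u (E j)))\<^sup>2 = nu j"
    using assms by (auto simp: spec_eigb)
  have u: "inW 1 u" and E: "onf N E" and sp: "\<And>n. inspan N E (sh n u)"
    using eb by (auto simp: eigb_def)
  have uj: "ip u (E j) \<noteq> 0" if "j \<in> {1..N}" for j using nu[OF that] nu_pos[OF that] by auto
  {
    fix \<sigma> assume "\<sigma> \<in> posEigK2 u"
    then obtain h where h: "0 < \<sigma>" "inW 0 h" "h \<noteq> (\<lambda>k. 0)"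
      "Kank u (Kank u h) = (\<lambda>k. complex_of_real \<sigma> * h k)"
      by (auto simp: posEigK2_def inW_0)
    have sph: "inspan N E h"
      using eigb_Kspan[OF eb h(2)] inspan_eigen[OF E] h by simp
    have rel: "complex_of_real (x j - \<sigma>) * ip h (E j) = ip h u * ip u (E j)" if j: "j \<in> {1..N}" for j
      using eigb_Kcoord[OF eb h(2) j] ip_scale_left[OF h(2) onfD[OF E j], of "complex_of_real \<sigma>"]
      unfolding h(4) by (simp add: algebra_simps)
    \<comment> \<open>If s were some x_i, the nonzero coordinate (u | E_i) would force (h | u) = 0;
      then all coordinates of h except the i-th vanish, and finally that one too.\<close>
    have ne: "\<sigma> \<noteq> x i" if i: "i \<in> {1..N}" for i
    proof
      assume e: "\<sigma> = x i"
      then have s0: "ip h u = 0" using rel[OF i] uj[OF i] by simp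
      have z: "ip h (E j) = 0" if "j \<in> {1..N}" "j \<noteq> i" for j
        using rel[OF that(1)] s0 x_neq[OF that(1) i that(2)] e by simp
      have "ip h u = (\<Sum>j=1..N. ip h (E j) * cnj (ip u (E j)))"
        by (rule onf_ip_sum[OF E sph inW_10[OF u]])
      also have "\<dots> = (\<Sum>j=1..N. if j = i then ip h (E i) * cnj (ip u (E i)) else 0)"
        by (rule sum.cong[OF refl]) (use z in auto)
      finally have "ip h (E i) = 0" using s0 uj[OF i] i by simp
      then show False using inspan_nonzero[OF E sph h(3)] z by metis
    qed
    have "(\<Sum>j=1..N. (cmod (ip u (E j)))\<^sup>2 / (x j - \<sigma>)) = 1"
      by (rule K_eigen_relation[OF eb h(2,3,1,4)]) (rule ne)
    moreover have "(\<Sum>j=1..N. (cmod (ip u (E j)))\<^sup>2 / (x j - \<sigma>)) = (\<Sum>j=1..N. nu j / (x j - \<sigma>))"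
      by (rule sum.cong[OF refl]) (simp only: nu)
    ultimately show "\<sigma> \<in> y ` {1..N}" using secular_iff[of \<sigma>] ne by metis
  next
    fix \<sigma> assume "\<sigma> \<in> y ` {1..N}"
    then obtain m where m: "m \<in> {1..N}" "\<sigma> = y m" by blast
    \<comment> \<open>The candidate eigenvector solves the coordinate relation with (h | u) = 1, and
      the secular equation at y_m confirms this normalisation.\<close>
    define c where "c j = ip u (E j) / complex_of_real (x j - y m)" for j
    define h where "h = (\<lambda>k. \<Sum>j=1..N. c j * E j k)"
    have sph: "inspan N E h" by (rule inspanI[OF E h_def])
    have h0: "inW 0 h" by (rule inspan_inW[OF E sph])
    have cj: "ip h (E j) = c j" if "j \<in> {1..N}" for j unfolding h_def by (rule onf_coord[OF E that])
    have xm: "complex_of_real (x j - y m) \<noteq> 0" if "j \<in> {1..N}" for j using xy_neq[OF that m(1)] by simp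
    have "ip h u = (\<Sum>j=1..N. ip h (E j) * cnj (ip u (E j)))"
      by (rule onf_ip_sum[OF E sph inW_10[OF u]])
    also have "\<dots> = (\<Sum>j=1..N. complex_of_real (nu j / (x j - y m)))"
    proof (rule sum.cong[OF refl])
      fix j assume j: "j \<in> {1..N}"
      have "ip u (E j) * cnj (ip u (E j)) = complex_of_real (nu j)"
        using nu[OF j] by (simp add: complex_norm_square[symmetric] flip: of_real_power)
      then show "ip h (E j) * cnj (ip u (E j)) = complex_of_real (nu j / (x j - y m))"
        unfolding cj[OF j] c_def by simp
    qed
    also have "\<dots> = 1" unfolding of_real_sum[symmetric] secular_y[OF m(1)] by simp
    finally have hu: "ip h u = 1" .
    have "Kank u (Kank u h) k = complex_of_real (y m) * h k" for k
    proof -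
      have "Kank u (Kank u h) k = (\<Sum>j=1..N. ip (Kank u (Kank u h)) (E j) * E j k)"
        using eigb_Kspan[OF eb h0] unfolding inspan_def by (rule fun_cong)
      also have "\<dots> = (\<Sum>j=1..N. complex_of_real (y m) * (c j * E j k))"
      proof (rule sum.cong[OF refl])
        fix j assume j: "j \<in> {1..N}"
        have "complex_of_real (x j) * c j - ip u (E j) = complex_of_real (y m) * c j"
          using xm[OF j] by (simp add: c_def field_simps)
        then show "ip (Kank u (Kank u h)) (E j) * E j k = complex_of_real (y m) * (c j * E j k)"
          unfolding eigb_Kcoord[OF eb h0 j] hu cj[OF j] by (simp add: mult.assoc[symmetric])
      qed
      finally show ?thesis by (simp add: h_def sum_distrib_left)
    qed
    moreover have "h \<noteq> (\<lambda>k. 0)" using hu by (auto simp: ip_0_left)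
    ultimately show "\<sigma> \<in> posEigK2 u"
      unfolding posEigK2_def using m y0[OF m(1)] h0 by (auto simp: inW_0)
  }
qed

text \<open>H_u E_j lies in the x_j-eigenspace of H_u^2 within the span, a line since the x_i are
  distinct. So H_u E_j = c E_j with |c|^2 = x_j, and (u | E_j) = (H_u E_j | 1) = c (E_j |
  1).\<close>

lemma spec_one_coord:
  assumes "spec u E" "j \<in> {1..N}"
  shows "(cmod (ip one_seq (E j)))\<^sup>2 = nu j / x j"
proof -
  have eb: "eigb u E" and nu: "(cmod (ip u (E j)))\<^sup>2 = nu j"
    using assms by (auto simp: spec_eigb)
  have u: "inW 1 u" and E: "onf N E" and sp: "\<And>n. inspan N E (sh n u)"
    and eig: "Hank u (Hank u (E j)) = (\<lambda>k. complex_of_real (x j) * E j k)"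
    using eb assms(2) by (auto simp: eigb_def)
  have Ej: "inW 0 (E j)" by (rule onfD[OF E assms(2)])
  let ?g = "Hank u (E j)"
  have g0: "inW 0 ?g" by (rule Hank_bound(1)[OF u Ej])
  have "Hank u (Hank u ?g) = (\<lambda>n. complex_of_real (x j) * ?g n)"
    unfolding eig using Hank_scale[OF Ej u, of "complex_of_real (x j)"] by simp
  then have z: "ip ?g (E i) = 0" if "i \<in> {1..N}" "i \<noteq> j" for i
    using eigb_coord[OF eb g0 that(1)] ip_scale_left[OF g0 onfD[OF E that(1)], of "complex_of_real (x j)"]
      x_neq[OF that(1) assms(2) that(2)] by auto
  have g: "?g k = ip ?g (E j) * E j k" for k
  proof -
    have "?g k = (\<Sum>i=1..N. ip ?g (E i) * E i k)"
      using Hank_span[OF u E sp Ej] unfolding inspan_def by (rule fun_cong)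
    also have "\<dots> = (\<Sum>i=1..N. if i = j then ip ?g (E j) * E j k else 0)"
      by (rule sum.cong[OF refl]) (use z in auto)
    finally show ?thesis using assms(2) by simp
  qed
  have gf: "?g = (\<lambda>k. ip ?g (E j) * E j k)" by (rule ext) (rule g)
  have "(wn 0 ?g)\<^sup>2 = (cmod (ip ?g (E j)))\<^sup>2"
  proof -
    have "(wn 0 (E j))\<^sup>2 = 1" using ip_self[OF Ej] onf_ip[OF E assms(2,2)] by (simp flip: of_real_power)
    moreover have "wn 0 ?g = cmod (ip ?g (E j)) * wn 0 (E j)"
      by (subst gf) (rule wn_scale[OF Ej])
    ultimately show ?thesis by (simp add: power_mult_distrib)
  qed
  then have a: "(cmod (ip ?g (E j)))\<^sup>2 = x j" using spec_norm[OF assms] by simp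
  have "ip u (E j) = ip ?g one_seq"
    using ip_Hank_sym[OF u inW_one Ej] by (simp add: Hank_one)
  also have "\<dots> = ip ?g (E j) * ip (E j) one_seq"
    by (subst gf) (rule ip_scale_left[OF Ej inW_one])
  finally have "nu j = x j * (cmod (ip (E j) one_seq))\<^sup>2"
    using nu a by (simp add: norm_mult power_mult_distrib)
  moreover have "cmod (ip (E j) one_seq) = cmod (ip one_seq (E j))"
    using ip_cnj[OF inW_one Ej] by (metis complex_mod_cnj)
  ultimately show ?thesis using x0[OF assms(2)] by simp
qed

text \<open>If 1 were in the range of H_u it would lie in the span, and equality in Bessel's
  inequality would say sum nu_j / x_j = 1, against \<open>sum_nu_over_x\<close>.\<close>

lemma spec_one_notin:
  assumes "spec u E"
  shows "one_seq \<notin> RanH u"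
proof
  assume "one_seq \<in> RanH u"
  then obtain h where h: "one_seq = Hank u h" "inW 0 h" by (auto simp: RanH_def inW_0)
  have u: "inW 1 u" and E: "onf N E" and sp: "\<And>n. inspan N E (sh n u)"
    using assms by (auto simp: spec_def)
  have "inspan N E one_seq" unfolding h(1) by (rule Hank_span[OF u E sp h(2)])
  then have "(\<Sum>j=1..N. (cmod (ip one_seq (E j)))\<^sup>2) = (wn 0 one_seq)\<^sup>2"
    using bessel(2)[OF E inW_one] by simp
  moreover have "complex_of_real ((wn 0 one_seq)\<^sup>2) = 1"
    using ip_self[OF inW_one] by (simp add: ip_one_right one_seq_def)
  then have "(wn 0 one_seq)\<^sup>2 = 1" using of_real_eq_1_iff by blast
  moreover have "(\<Sum>j=1..N. (cmod (ip one_seq (E j)))\<^sup>2) = (\<Sum>j=1..N. nu j / x j)"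
    by (rule sum.cong[OF refl]) (rule spec_one_coord[OF assms])
  ultimately show False using sum_nu_over_x by simp
qed

text \<open>The polynomial sum c_k X^k has degree at most N and vanishes at the N points x_j and
  also at 0, because the sum starts at k = 1.\<close>

lemma spec_indep:
  assumes "spec u E" "(\<lambda>m. \<Sum>k=1..N. c k * (Hank u ^^ (2 * k)) one_seq m) = (\<lambda>m. 0)" "k \<in> {1..N}"
  shows "c k = 0"
proof -
  have u: "inW 1 u" and E: "onf N E" using assms by (auto simp: spec_def)
  have pw: "ip ((Hank u ^^ (2*k)) one_seq) (E j) = complex_of_real (x j) ^ k * ip one_seq (E j)"
    if j: "j \<in> {1..N}" for j k
  proof (induction k)
    case (Suc k)
    then show ?case
      using eigb_coord[of u E "(Hank u ^^ (2*k)) one_seq" j] assms(1) j Hank_pow_inW[OF u inW_one, of "2*k"]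
      by (simp add: spec_eigb)
  qed simp
  define P where "P = (\<Sum>k=1..N. monom (c k) k)"
  have Pe: "poly P z = (\<Sum>k=1..N. c k * z ^ k)" for z by (simp add: P_def poly_sum poly_monom)
  have Px: "poly P (complex_of_real (x j)) = 0" if j: "j \<in> {1..N}" for j
  proof -
    have "0 = ip (\<lambda>m. \<Sum>k=1..N. c k * (Hank u ^^ (2 * k)) one_seq m) (E j)"
      unfolding assms(2) by (simp add: ip_0_left)
    also have "\<dots> = (\<Sum>k=1..N. c k * ip ((Hank u ^^ (2 * k)) one_seq) (E j))"
      by (rule ip_lincomb_left) (use Hank_pow_inW[OF u inW_one] onfD[OF E j] in auto)
    also have "\<dots> = poly P (complex_of_real (x j)) * ip one_seq (E j)"
      by (simp only: pw[OF j] Pe sum_distrib_right mult.assoc)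
    finally show ?thesis
      using spec_one_coord[OF assms(1) j] nu_pos[OF j] x0[OF j] by auto
  qed
  have "P = 0"
  proof (rule poly_eqI_degree[where A = "insert 0 ((\<lambda>j. complex_of_real (x j)) ` {1..N})"])
    have "inj_on (\<lambda>j. complex_of_real (x j)) {1..N}"
      by (rule inj_onI) (use inj_onD[OF inj_x] in auto)
    moreover have "0 \<notin> (\<lambda>j. complex_of_real (x j)) ` {1..N}"
    proof
      assume "0 \<in> (\<lambda>j. complex_of_real (x j)) ` {1..N}"
      then obtain j where "0 = complex_of_real (x j)" "j \<in> {1..N}" by (rule imageE)
      then show False using x0[of j] by simp
    qed
    ultimately have c: "card (insert 0 ((\<lambda>j. complex_of_real (x j)) ` {1..N})) = Suc N"
      by (simp add: card_image del: One_nat_def)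
    have "degree P \<le> N" unfolding P_def
      by (rule degree_sum_le) (auto intro: order_trans[OF degree_monom_le])
    then show "degree P < card (insert 0 ((\<lambda>j. complex_of_real (x j)) ` {1..N}))"
      "degree 0 < card (insert 0 ((\<lambda>j. complex_of_real (x j)) ` {1..N}))" unfolding c by simp_all
    fix z assume "z \<in> insert 0 ((\<lambda>j. complex_of_real (x j)) ` {1..N})"
    then show "poly P z = poly 0 z"
    proof
      assume "z = 0"
      then show ?thesis unfolding Pe by (auto intro!: sum.neutral)
    qed (use Px in auto)
  qed
  moreover have "coeff P k = c k"
  proof -
    have "coeff P k = (\<Sum>i=1..N. if i = k then c k else 0)"
      unfolding P_def coeff_sum coeff_monom by (rule sum.cong) auto
    then show ?thesis using assms(3) by simp
  qed
  ultimately show ?thesis by simp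
qed

text \<open>A shorter recurrence would leave a nonzero combination of the \<open>E j\<close>
  orthogonal to all rows, that is, in the kernel of H_u, although all x_j are positive.\<close>

lemma eigb_recur_ge:
  assumes "eigb u E" "recur d u"
  shows "N \<le> d"
proof (rule ccontr)
  assume "\<not> N \<le> d"
  then have "d < card {1..N}" by simp
  have u: "inW 1 u" and E: "onf N E" using assms by (auto simp: eigb_def)
  obtain v where v: "\<exists>j\<in>{1..N}. v j \<noteq> 0" "\<And>i. i < d \<Longrightarrow> (\<Sum>j\<in>{1..N}. ip (sh i u) (E j) * v j) = 0"
    using underdetermined[OF _ \<open>d < card {1..N}\<close>, of "\<lambda>i j. ip (sh i u) (E j)"] by auto
  define f where "f = (\<lambda>k. \<Sum>j=1..N. cnj (v j) * E j k)"
  have f0: "inW 0 f" unfolding f_def by (intro inW_sum inW_scale) (use onfD[OF E] in auto)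
  have "ip (sh i u) f = 0" if "i < d" for i
  proof -
    have "ip (sh i u) f = (\<Sum>j=1..N. cnj (cnj (v j)) * ip (sh i u) (E j))"
      unfolding f_def by (rule ip_lincomb_right) (use onfD[OF E] inW_sh[OF inW_10[OF u]] in auto)
    then show ?thesis using v(2)[OF that] by (simp add: mult.commute)
  qed
  then have "ip (sh n u) f = 0" for n by (rule recur_orth[OF assms(2) inW_10[OF u] f0])
  then have "Hank u f = (\<lambda>n. 0)" by (simp add: Hank_ip fun_eq_iff)
  then have "Hank u (Hank u f) = (\<lambda>n. 0)" by (simp add: Hank_def)
  then have "x j * ip f (E j) = 0" if "j \<in> {1..N}" for j
    using eigb_coord[OF assms(1) f0 that] by (simp add: ip_0_left)
  moreover have "ip f (E j) = cnj (v j)" if "j \<in> {1..N}" for j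
    unfolding f_def by (rule onf_coord[OF E that])
  ultimately show False using v(1) x0 by fastforce
qed

text \<open>The first N + 1 rows live in an N-dimensional space and are dependent. The last row with
  nonzero coefficient defines a recurrence, whose order must be N by
  \<open>eigb_recur_ge\<close>.\<close>

lemma eigb_recur:
  assumes "eigb u E"
  shows "recur N u"
proof -
  have u: "inW 1 u" and E: "onf N E" and sp: "\<And>n. inspan N E (sh n u)"
    using assms by (auto simp: eigb_def)
  obtain b where b: "\<exists>i\<in>{..N}. b i \<noteq> 0" "\<And>j. j < N \<Longrightarrow> (\<Sum>i\<le>N. ip (sh i u) (E (Suc j)) * b i) = 0"
    using underdetermined[of "{..N}" N "\<lambda>j i. ip (sh i u) (E (Suc j))"] by auto
  define d where "d = Max {i\<in>{..N}. b i \<noteq> 0}"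
  have "d \<in> {i\<in>{..N}. b i \<noteq> 0}" unfolding d_def by (rule Max_in) (use b(1) in auto)
  then have d: "d \<le> N" "b d \<noteq> 0" by auto
  have above: "b i = 0" if "d < i" "i \<le> N" for i
  proof (rule ccontr)
    assume "b i \<noteq> 0"
    then have "i \<le> d" unfolding d_def using that by (intro Max_ge) auto
    then show False using that by simp
  qed
  have bj: "(\<Sum>i\<le>N. ip (sh i u) (E j) * b i) = 0" if "j \<in> {1..N}" for j
  proof -
    have "j - 1 < N" "Suc (j - 1) = j" using that by auto
    then show ?thesis using b(2)[of "j - 1"] by simp
  qed
  have rel: "(\<Sum>i\<le>N. b i * u (n + i)) = 0" for n
  proof -
    have "(\<Sum>i\<le>N. b i * u (n + i)) = (\<Sum>i\<le>N. b i * (\<Sum>j=1..N. ip (sh i u) (E j) * E j n))"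
    proof (rule sum.cong[OF refl])
      fix i
      have "sh i u n = (\<Sum>j=1..N. ip (sh i u) (E j) * E j n)"
        using sp[of i] unfolding inspan_def by (rule fun_cong)
      then show "b i * u (n + i) = b i * (\<Sum>j=1..N. ip (sh i u) (E j) * E j n)"
        by (simp add: sh_def add.commute)
    qed
    also have "\<dots> = (\<Sum>i\<le>N. \<Sum>j=1..N. (ip (sh i u) (E j) * b i) * E j n)"
      by (simp add: sum_distrib_left mult_ac)
    also have "\<dots> = (\<Sum>j=1..N. \<Sum>i\<le>N. (ip (sh i u) (E j) * b i) * E j n)" by (rule sum.swap)
    also have "\<dots> = (\<Sum>j=1..N. 0)"
      by (rule sum.cong[OF refl]) (simp only: sum_distrib_right[symmetric] bj mult_zero_left)
    finally show ?thesis by simp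
  qed
  have "(\<Sum>i\<le>d. b i * u (n + i)) = 0" for n
  proof -
    have "(\<Sum>i\<le>d. b i * u (n + i)) = (\<Sum>i\<le>N. b i * u (n + i))"
      by (rule sum.mono_neutral_left) (use d above in auto)
    then show ?thesis using rel by simp
  qed
  then have r: "recur d u" unfolding recur_def using d by blast
  then have "N \<le> d" by (rule eigb_recur_ge[OF assms])
  then show ?thesis using r d by simp
qed

text \<open>The denominator is the reversed recurrence, normalised to B(0) = 1. A drop of both
  degrees or a common factor of A and B would produce a recurrence of order N - 1, contradicting
  \<open>eigb_recur_ge\<close>; \<open>l2_no_pole\<close> keeps the zeros of B off the closed
  disc.\<close>

lemma eigb_inM:
  assumes "eigb u E"
  shows "inM N u"
proof -
  have u: "inW 1 u" using assms by (auto simp: eigb_def)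
  obtain b where b: "b N \<noteq> 0" "\<And>n. (\<Sum>i\<le>N. b i * u (n + i)) = 0"
    using eigb_recur[OF assms] by (auto simp: recur_def)
  define B where "B = (\<Sum>k\<le>N. monom (b (N - k) / b N) k)"
  have cB: "coeff B k = (if k \<le> N then b (N - k) / b N else 0)" for k
    by (simp add: B_def coeff_sum coeff_monom)
  have dB: "degree B \<le> N" by (rule degree_le) (simp add: cB)
  have B0: "coeff B 0 = 1" using b(1) by (simp add: cB)
  define A where "A = (\<Sum>n<N. monom (fps_nth (Abs_fps u * fps_of_poly B) n) n)"
  have cA: "coeff A n = (if n < N then fps_nth (Abs_fps u * fps_of_poly B) n else 0)" for n
    by (simp add: A_def coeff_sum coeff_monom)
  have dA: "degree A \<le> N - 1" by (rule degree_le) (auto simp: cA)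
  have eq: "Abs_fps u * fps_of_poly B = fps_of_poly A"
  proof (rule fps_ext)
    fix n
    show "fps_nth (Abs_fps u * fps_of_poly B) n = fps_nth (fps_of_poly A) n"
    proof (cases "n < N")
      case False
      have "fps_nth (Abs_fps u * fps_of_poly B) n = (\<Sum>i\<le>N. coeff B (N - i) * u (n - N + i))"
        by (rule fps_poly_coeff[OF dB]) (use False in simp)
      also have "\<dots> = (\<Sum>i\<le>N. (b i * u (n - N + i)) / b N)"
        by (rule sum.cong[OF refl]) (simp add: cB)
      also have "\<dots> = 0" unfolding sum_divide_distrib[symmetric] b(2) by simp
      finally show ?thesis using False by (simp add: cA)
    qed (simp add: cA)
  qed
  have cond: "(A \<noteq> 0 \<and> degree A = N - 1) \<or> degree B = N"
  proof (rule ccontr)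
    assume c: "\<not> ?thesis"
    have "recur (N - 1) u"
    proof (rule rational_recur[OF eq])
      show "degree B \<le> N - 1" using c dB by auto
      show "coeff B 0 \<noteq> 0" using B0 by simp
      fix n assume "N - 1 \<le> n"
      show "coeff A n = 0"
      proof (cases "A = 0")
        case False
        then have "degree A < N - 1" using c dA by auto
        then show ?thesis using \<open>N - 1 \<le> n\<close> by (intro coeff_eq_0) simp
      qed simp
    qed
    then show False using eigb_recur_ge[OF assms, of "N - 1"] N1 by simp
  qed
  have cop: "coprime A B"
  proof (rule coprimeI)
    fix D assume D: "D dvd A" "D dvd B"
    obtain A' B' where AB: "A = D * A'" "B = D * B'" using D by (auto elim!: dvdE)
    have Bn: "B \<noteq> 0" using B0 by auto
    then have D0: "D \<noteq> 0" "B' \<noteq> 0" using AB by auto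
    show "is_unit D"
    proof (rule ccontr)
      assume "\<not> is_unit D"
      then have dD: "1 \<le> degree D" using is_unit_iff_degree[OF D0(1)] by simp
      have "fps_of_poly D * (Abs_fps u * fps_of_poly B') = fps_of_poly D * fps_of_poly A'"
        using eq unfolding AB fps_of_poly_mult by (simp add: mult_ac)
      moreover have "fps_of_poly D \<noteq> 0" using D0 by simp
      ultimately have eq': "Abs_fps u * fps_of_poly B' = fps_of_poly A'"
        using mult_cancel_left by blast
      have "recur (N - 1) u"
      proof (rule rational_recur[OF eq'])
        have "degree B = degree D + degree B'" unfolding AB using D0 by (rule degree_mult_eq)
        then show "degree B' \<le> N - 1" using dB dD by simp
        have "coeff B 0 = coeff D 0 * coeff B' 0" unfolding AB by (simp add: coeff_mult)
        then show "coeff B' 0 \<noteq> 0" using B0 by auto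
        fix n assume n: "N - 1 \<le> n"
        show "coeff A' n = 0"
        proof (cases "A' = 0")
          case False
          then have "degree A = degree D + degree A'" unfolding AB using D0 by (intro degree_mult_eq)
          then have "degree A' < n" using dA dD n by simp
          then show ?thesis by (rule coeff_eq_0)
        qed simp
      qed
      then show False using eigb_recur_ge[OF assms, of "N - 1"] N1 by simp
    qed
  qed
  have "poly B z \<noteq> 0" if "cmod z \<le> 1" for z
    by (rule l2_no_pole[OF inW_10[OF u] eq cop that])
  then show ?thesis
    unfolding inM_def using dA dB B0 cond cop eq by (intro exI[of _ A] exI[of _ B]) (auto simp: poly_0_coeff_0)
qed

text \<open>Eigenvectors for distinct x_j are orthogonal. Since u is rational, H_u has rank at most
  N, so the N eigenvectors already span all rows.\<close>

lemma eigb_exists: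
  assumes "inM N u" "posEigH2 u = x ` {1..N}"
  shows "\<exists>E. eigb u E"
proof -
  have u: "inW 1 u" by (rule inM_inW[OF assms(1)])
  have u0: "inW 0 u" by (rule inW_10[OF u])
  have "\<exists>h. inW 0 h \<and> h \<noteq> (\<lambda>k. 0) \<and> Hank u (Hank u h) = (\<lambda>k. complex_of_real (x j) * h k)"
    if "j \<in> {1..N}" for j
  proof -
    have "x j \<in> posEigH2 u" using assms(2) that by simp
    then show ?thesis by (auto simp: posEigH2_def inW_0)
  qed
  then obtain h where h: "\<And>j. j \<in> {1..N} \<Longrightarrow> inW 0 (h j)" "\<And>j. j \<in> {1..N} \<Longrightarrow> h j \<noteq> (\<lambda>k. 0)"
    "\<And>j. j \<in> {1..N} \<Longrightarrow> Hank u (Hank u (h j)) = (\<lambda>k. complex_of_real (x j) * h j k)" by metis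
  define E where "E j = (\<lambda>k. complex_of_real (1 / wn 0 (h j)) * h j k)" for j
  have E0: "inW 0 (E j)" if "j \<in> {1..N}" for j unfolding E_def by (rule inW_scale[OF h(1)[OF that]])
  have wpos: "0 < wn 0 (h j)" if "j \<in> {1..N}" for j
  proof -
    have "wn 0 (h j) \<noteq> 0" using wn_eq_0[OF h(1)[OF that]] h(2)[OF that] by auto
    then show ?thesis using wn_nonneg[OF h(1)[OF that]] by simp
  qed
  have eig: "Hank u (Hank u (E j)) = (\<lambda>k. complex_of_real (x j) * E j k)" if j: "j \<in> {1..N}" for j
  proof -
    have "Hank u (Hank u (E j)) = (\<lambda>k. complex_of_real (1 / wn 0 (h j)) * Hank u (Hank u (h j)) k)"
      unfolding E_def
      by (simp only: Hank_scale[OF h(1)[OF j] u] Hank_scale[OF Hank_bound(1)[OF u h(1)[OF j]] u] complex_cnj_complex_of_real)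
    then show ?thesis unfolding h(3)[OF j] by (simp add: E_def)
  qed
  have on: "ip (E i) (E j) = (if i = j then 1 else 0)" if ij: "i \<in> {1..N}" "j \<in> {1..N}" for i j
  proof (cases "i = j")
    case True
    have "wn 0 (E j) = 1" unfolding E_def wn_scale[OF h(1)[OF ij(2)]] norm_of_real using wpos[OF ij(2)] by simp
    then show ?thesis using True ip_self[OF E0[OF ij(2)]] by simp
  next
    case False
    have "complex_of_real (x i) * ip (E i) (E j) = ip (Hank u (Hank u (E i))) (E j)"
      unfolding eig[OF ij(1)] by (rule ip_scale_left[symmetric]) (use E0 ij in auto)
    also have "\<dots> = ip (E i) (Hank u (Hank u (E j)))" by (rule Hank2_sym[OF u]) (use E0 ij in auto)
    also have "\<dots> = complex_of_real (x j) * ip (E i) (E j)"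
      unfolding eig[OF ij(2)] using ip_scale_right[OF E0[OF ij(2)] E0[OF ij(1)], of "complex_of_real (x j)"] by simp
    finally show ?thesis using False x_neq[OF ij False] by auto
  qed
  have onE: "onf N E" using E0 on by (simp add: onf_def)
  obtain A B :: "complex poly" where AB: "degree A \<le> N - 1" "degree B \<le> N" "poly B 0 = 1"
    "Abs_fps u * fps_of_poly B = fps_of_poly A"
    using assms(1) by (auto simp: inM_def)
  have rec: "recur N u"
    by (rule rational_recur[OF AB(4,2)]) (use AB N1 in \<open>auto simp: poly_0_coeff_0 intro!: coeff_eq_0\<close>)
  have "inspan N E (sh m u)" for m
  proof -
    let ?f = "sh m u"
    have f0: "inW 0 ?f" by (rule inW_sh[OF u0])
    define P where "P = (\<lambda>k. \<Sum>j=1..N. ip ?f (E j) * E j k)"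
    have P0: "inW 0 P" unfolding P_def by (intro inW_sum inW_scale) (use E0 in auto)
    define r where "r = (\<lambda>k. ?f k - P k)"
    have r0: "inW 0 r" unfolding r_def by (rule inW_diff[OF f0 P0])
    have rE: "ip r (E j) = 0" if "j \<in> {1..N}" for j
      unfolding r_def ip_diff_left[OF f0 P0 E0[OF that]] unfolding P_def onf_coord[OF onE that] by simp
    \<comment> \<open>Index 0 carries the residual r of the row. Among N + 1 vectors some
      combination is orthogonal to the first N rows, hence lies in the kernel of H_u. Its
      \<open>E j\<close> coordinates vanish because x_j > 0, so it is a multiple of r, and r is
      orthogonal to the very row it came from.\<close>
    define G where "G j = (if j = 0 then r else E j)" for j
    have G0: "inW 0 (G j)" if "j \<in> {..N}" for j using that r0 E0 by (auto simp: G_def)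
    obtain v where v: "\<exists>j\<in>{..N}. v j \<noteq> 0" "\<And>i. i < N \<Longrightarrow> (\<Sum>j\<le>N. ip (sh i u) (G j) * v j) = 0"
      using underdetermined[of "{..N}" N "\<lambda>i j. ip (sh i u) (G j)"] by auto
    define g where "g = (\<lambda>k. \<Sum>j\<le>N. cnj (v j) * G j k)"
    have g0: "inW 0 g" unfolding g_def by (intro inW_sum inW_scale) (use G0 in auto)
    have "ip (sh i u) g = 0" if "i < N" for i
    proof -
      have "ip (sh i u) g = (\<Sum>j\<le>N. cnj (cnj (v j)) * ip (sh i u) (G j))"
        unfolding g_def by (rule ip_lincomb_right) (use G0 inW_sh[OF u0] in auto)
      then show ?thesis using v(2)[OF that] by (simp add: mult.commute)
    qed
    then have go: "ip (sh n u) g = 0" for n by (rule recur_orth[OF rec u0 g0])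
    then have "Hank u g = (\<lambda>n. 0)" by (simp add: Hank_ip fun_eq_iff)
    then have Hg: "Hank u (Hank u g) = (\<lambda>n. 0)" by (simp add: Hank_def)
    have gE: "ip g (E j) = cnj (v j)" if j: "j \<in> {1..N}" for j
    proof -
      have "ip g (E j) = (\<Sum>i\<le>N. cnj (v i) * ip (G i) (E j))"
        unfolding g_def by (rule ip_lincomb_left) (use G0 E0[OF j] in auto)
      also have "\<dots> = (\<Sum>i\<le>N. if i = j then cnj (v j) else 0)"
        by (rule sum.cong[OF refl]) (use rE[OF j] on[OF _ j] j in \<open>auto simp: G_def\<close>)
      finally show ?thesis using j by simp
    qed
    have vz: "v j = 0" if j: "j \<in> {1..N}" for j
    proof -
      have "0 = ip g (Hank u (Hank u (E j)))"
        using Hank2_sym[OF u g0 E0[OF j]] Hg by (simp add: ip_0_left)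
      also have "\<dots> = complex_of_real (x j) * ip g (E j)"
        unfolding eig[OF j] using ip_scale_right[OF E0[OF j] g0, of "complex_of_real (x j)"] by simp
      finally show ?thesis using gE[OF j] x0[OF j] by simp
    qed
    then have v0: "v 0 \<noteq> 0" using v(1) by (metis atLeastAtMost_iff atMost_iff less_one not_le)
    have gr: "g = (\<lambda>k. cnj (v 0) * r k)"
    proof
      fix k
      have "g k = (\<Sum>j\<le>N. if j = 0 then cnj (v 0) * r k else 0)"
        unfolding g_def by (rule sum.cong[OF refl]) (use vz in \<open>auto simp: G_def\<close>)
      then show "g k = cnj (v 0) * r k" by simp
    qed
    have "ip ?f r = 0"
      using go[of m] ip_scale_right[OF r0 f0, of "cnj (v 0)"] v0 unfolding gr by simp
    moreover have "ip P r = 0"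
    proof -
      have "ip P r = (\<Sum>j=1..N. ip ?f (E j) * ip (E j) r)"
        unfolding P_def by (rule ip_lincomb_left) (use E0 r0 in auto)
      also have "\<dots> = (\<Sum>j=1..N. 0)"
      proof (rule sum.cong[OF refl])
        fix j assume "j \<in> {1..N}"
        then show "ip ?f (E j) * ip (E j) r = 0" using ip_cnj[OF r0 E0] rE by (metis complex_cnj_zero mult_zero_right)
      qed
      finally show ?thesis by simp
    qed
    ultimately have "ip r r = 0" using ip_diff_left[OF f0 P0 r0] by (simp add: r_def)
    then have "wn 0 r = 0" using ip_self[OF r0] by simp
    then have "r k = 0" for k by (rule wn_eq_0[OF r0])
    then have "?f = P" by (auto simp: r_def fun_eq_iff)
    then show ?thesis unfolding inspan_def P_def .
  qed
  then show ?thesis using u onE eig unfolding eigb_def by blast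
qed

text \<open>For the converse, the actual masses of u and the numbers \<open>nu j\<close> satisfy the
  same secular equations at all y_m, so \<open>cauchy_unique\<close> identifies them.\<close>

theorem Tset_iff_spec: "u \<in> Tset N (\<lambda>j. 2 * x j) (\<lambda>j. 2 * y j) \<longleftrightarrow> (\<exists>E. spec u E)"
proof
  assume "\<exists>E. spec u E"
  then obtain E where E: "spec u E" by blast
  then have eb: "eigb u E" by (simp add: spec_eigb)
  have "inMgen N u"
    unfolding inMgen_def using eigb_inM[OF eb] spec_one_notin[OF E] spec_indep[OF E] by blast
  then show "u \<in> Tset N (\<lambda>j. 2 * x j) (\<lambda>j. 2 * y j)"
    unfolding Tset_def using eigb_posEigH2[OF eb] spec_posEigK2[OF E] by simp
next
  assume "u \<in> Tset N (\<lambda>j. 2 * x j) (\<lambda>j. 2 * y j)"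
  then have M: "inM N u" and H: "posEigH2 u = x ` {1..N}" and K: "posEigK2 u = y ` {1..N}"
    by (auto simp: Tset_def inMgen_def)
  obtain E where eb: "eigb u E" using eigb_exists[OF M H] by blast
  have "(\<Sum>j=1..N. ((cmod (ip u (E j)))\<^sup>2 - nu j) / (x j - y m)) = 0" if m: "m \<in> {1..N}" for m
  proof -
    have "y m \<in> posEigK2 u" using K m by simp
    then obtain h where h: "inW 0 h" "h \<noteq> (\<lambda>k. 0)" "Kank u (Kank u h) = (\<lambda>k. complex_of_real (y m) * h k)"
      by (auto simp: posEigK2_def inW_0)
    have "(\<Sum>j=1..N. (cmod (ip u (E j)))\<^sup>2 / (x j - y m)) = 1"
      by (rule K_eigen_relation[OF eb h(1,2) y0[OF m] h(3)]) (use xy_neq[OF _ m] in metis)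
    then show ?thesis using secular_y[OF m] by (simp add: diff_divide_distrib sum_subtractf del: One_nat_def)
  qed
  from cauchy_unique[OF this] have "(cmod (ip u (E j)))\<^sup>2 = nu j" if "j \<in> {1..N}" for j
    using that by fastforce
  then show "\<exists>E. spec u E" using eb by (auto simp: spec_eigb)
qed

end

section \<open>Convolution estimates and the Lax identity\<close>

definition cv :: "(nat \<Rightarrow> complex) \<Rightarrow> (nat \<Rightarrow> complex) \<Rightarrow> nat \<Rightarrow> complex" where
  "cv h g j = (\<Sum>k\<le>j. h k * g (j - k))"

lemma rect_le_triangle:
  fixes f :: "nat \<Rightarrow> nat \<Rightarrow> real"
  assumes "\<And>n k. 0 \<le> f n k"
  shows "(\<Sum>n<R. \<Sum>k<P. f n k) \<le> (\<Sum>j<R+P. \<Sum>k\<le>j. f (j - k) k)"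
proof -
  have "(\<Sum>n<R. \<Sum>k<P. f n k) = (\<Sum>(n,k)\<in>{..<R}\<times>{..<P}. f n k)"
    by (simp add: sum.cartesian_product)
  also have "\<dots> = (\<Sum>(j,k)\<in>(\<lambda>(n,k). (n+k,k)) ` ({..<R}\<times>{..<P}). f (j - k) k)"
    by (subst sum.reindex) (auto simp: inj_on_def case_prod_unfold)
  also have "\<dots> \<le> (\<Sum>(j,k)\<in>(SIGMA j:{..<R+P}. {..j}). f (j - k) k)"
    by (rule sum_mono2) (use assms in auto)
  also have "\<dots> = (\<Sum>j<R+P. \<Sum>k\<le>j. f (j - k) k)"
    by (subst sum.Sigma) auto
  finally show ?thesis .
qed

lemma triangle_le_rect:
  fixes f :: "nat \<Rightarrow> nat \<Rightarrow> real"
  assumes "\<And>n k. 0 \<le> f n k"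
  shows "(\<Sum>j<R. \<Sum>k\<le>j. f (j - k) k) \<le> (\<Sum>n<R. \<Sum>k<R. f n k)"
proof -
  have "(\<Sum>j<R. \<Sum>k\<le>j. f (j - k) k) = (\<Sum>(j,k)\<in>(SIGMA j:{..<R}. {..j}). f (j - k) k)"
    by (subst sum.Sigma) auto
  also have "\<dots> = (\<Sum>(n,k)\<in>(\<lambda>(j,k). (j-k,k)) ` (SIGMA j:{..<R}. {..j}). f n k)"
    by (subst sum.reindex) (auto simp: inj_on_def case_prod_unfold)
  also have "\<dots> \<le> (\<Sum>(n,k)\<in>{..<R}\<times>{..<R}. f n k)"
    by (rule sum_mono2) (use assms in auto)
  also have "\<dots> = (\<Sum>n<R. \<Sum>k<R. f n k)" by (simp add: sum.cartesian_product)
  finally show ?thesis .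
qed

lemma powr_half_square: "(z powr (e / 2))\<^sup>2 = z powr (e::real)"
  unfolding power2_eq_square by (simp flip: powr_add)

text \<open>A weighted Schur test: Cauchy-Schwarz in k with the weights (1+k)^(b/2) and its inverse,
  then summation along antidiagonals n + k = j, which reduces everything to \<open>wt\<close>. The
  inner series is truncated at P, so only finite sums are rearranged.\<close>

lemma Hank_weighted:
  assumes s: "inW a s" and h: "inW b h" and s0: "inW 0 s" and h0: "inW 0 h" and K: "0 \<le> K"
    and wt: "\<And>j. (\<Sum>k\<le>j. (1 + real (j - k)) powr c * (1 + real k) powr (- b)) \<le> K * (1 + real j) powr a"
  shows "inW c (Hank s h)" "wn c (Hank s h) \<le> sqrt K * (wn a s * wn b h)"
proof -
  have "(\<Sum>n<R. (1 + real n) powr c * (cmod (Hank s h n))\<^sup>2) \<le> (sqrt K * (wn a s * wn b h))\<^sup>2" for R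
  proof (rule LIMSEQ_le_const2)
    show "(\<lambda>P. \<Sum>n<R. (1 + real n) powr c * (cmod (\<Sum>k<P. s (n+k) * cnj (h k)))\<^sup>2)
        \<longlonglongrightarrow> (\<Sum>n<R. (1 + real n) powr c * (cmod (Hank s h n))\<^sup>2)"
    proof (intro tendsto_intros)
      fix n
      have "summable (\<lambda>k. sh n s k * cnj (h k))" by (rule ip_summable[OF inW_sh[OF s0] h0])
      then show "(\<lambda>P. \<Sum>k<P. s (n+k) * cnj (h k)) \<longlonglongrightarrow> Hank s h n"
        using summable_LIMSEQ unfolding Hank_def sh_def by blast
    qed
    show "\<exists>P0. \<forall>P\<ge>P0. (\<Sum>n<R. (1 + real n) powr c * (cmod (\<Sum>k<P. s (n+k) * cnj (h k)))\<^sup>2)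
      \<le> (sqrt K * (wn a s * wn b h))\<^sup>2"
    proof (intro exI[of _ 0] allI impI)
      fix P :: nat
      have CS: "(cmod (\<Sum>k<P. s (n+k) * cnj (h k)))\<^sup>2
        \<le> (\<Sum>k<P. (1 + real k) powr (- b) * (cmod (s (n+k)))\<^sup>2) * (wn b h)\<^sup>2" for n
      proof -
        have "cmod (\<Sum>k<P. s (n+k) * cnj (h k)) \<le> (\<Sum>k<P. cmod (s (n+k)) * cmod (h k))"
          by (rule order_trans[OF norm_sum]) (simp add: norm_mult)
        also have "\<dots> = (\<Sum>k<P. ((1 + real k) powr (- b/2) * cmod (s (n+k))) * ((1 + real k) powr (b/2) * cmod (h k)))"
        proof (rule sum.cong[OF refl])
          fix k
          have "(1 + real k) powr (- b/2) * (1 + real k) powr (b/2) = 1" by (simp flip: powr_add)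
          then show "cmod (s (n+k)) * cmod (h k)
            = ((1 + real k) powr (- b/2) * cmod (s (n+k))) * ((1 + real k) powr (b/2) * cmod (h k))"
            by (metis (no_types, lifting) mult.assoc mult.left_commute mult_1)
        qed
        finally have "(cmod (\<Sum>k<P. s (n+k) * cnj (h k)))\<^sup>2 \<le>
          (\<Sum>k<P. ((1 + real k) powr (- b/2) * cmod (s (n+k))) * ((1 + real k) powr (b/2) * cmod (h k)))\<^sup>2"
          by (rule power_mono) simp
        also have "\<dots> \<le> (\<Sum>k<P. ((1 + real k) powr (- b/2) * cmod (s (n+k)))\<^sup>2) * (\<Sum>k<P. ((1 + real k) powr (b/2) * cmod (h k))\<^sup>2)"
          by (rule Cauchy_Schwarz_ineq_sum)
        also have "\<dots> = (\<Sum>k<P. (1 + real k) powr (- b) * (cmod (s (n+k)))\<^sup>2) * (\<Sum>k<P. (1 + real k) powr b * (cmod (h k))\<^sup>2)"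
          by (simp only: power_mult_distrib powr_half_square)
        also have "\<dots> \<le> (\<Sum>k<P. (1 + real k) powr (- b) * (cmod (s (n+k)))\<^sup>2) * (wn b h)\<^sup>2"
          by (intro mult_left_mono wn_partial[OF h] sum_nonneg) auto
        finally show ?thesis .
      qed
      have "(\<Sum>n<R. (1 + real n) powr c * (cmod (\<Sum>k<P. s (n+k) * cnj (h k)))\<^sup>2)
        \<le> (\<Sum>n<R. (1 + real n) powr c * ((\<Sum>k<P. (1 + real k) powr (- b) * (cmod (s (n+k)))\<^sup>2) * (wn b h)\<^sup>2))"
        by (intro sum_mono mult_left_mono CS) auto
      also have "\<dots> = (\<Sum>n<R. \<Sum>k<P. (1 + real n) powr c * (1 + real k) powr (- b) * (cmod (s (n+k)))\<^sup>2) * (wn b h)\<^sup>2"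
        by (simp add: sum_distrib_left sum_distrib_right mult_ac)
      also have "\<dots> \<le> (\<Sum>j<R+P. \<Sum>k\<le>j. (1 + real (j-k)) powr c * (1 + real k) powr (- b) * (cmod (s (j-k+k)))\<^sup>2) * (wn b h)\<^sup>2"
        by (intro mult_right_mono rect_le_triangle) auto
      also have "(\<Sum>j<R+P. \<Sum>k\<le>j. (1 + real (j-k)) powr c * (1 + real k) powr (- b) * (cmod (s (j-k+k)))\<^sup>2)
        = (\<Sum>j<R+P. (\<Sum>k\<le>j. (1 + real (j-k)) powr c * (1 + real k) powr (- b)) * (cmod (s j))\<^sup>2)"
        by (simp add: sum_distrib_right)
      also have "\<dots> \<le> (\<Sum>j<R+P. (K * (1 + real j) powr a) * (cmod (s j))\<^sup>2)"
        by (intro sum_mono mult_right_mono wt) auto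
      also have "\<dots> = K * (\<Sum>j<R+P. (1 + real j) powr a * (cmod (s j))\<^sup>2)"
        by (simp add: sum_distrib_left mult_ac)
      also have "\<dots> \<le> K * (wn a s)\<^sup>2" by (intro mult_left_mono wn_partial[OF s] K) auto
      finally show "(\<Sum>n<R. (1 + real n) powr c * (cmod (\<Sum>k<P. s (n+k) * cnj (h k)))\<^sup>2)
        \<le> (sqrt K * (wn a s * wn b h))\<^sup>2"
        using K by (simp add: power_mult_distrib mult_right_mono mult.assoc)
    qed
  qed
  then show "inW c (Hank s h)" "wn c (Hank s h) \<le> sqrt K * (wn a s * wn b h)"
    using inWI[of c "Hank s h" "sqrt K * (wn a s * wn b h)"] K wn_nonneg[OF s] wn_nonneg[OF h] by auto
qed

text \<open>The same scheme as in \<open>Hank_weighted\<close>: \<open>wt\<close> bounds the weights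
  within one antidiagonal, and the remaining double sum is dominated by a product.\<close>

lemma cv_weighted:
  assumes h: "inW b h" and g: "inW b' g" and K: "0 \<le> K"
    and wt: "\<And>j. (\<Sum>k\<le>j. (1 + real k) powr (- b) * (1 + real (j - k)) powr (- b')) \<le> K * (1 + real j) powr (- a)"
  shows "inW a (cv h g)" "wn a (cv h g) \<le> sqrt K * (wn b h * wn b' g)"
proof -
  have "(\<Sum>j<R. (1 + real j) powr a * (cmod (cv h g j))\<^sup>2) \<le> (sqrt K * (wn b h * wn b' g))\<^sup>2" for R
  proof -
    let ?X = "\<lambda>k. (1 + real k) powr b * (cmod (h k))\<^sup>2"
    let ?Y = "\<lambda>k. (1 + real k) powr b' * (cmod (g k))\<^sup>2"
    have CS: "(1 + real j) powr a * (cmod (cv h g j))\<^sup>2 \<le> K * (\<Sum>k\<le>j. ?Y (j - k) * ?X k)" for j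
    proof -
      let ?p = "\<lambda>k. (1 + real k) powr (- b/2) * (1 + real (j-k)) powr (- b'/2)"
      let ?q = "\<lambda>k. ((1 + real k) powr (b/2) * (1 + real (j-k)) powr (b'/2)) * (cmod (h k) * cmod (g (j-k)))"
      have "cmod (cv h g j) \<le> (\<Sum>k\<le>j. cmod (h k) * cmod (g (j-k)))"
        unfolding cv_def by (rule order_trans[OF norm_sum]) (simp add: norm_mult)
      also have "\<dots> = (\<Sum>k\<le>j. ?p k * ?q k)"
      proof (rule sum.cong[OF refl])
        fix k
        have "?p k * ?q k = ((1 + real k) powr (- b/2) * (1 + real k) powr (b/2)) *
           ((1 + real (j-k)) powr (- b'/2) * (1 + real (j-k)) powr (b'/2)) * (cmod (h k) * cmod (g (j-k)))"
          by (simp only: mult_ac)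
        then show "cmod (h k) * cmod (g (j-k)) = ?p k * ?q k" by (simp flip: powr_add)
      qed
      finally have "(cmod (cv h g j))\<^sup>2 \<le> (\<Sum>k\<le>j. ?p k * ?q k)\<^sup>2" by (rule power_mono) simp
      also have "\<dots> \<le> (\<Sum>k\<le>j. (?p k)\<^sup>2) * (\<Sum>k\<le>j. (?q k)\<^sup>2)" by (rule Cauchy_Schwarz_ineq_sum)
      also have "(\<Sum>k\<le>j. (?p k)\<^sup>2) = (\<Sum>k\<le>j. (1 + real k) powr (- b) * (1 + real (j - k)) powr (- b'))"
        by (simp only: power_mult_distrib powr_half_square)
      also have "(\<Sum>k\<le>j. (?q k)\<^sup>2) = (\<Sum>k\<le>j. ?Y (j - k) * ?X k)"
      proof (rule sum.cong[OF refl])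
        fix k
        have sq: "z powr (e/2) * z powr (e/2) = z powr e" for z e :: real by (simp flip: powr_add)
        have "(?q k)\<^sup>2 = (((1 + real k) powr (b/2) * (1 + real k) powr (b/2)) * (cmod (h k))\<^sup>2) *
          (((1 + real (j-k)) powr (b'/2) * (1 + real (j-k)) powr (b'/2)) * (cmod (g (j-k)))\<^sup>2)"
          by (simp only: power2_eq_square mult_ac)
        then show "(?q k)\<^sup>2 = ?Y (j - k) * ?X k" unfolding sq by (simp only: mult_ac)
      qed
      finally have "(cmod (cv h g j))\<^sup>2 \<le> (\<Sum>k\<le>j. (1 + real k) powr (- b) * (1 + real (j - k)) powr (- b')) *
         (\<Sum>k\<le>j. ?Y (j - k) * ?X k)" .
      also have "\<dots> \<le> (K * (1 + real j) powr (- a)) * (\<Sum>k\<le>j. ?Y (j - k) * ?X k)"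
        by (intro mult_right_mono wt sum_nonneg) auto
      finally have "(1 + real j) powr a * (cmod (cv h g j))\<^sup>2
         \<le> (1 + real j) powr a * ((K * (1 + real j) powr (- a)) * (\<Sum>k\<le>j. ?Y (j - k) * ?X k))"
        by (rule mult_left_mono) simp
      also have "\<dots> = ((1 + real j) powr a * (1 + real j) powr (- a)) * (K * (\<Sum>k\<le>j. ?Y (j - k) * ?X k))"
        by (simp only: mult_ac)
      also have "(1 + real j) powr a * (1 + real j) powr (- a) = 1" by (simp flip: powr_add)
      finally show ?thesis by simp
    qed
    have "(\<Sum>j<R. (1 + real j) powr a * (cmod (cv h g j))\<^sup>2) \<le> (\<Sum>j<R. K * (\<Sum>k\<le>j. ?Y (j - k) * ?X k))"
      by (intro sum_mono CS)
    also have "\<dots> = K * (\<Sum>j<R. \<Sum>k\<le>j. ?Y (j - k) * ?X k)" by (simp only: sum_distrib_left)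
    also have "\<dots> \<le> K * (\<Sum>n<R. \<Sum>k<R. ?Y n * ?X k)"
      by (intro mult_left_mono triangle_le_rect[of "\<lambda>n k. ?Y n * ?X k"] K) auto
    also have "\<dots> = K * ((\<Sum>n<R. ?Y n) * (\<Sum>k<R. ?X k))" by (simp only: sum_product)
    also have "\<dots> \<le> K * ((wn b' g)\<^sup>2 * (wn b h)\<^sup>2)"
      by (intro mult_left_mono mult_mono wn_partial g h K sum_nonneg) auto
    finally show ?thesis using K by (simp add: power_mult_distrib mult_ac)
  qed
  then show "inW a (cv h g)" "wn a (cv h g) \<le> sqrt K * (wn b h * wn b' g)"
    using inWI[of a "cv h g" "sqrt K * (wn b h * wn b' g)"] K wn_nonneg[OF h] wn_nonneg[OF g] by auto
qed

lemma sum_inv_sqrt: "(\<Sum>k\<le>j. (1 + real k) powr (- (1/2))) \<le> 2 * sqrt (1 + real j)"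
proof -
  have p: "(1 + real k) powr (- (1/2)) = 1 / sqrt (1 + real k)" for k
    by (simp add: powr_minus_divide powr_half_sqrt)
  have "(\<Sum>k<n. 1 / sqrt (1 + real k)) \<le> 2 * sqrt (real n)" for n
  proof (induction n)
    case (Suc n)
    have "2 * (sqrt (real n) * sqrt (1 + real n)) + 1 \<le> 2 * (1 + real n)"
    proof -
      have "sqrt (real n) * sqrt (1 + real n) \<le> real n + 1/2"
        unfolding real_sqrt_mult[symmetric] by (rule real_le_lsqrt) (auto simp: power2_eq_square algebra_simps)
      then show ?thesis by simp
    qed
    then have "2 * sqrt (real n) + 1 / sqrt (1 + real n) \<le> 2 * sqrt (1 + real n)"
      by (simp add: field_simps)
    then show ?case using Suc by (simp add: add.commute)
  qed simp
  from this[of "Suc j"] show ?thesis unfolding p by (simp add: lessThan_Suc_atMost add.commute)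
qed

text \<open>One of k and j - k is at least j / 2, so one factor can be taken out. The constant is 4
  times 3/2, as (1 + j) / (1 + j / 2) < 2 <= (3/2)^2.\<close>

lemma sum_inv_sqrt2: "(\<Sum>k\<le>j. (1 + real k) powr (- (1/2)) * (1 + real (j - k)) powr (- (1/2))) \<le> 6"
proof -
  let ?a = "\<lambda>k. (1 + real k) powr (- (1/2))"
  let ?m = "(1 + real j / 2) powr (- (1/2))"
  have "?a k * ?a (j - k) \<le> ?m * (?a k + ?a (j - k))" if "k \<le> j" for k
  proof (cases "real j / 2 \<le> real k")
    case True
    then have "?a k \<le> ?m" by (intro powr_mono2') auto
    then have "?a k * ?a (j - k) \<le> ?m * ?a (j - k)" by (rule mult_right_mono) simp
    moreover have "0 \<le> ?m * ?a k" by simp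
    ultimately show ?thesis unfolding distrib_left by linarith
  next
    case False
    then have "?a (j - k) \<le> ?m" using that by (intro powr_mono2') (auto simp: of_nat_diff)
    then have "?a (j - k) * ?a k \<le> ?m * ?a k" by (rule mult_right_mono) simp
    moreover have "0 \<le> ?m * ?a (j - k)" by simp
    ultimately show ?thesis unfolding distrib_left using mult.commute[of "?a k" "?a (j - k)"] by linarith
  qed
  then have "(\<Sum>k\<le>j. ?a k * ?a (j - k)) \<le> (\<Sum>k\<le>j. ?m * (?a k + ?a (j - k)))"
    by (intro sum_mono) auto
  also have "\<dots> = ?m * ((\<Sum>k\<le>j. ?a k) + (\<Sum>k\<le>j. ?a (j - k)))"
    by (simp only: sum_distrib_left[symmetric] sum.distrib)
  also have "(\<Sum>k\<le>j. ?a (j - k)) = (\<Sum>k\<le>j. ?a k)"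
    by (rule sum.reindex_bij_witness[of _ "\<lambda>k. j - k" "\<lambda>k. j - k"]) auto
  also have "?m * ((\<Sum>k\<le>j. ?a k) + (\<Sum>k\<le>j. ?a k)) \<le> ?m * (2 * sqrt (1 + real j) + 2 * sqrt (1 + real j))"
    by (intro mult_left_mono add_mono sum_inv_sqrt) auto
  also have "\<dots> = 4 * sqrt ((1 + real j) / (1 + real j / 2))"
    by (simp add: powr_minus_divide powr_half_sqrt real_sqrt_divide)
  also have "\<dots> \<le> 4 * sqrt ((3/2)\<^sup>2)"
    by (intro mult_left_mono real_sqrt_le_mono) (auto simp: field_simps power2_eq_square)
  also have "\<dots> = 6" by simp
  finally show ?thesis .
qed

text \<open>H_u preserves H^{1/4} for u in H^{1/2}; this keeps all vectors H_u^q(1) in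
  H^{1/4}.\<close>

lemma Hank_half:
  assumes "inW 1 u" "inW (1/2) h"
  shows "inW (1/2) (Hank u h)" "wn (1/2) (Hank u h) \<le> sqrt 2 * (wn 1 u * wn (1/2) h)"
proof -
  have wt: "(\<Sum>k\<le>j. (1 + real (j - k)) powr (1/2) * (1 + real k) powr (- (1/2))) \<le> 2 * (1 + real j) powr 1" for j
  proof -
    have "(\<Sum>k\<le>j. (1 + real (j - k)) powr (1/2) * (1 + real k) powr (- (1/2)))
      \<le> (\<Sum>k\<le>j. sqrt (1 + real j) * (1 + real k) powr (- (1/2)))"
      by (intro sum_mono mult_right_mono) (auto simp: powr_half_sqrt)
    also have "\<dots> \<le> sqrt (1 + real j) * (2 * sqrt (1 + real j))"
      unfolding sum_distrib_left[symmetric] by (intro mult_left_mono sum_inv_sqrt) auto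
    also have "\<dots> = 2 * (sqrt (1 + real j) * sqrt (1 + real j))" by (simp only: mult_ac)
    also have "\<dots> = 2 * (1 + real j) powr 1" by simp
    finally show ?thesis .
  qed
  show "inW (1/2) (Hank u h)" "wn (1/2) (Hank u h) \<le> sqrt 2 * (wn 1 u * wn (1/2) h)"
    by (rule Hank_weighted[OF assms inW_10[OF assms(1)] inW_mono[OF assms(2)] _ wt]; simp)+
qed

text \<open>The product estimate H^{1/4} times H^{1/4} into L^2.\<close>

lemma cv_half:
  assumes "inW (1/2) h" "inW (1/2) g"
  shows "inW 0 (cv h g)" "wn 0 (cv h g) \<le> sqrt 6 * (wn (1/2) h * wn (1/2) g)"
proof -
  have wt: "(\<Sum>k\<le>j. (1 + real k) powr (- (1/2)) * (1 + real (j - k)) powr (- (1/2))) \<le> 6 * (1 + real j) powr (- 0)" for j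
    using sum_inv_sqrt2[of j] by simp
  show "inW 0 (cv h g)" "wn 0 (cv h g) \<le> sqrt 6 * (wn (1/2) h * wn (1/2) g)"
    by (rule cv_weighted[OF assms _ wt]; simp)+
qed

text \<open>The product estimate H^{1/2} times H^{1/2} into H^{1/4}, obtained from
  \<open>sum_inv_sqrt2\<close> because (1 + k)(1 + j - k) >= 1 + j.\<close>

lemma cv_one:
  assumes "inW 1 h" "inW 1 g"
  shows "inW (1/2) (cv h g)" "wn (1/2) (cv h g) \<le> sqrt 6 * (wn 1 h * wn 1 g)"
proof -
  have wt: "(\<Sum>k\<le>j. (1 + real k) powr (- 1) * (1 + real (j - k)) powr (- 1)) \<le> 6 * (1 + real j) powr (- (1/2))" for j
  proof -
    have "(1 + real k) powr (- 1) * (1 + real (j - k)) powr (- 1) \<le>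
       (1 + real j) powr (- (1/2)) * ((1 + real k) powr (- (1/2)) * (1 + real (j - k)) powr (- (1/2)))"
      if "k \<le> j" for k
    proof -
      have e: "z powr (- 1) = z powr (- (1/2)) * z powr (- (1/2))" if "0 < z" for z :: real
        using that by (simp flip: powr_add)
      have "1 + real j \<le> (1 + real k) * (1 + real (j - k))"
        using that by (simp add: of_nat_diff algebra_simps mult_right_mono)
      then have "((1 + real k) * (1 + real (j - k))) powr (- (1/2)) \<le> (1 + real j) powr (- (1/2))"
        by (intro powr_mono2') auto
      then have "((1 + real k) powr (- (1/2)) * (1 + real (j - k)) powr (- (1/2))) *
          ((1 + real k) powr (- (1/2)) * (1 + real (j - k)) powr (- (1/2)))
        \<le> (1 + real j) powr (- (1/2)) * ((1 + real k) powr (- (1/2)) * (1 + real (j - k)) powr (- (1/2)))"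
        by (intro mult_right_mono) (auto simp: powr_mult)
      then show ?thesis by (simp only: e mult_ac)
    qed
    then have "(\<Sum>k\<le>j. (1 + real k) powr (- 1) * (1 + real (j - k)) powr (- 1)) \<le>
      (\<Sum>k\<le>j. (1 + real j) powr (- (1/2)) * ((1 + real k) powr (- (1/2)) * (1 + real (j - k)) powr (- (1/2))))"
      by (intro sum_mono) auto
    also have "\<dots> \<le> (1 + real j) powr (- (1/2)) * 6"
      unfolding sum_distrib_left[symmetric] by (intro mult_left_mono sum_inv_sqrt2) auto
    finally show ?thesis by simp
  qed
  show "inW (1/2) (cv h g)" "wn (1/2) (cv h g) \<le> sqrt 6 * (wn 1 h * wn 1 g)"
    by (rule cv_weighted[OF assms _ wt]; simp)+
qed

text \<open>The estimate needed for the symbol u^2, which is only known to be in H^{1/4}, applied to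
  u in H^{1/2}.\<close>

lemma Hank_low:
  assumes "inW (1/2) s" "inW 1 h"
  shows "inW 0 (Hank s h)" "wn 0 (Hank s h) \<le> sqrt 2 * (wn (1/2) s * wn 1 h)"
proof -
  have wt: "(\<Sum>k\<le>j. (1 + real (j - k)) powr 0 * (1 + real k) powr (- 1)) \<le> 2 * (1 + real j) powr (1/2)" for j
  proof -
    have "(\<Sum>k\<le>j. (1 + real (j - k)) powr 0 * (1 + real k) powr (- 1)) \<le> (\<Sum>k\<le>j. (1 + real k) powr (- (1/2)))"
    proof (rule sum_mono)
      fix k
      show "(1 + real (j - k)) powr 0 * (1 + real k) powr (- 1) \<le> (1 + real k) powr (- (1/2))"
        using powr_mono[of "- 1" "- (1/2)" "1 + real k"] by simp
    qed
    also have "\<dots> \<le> 2 * sqrt (1 + real j)" by (rule sum_inv_sqrt)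
    finally show ?thesis by (simp add: powr_half_sqrt)
  qed
  show "inW 0 (Hank s h)" "wn 0 (Hank s h) \<le> sqrt 2 * (wn (1/2) s * wn 1 h)"
    by (rule Hank_weighted[OF assms inW_mono[OF assms(1)] inW_mono[OF assms(2)] _ wt]; simp)+
qed

lemma inW_abs: "inW s (\<lambda>k. complex_of_real (cmod (f k))) \<longleftrightarrow> inW s f"
  by (simp add: inW_def)

lemma Hank_summable_low:
  assumes "inW (1/2) s" "inW 1 h"
  shows "summable (\<lambda>k. norm (s (n + k) * cnj (h k)))"
  using ip_summable_norm[OF inW_sh[of s n] , of h] assms inW_mono[of "1/2" s 0] inW_10
  by (simp add: sh_def)

lemma infsum_finite_fibers:
  fixes f :: "'a \<times> 'b \<Rightarrow> complex"
  assumes fin: "\<And>x. x \<in> A \<Longrightarrow> finite (B x)"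
    and summ: "(\<lambda>x. \<Sum>y\<in>B x. norm (f (x, y))) summable_on A"
  shows "(\<lambda>z. norm (f z)) summable_on Sigma A B"
    and "infsum f (Sigma A B) = (\<Sum>\<^sub>\<infinity>x\<in>A. \<Sum>y\<in>B x. f (x, y))"
proof -
  have "(\<lambda>x. infsum (\<lambda>y. norm (f (x,y))) (B x)) summable_on A"
    by (rule summable_on_cong[THEN iffD1, OF _ summ]) (simp add: fin)
  then have "(\<lambda>x. norm (infsum (\<lambda>y. norm (f (x,y))) (B x))) summable_on A"
    by (rule summable_on_cong[THEN iffD1, rotated]) (simp add: infsum_nonneg)
  then show s: "(\<lambda>z. norm (f z)) summable_on Sigma A B"
    using fin unfolding Infinite_Sum.abs_summable_on_Sigma_iff by (auto intro: summable_on_finite)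
  have "infsum f (Sigma A B) = (\<Sum>\<^sub>\<infinity>x\<in>A. infsum (\<lambda>y. f (x,y)) (B x))"
    by (rule infsum_Sigma_banach[symmetric, OF abs_summable_summable[OF s]])
  also have "\<dots> = (\<Sum>\<^sub>\<infinity>x\<in>A. \<Sum>y\<in>B x. f (x, y))"
    by (rule infsum_cong) (simp add: fin)
  finally show "infsum f (Sigma A B) = (\<Sum>\<^sub>\<infinity>x\<in>A. \<Sum>y\<in>B x. f (x, y))" .
qed

lemma summable_on_Sigma_infsum:
  fixes f :: "'a \<times> 'b \<Rightarrow> complex"
  assumes "f summable_on Sigma A B"
  shows "(\<lambda>x. infsum (\<lambda>y. f (x, y)) (B x)) summable_on A"
  by (rule summable_on_Sigma_banach) (use assms in simp)

lemma nat_add_eq_iff: "k + m = l + n + p \<longleftrightarrow> m = n + p + l - k \<and> k \<le> n + p + (l::nat)"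
  by auto

lemma nat_add_eq_iff2: "k + m = l + n \<longleftrightarrow> m = n + l - k \<and> k \<le> n + (l::nat)"
  by auto

text \<open>The identity (H_f h | g) = (f | h g), by summation along antidiagonals. It makes H_f h
  linear in the symbol f, tested against an L^2 function.\<close>

lemma ip_Hank_cv:
  assumes f: "inW 1 f" and h: "inW (1/2) h" and g: "inW (1/2) g"
  shows "ip (Hank f h) g = ip f (cv h g)"
proof -
  have f0: "inW 0 f" and h0: "inW 0 h" and g0: "inW 0 g"
    using inW_10[OF f] inW_mono[OF h] inW_mono[OF g] by auto
  let ?t = "\<lambda>(n,k). f (n+k) * cnj (h k) * cnj (g n)"
  let ?s = "\<lambda>(j,k). f j * cnj (h k) * cnj (g (j - k))"
  have "?t summable_on UNIV" by (rule abs_summable_summable[OF Hank_abs_summable[OF f h0 g0]])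
  then have s: "?s summable_on (SIGMA j:UNIV. {..j})"
    by (rule summable_on_reindex_bij_witness[of _ "\<lambda>(j,k). (j - k, k)" "\<lambda>(n,k). (n + k, k)", THEN iffD1, rotated -1]) auto
  have "ip (Hank f h) g = infsum ?t UNIV" by (rule ip_Hank_infsum[OF f h0 g0])
  also have "\<dots> = infsum ?s (SIGMA j:UNIV. {..j})"
    by (rule infsum_reindex_bij_witness[of _ "\<lambda>(j,k). (j - k, k)" "\<lambda>(n,k). (n + k, k)"]) auto
  also have "\<dots> = (\<Sum>\<^sub>\<infinity>j. infsum (\<lambda>k. ?s (j,k)) {..j})"
    by (rule infsum_Sigma_banach[symmetric, OF s])
  also have "\<dots> = (\<Sum>\<^sub>\<infinity>j. f j * cnj (cv h g j))"
    by (rule infsum_cong) (simp add: cv_def sum_distrib_left mult.assoc)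
  also have "\<dots> = ip f (cv h g)" by (rule ip_infsum[symmetric, OF f0 cv_half(1)[OF h g]])
  finally show ?thesis .
qed

text \<open>Absolute convergence is obtained by applying \<open>Hank_low\<close> to the sequences of
  absolute values, whose norms are unchanged.\<close>

lemma pair_low:
  assumes s: "inW (1/2) s" and h: "inW 1 h" and c: "inW 0 c"
  shows "(\<lambda>x. norm (case x of (n,k) \<Rightarrow> s (n+k) * cnj (h k) * cnj (c n))) summable_on UNIV"
    and "ip (Hank s h) c = (\<Sum>\<^sub>\<infinity>(n,k). s (n+k) * cnj (h k) * cnj (c n))"
proof -
  let ?s = "\<lambda>k. complex_of_real (cmod (s k))" and ?h = "\<lambda>k. complex_of_real (cmod (h k))"
  have s0: "inW 0 s" and h0: "inW 0 h" using inW_mono[OF s] inW_10[OF h] by auto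
  have H: "inW 0 (Hank ?s ?h)" by (rule Hank_low) (use s h inW_abs in auto)
  have Hn: "cmod (Hank ?s ?h n) = (\<Sum>k. cmod (s (n+k)) * cmod (h k))"
    and Hs: "summable (\<lambda>k. cmod (s (n+k)) * cmod (h k))" for n
  proof -
    show sm: "summable (\<lambda>k. cmod (s (n+k)) * cmod (h k))"
      using Hank_summable_low[OF s h, of n] by (simp add: norm_mult)
    have "Hank ?s ?h n = complex_of_real (\<Sum>k. cmod (s (n+k)) * cmod (h k))"
      unfolding Hank_def using suminf_of_real[OF sm, where 'a=complex] by simp
    then show "cmod (Hank ?s ?h n) = (\<Sum>k. cmod (s (n+k)) * cmod (h k))"
      using suminf_nonneg[OF sm] by simp
  qed
  show a: "(\<lambda>x. norm (case x of (n,k) \<Rightarrow> s (n+k) * cnj (h k) * cnj (c n))) summable_on UNIV"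
  proof (rule abs_summable_natI)
    fix R K
    have "(\<Sum>n<R. \<Sum>k<K. norm (case (n,k) of (n,k) \<Rightarrow> s (n+k) * cnj (h k) * cnj (c n)))
        = (\<Sum>n<R. (\<Sum>k<K. cmod (s (n+k)) * cmod (h k)) * cmod (c n))"
      by (simp add: norm_mult sum_distrib_right)
    also have "\<dots> \<le> (\<Sum>n<R. cmod (Hank ?s ?h n) * cmod (c n))"
      unfolding Hn by (intro sum_mono mult_right_mono sum_le_suminf Hs) auto
    also have "\<dots> \<le> wn 0 (Hank ?s ?h) * wn 0 c" by (rule CS_fin[OF H c]) simp
    finally show "(\<Sum>n<R. \<Sum>k<K. norm (case (n,k) of (n,k) \<Rightarrow> s (n+k) * cnj (h k) * cnj (c n)))
      \<le> wn 0 (Hank ?s ?h) * wn 0 c" .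
  qed
  have "ip (Hank s h) c = (\<Sum>\<^sub>\<infinity>n. Hank s h n * cnj (c n))"
    by (rule ip_infsum[OF Hank_low(1)[OF s h] c])
  also have "\<dots> = (\<Sum>\<^sub>\<infinity>n. \<Sum>\<^sub>\<infinity>k. s (n+k) * cnj (h k) * cnj (c n))"
  proof (rule infsum_cong)
    fix n
    have "Hank s h n = (\<Sum>\<^sub>\<infinity>k. s (n+k) * cnj (h k))"
      unfolding Hank_ip ip_infsum[OF inW_sh[OF s0] h0] by (simp add: sh_def)
    then show "Hank s h n * cnj (c n) = (\<Sum>\<^sub>\<infinity>k. s (n+k) * cnj (h k) * cnj (c n))"
      by (simp add: infsum_cmult_left')
  qed
  also have "\<dots> = (\<Sum>\<^sub>\<infinity>(n,k)\<in>UNIV \<times> UNIV. s (n+k) * cnj (h k) * cnj (c n))"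
    by (rule infsum_Sigma'_banach) (use abs_summable_summable[OF a] in simp)
  finally show "ip (Hank s h) c = (\<Sum>\<^sub>\<infinity>(n,k). s (n+k) * cnj (h k) * cnj (c n))" by simp
qed

text \<open>|u|^2 u is u^2 times the conjugate of u, so its projection is H_{u^2}(u); the triple sum
  is grouped by n + l = k + m.\<close>

lemma cubic_Hank:
  assumes u: "inW 1 u"
  shows "cubic u = Hank (cv u u) u"
proof
  fix n
  let ?f = "\<lambda>(l,k). u k * cnj (u l) * u (n + l - k)"
  let ?a = "\<lambda>k. complex_of_real (cmod (u k))"
  have a1: "inW 1 ?a" using u inW_abs by auto
  have ab: "(\<Sum>k\<le>n+l. norm (?f (l,k))) = norm (cv ?a ?a (n+l) * cnj (?a l))" for l
  proof -
    have "cv ?a ?a (n+l) = complex_of_real (\<Sum>k\<le>n+l. cmod (u k) * cmod (u (n+l-k)))" by (simp add: cv_def)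
    then have "norm (cv ?a ?a (n+l)) = (\<Sum>k\<le>n+l. cmod (u k) * cmod (u (n+l-k)))"
      by (simp add: sum_nonneg del: of_real_sum)
    then show ?thesis by (simp add: norm_mult sum_distrib_left sum_distrib_right mult_ac)
  qed
  have "summable (\<lambda>l. norm (cv ?a ?a (n+l) * cnj (?a l)))"
    by (rule Hank_summable_low[OF cv_one(1)[OF a1 a1] a1])
  then have "(\<lambda>l. norm (cv ?a ?a (n+l) * cnj (?a l))) summable_on UNIV"
    by (intro norm_summable_imp_summable_on) simp
  then have sm: "(\<lambda>l. \<Sum>k\<in>{..n+l}. norm (?f (l,k))) summable_on UNIV" unfolding ab .
  have "cubic u n = infsum ?f (SIGMA l:UNIV. {..n+l})"
    unfolding cubic_def
    by (rule infsum_reindex_bij_witness[of _ "\<lambda>(l,k). (k,l,n+l-k)" "\<lambda>(k,l,m). (l,k)"])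
      (auto simp: nat_add_eq_iff2)
  also have "\<dots> = (\<Sum>\<^sub>\<infinity>l. \<Sum>k\<in>{..n+l}. ?f (l,k))"
    by (rule infsum_finite_fibers(2)[OF _ sm]) simp
  also have "\<dots> = (\<Sum>\<^sub>\<infinity>l. cv u u (n+l) * cnj (u l))"
    by (rule infsum_cong) (simp add: cv_def sum_distrib_right sum_distrib_left mult_ac)
  also have "\<dots> = Hank (cv u u) u n"
    unfolding Hank_def
    by (rule suminf_eq_infsum[symmetric, OF Hank_summable_low[OF cv_one(1)[OF u u] u]])
  finally show "cubic u n = Hank (cv u u) u n" .
qed

lemma cubic_bound:
  assumes u: "inW 1 u"
  shows "inW 0 (cubic u)" "wn 0 (cubic u) \<le> 4 * (wn 1 u) ^ 3"
proof -
  show "inW 0 (cubic u)" unfolding cubic_Hank[OF u] by (rule Hank_low(1)[OF cv_one(1)[OF u u] u])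
  have n: "0 \<le> wn 1 u" by (rule wn_nonneg[OF u])
  have "wn 0 (cubic u) \<le> sqrt 2 * (wn (1/2) (cv u u) * wn 1 u)"
    unfolding cubic_Hank[OF u] by (rule Hank_low(2)[OF cv_one(1)[OF u u] u])
  also have "\<dots> \<le> sqrt 2 * ((sqrt 6 * (wn 1 u * wn 1 u)) * wn 1 u)"
    by (intro mult_left_mono mult_right_mono cv_one(2)[OF u u] n) auto
  also have "\<dots> = sqrt 12 * (wn 1 u) ^ 3"
    by (simp add: power3_eq_cube mult_ac flip: real_sqrt_mult)
  also have "\<dots> \<le> 4 * (wn 1 u) ^ 3"
    by (intro mult_right_mono real_le_lsqrt) (use n in auto)
  finally show "wn 0 (cubic u) \<le> 4 * (wn 1 u) ^ 3" .
qed

section \<open>The quintilinear sum behind the Lax identity\<close>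

definition qt :: "(nat \<Rightarrow> complex) \<Rightarrow> (nat \<Rightarrow> complex) \<Rightarrow> (nat \<Rightarrow> complex) \<Rightarrow> nat \<times> nat \<times> nat \<times> nat \<times> nat \<Rightarrow> complex" where
  "qt u h g = (\<lambda>(k,l,m,n,p). u k * cnj (u l) * u m * cnj (h p) * cnj (g n))"

text \<open>Grouping by j = n + p and l leaves finite fibres and recovers H_{u^2}(u) paired with h
  g. Absolute convergence over the whole index set permits all later restrictions and
  rearrangements.\<close>

lemma qt_total:
  assumes u: "inW 1 u" and h: "inW (1/2) h" and g: "inW (1/2) g"
  shows "(\<lambda>z. norm (qt u h g z)) summable_on {(k,l,m,n,p). k + m = l + n + p}"
    and "infsum (qt u h g) {(k,l,m,n,p). k + m = l + n + p} = ip (cubic u) (cv h g)"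
proof -
  let ?S = "{(k,l,m,n,p). k + m = l + n + p} :: (nat \<times> nat \<times> nat \<times> nat \<times> nat) set"
  let ?B = "\<lambda>(j,l). {..j+l} \<times> {..j} :: (nat \<times> nat) set"
  let ?f = "\<lambda>((j,l),(k,p)). u k * cnj (u l) * u (j + l - k) * cnj (h p) * cnj (g (j - p))"
  let ?i = "\<lambda>((j,l),(k,p)). (k, l, j + l - k, j - p, p)"
  let ?j = "\<lambda>(k,l,m,n,p). ((n + p, l), (k, p))"
  let ?a = "\<lambda>f k. complex_of_real (cmod (f k :: complex))"
  have ab: "inW 1 (?a u)" "inW (1/2) (?a h)" "inW (1/2) (?a g)" using u h g inW_abs by auto
  have cvabs: "norm (cv (?a f) (?a f') j) = (\<Sum>k\<le>j. cmod (f k) * cmod (f' (j - k)))" for f f' :: "nat \<Rightarrow> complex" and j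
  proof -
    have "cv (?a f) (?a f') j = complex_of_real (\<Sum>k\<le>j. cmod (f k) * cmod (f' (j-k)))" by (simp add: cv_def)
    then show ?thesis by (simp add: sum_nonneg del: of_real_sum)
  qed
  have sumB: "(\<Sum>y\<in>?B (j,l). f (fst y) (snd y)) = (\<Sum>k\<le>j+l. \<Sum>p\<le>j. f k p)" for f :: "nat \<Rightarrow> nat \<Rightarrow> 'z::comm_monoid_add" and j l
    by (simp add: sum.cartesian_product case_prod_unfold)
  have ns: "(\<Sum>y\<in>?B x. norm (?f (x,y)))
      = norm (case x of (n,k) \<Rightarrow> cv (?a u) (?a u) (n+k) * cnj (?a u k) * cnj (cv (?a h) (?a g) n))" for x
  proof (cases x)
    case (Pair j l)
    have "(\<Sum>y\<in>?B (j,l). norm (?f ((j,l),y)))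
      = (\<Sum>k\<le>j+l. \<Sum>p\<le>j. (cmod (u k) * cmod (u (j + l - k))) * cmod (u l) * (cmod (h p) * cmod (g (j - p))))"
      using sumB[of "\<lambda>k p. (cmod (u k) * cmod (u (j + l - k))) * cmod (u l) * (cmod (h p) * cmod (g (j - p)))" j l]
      by (simp add: case_prod_unfold norm_mult mult_ac)
    also have "\<dots> = (\<Sum>k\<le>j+l. cmod (u k) * cmod (u (j + l - k))) * cmod (u l) * (\<Sum>p\<le>j. cmod (h p) * cmod (g (j - p)))"
      by (simp only: sum_product[symmetric] sum_distrib_right[symmetric])
    finally show ?thesis unfolding Pair by (simp only: prod.case norm_mult cvabs complex_mod_cnj norm_of_real abs_norm_cancel)
  qed
  have "(\<lambda>x. norm (case x of (n,k) \<Rightarrow> cv (?a u) (?a u) (n+k) * cnj (?a u k) * cnj (cv (?a h) (?a g) n))) summable_on UNIV"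
    by (rule pair_low(1)[OF cv_one(1)[OF ab(1,1)] ab(1) cv_half(1)[OF ab(2,3)]])
  then have sm: "(\<lambda>x. \<Sum>y\<in>?B x. norm (?f (x,y))) summable_on UNIV" unfolding ns .
  have fin: "finite (?B x)" for x by (cases x) simp
  have fs: "(\<lambda>z. norm (?f z)) summable_on Sigma UNIV ?B"
    by (rule infsum_finite_fibers(1)[OF fin sm])
  show "(\<lambda>z. norm (qt u h g z)) summable_on ?S"
    using fs
    by (rule summable_on_reindex_bij_witness[of _ ?j ?i, THEN iffD1, rotated -1]) (auto simp: qt_def nat_add_eq_iff)
  have "infsum (qt u h g) ?S = infsum ?f (Sigma UNIV ?B)"
    by (rule infsum_reindex_bij_witness[of _ ?i ?j]) (auto simp: qt_def nat_add_eq_iff)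
  also have "\<dots> = (\<Sum>\<^sub>\<infinity>x. \<Sum>y\<in>?B x. ?f (x,y))"
    by (rule infsum_finite_fibers(2)[OF fin sm])
  also have "\<dots> = (\<Sum>\<^sub>\<infinity>(j,l). cv u u (j+l) * cnj (u l) * cnj (cv h g j))"
  proof (rule infsum_cong)
    fix x :: "nat \<times> nat"
    obtain j l where x: "x = (j,l)" by (cases x)
    have "(\<Sum>y\<in>?B (j,l). ?f ((j,l),y))
      = (\<Sum>k\<le>j+l. \<Sum>p\<le>j. (u k * u (j + l - k)) * cnj (u l) * (cnj (h p) * cnj (g (j - p))))"
      using sumB[of "\<lambda>k p. (u k * u (j + l - k)) * cnj (u l) * (cnj (h p) * cnj (g (j - p)))" j l]
      by (simp add: case_prod_unfold mult_ac)
    also have "\<dots> = (\<Sum>k\<le>j+l. u k * u (j + l - k)) * cnj (u l) * (\<Sum>p\<le>j. cnj (h p) * cnj (g (j - p)))"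
      by (simp only: sum_product[symmetric] sum_distrib_right[symmetric])
    finally show "(\<Sum>y\<in>?B x. ?f (x,y)) = (case x of (j,l) \<Rightarrow> cv u u (j+l) * cnj (u l) * cnj (cv h g j))"
      unfolding x by (simp add: cv_def)
  qed
  also have "\<dots> = ip (cubic u) (cv h g)"
    unfolding cubic_Hank[OF u] by (rule pair_low(2)[symmetric, OF cv_one(1)[OF u u] u cv_half(1)[OF h g]])
  finally show "infsum (qt u h g) ?S = ip (cubic u) (cv h g)" .
qed

lemma Hank_infsum:
  assumes "inW 1 u" "inW 0 h"
  shows "Hank u h n = (\<Sum>\<^sub>\<infinity>k. u (n+k) * cnj (h k))"
  unfolding Hank_ip ip_infsum[OF inW_sh[OF inW_10[OF assms(1)]] assms(2)] by (simp add: sh_def)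

text \<open>For p <= m the constraint reads k + (m - p) = l + n = i. Summing over p creates (H_u
  h)(i - k), and the two remaining finite sums are the products u (H_u h) and u g.\<close>

lemma qt_part:
  assumes u: "inW 1 u" and h: "inW (1/2) h" and g: "inW (1/2) g"
  shows "infsum (qt u h g) {(k,l,m,n,p). k + m = l + n + p \<and> p \<le> m} = ip (cv u (Hank u h)) (cv u g)"
proof -
  let ?S = "{(k,l,m,n,p). k + m = l + n + p \<and> p \<le> m} :: (nat \<times> nat \<times> nat \<times> nat \<times> nat) set"
  let ?F = "\<lambda>i. {..i} \<times> {..i} :: (nat \<times> nat) set"
  let ?f = "\<lambda>((i,(k,l)),p). u k * cnj (u l) * u (i - k + p) * cnj (h p) * cnj (g (i - l))"
  let ?i = "\<lambda>((i,(k,l)),p). (k, l, i - k + p, i - l, p)"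
  let ?j = "\<lambda>(k,l,m,n,p). ((l + n, (k, l)), p)"
  have uh: "inW (1/2) u" by (rule inW_mono[OF u]) simp
  have h0: "inW 0 h" by (rule inW_mono[OF h]) simp
  have Hh: "inW (1/2) (Hank u h)" by (rule Hank_half(1)[OF u h])
  have "(\<lambda>z. norm (qt u h g z)) summable_on ?S"
    by (rule summable_on_subset_banach[OF qt_total(1)[OF u h g]]) auto
  then have qs: "qt u h g summable_on ?S" by (rule abs_summable_summable)
  then have fs: "?f summable_on (Sigma UNIV ?F) \<times> UNIV"
    by (rule summable_on_reindex_bij_witness[of _ ?i ?j, THEN iffD1, rotated -1]) (auto simp: qt_def nat_add_eq_iff; simp add: add_ac)+
  have "infsum (qt u h g) ?S = infsum ?f ((Sigma UNIV ?F) \<times> UNIV)"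
    by (rule infsum_reindex_bij_witness[of _ ?i ?j]) (auto simp: qt_def nat_add_eq_iff; simp add: add_ac)+
  also have "\<dots> = (\<Sum>\<^sub>\<infinity>x\<in>Sigma UNIV ?F. \<Sum>\<^sub>\<infinity>p. ?f (x,p))"
    by (rule infsum_Sigma_banach[symmetric, OF fs])
  also have "\<dots> = (\<Sum>\<^sub>\<infinity>i. \<Sum>\<^sub>\<infinity>y\<in>?F i. \<Sum>\<^sub>\<infinity>p. ?f ((i,y),p))"
    by (rule infsum_Sigma_banach[symmetric]) (rule summable_on_Sigma_infsum[OF fs])
  also have "\<dots> = (\<Sum>\<^sub>\<infinity>i. cv u (Hank u h) i * cnj (cv u g i))"
  proof (rule infsum_cong)
    fix i
    have "(\<Sum>\<^sub>\<infinity>p. ?f ((i,(k,l)),p)) = (u k * Hank u h (i - k)) * (cnj (u l) * cnj (g (i - l)))" for k l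
    proof -
      have "(\<Sum>\<^sub>\<infinity>p. ?f ((i,(k,l)),p)) = (\<Sum>\<^sub>\<infinity>p. (u k * cnj (u l) * cnj (g (i - l))) * (u (i - k + p) * cnj (h p)))"
        by (rule infsum_cong) (simp add: mult_ac)
      also have "\<dots> = (u k * cnj (u l) * cnj (g (i - l))) * Hank u h (i - k)"
        unfolding Hank_infsum[OF u h0] by (rule infsum_cmult_right')
      finally show ?thesis by (simp add: mult_ac)
    qed
    then have "(\<Sum>\<^sub>\<infinity>y\<in>?F i. \<Sum>\<^sub>\<infinity>p. ?f ((i,y),p))
       = (\<Sum>(k,l)\<in>?F i. (u k * Hank u h (i - k)) * (cnj (u l) * cnj (g (i - l))))"
      by (subst infsum_finite) (auto intro!: sum.cong)
    also have "\<dots> = (\<Sum>k\<le>i. u k * Hank u h (i - k)) * (\<Sum>l\<le>i. cnj (u l) * cnj (g (i - l)))"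
      by (simp add: sum_product sum.cartesian_product)
    finally show "(\<Sum>\<^sub>\<infinity>y\<in>?F i. \<Sum>\<^sub>\<infinity>p. ?f ((i,y),p)) = cv u (Hank u h) i * cnj (cv u g i)"
      by (simp add: cv_def)
  qed
  also have "\<dots> = ip (cv u (Hank u h)) (cv u g)"
    by (rule ip_infsum[symmetric, OF cv_half(1)[OF uh Hh] cv_half(1)[OF uh g]])
  finally show ?thesis .
qed

text \<open>With a = k - n and b = m - p the constraint becomes l = a + b. The sums over p and n
  create (H_u h)(b) and (H_u g)(a), coupled by the conjugate of u(a + b).\<close>

lemma qt_both:
  assumes u: "inW 1 u" and h: "inW (1/2) h" and g: "inW (1/2) g"
  shows "infsum (qt u h g) {(k,l,m,n,p). k + m = l + n + p \<and> p \<le> m \<and> n \<le> k}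
    = ip (Hank u (Hank u (Hank u h))) g"
proof -
  let ?S = "{(k,l,m,n,p). k + m = l + n + p \<and> p \<le> m \<and> n \<le> k} :: (nat \<times> nat \<times> nat \<times> nat \<times> nat) set"
  let ?f = "\<lambda>(((a,b),p),n). u (a + n) * cnj (u (a + b)) * u (b + p) * cnj (h p) * cnj (g n)"
  let ?i = "\<lambda>(((a,b),p),n). (a + n, a + b, b + p, n, p)"
  let ?j = "\<lambda>(k,l,m,n,p). (((k - n, m - p), p), n)"
  have h0: "inW 0 h" and g0: "inW 0 g" using inW_mono[OF h] inW_mono[OF g] by auto
  have Hh: "inW 0 (Hank u h)" and Hg: "inW 0 (Hank u g)" using Hank_bound(1)[OF u] h0 g0 by auto
  have "(\<lambda>z. norm (qt u h g z)) summable_on ?S"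
    by (rule summable_on_subset_banach[OF qt_total(1)[OF u h g]]) auto
  then have qs: "qt u h g summable_on ?S" by (rule abs_summable_summable)
  then have fs: "?f summable_on (UNIV \<times> UNIV) \<times> UNIV"
    by (rule summable_on_reindex_bij_witness[of _ ?i ?j, THEN iffD1, rotated -1]) (auto simp: qt_def nat_add_eq_iff; simp add: add_ac)+
  have "infsum (qt u h g) ?S = infsum ?f ((UNIV \<times> UNIV) \<times> UNIV)"
    by (rule infsum_reindex_bij_witness[of _ ?i ?j]) (auto simp: qt_def nat_add_eq_iff; simp add: add_ac)+
  also have "\<dots> = (\<Sum>\<^sub>\<infinity>x\<in>UNIV \<times> UNIV. \<Sum>\<^sub>\<infinity>n. ?f (x,n))"
    by (rule infsum_Sigma_banach[symmetric, OF fs])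
  also have "\<dots> = (\<Sum>\<^sub>\<infinity>x. \<Sum>\<^sub>\<infinity>p. \<Sum>\<^sub>\<infinity>n. ?f ((x,p),n))"
    by (rule infsum_Sigma_banach[symmetric]) (rule summable_on_Sigma_infsum[OF fs])
  also have "\<dots> = (\<Sum>\<^sub>\<infinity>x. cnj (case x of (a,b) \<Rightarrow> u (a + b) * cnj (Hank u h b) * cnj (Hank u g a)))"
  proof (rule infsum_cong)
    fix x :: "nat \<times> nat"
    obtain a b where x: "x = (a,b)" by (cases x)
    have "(\<Sum>\<^sub>\<infinity>n. ?f (((a,b),p),n)) = (cnj (u (a + b)) * Hank u g a) * (u (b + p) * cnj (h p))" for p
    proof -
      have "(\<Sum>\<^sub>\<infinity>n. ?f (((a,b),p),n)) = (\<Sum>\<^sub>\<infinity>n. (cnj (u (a + b)) * (u (b + p) * cnj (h p))) * (u (a + n) * cnj (g n)))"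
        by (rule infsum_cong) (simp add: mult_ac)
      also have "\<dots> = (cnj (u (a + b)) * (u (b + p) * cnj (h p))) * Hank u g a"
        unfolding Hank_infsum[OF u g0] by (rule infsum_cmult_right')
      finally show ?thesis by (simp add: mult_ac)
    qed
    then have "(\<Sum>\<^sub>\<infinity>p. \<Sum>\<^sub>\<infinity>n. ?f (((a,b),p),n)) = (\<Sum>\<^sub>\<infinity>p. (cnj (u (a + b)) * Hank u g a) * (u (b + p) * cnj (h p)))"
      by simp
    also have "\<dots> = (cnj (u (a + b)) * Hank u g a) * Hank u h b"
      unfolding Hank_infsum[OF u h0] by (rule infsum_cmult_right')
    finally show "(\<Sum>\<^sub>\<infinity>p. \<Sum>\<^sub>\<infinity>n. ?f ((x,p),n)) = cnj (case x of (a,b) \<Rightarrow> u (a + b) * cnj (Hank u h b) * cnj (Hank u g a))"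
      unfolding x by (simp add: mult_ac)
  qed
  also have "\<dots> = cnj (ip (Hank u (Hank u h)) (Hank u g))"
    unfolding infsum_cnj ip_Hank_infsum[OF u Hh Hg] ..
  also have "\<dots> = ip (Hank u g) (Hank u (Hank u h))"
    by (rule ip_cnj[OF Hank_bound(1)[OF u Hh] Hg])
  also have "\<dots> = ip (Hank u (Hank u (Hank u h))) g"
    by (rule ip_Hank_sym[OF u g0 Hank_bound(1)[OF u Hh]])
  finally show ?thesis .
qed

text \<open>The coefficient form of \<open>H\<^bsub>\<Pi>(|u|\<^sup>2u)\<^esub> = T\<^bsub>|u|\<^sup>2\<^esub> H\<^sub>u + H\<^sub>u T\<^bsub>|u|\<^sup>2\<^esub> - H\<^sub>u\<^sup>3\<close>. In the quintuple sum over
  \<open>k + m = l + n + p\<close> one has \<open>p \<le> m\<close> or \<open>n \<le> k\<close>, and the three terms come from inclusion and exclusion.\<close>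

lemma lax_identity:
  assumes u: "inW 1 u" and h: "inW (1/2) h" and g: "inW (1/2) g"
  shows "ip (cubic u) (cv h g) = ip (cv u (Hank u h)) (cv u g) + ip (cv u (Hank u g)) (cv u h)
    - ip (Hank u (Hank u (Hank u h))) g"
proof -
  let ?S = "{(k,l,m,n,p). k + m = l + n + p} :: (nat \<times> nat \<times> nat \<times> nat \<times> nat) set"
  let ?S1 = "{(k,l,m,n,p). k + m = l + n + p \<and> p \<le> m} :: (nat \<times> nat \<times> nat \<times> nat \<times> nat) set"
  let ?S2 = "{(k,l,m,n,p). k + m = l + n + p \<and> n \<le> k} :: (nat \<times> nat \<times> nat \<times> nat \<times> nat) set"
  let ?S3 = "{(k,l,m,n,p). k + m = l + n + p \<and> p \<le> m \<and> n \<le> k} :: (nat \<times> nat \<times> nat \<times> nat \<times> nat) set"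
  have s: "qt u h g summable_on T" if "T \<subseteq> ?S" for T
    by (rule abs_summable_summable[OF summable_on_subset_banach[OF qt_total(1)[OF u h g] that]])
  have U: "?S = ?S1 \<union> (?S2 - ?S1)" by auto
  have V: "?S2 = ?S3 \<union> (?S2 - ?S1)" by auto
  have "infsum (qt u h g) ?S = infsum (qt u h g) ?S1 + infsum (qt u h g) (?S2 - ?S1)"
    by (subst U, rule infsum_Un_disjoint) (intro s, auto)+
  moreover have "infsum (qt u h g) ?S2 = infsum (qt u h g) ?S3 + infsum (qt u h g) (?S2 - ?S1)"
    by (subst V, rule infsum_Un_disjoint) (intro s, auto)+
  moreover have "infsum (qt u h g) ?S2 = infsum (qt u g h) ?S1"
    by (rule infsum_reindex_bij_witness[of _ "\<lambda>(k,l,m,n,p). (m,l,k,p,n)" "\<lambda>(k,l,m,n,p). (m,l,k,p,n)"])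
      (auto simp: qt_def mult_ac)
  ultimately show ?thesis
    unfolding qt_total(2)[OF u h g] qt_part[OF u h g] qt_part[OF u g h] qt_both[OF u h g] by simp
qed

section \<open>Conservation laws\<close>

lemma tail_tendsto:
  assumes c: "inW 0 c"
  shows "(\<lambda>K. wn 0 (\<lambda>j. if j < K then 0 else c j)) \<longlonglongrightarrow> 0"
    and "inW 0 (\<lambda>j. if j < K then 0 else c j)"
proof -
  have s: "(\<lambda>j. (cmod (if j < K then 0 else c j))\<^sup>2) sums ((wn 0 c)\<^sup>2 - (\<Sum>j<K. (cmod (c j))\<^sup>2))" for K
  proof -
    have "(\<lambda>j. (cmod (c j))\<^sup>2 - (if j \<in> {..<K} then (cmod (c j))\<^sup>2 else 0)) sums
      ((wn 0 c)\<^sup>2 - (\<Sum>j<K. (cmod (c j))\<^sup>2))"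
      by (intro sums_diff wn0_sums[OF c] sums_If_finite_set) simp
    moreover have "(cmod (c j))\<^sup>2 - (if j \<in> {..<K} then (cmod (c j))\<^sup>2 else 0) = (cmod (if j < K then 0 else c j))\<^sup>2" for j
      by simp
    ultimately show ?thesis by simp
  qed
  show "inW 0 (\<lambda>j. if j < K then 0 else c j)" for K
    using s[of K] by (simp add: inW_def sums_iff)
  have "wn 0 (\<lambda>j. if j < K then 0 else c j) = sqrt ((wn 0 c)\<^sup>2 - (\<Sum>j<K. (cmod (c j))\<^sup>2))" for K
    using s[of K] by (simp add: wn_def wsq_def sums_iff)
  moreover have "(\<lambda>K. sqrt ((wn 0 c)\<^sup>2 - (\<Sum>j<K. (cmod (c j))\<^sup>2))) \<longlonglongrightarrow> sqrt ((wn 0 c)\<^sup>2 - (wn 0 c)\<^sup>2)"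
    using wn0_sums[OF c] unfolding sums_def by (intro tendsto_intros)
  ultimately show "(\<lambda>K. wn 0 (\<lambda>j. if j < K then 0 else c j)) \<longlonglongrightarrow> 0" by simp
qed

lemma ip_split:
  assumes "inW 0 f" "inW 0 c"
  shows "ip f c = (\<Sum>j<K. f j * cnj (c j)) + ip f (\<lambda>j. if j < K then 0 else c j)"
proof -
  let ?d = "\<lambda>j. if j < K then 0 else c j"
  have d: "inW 0 ?d" by (rule tail_tendsto(2)[OF assms(2)])
  have "(\<lambda>j. if j \<in> {..<K} then f j * cnj (c j) else 0) sums (\<Sum>j<K. f j * cnj (c j))"
    by (rule sums_If_finite_set) simp
  then have "(\<lambda>j. f j * cnj (c j - ?d j)) sums (\<Sum>j<K. f j * cnj (c j))"
    by (rule sums_cong[THEN iffD1, rotated]) simp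
  then have "ip f (\<lambda>j. c j - ?d j) = (\<Sum>j<K. f j * cnj (c j))" by (simp add: ip_def sums_iff)
  then show ?thesis using ip_diff_right[OF assms(2) d assms(1)] by (simp add: algebra_simps)
qed

lemma weak_tendsto_0:
  assumes f: "eventually (\<lambda>s. inW 0 (f s) \<and> wn 0 (f s) \<le> C) F"
    and lim: "\<And>j. ((\<lambda>s. f s j) \<longlongrightarrow> 0) F" and c: "inW 0 c"
  shows "((\<lambda>s. ip (f s) c) \<longlongrightarrow> 0) F"
proof (rule tendstoI)
  fix e :: real assume e: "0 < e"
  define C' where "C' = max C 0 + 1"
  have C': "0 < C'" "C \<le> C'" by (auto simp: C'_def)
  have "\<forall>\<^sub>F K in sequentially. wn 0 (\<lambda>j. if j < K then 0 else c j) < e / (2 * C')"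
    by (rule order_tendstoD(2)[OF tail_tendsto(1)[OF c]]) (use e C' in simp)
  then obtain K where K: "wn 0 (\<lambda>j. if j < K then 0 else c j) < e / (2 * C')"
    by (auto simp: eventually_sequentially)
  let ?d = "\<lambda>j. if j < K then 0 else c j"
  have d: "inW 0 ?d" by (rule tail_tendsto(2)[OF c])
  have "((\<lambda>s. \<Sum>j<K. f s j * cnj (c j)) \<longlongrightarrow> (\<Sum>j<K. 0 * cnj (c j))) F"
    by (intro tendsto_intros lim)
  then have "\<forall>\<^sub>F s in F. dist (\<Sum>j<K. f s j * cnj (c j)) 0 < e / 2"
    using e by (intro tendstoD) auto
  then show "\<forall>\<^sub>F s in F. dist (ip (f s) c) 0 < e"
    using f
  proof eventually_elim
    case (elim s)
    have "cmod (ip (f s) ?d) \<le> wn 0 (f s) * wn 0 ?d" using elim d by (intro ip_bound) auto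
    also have "\<dots> \<le> C' * wn 0 ?d" using elim C' wn_nonneg[OF d] by (intro mult_right_mono) auto
    also have "\<dots> < C' * (e / (2 * C'))" using K C' by (intro mult_strict_left_mono) auto
    also have "\<dots> = e / 2" using C' by simp
    finally have "cmod (ip (f s) ?d) < e / 2" .
    moreover have "ip (f s) c = (\<Sum>j<K. f s j * cnj (c j)) + ip (f s) ?d"
      using elim c by (intro ip_split) auto
    ultimately show ?case
      using elim norm_triangle_ineq[of "\<Sum>j<K. f s j * cnj (c j)" "ip (f s) ?d"] by (simp add: dist_norm)
  qed
qed

text \<open>Bounded coefficientwise convergence is weak convergence, and pairing a weakly convergent
  family with a strongly convergent one passes to the limit.\<close>

lemma tendsto_ip:
  assumes f: "eventually (\<lambda>s. inW 0 (f s) \<and> wn 0 (f s) \<le> C) F"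
    and lim: "\<And>j. ((\<lambda>s. f s j) \<longlongrightarrow> q j) F" and q: "inW 0 q"
    and c: "inW 0 c" and cs: "\<And>s. inW 0 (c' s)" and cl: "((\<lambda>s. wn 0 (\<lambda>j. c' s j - c j)) \<longlongrightarrow> 0) F"
  shows "((\<lambda>s. ip (f s) (c' s)) \<longlongrightarrow> ip q c) F"
proof -
  have 1: "((\<lambda>s. ip (\<lambda>j. f s j - q j) c) \<longlongrightarrow> 0) F"
  proof (rule weak_tendsto_0[OF _ _ c])
    show "\<forall>\<^sub>F s in F. inW 0 (\<lambda>j. f s j - q j) \<and> wn 0 (\<lambda>j. f s j - q j) \<le> C + wn 0 q"
      using f
    proof eventually_elim
      case (elim s)
      have "wn 0 (\<lambda>j. f s j + (- 1) * q j) \<le> wn 0 (f s) + wn 0 (\<lambda>j. (- 1) * q j)"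
        using elim by (intro wn_add inW_scale q) auto
      then have "wn 0 (\<lambda>j. f s j - q j) \<le> wn 0 (f s) + wn 0 q" unfolding wn_scale[OF q] by simp
      then show ?case using elim inW_diff[OF _ q] by auto
    qed
    show "((\<lambda>s. f s j - q j) \<longlongrightarrow> 0) F" for j using tendsto_diff[OF lim[of j] tendsto_const[of "q j"]] by simp
  qed
  have 2: "((\<lambda>s. ip (f s) (\<lambda>j. c' s j - c j)) \<longlongrightarrow> 0) F"
  proof (rule tendsto_norm_zero_cancel, rule tendsto_sandwich[OF _ _ tendsto_const])
    show "\<forall>\<^sub>F s in F. norm (ip (f s) (\<lambda>j. c' s j - c j)) \<le> \<bar>C\<bar> * wn 0 (\<lambda>j. c' s j - c j)"
      using f
    proof eventually_elim
      case (elim s)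
      have d: "inW 0 (\<lambda>j. c' s j - c j)" by (rule inW_diff[OF cs c])
      have "norm (ip (f s) (\<lambda>j. c' s j - c j)) \<le> wn 0 (f s) * wn 0 (\<lambda>j. c' s j - c j)"
        using elim d by (intro ip_bound) auto
      also have "\<dots> \<le> \<bar>C\<bar> * wn 0 (\<lambda>j. c' s j - c j)" using elim wn_nonneg[OF d] by (intro mult_right_mono) auto
      finally show ?case .
    qed
    show "((\<lambda>s. \<bar>C\<bar> * wn 0 (\<lambda>j. c' s j - c j)) \<longlongrightarrow> 0) F" by (rule tendsto_mult_right_zero[OF cl])
  qed auto
  have 3: "((\<lambda>s. ip (\<lambda>j. f s j - q j) c + ip (f s) (\<lambda>j. c' s j - c j) + ip q c) \<longlongrightarrow> 0 + 0 + ip q c) F"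
    by (intro tendsto_add 1 2 tendsto_const)
  have "\<forall>\<^sub>F s in F. ip (\<lambda>j. f s j - q j) c + ip (f s) (\<lambda>j. c' s j - c j) + ip q c = ip (f s) (c' s)"
    using f
  proof eventually_elim
    case (elim s)
    then show ?case using q c cs[of s] by (simp add: ip_diff_left ip_diff_right)
  qed
  from Lim_transform_eventually[OF 3 this] show ?thesis by simp
qed

section \<open>Differentiating J along the flow\<close>

abbreviation Hp :: "(nat \<Rightarrow> complex) \<Rightarrow> nat \<Rightarrow> nat \<Rightarrow> complex" where
  "Hp u q \<equiv> (Hank u ^^ q) one_seq"

lemma Hp_half: "inW 1 u \<Longrightarrow> inW (1/2) (Hp u q)"
  by (induction q) (auto simp: inW_one Hank_half(1))

lemma Hp_0: "inW 1 u \<Longrightarrow> inW 0 (Hp u q)"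
  by (rule Hank_pow_inW[OF _ inW_one])

text \<open>With an even total the two powers have equal parity: even ones are moved across
  directly, odd ones after writing H_u(1) = u as in \<open>J_gram\<close>.\<close>

lemma Hp_gram:
  assumes u: "inW 1 u" and ev: "even (a + b)"
  shows "ip (Hp u a) (Hp u b) = Jfun ((a + b) div 2) u"
proof (cases "even a")
  case True
  then obtain i j where ij: "a = 2 * i" "b = 2 * j" using ev by (auto elim!: evenE)
  have "ip (Hp u a) (Hp u b) = ip ((Hank u ^^ (2*j)) (Hp u a)) one_seq"
    unfolding ij by (rule Hank_even_sym[symmetric, OF u Hp_0[OF u] inW_one])
  also have "(Hank u ^^ (2*j)) (Hp u a) = Hp u (2 * (i + j))"
    unfolding ij by (simp add: funpow_add distrib_left add.commute[of "2*i"])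
  finally show ?thesis by (simp add: Jfun_ip ij)
next
  case False
  then obtain i j where ij: "a = Suc (2 * i)" "b = Suc (2 * j)" using ev by (auto elim!: oddE)
  have "Hp u (Suc m) = (Hank u ^^ m) u" for m
  proof -
    have "Hp u (Suc m) = (Hank u ^^ m) (Hank u one_seq)" by (simp add: funpow_swap1)
    then show ?thesis by (simp add: Hank_one)
  qed
  then show ?thesis unfolding ij using J_gram[OF u, of i j] by simp
qed

lemma J_real: "inW 1 u \<Longrightarrow> cnj (Jfun n u) = Jfun n u"
  using Hp_gram[of u "2*n" 0] Hp_gram[of u 0 "2*n"] ip_cnj[OF Hp_0 Hp_0, of u u "2*n" 0] by simp

text \<open>Bookkeeping for antilinearity: moving one H_u across the inner product conjugates the
  value.\<close>

definition cj :: "nat \<Rightarrow> complex \<Rightarrow> complex" where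
  "cj p z = (if even p then z else cnj z)"

text \<open>Telescoping over mixed products with 2n - p factors H_v on the left and p factors H_u on
  the right. One replacement changes the value by a pairing with H_{u-v}, which
  \<open>ip_Hank_cv\<close> turns into u - v tested against an L^2 function.\<close>

lemma J_difference:
  assumes u: "inW 1 u" and v: "inW 1 v"
  shows "Jfun n u - Jfun n v = (\<Sum>p<2*n. cj p (ip (\<lambda>k. u k - v k) (cv (Hp v (2*n-1-p)) (Hp u p))))"
proof -
  define G where "G p = cj p (ip (Hp v (2*n-p)) (Hp u p))" for p
  have "Jfun n u - Jfun n v = G (2*n) - G 0"
  proof -
    have "G (2*n) = Jfun n u" unfolding G_def cj_def using Hp_gram[OF u, of 0 "2*n"] by simp
    moreover have "G 0 = Jfun n v" unfolding G_def cj_def using Hp_gram[OF v, of "2*n" 0] by simp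
    ultimately show ?thesis by simp
  qed
  also have "\<dots> = (\<Sum>p<2*n. G (Suc p) - G p)" by (rule sum_lessThan_telescope[symmetric])
  also have "\<dots> = (\<Sum>p<2*n. cj p (ip (\<lambda>k. u k - v k) (cv (Hp v (2*n-1-p)) (Hp u p))))"
  proof (rule sum.cong[OF refl])
    fix p assume "p \<in> {..<2*n}"
    then have p: "2*n - p = Suc (2*n-1-p)" "2*n - Suc p = 2*n-1-p" by auto
    let ?X = "Hp v (2*n-1-p)" and ?Y = "Hp u p"
    have X: "inW 0 ?X" and Y: "inW 0 ?Y" by (rule Hp_0[OF v], rule Hp_0[OF u])
    have uv: "inW 1 (\<lambda>k. u k - v k)" by (rule inW_diff[OF u v])
    have "cnj (ip ?X (Hank u ?Y)) = ip (Hank u ?Y) ?X" by (rule ip_cnj[OF X Hank_bound(1)[OF u Y]])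
    also have "\<dots> = ip (Hank u ?X) ?Y" by (rule ip_Hank_sym[OF u Y X])
    finally have c: "ip ?X (Hank u ?Y) = cnj (ip (Hank u ?X) ?Y)" by (metis complex_cnj_cnj)
    have "ip (Hank u ?X) ?Y - ip (Hank v ?X) ?Y = ip (Hank (\<lambda>k. u k - v k) ?X) ?Y"
      unfolding Hank_diff_left[OF u v X]
      by (rule ip_diff_left[symmetric, OF Hank_bound(1)[OF u X] Hank_bound(1)[OF v X] Y])
    also have "\<dots> = ip (\<lambda>k. u k - v k) (cv ?X ?Y)"
      by (rule ip_Hank_cv[OF uv Hp_half[OF v] Hp_half[OF u]])
    finally have d: "ip (\<lambda>k. u k - v k) (cv ?X ?Y) = ip (Hank u ?X) ?Y - ip (Hank v ?X) ?Y" by simp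
    have "G (Suc p) = cj (Suc p) (ip ?X (Hank u ?Y))" unfolding G_def p(2) by simp
    moreover have "G p = cj p (ip (Hank v ?X) ?Y)" unfolding G_def p(1) by simp
    ultimately show "G (Suc p) - G p = cj p (ip (\<lambda>k. u k - v k) (cv ?X ?Y))"
      unfolding d c by (simp add: cj_def)
  qed
  finally show ?thesis .
qed

text \<open>The Lax identity writes each summand as T p - T (p + 1) plus or minus i J_{2n+2}. The
  alternating part cancels over the 2n terms, and the two boundary values of T coincide since b 0 =
  J_{2n+2} is real.\<close>

lemma J_derivative_zero:
  assumes u: "inW 1 u"
  shows "(\<Sum>p<2*n. cj p (ip (\<lambda>k. - \<i> * cubic u k) (cv (Hp u (2*n-1-p)) (Hp u p)))) = 0"
proof -
  have uh: "inW (1/2) u" by (rule inW_mono[OF u]) simp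
  have cw: "inW 0 (cv u (Hp u q))" for q by (rule cv_half(1)[OF uh Hp_half[OF u]])
  define b where "b p = ip (cv u (Hp u (2*n-p))) (cv u (Hp u p))" for p
  define T where "T p = cj p (- \<i> * b p)" for p
  define J where "J = Jfun (Suc n) u"
  have Jr: "cnj J = J" unfolding J_def by (rule J_real[OF u])
  have tm: "cj p (ip (\<lambda>k. - \<i> * cubic u k) (cv (Hp u (2*n-1-p)) (Hp u p)))
      = T p - T (Suc p) + (if even p then \<i> * J else - (\<i> * J))" if "p < 2*n" for p
  proof -
    have p: "Hank u (Hp u (2*n-1-p)) = Hp u (2*n-p)" "2*n - Suc p = 2*n-1-p"
    proof -
      have "2*n-p = Suc (2*n-1-p)" using that by simp
      then show "Hank u (Hp u (2*n-1-p)) = Hp u (2*n-p)" by simp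
    qed simp
    have bs: "ip (cv u (Hank u (Hp u p))) (cv u (Hp u (2*n-1-p))) = cnj (b (Suc p))"
      unfolding b_def p(2) using ip_cnj[OF cw cw, of "2*n-1-p" "Suc p"] by simp
    have r: "ip (Hank u (Hank u (Hank u (Hp u (2*n-1-p))))) (Hp u p) = J"
    proof -
      have "Hank u (Hank u (Hank u (Hp u (2*n-1-p)))) = Hp u (2*n+2-p)"
      proof -
        have "2*n+2-p = Suc (Suc (Suc (2*n-1-p)))" using that by simp
        then show ?thesis by simp
      qed
      moreover have "2*n+2-p + p = 2 * Suc n" using that by simp
      ultimately show ?thesis using Hp_gram[OF u, of "2*n+2-p" p] by (simp add: J_def)
    qed
    have "ip (\<lambda>k. - \<i> * cubic u k) (cv (Hp u (2*n-1-p)) (Hp u p))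
        = - \<i> * ip (cubic u) (cv (Hp u (2*n-1-p)) (Hp u p))"
      by (rule ip_scale_left[OF cubic_bound(1)[OF u] cv_half(1)[OF Hp_half[OF u] Hp_half[OF u]]])
    also have "ip (cubic u) (cv (Hp u (2*n-1-p)) (Hp u p)) = b p + cnj (b (Suc p)) - J"
      unfolding lax_identity[OF u Hp_half[OF u] Hp_half[OF u]] bs r unfolding p(1) b_def ..
    finally have X: "ip (\<lambda>k. - \<i> * cubic u k) (cv (Hp u (2*n-1-p)) (Hp u p)) = - \<i> * (b p + cnj (b (Suc p)) - J)" .
    show ?thesis unfolding X by (simp add: T_def cj_def Jr algebra_simps)
  qed
  have alt: "(\<Sum>p<2*n. if even p then z else - z) = 0" for z :: complex by (induction n) auto
  have "(\<Sum>p<2*n. cj p (ip (\<lambda>k. - \<i> * cubic u k) (cv (Hp u (2*n-1-p)) (Hp u p))))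
    = (\<Sum>p<2*n. T p - T (Suc p) + (if even p then \<i> * J else - (\<i> * J)))"
    by (rule sum.cong) (use tm in auto)
  also have "\<dots> = (\<Sum>p<2*n. T p - T (Suc p))" unfolding sum.distrib alt by simp
  also have "\<dots> = T 0 - T (2*n)" by (rule sum_lessThan_telescope')
  also have "\<dots> = 0"
  proof -
    have cv1: "cv u one_seq = u"
    proof
      fix j
      have "cv u one_seq j = (\<Sum>k\<le>j. if k = j then u j else 0)"
        unfolding cv_def by (rule sum.cong) (auto simp: one_seq_def)
      then show "cv u one_seq j = u j" by simp
    qed
    have "cnj (b 0) = ip u (cv u (Hp u (2*n)))"
      unfolding b_def using ip_cnj[OF cw inW_10[OF u], of "2*n"] by (simp add: cv1)
    also have "\<dots> = ip (Hank u u) (Hp u (2*n))" by (rule ip_Hank_cv[symmetric, OF u uh Hp_half[OF u]])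
    also have "Hank u u = Hp u 2" by (simp add: numeral_2_eq_2 Hank_one)
    also have "ip (Hp u 2) (Hp u (2*n)) = J" using Hp_gram[OF u, of 2 "2*n"] by (simp add: J_def)
    finally have b0: "b 0 = J" using Jr by (metis complex_cnj_cnj)
    have "b (2*n) = cnj (b 0)" unfolding b_def using ip_cnj[OF cw cw, of "2*n" 0] by simp
    then show ?thesis using b0 Jr by (simp add: T_def cj_def)
  qed
  finally show ?thesis .
qed

lemma szegoD:
  assumes "szego_sol u"
  shows "inW 1 (u t)" "((\<lambda>s. wn 1 (\<lambda>k. u s k - u t k)) \<longlongrightarrow> 0) (at t)"
    "((\<lambda>s. u s n) has_vector_derivative (- \<i> * cubic (u t) n)) (at t)"
  using assms by (auto simp: szego_sol_def inW_1 wn_1 fun_diff_def)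

text \<open>The coefficientwise derivative is bounded in L^2 near t by \<open>cubic_bound\<close>.
  This is what bounds the difference quotients of u in L^2.\<close>

lemma szego_lipschitz:
  assumes "szego_sol u"
  shows "\<exists>C. \<forall>\<^sub>F s in at t. wn 0 (\<lambda>k. u s k - u t k) \<le> C * \<bar>s - t\<bar>"
proof -
  note u = szegoD[OF assms]
  define A where "A = wn 1 (u t) + 1"
  have "\<forall>\<^sub>F s in at t. wn 1 (\<lambda>k. u s k - u t k) < 1"
    by (rule order_tendstoD(2)[OF u(2)]) simp
  then obtain d where d: "0 < d" "\<And>s. s \<noteq> t \<Longrightarrow> dist s t < d \<Longrightarrow> wn 1 (\<lambda>k. u s k - u t k) < 1"
    by (auto simp: eventually_at)
  have A: "wn 1 (u s) \<le> A" if "\<bar>s - t\<bar> < d" for s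
  proof (cases "s = t")
    case False
    then show ?thesis using d(2)[of s] that wn_diff_triangle[OF u(1)[of s] u(1)[of t]] by (auto simp: A_def dist_real_def)
  qed (simp add: A_def)
  define C where "C = 4 * A ^ 3"
  have A0: "0 \<le> A" using wn_nonneg[OF u(1)] by (simp add: A_def)
  have C: "wn 0 (cubic (u s)) \<le> C" if "\<bar>s - t\<bar> < d" for s
    using cubic_bound(2)[OF u(1)[of s]] power_mono[OF A[OF that] wn_nonneg[OF u(1)], of 3] by (simp add: C_def)
  have C0: "0 \<le> C" using A0 by (simp add: C_def)
  have "wn 0 (\<lambda>k. u s k - u t k) \<le> C * \<bar>s - t\<bar>" if s: "\<bar>s - t\<bar> < d" "s \<noteq> t" for s
  proof (rule inWI(2))
    show "0 \<le> C * \<bar>s - t\<bar>" using C0 by simp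
    fix R
    define e where "e k = u s k - u t k" for k
    define D where "D = (\<Sum>k<R. (cmod (e k))\<^sup>2)"
    \<comment> \<open>The mean value theorem is scalar, so u is paired with the truncated increment
      e itself. The increment of \<psi> is then D, while its derivative is at most sqrt D times
      C.\<close>
    define \<psi> where "\<psi> x = (\<Sum>k<R. Re (cnj (e k) * u x k))" for x
    define \<psi>' where "\<psi>' x = (\<Sum>k<R. Re (cnj (e k) * (- \<i> * cubic (u x) k)))" for x
    have der: "(\<psi> has_real_derivative \<psi>' x) (at x)" for x
    proof -
      have "((\<lambda>x. Re (cnj (e k) * u x k)) has_real_derivative Re (cnj (e k) * (- \<i> * cubic (u x) k))) (at x)" for k
        unfolding has_real_derivative_iff_has_vector_derivative
        by (rule bounded_linear.has_vector_derivative[OF bounded_linear_Re has_vector_derivative_mult_right[OF u(3)]])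
      then show ?thesis unfolding \<psi>_def \<psi>'_def by (intro DERIV_sum)
    qed
    have bd: "\<bar>\<psi>' x\<bar> \<le> sqrt D * C" if "\<bar>x - t\<bar> < d" for x
    proof -
      have "\<bar>\<psi>' x\<bar> \<le> (\<Sum>k<R. \<bar>cmod (e k) * cmod (cubic (u x) k)\<bar>)"
        unfolding \<psi>'_def
      proof (rule order_trans[OF sum_abs], rule sum_mono)
        fix k
        have "\<bar>Re (cnj (e k) * (- \<i> * cubic (u x) k))\<bar> \<le> cmod (cnj (e k) * (- \<i> * cubic (u x) k))"
          by (rule abs_Re_le_cmod)
        then show "\<bar>Re (cnj (e k) * (- \<i> * cubic (u x) k))\<bar> \<le> \<bar>cmod (e k) * cmod (cubic (u x) k)\<bar>"
          by (simp add: norm_mult)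
      qed
      also have "\<dots> \<le> L2_set (\<lambda>k. cmod (e k)) {..<R} * L2_set (\<lambda>k. cmod (cubic (u x) k)) {..<R}"
        using L2_set_mult_ineq[of "\<lambda>k. cmod (e k)" "\<lambda>k. cmod (cubic (u x) k)" "{..<R}"] by simp
      also have "\<dots> \<le> sqrt D * C"
      proof (rule mult_mono)
        show "L2_set (\<lambda>k. cmod (e k)) {..<R} \<le> sqrt D" by (simp add: L2_set_def D_def)
        show "L2_set (\<lambda>k. cmod (cubic (u x) k)) {..<R} \<le> C"
          using wn_L2_set[OF cubic_bound(1)[OF u(1)[of x]], of "{..<R}"] C[OF that] by simp
      qed (auto simp: L2_set_nonneg D_def sum_nonneg)
      finally show ?thesis .
    qed
    have "\<psi> s - \<psi> t = D"
    proof -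
      have "\<psi> s - \<psi> t = (\<Sum>k<R. Re (cnj (e k) * e k))"
        unfolding \<psi>_def sum_subtractf[symmetric] by (rule sum.cong) (auto simp: e_def algebra_simps)
      also have "\<dots> = D" unfolding D_def
        by (rule sum.cong[OF refl], simp only: cmod_power2) (simp add: power2_eq_square)
      finally show ?thesis .
    qed
    moreover have "\<exists>\<xi>. \<bar>\<xi> - t\<bar> < d \<and> \<bar>\<psi> s - \<psi> t\<bar> = \<bar>s - t\<bar> * \<bar>\<psi>' \<xi>\<bar>"
    proof (cases "s < t")
      case True
      then obtain \<xi> where "s < \<xi>" "\<xi> < t" "\<psi> t - \<psi> s = (t - s) * \<psi>' \<xi>"
        using MVT2[of s t \<psi> \<psi>'] der by blast
      moreover from this(3) have "\<psi> s - \<psi> t = (s - t) * \<psi>' \<xi>" by (simp add: algebra_simps)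
      ultimately show ?thesis using s by (intro exI[of _ \<xi>]) (auto simp: abs_mult)
    next
      case False
      then have "t < s" using s by simp
      then obtain \<xi> where "t < \<xi>" "\<xi> < s" "\<psi> s - \<psi> t = (s - t) * \<psi>' \<xi>"
        using MVT2[of t s \<psi> \<psi>'] der by blast
      then show ?thesis using s by (intro exI[of _ \<xi>]) (auto simp: abs_mult)
    qed
    ultimately obtain \<xi> where \<xi>: "\<bar>\<xi> - t\<bar> < d" "\<bar>D\<bar> = \<bar>s - t\<bar> * \<bar>\<psi>' \<xi>\<bar>" by auto
    have D0: "0 \<le> D" by (simp add: D_def sum_nonneg)
    have "D \<le> \<bar>s - t\<bar> * (sqrt D * C)" using \<xi>(2) bd[OF \<xi>(1)] D0 mult_left_mono[of "\<bar>\<psi>' \<xi>\<bar>" "sqrt D * C" "\<bar>s - t\<bar>"] by simp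
    then have le: "sqrt D * sqrt D \<le> sqrt D * (C * \<bar>s - t\<bar>)" using D0 by (simp add: mult_ac)
    have "sqrt D \<le> C * \<bar>s - t\<bar>"
    proof (cases "D = 0")
      case False
      then have "0 < sqrt D" using D0 by simp
      then show ?thesis using le mult_le_cancel_left_pos by blast
    qed (use C0 in simp)
    then have "(sqrt D)\<^sup>2 \<le> (C * \<bar>s - t\<bar>)\<^sup>2" using D0 by (intro power_mono) auto
    then show "(\<Sum>k<R. (1 + real k) powr 0 * (cmod (u s k - u t k))\<^sup>2) \<le> (C * \<bar>s - t\<bar>)\<^sup>2"
      using D0 by (simp add: D_def e_def)
  qed
  then have "\<forall>\<^sub>F s in at t. wn 0 (\<lambda>k. u s k - u t k) \<le> C * \<bar>s - t\<bar>"
    unfolding eventually_at using d(1) by (auto simp: dist_real_def)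
  then show ?thesis by blast
qed

lemma Hp_continuous:
  assumes "szego_sol u"
  shows "((\<lambda>s. wn (1/2) (\<lambda>k. Hp (u s) q k - Hp (u t) q k)) \<longlongrightarrow> 0) (at t)"
proof (induction q)
  case 0
  then show ?case by (simp add: wn_0const)
next
  case (Suc q)
  note u = szegoD[OF assms]
  let ?d = "\<lambda>s. wn 1 (\<lambda>k. u s k - u t k)" and ?e = "\<lambda>s. wn (1/2) (\<lambda>k. Hp (u s) q k - Hp (u t) q k)"
  let ?A = "wn 1 (u t)" and ?B = "wn (1/2) (Hp (u t) q)"
  have bd: "wn (1/2) (\<lambda>k. Hp (u s) (Suc q) k - Hp (u t) (Suc q) k) \<le> sqrt 2 * (?d s * (?B + ?e s)) + sqrt 2 * (?A * ?e s)" for s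
  proof -
    have dW: "inW 1 (\<lambda>k. u s k - u t k)" by (rule inW_diff[OF u(1) u(1)])
    have hs: "inW (1/2) (Hp (u s) q)" and ht: "inW (1/2) (Hp (u t) q)" by (rule Hp_half[OF u(1)])+
    have hd: "inW (1/2) (\<lambda>k. Hp (u s) q k - Hp (u t) q k)" by (rule inW_diff[OF hs ht])
    have h0: "inW 0 (Hp (u s) q)" "inW 0 (Hp (u t) q)" by (rule Hp_0[OF u(1)])+
    have eq: "(\<lambda>k. Hp (u s) (Suc q) k - Hp (u t) (Suc q) k)
      = (\<lambda>k. Hank (\<lambda>k. u s k - u t k) (Hp (u s) q) k + Hank (u t) (\<lambda>k. Hp (u s) q k - Hp (u t) q k) k)"
      unfolding Hank_diff_left[OF u(1) u(1) h0(1)] Hank_diff_right[OF u(1) h0] by simp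
    have "wn (1/2) (\<lambda>k. Hp (u s) (Suc q) k - Hp (u t) (Suc q) k)
      \<le> wn (1/2) (Hank (\<lambda>k. u s k - u t k) (Hp (u s) q)) + wn (1/2) (Hank (u t) (\<lambda>k. Hp (u s) q k - Hp (u t) q k))"
      unfolding eq by (rule wn_add[OF Hank_half(1)[OF dW hs] Hank_half(1)[OF u(1) hd]])
    also have "\<dots> \<le> sqrt 2 * (?d s * wn (1/2) (Hp (u s) q)) + sqrt 2 * (?A * ?e s)"
      by (intro add_mono Hank_half(2) dW hs u(1) hd)
    also have "\<dots> \<le> sqrt 2 * (?d s * (?B + ?e s)) + sqrt 2 * (?A * ?e s)"
      using wn_diff_triangle[OF hs ht] by (intro add_right_mono mult_left_mono wn_nonneg[OF dW]) auto
    finally show ?thesis .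
  qed
  have "((\<lambda>s. sqrt 2 * (?d s * (?B + ?e s)) + sqrt 2 * (?A * ?e s)) \<longlongrightarrow> sqrt 2 * (0 * (?B + 0)) + sqrt 2 * (?A * 0)) (at t)"
    by (intro tendsto_intros u(2) Suc)
  then have lim: "((\<lambda>s. sqrt 2 * (?d s * (?B + ?e s)) + sqrt 2 * (?A * ?e s)) \<longlongrightarrow> 0) (at t)" by simp
  show ?case
  proof (rule tendsto_sandwich[OF _ _ tendsto_const lim])
    show "\<forall>\<^sub>F s in at t. wn (1/2) (\<lambda>k. Hp (u s) (Suc q) k - Hp (u t) (Suc q) k) \<le> sqrt 2 * (?d s * (?B + ?e s)) + sqrt 2 * (?A * ?e s)"
      by (rule always_eventually) (use bd in blast)
    show "\<forall>\<^sub>F s in at t. 0 \<le> wn (1/2) (\<lambda>k. Hp (u s) (Suc q) k - Hp (u t) (Suc q) k)"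
      by (intro always_eventually allI wn_nonneg inW_diff Hp_half u(1))
  qed
qed

lemma cv_diff_right: "cv h (\<lambda>k. f k - g k) = (\<lambda>j. cv h f j - cv h g j)"
  by (rule ext) (simp add: cv_def right_diff_distrib sum_subtractf)

text \<open>In \<open>J_difference\<close> the difference quotient of u is bounded in L^2 and
  converges coefficientwise, hence weakly, while the test products converge strongly. So the
  derivative of J is the sum in \<open>J_derivative_zero\<close>.\<close>

theorem J_conserved:
  assumes "szego_sol u"
  shows "Jfun n (u t) = Jfun n (u 0)"
proof -
  note u = szegoD[OF assms]
  have quot: "((\<lambda>s. (Jfun n (u s) - Jfun n (u t)) / of_real (s - t)) \<longlongrightarrow> 0) (at t)" for t
  proof -
    obtain C where C: "\<forall>\<^sub>F s in at t. wn 0 (\<lambda>k. u s k - u t k) \<le> C * \<bar>s - t\<bar>"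
      using szego_lipschitz[OF assms] by blast
    define q where "q s = (\<lambda>k. (1 / of_real (s - t)) * (u s k - u t k))" for s
    have d0: "inW 0 (\<lambda>k. u s k - u t k)" for s by (intro inW_diff inW_10 u(1))
    have q0: "inW 0 (q s)" for s unfolding q_def by (rule inW_scale[OF d0])
    have qb: "\<forall>\<^sub>F s in at t. inW 0 (q s) \<and> wn 0 (q s) \<le> C"
      using C eventually_neq_at_within[of t t UNIV]
    proof eventually_elim
      case (elim s)
      have "wn 0 (q s) = (1 / \<bar>s - t\<bar>) * wn 0 (\<lambda>k. u s k - u t k)"
        unfolding q_def wn_scale[OF d0] by (simp add: norm_divide flip: of_real_diff)
      also have "\<dots> \<le> (1 / \<bar>s - t\<bar>) * (C * \<bar>s - t\<bar>)" using elim by (intro mult_left_mono) auto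
      also have "\<dots> = C" using elim by simp
      finally show ?case using q0 by simp
    qed
    have ql: "((\<lambda>s. q s k) \<longlongrightarrow> - \<i> * cubic (u t) k) (at t)" for k
    proof -
      define D where "D = - \<i> * cubic (u t) k"
      have "((\<lambda>s. Re (u s k)) has_field_derivative Re D) (at t)" "((\<lambda>s. Im (u s k)) has_field_derivative Im D) (at t)"
        using u(3)[of k t] unfolding has_vector_derivative_complex_iff D_def by auto
      then have "((\<lambda>s. (Re (u s k) - Re (u t k)) / (s - t)) \<longlongrightarrow> Re D) (at t)"
        "((\<lambda>s. (Im (u s k) - Im (u t k)) / (s - t)) \<longlongrightarrow> Im D) (at t)"
        unfolding has_field_derivative_iff by auto
      moreover have "q s k = (u s k - u t k) / of_real (s - t)" for s by (simp add: q_def)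
      ultimately show ?thesis
        unfolding D_def[symmetric] tendsto_complex_iff by (simp del: of_real_diff)
    qed
    have ci: "inW 0 (\<lambda>k. - \<i> * cubic (u t) k)" by (rule inW_scale[OF cubic_bound(1)[OF u(1)]])
    have lim: "((\<lambda>s. ip (q s) (cv (Hp (u t) a) (Hp (u s) p))) \<longlongrightarrow>
        ip (\<lambda>k. - \<i> * cubic (u t) k) (cv (Hp (u t) a) (Hp (u t) p))) (at t)" for a p
    proof (rule tendsto_ip[OF qb ql ci])
      show "inW 0 (cv (Hp (u t) a) (Hp (u t) p))" by (intro cv_half(1) Hp_half u(1))
      show "inW 0 (cv (Hp (u t) a) (Hp (u s) p))" for s by (intro cv_half(1) Hp_half u(1))
      let ?e = "\<lambda>s. \<lambda>k. Hp (u s) p k - Hp (u t) p k"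
      have e: "inW (1/2) (?e s)" for s by (intro inW_diff Hp_half u(1))
      have z: "((\<lambda>s. sqrt 6 * (wn (1/2) (Hp (u t) a) * wn (1/2) (?e s))) \<longlongrightarrow> 0) (at t)"
        by (intro tendsto_mult_right_zero Hp_continuous[OF assms])
      show "((\<lambda>s. wn 0 (\<lambda>j. cv (Hp (u t) a) (Hp (u s) p) j - cv (Hp (u t) a) (Hp (u t) p) j)) \<longlongrightarrow> 0) (at t)"
        unfolding cv_diff_right[symmetric]
      proof (rule tendsto_sandwich[OF _ _ tendsto_const z])
        show "\<forall>\<^sub>F s in at t. wn 0 (cv (Hp (u t) a) (?e s)) \<le> sqrt 6 * (wn (1/2) (Hp (u t) a) * wn (1/2) (?e s))"
          by (intro always_eventually allI cv_half(2) Hp_half u(1) e)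
        show "\<forall>\<^sub>F s in at t. 0 \<le> wn 0 (cv (Hp (u t) a) (?e s))"
          by (intro always_eventually allI wn_nonneg cv_half(1) Hp_half u(1) e)
      qed
    qed
    have limc: "((\<lambda>s. cj p (ip (q s) (cv (Hp (u t) a) (Hp (u s) p)))) \<longlongrightarrow>
        cj p (ip (\<lambda>k. - \<i> * cubic (u t) k) (cv (Hp (u t) a) (Hp (u t) p)))) (at t)" for a p
      unfolding cj_def using lim[of a p] by (auto intro: tendsto_cnj)
    have "((\<lambda>s. \<Sum>p<2*n. cj p (ip (q s) (cv (Hp (u t) (2*n-1-p)) (Hp (u s) p)))) \<longlongrightarrow>
       (\<Sum>p<2*n. cj p (ip (\<lambda>k. - \<i> * cubic (u t) k) (cv (Hp (u t) (2*n-1-p)) (Hp (u t) p))))) (at t)"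
      by (intro tendsto_sum limc)
    moreover have "(Jfun n (u s) - Jfun n (u t)) / of_real (s - t)
      = (\<Sum>p<2*n. cj p (ip (q s) (cv (Hp (u t) (2*n-1-p)) (Hp (u s) p))))" for s
    proof -
      have "cj p (ip (q s) c) = cj p (ip (\<lambda>k. u s k - u t k) c) / of_real (s - t)" if "inW 0 c" for p c
      proof -
        have "ip (q s) c = (1 / of_real (s - t)) * ip (\<lambda>k. u s k - u t k) c"
          unfolding q_def by (rule ip_scale_left[OF d0 that])
        then show ?thesis by (simp add: cj_def)
      qed
      then have "cj p (ip (q s) (cv (Hp (u t) a) (Hp (u s) p)))
        = cj p (ip (\<lambda>k. u s k - u t k) (cv (Hp (u t) a) (Hp (u s) p))) / of_real (s - t)" for p a
        by (simp add: cv_half(1) Hp_half u(1))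
      then show ?thesis unfolding J_difference[OF u(1) u(1)] by (simp add: sum_divide_distrib)
    qed
    ultimately show ?thesis unfolding J_derivative_zero[OF u(1)] by simp
  qed
  have "Re (Jfun n (u t)) = Re (Jfun n (u 0))"
  proof (rule DERIV_isconst_all[of "\<lambda>t. Re (Jfun n (u t))"], rule allI)
    fix t
    have "((\<lambda>s. Re ((Jfun n (u s) - Jfun n (u t)) / of_real (s - t))) \<longlongrightarrow> Re 0) (at t)"
      by (rule tendsto_Re[OF quot])
    then show "((\<lambda>t. Re (Jfun n (u t))) has_real_derivative 0) (at t)"
      unfolding has_field_derivative_iff by (simp del: of_real_diff)
  qed
  moreover have "Im (Jfun n (u t)) = Im (Jfun n (u 0))"
    using J_real[OF u(1), of n t] J_real[OF u(1), of n 0] by (simp add: complex_eq_iff)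
  ultimately show ?thesis by (simp add: complex_eq_iff)
qed

section \<open>Momentum along the flow\<close>

definition Q4 :: "(nat \<times> nat \<times> nat \<times> nat) set" where
  "Q4 = {(k,l,m,n). k + m = l + n}"

definition q4 :: "(nat \<Rightarrow> complex) \<Rightarrow> nat \<times> nat \<times> nat \<times> nat \<Rightarrow> complex" where
  "q4 u = (\<lambda>(k,l,m,n). u k * cnj (u l) * u m * cnj (u n))"

text \<open>Grouped by j = k + m = l + n, the absolute series is the squared L^2 norm of the square
  of the function with coefficients |u_k|.\<close>

lemma q4_summable:
  assumes u: "inW 1 u"
  shows "(\<lambda>z. norm (q4 u z)) summable_on Q4"
proof -
  let ?a = "\<lambda>k. complex_of_real (cmod (u k))"
  let ?B = "\<lambda>j. {..j} \<times> {..j} :: (nat \<times> nat) set"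
  let ?f = "\<lambda>(j,(k,l)). u k * cnj (u l) * u (j - k) * cnj (u (j - l))"
  have a: "inW (1/2) ?a" using inW_mono[OF u, of "1/2"] inW_abs by auto
  have c0: "inW 0 (cv ?a ?a)" by (rule cv_half(1)[OF a a])
  have cvabs: "cmod (cv ?a ?a j) = (\<Sum>k\<le>j. cmod (u k) * cmod (u (j - k)))" for j
  proof -
    have "cv ?a ?a j = complex_of_real (\<Sum>k\<le>j. cmod (u k) * cmod (u (j-k)))" by (simp add: cv_def)
    then show ?thesis by (simp add: sum_nonneg del: of_real_sum)
  qed
  have e: "(\<Sum>y\<in>?B j. norm (?f (j,y))) = (cmod (cv ?a ?a j))\<^sup>2" for j
  proof -
    have "(\<Sum>y\<in>?B j. norm (?f (j,y))) = (\<Sum>k\<le>j. \<Sum>l\<le>j. (cmod (u k) * cmod (u (j - k))) * (cmod (u l) * cmod (u (j - l))))"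
      unfolding sum.cartesian_product by (rule sum.cong) (auto simp: norm_mult)
    then show ?thesis unfolding cvabs power2_eq_square by (simp only: sum_product)
  qed
  have "summable (\<lambda>j. norm ((cmod (cv ?a ?a j))\<^sup>2))" using c0 by (simp add: inW_def)
  then have "(\<lambda>j. (cmod (cv ?a ?a j))\<^sup>2) summable_on UNIV" by (rule norm_summable_imp_summable_on)
  then have sm: "(\<lambda>j. \<Sum>y\<in>?B j. norm (?f (j,y))) summable_on UNIV" unfolding e .
  have "(\<lambda>z. norm (?f z)) summable_on Sigma UNIV ?B"
    by (rule infsum_finite_fibers(1)[OF _ sm]) simp
  then show ?thesis
    by (rule summable_on_reindex_bij_witness[of _ "\<lambda>(k,l,m,n). (k + m, (k, l))" "\<lambda>(j,(k,l)). (k, l, j - k, j - l)", THEN iffD1, rotated -1])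
      (auto simp: Q4_def q4_def)
qed

text \<open>The involution p carries the complement of B into B without changing the summand. Three
  such reductions will order the four frequencies.\<close>

lemma infsum_sym_half:
  fixes a :: "'a \<Rightarrow> real"
  assumes s: "a summable_on A" and BA: "B \<subseteq> A" and nn: "\<And>x. 0 \<le> a x"
    and p: "\<And>x. x \<in> A \<Longrightarrow> p (p x) = x" "\<And>x. x \<in> A \<Longrightarrow> a (p x) = a x"
    and B: "\<And>x. x \<in> A \<Longrightarrow> x \<notin> B \<Longrightarrow> p x \<in> B"
  shows "infsum a A \<le> 2 * infsum a B"
proof -
  have sB: "a summable_on T" if "T \<subseteq> A" for T by (rule summable_on_subset_banach[OF s that])
  have "infsum a A = infsum a B + infsum a (A - B)"
    using infsum_Un_disjoint[OF sB[OF BA] sB[of "A - B"]] BA by (simp add: Un_absorb1)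
  also have "infsum a (A - B) = infsum a (p ` (A - B))"
    by (rule infsum_reindex_bij_witness[of _ p p]) (use p in auto)
  also have "\<dots> \<le> infsum a B"
  proof (rule infsum_mono_neutral)
    show "a summable_on p ` (A - B)" by (rule sB) (use B BA in auto)
    show "a summable_on B" by (rule sB[OF BA])
  qed (use B nn in auto)
  finally show ?thesis by simp
qed

text \<open>The slope of the weight \<open>gw X 0 - gw X k\<close>. For fixed y it tends to 1 as X
  grows, so the weight tends to k.\<close>

definition phi :: "nat \<Rightarrow> nat \<Rightarrow> real" where
  "phi X y = max 0 (1 - ln (1 + real y) / ln (1 + real X))"

text \<open>\<open>gw X 0 - gw X k\<close> is a finite-range substitute for the weight \<open>k\<close> of the momentum. The logarithmic
  cutoff gains a factor \<open>1 / ln X\<close> in its second differences, while the sum over the lowest frequency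
  costs only \<open>(ln X)\<^sup>1\<^sup>/\<^sup>2\<close>.\<close>

definition gw :: "nat \<Rightarrow> nat \<Rightarrow> real" where
  "gw X k = (\<Sum>y=k..<X. phi X y)"

context
  fixes X :: nat
  assumes X: "1 \<le> X"
begin

lemma lnX: "0 < ln (1 + real X)" using X by simp

lemma phi_bounds: "0 \<le> phi X y" "phi X y \<le> 1"
  using lnX by (auto simp: phi_def)

lemma phi_zero: "X \<le> y \<Longrightarrow> phi X y = 0"
proof -
  assume "X \<le> y"
  then have "ln (1 + real X) \<le> ln (1 + real y)" by simp
  then show ?thesis using lnX by (simp add: phi_def)
qed

text \<open>The logarithm of the ratio is twice the logarithm of its square root, and ln z <= z - 1
  applied to the root keeps the growth at a square root.\<close>

lemma phi_diff:
  assumes "a \<le> b"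
  shows "0 \<le> phi X a - phi X b" "phi X a - phi X b \<le> 2 / ln (1 + real X) * sqrt ((1 + real b) / (1 + real a))"
proof -
  let ?d = "1 / ln (1 + real X)"
  have d: "0 < ?d" using lnX by simp
  have mono: "ln (1 + real a) \<le> ln (1 + real b)" using assms by simp
  have e: "(1 - ln (1 + real a) / ln (1 + real X)) - (1 - ln (1 + real b) / ln (1 + real X)) = ?d * (ln (1 + real b) - ln (1 + real a))"
    by (simp add: diff_divide_distrib)
  have p: "0 \<le> ?d * (ln (1 + real b) - ln (1 + real a))" using mono d by simp
  then show "0 \<le> phi X a - phi X b" using e unfolding phi_def by linarith
  have "ln (1 + real b) - ln (1 + real a) = ln ((1 + real b) / (1 + real a))" by (subst ln_div) auto
  also have "\<dots> = 2 * ln (sqrt ((1 + real b) / (1 + real a)))" by (simp add: ln_sqrt)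
  also have "\<dots> \<le> 2 * (sqrt ((1 + real b) / (1 + real a)) - 1)"
    by (intro mult_left_mono ln_le_minus_one) auto
  also have "\<dots> \<le> 2 * sqrt ((1 + real b) / (1 + real a))" by simp
  finally have L: "ln (1 + real b) - ln (1 + real a) \<le> 2 * sqrt ((1 + real b) / (1 + real a))" .
  have "phi X a - phi X b \<le> ?d * (ln (1 + real b) - ln (1 + real a))" using e p unfolding phi_def by linarith
  also have "\<dots> \<le> ?d * (2 * sqrt ((1 + real b) / (1 + real a)))"
    by (rule mult_left_mono[OF L less_imp_le[OF d]])
  finally show "phi X a - phi X b \<le> 2 / ln (1 + real X) * sqrt ((1 + real b) / (1 + real a))" by simp
qed

lemma gw_ext: "X \<le> Y \<Longrightarrow> gw X k = (\<Sum>y=k..<Y. phi X y)"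
  unfolding gw_def by (rule sum.mono_neutral_left) (auto intro: phi_zero)

lemma gw_zero: "X \<le> k \<Longrightarrow> gw X k = 0" by (simp add: gw_def)

lemma gw_diff:
  assumes "l \<le> k"
  shows "gw X l - gw X k = (\<Sum>i<k-l. phi X (l + i))"
proof -
  have "gw X l = (\<Sum>y=l..<X+k. phi X y)" by (rule gw_ext) simp
  also have "\<dots> = (\<Sum>y=l..<k. phi X y) + (\<Sum>y=k..<X+k. phi X y)"
    by (rule sum.atLeastLessThan_concat[symmetric]) (use assms in auto)
  also have "(\<Sum>y=k..<X+k. phi X y) = gw X k" by (rule gw_ext[symmetric]) simp
  finally have "gw X l - gw X k = (\<Sum>y=l..<k. phi X y)" by simp
  also have "\<dots> = (\<Sum>i<k-l. phi X (l + i))"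
    by (rule sum.reindex_bij_witness[of _ "\<lambda>i. l + i" "\<lambda>y. y - l"]) (use assms in auto)
  finally show ?thesis .
qed

text \<open>The constraints give l <= k <= m <= n with equal gaps k - l = n - m, so the expression
  is a sum of phi(l + i) - phi(m + i) over i < k - l. Bounding m + i by n and l + i from below by i
  leaves a sum of (1 + i)^(-1/2), which yields sqrt(1 + k).\<close>

lemma gw_second_difference:
  assumes "k + m = l + n" "k \<le> m" "m \<le> n"
  shows "\<bar>gw X n + gw X l - gw X k - gw X m\<bar> \<le> 4 / ln (1 + real X) * (sqrt (1 + real n) * sqrt (1 + real k))"
    and "X \<le> l \<Longrightarrow> gw X n + gw X l - gw X k - gw X m = 0"
proof -
  have lk: "l \<le> k" and eq: "n - m = k - l" using assms by auto
  have "gw X n + gw X l - gw X k - gw X m = (\<Sum>i<k-l. phi X (l + i)) - (\<Sum>i<n-m. phi X (m + i))"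
    using gw_diff[OF lk] gw_diff[OF assms(3)] by simp
  also have "\<dots> = (\<Sum>i<k-l. phi X (l + i) - phi X (m + i))" by (simp add: eq sum_subtractf)
  finally have D: "gw X n + gw X l - gw X k - gw X m = (\<Sum>i<k-l. phi X (l + i) - phi X (m + i))" .
  have le: "l + i \<le> m + i" for i using lk assms by simp
  have "\<bar>gw X n + gw X l - gw X k - gw X m\<bar> = (\<Sum>i<k-l. phi X (l + i) - phi X (m + i))"
    unfolding D by (rule abs_of_nonneg) (intro sum_nonneg phi_diff(1) le)
  also have "\<dots> \<le> (\<Sum>i<k-l. 2 / ln (1 + real X) * (sqrt (1 + real n) * (1 + real i) powr (- (1/2))))"
  proof (rule sum_mono)
    fix i assume i: "i \<in> {..<k-l}"
    have "phi X (l + i) - phi X (m + i) \<le> 2 / ln (1 + real X) * sqrt ((1 + real (m + i)) / (1 + real (l + i)))"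
      by (rule phi_diff(2)[OF le])
    also have "\<dots> \<le> 2 / ln (1 + real X) * sqrt ((1 + real n) / (1 + real i))"
    proof (intro mult_left_mono real_sqrt_le_mono frac_le)
      have "m + i \<le> n" using i eq assms by simp
      then show "1 + real (m + i) \<le> 1 + real n" by simp
    qed (use lnX in auto)
    also have "sqrt ((1 + real n) / (1 + real i)) = sqrt (1 + real n) * (1 + real i) powr (- (1/2))"
      by (simp add: real_sqrt_divide powr_minus_divide powr_half_sqrt)
    finally show "phi X (l + i) - phi X (m + i) \<le> 2 / ln (1 + real X) * (sqrt (1 + real n) * (1 + real i) powr (- (1/2)))" .
  qed
  also have "\<dots> = 2 / ln (1 + real X) * sqrt (1 + real n) * (\<Sum>i<k-l. (1 + real i) powr (- (1/2)))"
    by (simp add: sum_distrib_left mult.assoc)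
  also have "\<dots> \<le> 2 / ln (1 + real X) * sqrt (1 + real n) * (2 * sqrt (1 + real k))"
  proof (intro mult_left_mono mult_nonneg_nonneg)
    have "(\<Sum>i<k-l. (1 + real i) powr (- (1/2))) \<le> (\<Sum>i\<le>k. (1 + real i) powr (- (1/2)))"
      by (rule sum_mono2) auto
    then show "(\<Sum>i<k-l. (1 + real i) powr (- (1/2))) \<le> 2 * sqrt (1 + real k)" using sum_inv_sqrt[of k] by linarith
  qed (use lnX in auto)
  finally show "\<bar>gw X n + gw X l - gw X k - gw X m\<bar> \<le> 4 / ln (1 + real X) * (sqrt (1 + real n) * sqrt (1 + real k))"
    by simp
  show "gw X n + gw X l - gw X k - gw X m = 0" if "X \<le> l"
    using that lk assms by (simp add: gw_zero)
qed

lemma harmonic_ln: "(\<Sum>l<X. 1 / (1 + real l)) \<le> 1 + ln (1 + real X)"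
proof -
  have "(\<Sum>l<Suc n. 1 / (1 + real l)) \<le> 1 + ln (1 + real n)" for n
  proof (induction n)
    case (Suc n)
    have "ln ((1 + real n) / (2 + real n)) \<le> (1 + real n) / (2 + real n) - 1"
      by (rule ln_le_minus_one) simp
    also have "\<dots> = - (1 / (2 + real n))" by (simp add: field_simps)
    finally have "1 / (2 + real n) \<le> ln (2 + real n) - ln (1 + real n)" by (simp add: ln_div)
    then show ?case using Suc by (simp add: add.commute)
  qed simp
  from this[of "X - 1"] have "(\<Sum>l<X. 1 / (1 + real l)) \<le> 1 + ln (1 + real (X - 1))" using X by simp
  also have "\<dots> \<le> 1 + ln (1 + real X)" by simp
  finally show ?thesis .
qed

end

text \<open>The four frequencies are controlled by the square-summable A_k = sqrt(1 + k) |u_k|. For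
  fixed lowest frequency l, Cauchy-Schwarz over (k, m) costs no logarithm; only the final sum over l
  < X does.\<close>

lemma ordered_quad_bound:
  assumes u: "inW 1 u" and F: "finite F" "F \<subseteq> {(k,l,m,n). k + m = l + n \<and> k \<le> m \<and> m \<le> n \<and> l < X}"
  shows "(\<Sum>(k,l,m,n)\<in>F. (sqrt (1 + real n) * sqrt (1 + real k)) * (cmod (u k) * cmod (u l) * cmod (u m) * cmod (u n)))
    \<le> (wn 1 u) ^ 4 * sqrt (\<Sum>l<X. 1 / (1 + real l))"
proof -
  define A where "A k = sqrt (1 + real k) * cmod (u k)" for k
  have A0: "0 \<le> A k" for k by (simp add: A_def)
  have Asum: "(\<Sum>k\<in>T. (A k)\<^sup>2) \<le> (wn 1 u)\<^sup>2" if "finite T" for T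
    using wn_partial[OF u that] by (simp add: A_def power_mult_distrib)
  obtain P where P: "(\<lambda>(k,l,m,n). k) ` F \<subseteq> {..<P}" "(\<lambda>(k,l,m,n). m) ` F \<subseteq> {..<P}"
  proof -
    obtain P1 where 1: "(\<lambda>(k,l,m,n). k) ` F \<subseteq> {..<P1}"
      using finite_nat_iff_bounded[THEN iffD1, OF finite_imageI[OF F(1)]] by metis
    obtain P2 where 2: "(\<lambda>(k,l,m,n). m) ` F \<subseteq> {..<P2}"
      using finite_nat_iff_bounded[THEN iffD1, OF finite_imageI[OF F(1)]] by metis
    show ?thesis
    proof (rule that[of "max P1 P2"])
      show "(\<lambda>(k,l,m,n). k) ` F \<subseteq> {..<max P1 P2}" by (rule order_trans[OF 1]) auto
      show "(\<lambda>(k,l,m,n). m) ` F \<subseteq> {..<max P1 P2}" by (rule order_trans[OF 2]) auto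
    qed
  qed
  define G where "G l = {(k,m). k < P \<and> m < P \<and> l \<le> k \<and> k \<le> m}" for l
  have Gfin: "finite (G l)" for l by (rule finite_subset[of _ "{..<P} \<times> {..<P}"]) (auto simp: G_def)
  define t where "t l k m = (A k * A m) * (A (k + m - l) / sqrt (1 + real m))" for l k m
  have t0: "0 \<le> t l k m" for l k m by (simp add: t_def A0)
  have inner: "(\<Sum>(k,m)\<in>G l. t l k m) \<le> (wn 1 u) ^ 3" for l
  proof -
    have "(\<Sum>(k,m)\<in>G l. t l k m)\<^sup>2 = (\<Sum>z\<in>G l. (A (fst z) * A (snd z)) * (A (fst z + snd z - l) / sqrt (1 + real (snd z))))\<^sup>2"
      by (simp add: t_def case_prod_unfold)
    also have "\<dots> \<le> (\<Sum>z\<in>G l. (A (fst z) * A (snd z))\<^sup>2) * (\<Sum>z\<in>G l. (A (fst z + snd z - l) / sqrt (1 + real (snd z)))\<^sup>2)"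
      by (rule Cauchy_Schwarz_ineq_sum)
    also have "\<dots> \<le> ((wn 1 u)\<^sup>2 * (wn 1 u)\<^sup>2) * (wn 1 u)\<^sup>2"
    proof (rule mult_mono)
      have "(\<Sum>z\<in>G l. (A (fst z) * A (snd z))\<^sup>2) \<le> (\<Sum>z\<in>{..<P}\<times>{..<P}. (A (fst z) * A (snd z))\<^sup>2)"
        by (rule sum_mono2) (auto simp: G_def)
      also have "\<dots> = (\<Sum>k<P. (A k)\<^sup>2) * (\<Sum>m<P. (A m)\<^sup>2)"
        by (simp add: sum_product sum.cartesian_product power_mult_distrib case_prod_unfold)
      also have "\<dots> \<le> (wn 1 u)\<^sup>2 * (wn 1 u)\<^sup>2" by (intro mult_mono Asum sum_nonneg) auto
      finally show "(\<Sum>z\<in>G l. (A (fst z) * A (snd z))\<^sup>2) \<le> (wn 1 u)\<^sup>2 * (wn 1 u)\<^sup>2" .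
      \<comment> \<open>Since k <= m, one has m <= n <= 2m. For given n there are at most n/2 + 1
        values of m, each with weight at most 1 / (1 + n/2), so the sum over m is bounded by
        1.\<close>
      let ?B = "\<lambda>n::nat. {m. n \<le> 2 * m \<and> m \<le> n}"
      have "(\<Sum>z\<in>G l. (A (fst z + snd z - l) / sqrt (1 + real (snd z)))\<^sup>2)
        = (\<Sum>z\<in>(\<lambda>(k,m). (k + m - l, m)) ` G l. (A (fst z))\<^sup>2 / (1 + real (snd z)))"
        by (subst sum.reindex) (auto simp: inj_on_def G_def case_prod_unfold power_divide)
      also have "\<dots> \<le> (\<Sum>z\<in>Sigma {..<2*P} ?B. (A (fst z))\<^sup>2 / (1 + real (snd z)))"
      proof (rule sum_mono2)
        have "finite (?B n)" for n by (rule finite_subset[of _ "{..n}"]) auto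
        then show "finite (Sigma {..<2*P} ?B)" by (intro finite_SigmaI) auto
      qed (auto simp: G_def)
      also have "\<dots> = (\<Sum>n<2*P. \<Sum>m\<in>?B n. (A n)\<^sup>2 / (1 + real m))"
      proof -
        have "\<forall>n\<in>{..<2*P}. finite (?B n)" by (auto intro: finite_subset[of _ "{.._}"])
        then show ?thesis by (subst sum.Sigma) (auto simp: case_prod_unfold)
      qed
      also have "\<dots> \<le> (\<Sum>n<2*P. (A n)\<^sup>2)"
      proof (rule sum_mono)
        fix n
        have "?B n \<subseteq> {n - n div 2..n}" by auto
        then have "card (?B n) \<le> card {n - n div 2..n}" by (intro card_mono) auto
        then have c: "card (?B n) \<le> n div 2 + 1" by simp
        have "(\<Sum>m\<in>?B n. (A n)\<^sup>2 / (1 + real m)) \<le> (\<Sum>m\<in>?B n. (A n)\<^sup>2 / (1 + real n / 2))"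
          by (intro sum_mono divide_left_mono) auto
        also have "\<dots> = real (card (?B n)) * ((A n)\<^sup>2 / (1 + real n / 2))" by simp
        also have "\<dots> \<le> (1 + real n / 2) * ((A n)\<^sup>2 / (1 + real n / 2))"
        proof (rule mult_right_mono)
          have "real (card (?B n)) \<le> real (n div 2 + 1)" using c of_nat_le_iff by blast
          also have "\<dots> \<le> 1 + real n / 2"
          proof -
            have "real (2 * (n div 2)) \<le> real n" by (subst of_nat_le_iff) simp
            then show ?thesis by simp
          qed
          finally show "real (card (?B n)) \<le> 1 + real n / 2" .
        qed simp
        also have "\<dots> = (A n)\<^sup>2" by (simp add: field_simps)
        finally show "(\<Sum>m\<in>?B n. (A n)\<^sup>2 / (1 + real m)) \<le> (A n)\<^sup>2" .
      qed
      also have "\<dots> \<le> (wn 1 u)\<^sup>2" by (rule Asum) simp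
      finally show "(\<Sum>z\<in>G l. (A (fst z + snd z - l) / sqrt (1 + real (snd z)))\<^sup>2) \<le> (wn 1 u)\<^sup>2" .
    qed (auto intro: sum_nonneg)
    also have "\<dots> = ((wn 1 u) ^ 3)\<^sup>2" by (simp add: power2_eq_square power3_eq_cube)
    finally show ?thesis by (rule power2_le_imp_le) (simp add: wn_nonneg[OF u])
  qed
  have "(\<Sum>(k,l,m,n)\<in>F. (sqrt (1 + real n) * sqrt (1 + real k)) * (cmod (u k) * cmod (u l) * cmod (u m) * cmod (u n)))
    = (\<Sum>(k,l,m,n)\<in>F. cmod (u l) * t l k m)"
  proof (rule sum.cong[OF refl])
    fix z assume z: "z \<in> F"
    obtain k l m n where zz: "z = (k,l,m,n)" by (cases z)
    have n: "k + m - l = n" using z F unfolding zz by auto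
    have "A m / sqrt (1 + real m) = cmod (u m)" by (simp add: A_def)
    then have "t l k m = A k * cmod (u m) * A n" unfolding t_def n by (simp add: mult_ac) (simp add: A_def)
    then show "(case z of (k,l,m,n) \<Rightarrow> (sqrt (1 + real n) * sqrt (1 + real k)) * (cmod (u k) * cmod (u l) * cmod (u m) * cmod (u n)))
      = (case z of (k,l,m,n) \<Rightarrow> cmod (u l) * t l k m)"
      unfolding zz by (simp add: A_def mult_ac)
  qed
  also have "\<dots> = (\<Sum>(l,(k,m))\<in>(\<lambda>(k,l,m,n). (l,(k,m))) ` F. cmod (u l) * t l k m)"
  proof -
    have "inj_on (\<lambda>(k,l,m,n). (l,(k,m))) F"
    proof (rule inj_onI)
      fix z z' assume z: "z \<in> F" "z' \<in> F"
        and e: "(case z of (k,l,m,n) \<Rightarrow> (l,(k,m))) = (case z' of (k,l,m,n) \<Rightarrow> (l,(k,m)))"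
      obtain k l m n where zz: "z = (k,l,m,n)" by (cases z)
      obtain k' l' m' n' where zz': "z' = (k',l',m',n')" by (cases z')
      have "k + m = l + n" "k' + m' = l' + n'" using z F(2) unfolding zz zz' by auto
      then show "z = z'" using e unfolding zz zz' by simp
    qed
    from sum.reindex[OF this, of "\<lambda>(l,(k,m)). cmod (u l) * t l k m"]
    show ?thesis by (simp add: case_prod_unfold o_def)
  qed
  also have "\<dots> \<le> (\<Sum>(l,(k,m))\<in>Sigma {..<X} G. cmod (u l) * t l k m)"
  proof (rule sum_mono2)
    show "finite (Sigma {..<X} G)" using Gfin by (intro finite_SigmaI) auto
    show "(\<lambda>(k,l,m,n). (l,(k,m))) ` F \<subseteq> Sigma {..<X} G"
    proof
      fix z assume "z \<in> (\<lambda>(k,l,m,n). (l,(k,m))) ` F"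
      then obtain k l m n where z: "(k,l,m,n) \<in> F" "z = (l,(k,m))" by auto
      have "k < P" "m < P" using P z(1) by (force simp: image_subset_iff)+
      then show "z \<in> Sigma {..<X} G" using z F by (auto simp: G_def)
    qed
  qed (auto simp: t0)
  also have "\<dots> = (\<Sum>l<X. \<Sum>(k,m)\<in>G l. cmod (u l) * t l k m)"
    by (subst sum.Sigma) (auto simp: Gfin case_prod_unfold)
  also have "\<dots> = (\<Sum>l<X. cmod (u l) * (\<Sum>(k,m)\<in>G l. t l k m))"
    by (simp add: sum_distrib_left case_prod_unfold)
  also have "\<dots> \<le> (\<Sum>l<X. cmod (u l) * (wn 1 u) ^ 3)"
    by (intro sum_mono mult_left_mono inner) auto
  also have "\<dots> = (\<Sum>l<X. cmod (u l)) * (wn 1 u) ^ 3" by (simp only: sum_distrib_right)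
  \<comment> \<open>The coefficients of an H^{1/2} function are not summable in general; up to X
    their sum is bounded by the square root of a harmonic sum.\<close>
  also have "\<dots> \<le> (wn 1 u * sqrt (\<Sum>l<X. 1 / (1 + real l))) * (wn 1 u) ^ 3"
  proof (rule mult_right_mono)
    have "(\<Sum>l<X. cmod (u l)) = (\<Sum>l<X. A l * (1 / sqrt (1 + real l)))" by (simp add: A_def)
    also have "\<dots> \<le> sqrt ((\<Sum>l<X. (A l)\<^sup>2) * (\<Sum>l<X. (1 / sqrt (1 + real l))\<^sup>2))"
      by (rule real_le_rsqrt[OF Cauchy_Schwarz_ineq_sum])
    also have "\<dots> \<le> sqrt ((wn 1 u)\<^sup>2 * (\<Sum>l<X. 1 / (1 + real l)))"
      by (intro real_sqrt_le_mono mult_mono Asum) (auto simp: power_divide intro: sum_nonneg)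
    also have "\<dots> = wn 1 u * sqrt (\<Sum>l<X. 1 / (1 + real l))"
      using wn_nonneg[OF u] by (simp add: real_sqrt_mult)
    finally show "(\<Sum>l<X. cmod (u l)) \<le> wn 1 u * sqrt (\<Sum>l<X. 1 / (1 + real l))" .
  qed (simp add: wn_nonneg[OF u])
  finally show ?thesis by (simp add: power4_eq_xxxx power3_eq_cube mult_ac)
qed

lemma gw_bounds: "1 \<le> X \<Longrightarrow> 0 \<le> gw X k" "1 \<le> X \<Longrightarrow> gw X k \<le> real X"
proof -
  assume X: "1 \<le> X"
  show "0 \<le> gw X k" unfolding gw_def by (intro sum_nonneg phi_bounds(1)[OF X])
  have "gw X k \<le> (\<Sum>y=k..<X. 1)" unfolding gw_def by (intro sum_mono phi_bounds(2)[OF X])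
  then show "gw X k \<le> real X" by simp
qed

text \<open>The sum is the time derivative of the total weighted mass. Symmetrisation replaces the
  weight at n by a second difference of \<open>gw\<close>. The gain 1 / ln X against the loss
  sqrt(ln X) leaves a bound that tends to 0.\<close>

lemma momentum_derivative_bound:
  assumes u: "inW 1 u" and X: "1 \<le> X"
  shows "\<bar>\<Sum>n<X. gw X n * (2 * Im (cubic u n * cnj (u n)))\<bar>
    \<le> 16 * (wn 1 u) ^ 4 * (sqrt (1 + ln (1 + real X)) / ln (1 + real X))"
proof -
  define I where "I h = infsum (\<lambda>z. complex_of_real (h z) * q4 u z) Q4" for h
  have sq: "(\<lambda>z. norm (q4 u z)) summable_on Q4" by (rule q4_summable[OF u])
  have sn: "(\<lambda>z. norm (complex_of_real (h z) * q4 u z)) summable_on Q4"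
    if h: "\<And>z. \<bar>h z\<bar> \<le> c" for h and c :: real
  proof (rule summable_on_comparison_test)
    show "(\<lambda>z. c * norm (q4 u z)) summable_on Q4" by (rule summable_on_cmult_right[OF sq])
    show "norm (complex_of_real (h z) * q4 u z) \<le> c * norm (q4 u z)" for z
      using h[of z] by (simp add: norm_mult mult_right_mono)
  qed simp
  have s: "(\<lambda>z. complex_of_real (h z) * q4 u z) summable_on Q4" if "\<And>z. \<bar>h z\<bar> \<le> c" for h and c :: real
    by (rule abs_summable_summable[OF sn[OF that]])
  define gk gl gm gn where "gk = (\<lambda>(k,l::nat,m::nat,n::nat). gw X k)"
    and "gl = (\<lambda>(k::nat,l,m::nat,n::nat). gw X l)"
    and "gm = (\<lambda>(k::nat,l::nat,m,n::nat). gw X m)" and "gn = (\<lambda>(k::nat,l::nat,m::nat,n). gw X n)"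
  note gdefs = gk_def gl_def gm_def gn_def
  have gb: "\<bar>gk z\<bar> \<le> real X" "\<bar>gl z\<bar> \<le> real X" "\<bar>gm z\<bar> \<le> real X" "\<bar>gn z\<bar> \<le> real X" for z
    using gw_bounds[OF X] by (auto simp: gdefs split: prod.splits)
  \<comment> \<open>Exchanging l with n, or k with m, preserves \<open>q4\<close>; exchanging (k, m)
    with (l, n) conjugates it. Hence the combination \<open>D\<close> has integral 4 i times the
    imaginary part of \<open>I gn\<close>.\<close>
  have Iln: "I gl = I gn"
    unfolding I_def by (rule infsum_reindex_bij_witness[of _ "\<lambda>(k,l,m,n). (k,n,m,l)" "\<lambda>(k,l,m,n). (k,n,m,l)"])
      (auto simp: Q4_def q4_def gdefs mult_ac add_ac)
  have Ikm: "I gk = I gm"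
    unfolding I_def by (rule infsum_reindex_bij_witness[of _ "\<lambda>(k,l,m,n). (m,l,k,n)" "\<lambda>(k,l,m,n). (m,l,k,n)"])
      (auto simp: Q4_def q4_def gdefs mult_ac add_ac)
  have "I gm = infsum (\<lambda>z. cnj (complex_of_real (gn z) * q4 u z)) Q4"
    unfolding I_def by (rule infsum_reindex_bij_witness[of _ "\<lambda>(k,l,m,n). (l,k,n,m)" "\<lambda>(k,l,m,n). (l,k,n,m)"])
      (auto simp: Q4_def q4_def gdefs mult_ac add_ac)
  then have Imn: "I gm = cnj (I gn)" unfolding infsum_cnj I_def .
  have In: "I gn = (\<Sum>n<X. complex_of_real (gw X n) * (cubic u n * cnj (u n)))"
  proof -
    let ?f = "\<lambda>(n,(k,l,m)). complex_of_real (gw X n) * (u k * cnj (u l) * u m * cnj (u n))"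
    let ?S = "SIGMA n:UNIV. {(k,l,m). k + m = l + (n::nat)}"
    have "(\<lambda>z. complex_of_real (gn z) * q4 u z) summable_on Q4" by (rule s[OF gb(4)])
    then have fs: "?f summable_on ?S"
      by (rule summable_on_reindex_bij_witness[of _ "\<lambda>(n,(k,l,m)). (k,l,m,n)" "\<lambda>(k,l,m,n). (n,(k,l,m))", THEN iffD1, rotated -1])
        (auto simp: Q4_def q4_def gdefs)
    have "I gn = infsum ?f ?S"
      unfolding I_def
      by (rule infsum_reindex_bij_witness[of _ "\<lambda>(n,(k,l,m)). (k,l,m,n)" "\<lambda>(k,l,m,n). (n,(k,l,m))"])
        (auto simp: Q4_def q4_def gdefs)
    also have "\<dots> = (\<Sum>\<^sub>\<infinity>n. \<Sum>\<^sub>\<infinity>y\<in>{(k,l,m). k + m = l + n}. ?f (n,y))"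
      by (rule infsum_Sigma_banach[symmetric, OF fs])
    also have "\<dots> = (\<Sum>\<^sub>\<infinity>n. complex_of_real (gw X n) * (cubic u n * cnj (u n)))"
    proof (rule infsum_cong)
      fix n
      have "(\<Sum>\<^sub>\<infinity>y\<in>{(k,l,m). k + m = l + n}. ?f (n,y))
        = (\<Sum>\<^sub>\<infinity>y\<in>{(k,l,m). k + m = l + n}. (complex_of_real (gw X n) * cnj (u n)) * (case y of (k,l,m) \<Rightarrow> u k * cnj (u l) * u m))"
        by (rule infsum_cong) (auto simp: mult_ac)
      also have "\<dots> = (complex_of_real (gw X n) * cnj (u n)) * cubic u n"
        unfolding cubic_def by (rule infsum_cmult_right')
      finally show "(\<Sum>\<^sub>\<infinity>y\<in>{(k,l,m). k + m = l + n}. ?f (n,y)) = complex_of_real (gw X n) * (cubic u n * cnj (u n))"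
        by (simp add: mult_ac)
    qed
    also have "\<dots> = infsum (\<lambda>n. complex_of_real (gw X n) * (cubic u n * cnj (u n))) {..<X}"
      by (rule infsum_cong_neutral) (auto simp: gw_zero[OF X])
    finally show ?thesis by simp
  qed
  define D where "D z = gn z + gl z - gk z - gm z" for z
  have ID: "I D = I gn + I gl - I gk - I gm"
  proof -
    have e: "complex_of_real (D z) * q4 u z = (complex_of_real (gn z) * q4 u z + complex_of_real (gl z) * q4 u z)
       + ((- 1) * (complex_of_real (gk z) * q4 u z) + (- 1) * (complex_of_real (gm z) * q4 u z))" for z
      by (simp add: D_def algebra_simps)
    note ss = s[OF gb(1)] s[OF gb(2)] s[OF gb(3)] s[OF gb(4)]
    have "I D = infsum (\<lambda>z. complex_of_real (gn z) * q4 u z + complex_of_real (gl z) * q4 u z) Q4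
       + infsum (\<lambda>z. (- 1) * (complex_of_real (gk z) * q4 u z) + (- 1) * (complex_of_real (gm z) * q4 u z)) Q4"
      unfolding I_def e by (intro infsum_add summable_on_add summable_on_cmult_right ss)
    also have "\<dots> = (I gn + I gl) + ((- 1) * I gk + (- 1) * I gm)"
      unfolding I_def
      by (subst infsum_add[OF ss(4) ss(2)], subst infsum_add[OF summable_on_cmult_right[OF ss(1)] summable_on_cmult_right[OF ss(3)]])
        (simp only: infsum_cmult_right')
    finally show ?thesis by simp
  qed
  have 4: "Im (I D) = 4 * Im (I gn)" unfolding ID Ikm Imn Iln by simp
  define a where "a z = \<bar>D z\<bar> * norm (q4 u z)" for z
  have Db: "\<bar>D z\<bar> \<le> 4 * real X" for z using gb[of z] unfolding D_def by linarith
  have sa: "a summable_on Q4"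
    using sn[OF Db] by (simp add: a_def[abs_def] norm_mult)
  have a0: "0 \<le> a z" for z by (simp add: a_def)
  have "cmod (I D) \<le> infsum (\<lambda>z. norm (complex_of_real (D z) * q4 u z)) Q4"
    unfolding I_def by (rule norm_infsum_bound[OF sn[OF Db]])
  also have "\<dots> = infsum a Q4" by (simp add: a_def[abs_def] norm_mult)
  finally have ineq: "4 * \<bar>Im (I gn)\<bar> \<le> infsum a Q4"
    using abs_Im_le_cmod[of "I D"] 4 by simp
  \<comment> \<open>Successive reduction to l <= n, k <= m and m <= n, each halving the index set.
    The resulting factor 8, divided by the 4 of the symmetrisation, leaves 2; doubled by the factor
    2 in the derivative and multiplied by the 4 of \<open>gw_second_difference\<close>, it gives
    16.\<close>
  define Q1 Q2 Q3 where "Q1 = Q4 \<inter> {(k,l,m,n). l \<le> n}" and "Q2 = Q1 \<inter> {(k,l,m,n). k \<le> m}"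
    and "Q3 = Q2 \<inter> {(k,l,m,n). m \<le> n}"
  note Qd = Q1_def Q2_def Q3_def Q4_def
  have "infsum a Q4 \<le> 2 * infsum a Q1"
    by (rule infsum_sym_half[OF sa _ a0, where p="\<lambda>(k,l,m,n). (k,n,m,l)"])
      (auto simp: Qd a_def D_def gdefs q4_def norm_mult mult_ac add_ac)
  moreover have "infsum a Q1 \<le> 2 * infsum a Q2"
    by (rule infsum_sym_half[OF summable_on_subset_banach[OF sa] _ a0, where p="\<lambda>(k,l,m,n). (m,l,k,n)"])
      (auto simp: Qd a_def D_def gdefs q4_def norm_mult mult_ac add_ac diff_diff_eq)
  moreover have "infsum a Q2 \<le> 2 * infsum a Q3"
  proof (rule infsum_sym_half[OF summable_on_subset_banach[OF sa] _ a0, where p="\<lambda>(k,l,m,n). (l,k,n,m)"])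
    fix z :: "nat \<times> nat \<times> nat \<times> nat"
    obtain k l m n where z: "z = (k,l,m,n)" by (cases z)
    have "D (l,k,n,m) = - D (k,l,m,n)" by (simp add: D_def gdefs)
    then show "a ((\<lambda>(k,l,m,n). (l,k,n,m)) z) = a z"
      unfolding z a_def by (simp add: q4_def norm_mult mult_ac)
  qed (auto simp: Qd)
  moreover have "infsum a Q3 \<le> 4 / ln (1 + real X) * ((wn 1 u) ^ 4 * sqrt (1 + ln (1 + real X)))"
  proof (rule infsum_le_finite_sums)
    show "a summable_on Q3" by (rule summable_on_subset_banach[OF sa]) (auto simp: Qd)
    fix F assume F: "finite F" "F \<subseteq> Q3"
    let ?L = "4 / ln (1 + real X)"
    let ?b = "\<lambda>(k,l,m,n). (sqrt (1 + real n) * sqrt (1 + real k)) * (cmod (u k) * cmod (u l) * cmod (u m) * cmod (u n))"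
    define F' where "F' = F \<inter> {(k,l,m,n). l < X}"
    have L0: "0 \<le> ?L" using lnX[OF X] by simp
    have "sum a F = sum a F'"
    proof (rule sum.mono_neutral_right)
      show "\<forall>z\<in>F - F'. a z = 0"
      proof
        fix z assume z: "z \<in> F - F'"
        obtain k l m n where zz: "z = (k,l,m,n)" by (cases z)
        have "k + m = l + n" "k \<le> m" "m \<le> n" "X \<le> l" using z F unfolding zz F'_def Qd by auto
        then have "D z = 0" unfolding D_def zz gdefs using gw_second_difference(2)[OF X] by simp
        then show "a z = 0" by (simp add: a_def)
      qed
    qed (use F in \<open>auto simp: F'_def\<close>)
    also have "\<dots> \<le> (\<Sum>z\<in>F'. ?L * ?b z)"
    proof (rule sum_mono)
      fix z assume z: "z \<in> F'"
      obtain k l m n where zz: "z = (k,l,m,n)" by (cases z)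
      have "k + m = l + n" "k \<le> m" "m \<le> n" using z F unfolding zz F'_def Qd by auto
      then have "\<bar>D z\<bar> \<le> ?L * (sqrt (1 + real n) * sqrt (1 + real k))"
        unfolding D_def zz gdefs using gw_second_difference(1)[OF X] by simp
      then have "a z \<le> (?L * (sqrt (1 + real n) * sqrt (1 + real k))) * norm (q4 u z)"
        unfolding a_def by (rule mult_right_mono) simp
      then show "a z \<le> ?L * ?b z" unfolding zz by (simp add: q4_def norm_mult mult_ac)
    qed
    also have "\<dots> = ?L * (\<Sum>z\<in>F'. ?b z)" by (rule sum_distrib_left[symmetric])
    also have "\<dots> \<le> ?L * ((wn 1 u) ^ 4 * sqrt (\<Sum>l<X. 1 / (1 + real l)))"
      by (intro mult_left_mono L0 ordered_quad_bound[OF u]) (use F in \<open>auto simp: F'_def Qd\<close>)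
    also have "\<dots> \<le> ?L * ((wn 1 u) ^ 4 * sqrt (1 + ln (1 + real X)))"
      by (intro mult_left_mono L0 real_sqrt_le_mono harmonic_ln[OF X]) simp
    finally show "sum a F \<le> ?L * ((wn 1 u) ^ 4 * sqrt (1 + ln (1 + real X)))" .
  qed
  ultimately have "2 * \<bar>Im (I gn)\<bar> \<le> 16 / ln (1 + real X) * ((wn 1 u) ^ 4 * sqrt (1 + ln (1 + real X)))"
    using ineq by simp
  moreover have "(\<Sum>n<X. gw X n * (2 * Im (cubic u n * cnj (u n)))) = 2 * Im (I gn)"
  proof -
    have e: "Im (complex_of_real r * z) = r * Im z" for r z by simp
    have "Im (I gn) = (\<Sum>n<X. gw X n * Im (cubic u n * cnj (u n)))" by (simp only: In Im_sum e)
    then show ?thesis by (simp only: sum_distrib_left) (rule sum.cong[OF refl], rule mult.left_commute)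
  qed
  ultimately show ?thesis by (simp add: abs_mult mult_ac)
qed

lemma wn_isCont:
  assumes "szego_sol u"
  shows "isCont (\<lambda>s. wn 1 (u s)) t"
proof -
  note u = szegoD[OF assms]
  have "((\<lambda>s. wn 1 (u s) - wn 1 (u t)) \<longlongrightarrow> 0) (at t)"
  proof (rule tendsto_rabs_zero_cancel, rule tendsto_sandwich[OF _ _ tendsto_const u(2)])
    show "\<forall>\<^sub>F s in at t. \<bar>wn 1 (u s) - wn 1 (u t)\<bar> \<le> wn 1 (\<lambda>k. u s k - u t k)"
      by (intro always_eventually allI wn_diff_triangle u(1))
  qed auto
  then show ?thesis unfolding isCont_def using LIM_zero_iff by blast
qed

text \<open>The truncated weights give M up to an error \<open>\<eta> X\<close> times |t|, uniformly
  on the compact time interval, where the H^{1/2} norm is bounded. Letting X grow with finitely many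
  coefficients fixed, a Fatou argument, loses the reverse inequality.\<close>

theorem momentum_nonincreasing:
  assumes "szego_sol u"
  shows "Mfun (u t) \<le> Mfun (u 0)"
proof -
  note u = szegoD[OF assms]
  let ?S = "{min 0 t..max 0 t}"
  have "bounded ((\<lambda>s. wn 1 (u s)) ` ?S)"
    by (intro compact_imp_bounded compact_continuous_image continuous_at_imp_continuous_on ballI wn_isCont[OF assms] compact_Icc)
  then obtain K where K': "\<forall>x\<in>(\<lambda>s. wn 1 (u s)) ` ?S. norm x \<le> K" unfolding bounded_iff by blast
  have K: "wn 1 (u s) \<le> K" if "s \<in> ?S" for s using bspec[OF K' imageI[OF that]] by simp
  define \<eta> where "\<eta> X = 16 * K ^ 4 * (sqrt (1 + ln (1 + real X)) / ln (1 + real X))" for X :: nat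
  \<comment> \<open>Conservation of J_2 allows passing from the finitely supported decreasing weight
    \<open>gw X n\<close>, whose sum can be differentiated, to the increasing weight
    \<open>gw X 0 - gw X n\<close>.\<close>
  have L2: "(wn 0 (u t))\<^sup>2 = (wn 0 (u 0))\<^sup>2"
  proof -
    have "complex_of_real ((wn 0 (u s))\<^sup>2) = Jfun 1 (u s)" for s
      using J_gram[OF u(1)[of s], of 0 0] ip_self[OF inW_10[OF u(1)]] by simp
    then have "complex_of_real ((wn 0 (u t))\<^sup>2) = of_real ((wn 0 (u 0))\<^sup>2)"
      using J_conserved[OF assms, of 1 t] by simp
    then show ?thesis using of_real_eq_iff by blast
  qed
  have main: "(\<Sum>n<R. (gw X 0 - gw X n) * (cmod (u t n))\<^sup>2) \<le> Mfun (u 0) + \<eta> X * \<bar>t\<bar>" if X: "1 \<le> X" for X R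
  proof -
    define G where "G s = (\<Sum>n<X. gw X n * (cmod (u s n))\<^sup>2)" for s
    have der: "(G has_field_derivative (\<Sum>n<X. gw X n * (2 * Im (cubic (u s) n * cnj (u s n))))) (at s)" for s
    proof -
      have "((\<lambda>s. (cmod (u s n))\<^sup>2) has_field_derivative (2 * Im (cubic (u s) n * cnj (u s n)))) (at s)" for n
      proof -
        have d: "((\<lambda>s. Re (u s n)) has_field_derivative Re (- \<i> * cubic (u s) n)) (at s)"
          "((\<lambda>s. Im (u s n)) has_field_derivative Im (- \<i> * cubic (u s) n)) (at s)"
          using u(3)[of n s] unfolding has_vector_derivative_complex_iff by auto
        have "((\<lambda>s. Re (u s n) * Re (u s n) + Im (u s n) * Im (u s n)) has_field_derivative
          (2 * Im (cubic (u s) n * cnj (u s n)))) (at s)"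
          by (rule DERIV_cong[OF DERIV_add[OF DERIV_mult[OF d(1) d(1)] DERIV_mult[OF d(2) d(2)]]])
            (simp add: algebra_simps)
        then show ?thesis unfolding cmod_power2 unfolding power2_eq_square .
      qed
      then show ?thesis unfolding G_def by (intro DERIV_sum DERIV_cmult)
    qed
    have "norm (G t - G 0) \<le> \<eta> X * norm (t - 0)"
    proof (rule field_differentiable_bound[of ?S G])
      show "(G has_field_derivative (\<Sum>n<X. gw X n * (2 * Im (cubic (u s) n * cnj (u s n))))) (at s within ?S)" for s
        using der has_field_derivative_at_within by blast
      show "norm (\<Sum>n<X. gw X n * (2 * Im (cubic (u s) n * cnj (u s n)))) \<le> \<eta> X" if "s \<in> ?S" for s
      proof -
        have "(wn 1 (u s)) ^ 4 \<le> K ^ 4" by (rule power_mono[OF K[OF that] wn_nonneg[OF u(1)]])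
        then have "16 * (wn 1 (u s)) ^ 4 * (sqrt (1 + ln (1 + real X)) / ln (1 + real X)) \<le> \<eta> X"
          unfolding \<eta>_def using lnX[OF X] by (intro mult_right_mono mult_left_mono) auto
        then show ?thesis using momentum_derivative_bound[OF u(1)[of s] X] by simp
      qed
    qed auto
    then have Gd: "G 0 - G t \<le> \<eta> X * \<bar>t\<bar>" by simp
    have S: "(\<lambda>n. (gw X 0 - gw X n) * (cmod (u s n))\<^sup>2) sums (gw X 0 * (wn 0 (u s))\<^sup>2 - G s)" for s
    proof -
      have "(\<lambda>n. gw X 0 * (cmod (u s n))\<^sup>2 - (if n \<in> {..<X} then gw X n * (cmod (u s n))\<^sup>2 else 0)) sums
         (gw X 0 * (wn 0 (u s))\<^sup>2 - (\<Sum>n<X. gw X n * (cmod (u s n))\<^sup>2))"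
        by (intro sums_diff sums_mult wn0_sums inW_10 u(1) sums_If_finite_set) simp
      moreover have "gw X 0 * (cmod (u s n))\<^sup>2 - (if n \<in> {..<X} then gw X n * (cmod (u s n))\<^sup>2 else 0)
         = (gw X 0 - gw X n) * (cmod (u s n))\<^sup>2" for n
        by (auto simp: gw_zero[OF X] algebra_simps)
      ultimately show ?thesis by (simp add: G_def)
    qed
    have w: "gw X 0 - gw X n = (\<Sum>i<n. phi X i)" for n using gw_diff[OF X, of 0 n] by simp
    have w0: "0 \<le> gw X 0 - gw X n" for n unfolding w by (intro sum_nonneg phi_bounds(1)[OF X])
    have wle: "gw X 0 - gw X n \<le> real n" for n
      unfolding w using sum_mono[of "{..<n}" "phi X" "\<lambda>_. 1"] phi_bounds(2)[OF X] by simp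
    have "(\<Sum>n<R. (gw X 0 - gw X n) * (cmod (u t n))\<^sup>2) \<le> gw X 0 * (wn 0 (u t))\<^sup>2 - G t"
    proof -
      have "(\<Sum>n<R. (gw X 0 - gw X n) * (cmod (u t n))\<^sup>2) \<le> (\<Sum>n. (gw X 0 - gw X n) * (cmod (u t n))\<^sup>2)"
        by (rule sum_le_suminf) (use S[of t] w0 in \<open>auto simp: sums_iff\<close>)
      then show ?thesis using S[of t] by (simp add: sums_iff)
    qed
    also have "\<dots> \<le> (gw X 0 * (wn 0 (u 0))\<^sup>2 - G 0) + \<eta> X * \<bar>t\<bar>" using Gd L2 by simp
    also have "gw X 0 * (wn 0 (u 0))\<^sup>2 - G 0 \<le> Mfun (u 0)"
    proof -
      have "gw X 0 * (wn 0 (u 0))\<^sup>2 - G 0 = (\<Sum>n. (gw X 0 - gw X n) * (cmod (u 0 n))\<^sup>2)"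
        using S[of 0] by (simp add: sums_iff)
      also have "\<dots> \<le> Mfun (u 0)"
        unfolding Mfun_def using S[of 0] wle
        by (intro suminf_le Mfun_summable u(1)) (auto simp: sums_iff intro!: mult_right_mono)
      finally show ?thesis .
    qed
    finally show ?thesis by simp
  qed
  have bound: "(\<Sum>n<R. real n * (cmod (u t n))\<^sup>2) \<le> Mfun (u 0)" for R
  proof (rule LIMSEQ_le)
    have ph: "(\<lambda>X. phi X y) \<longlonglongrightarrow> 1" for y unfolding phi_def by real_asymp
    have w: "\<forall>\<^sub>F X in sequentially. (\<Sum>n<R. (\<Sum>i<n. phi X i) * (cmod (u t n))\<^sup>2) = (\<Sum>n<R. (gw X 0 - gw X n) * (cmod (u t n))\<^sup>2)"
      using eventually_ge_at_top[of 1] by eventually_elim (simp add: gw_diff)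
    have "(\<lambda>X. \<Sum>n<R. (\<Sum>i<n. phi X i) * (cmod (u t n))\<^sup>2) \<longlonglongrightarrow> (\<Sum>n<R. (\<Sum>i<n. 1) * (cmod (u t n))\<^sup>2)"
      by (intro tendsto_intros ph)
    then show "(\<lambda>X. \<Sum>n<R. (gw X 0 - gw X n) * (cmod (u t n))\<^sup>2) \<longlonglongrightarrow> (\<Sum>n<R. real n * (cmod (u t n))\<^sup>2)"
      using Lim_transform_eventually[OF _ w] by simp
    have "(\<lambda>X. sqrt (1 + ln (1 + real X)) / ln (1 + real X)) \<longlonglongrightarrow> 0" by real_asymp
    then have "(\<lambda>X. Mfun (u 0) + \<eta> X * \<bar>t\<bar>) \<longlonglongrightarrow> Mfun (u 0) + (16 * K ^ 4 * 0) * \<bar>t\<bar>"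
      unfolding \<eta>_def by (intro tendsto_intros)
    then show "(\<lambda>X. Mfun (u 0) + \<eta> X * \<bar>t\<bar>) \<longlonglongrightarrow> Mfun (u 0)" by simp
    show "\<exists>X0. \<forall>X\<ge>X0. (\<Sum>n<R. (gw X 0 - gw X n) * (cmod (u t n))\<^sup>2) \<le> Mfun (u 0) + \<eta> X * \<bar>t\<bar>"
      using main by blast
  qed
  show ?thesis unfolding Mfun_def[of "u t"] by (rule suminf_le_const[OF Mfun_summable[OF u(1)] bound])
qed

section \<open>Stability\<close>

lemma wn1_limit:
  assumes w: "\<And>k. inW 1 (w k)" "\<And>k. wn 1 (w k) \<le> C" and lim: "\<And>j. (\<lambda>k. w k j) \<longlonglongrightarrow> v j"
  shows "inW 1 v" "wn 1 v \<le> C"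
proof -
  have C: "0 \<le> C" using wn_nonneg[OF w(1)[of 0]] w(2)[of 0] by linarith
  have "(\<Sum>j<n. (1 + real j) powr 1 * (cmod (v j))\<^sup>2) \<le> C\<^sup>2" for n
  proof (rule LIMSEQ_le_const2)
    show "(\<lambda>k. \<Sum>j<n. (1 + real j) powr 1 * (cmod (w k j))\<^sup>2) \<longlonglongrightarrow> (\<Sum>j<n. (1 + real j) powr 1 * (cmod (v j))\<^sup>2)"
      by (intro tendsto_sum tendsto_mult tendsto_const tendsto_power tendsto_norm lim)
    have "(\<Sum>j<n. (1 + real j) powr 1 * (cmod (w k j))\<^sup>2) \<le> C\<^sup>2" for k
      using wn_partial[OF w(1)[of k], of "{..<n}"] power_mono[OF w(2)[of k] wn_nonneg[OF w(1)], of 2] by simp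
    then show "\<exists>K. \<forall>k\<ge>K. (\<Sum>j<n. (1 + real j) powr 1 * (cmod (w k j))\<^sup>2) \<le> C\<^sup>2" by blast
  qed
  then show "inW 1 v" "wn 1 v \<le> C" using inWI[of 1 v C] C by auto
qed

text \<open>The compact embedding of H^{1/2} into L^2: beyond R the weight 1 + j makes the tail at
  most (2C)^2 / (1 + R), uniformly in k.\<close>

lemma wn0_strong:
  assumes w: "\<And>k. inW 1 (w k)" "\<And>k. wn 1 (w k) \<le> C" and lim: "\<And>j. (\<lambda>k. w k j) \<longlonglongrightarrow> v j"
  shows "(\<lambda>k. wn 0 (\<lambda>j. w k j - v j)) \<longlonglongrightarrow> 0"
proof -
  have v: "inW 1 v" "wn 1 v \<le> C" by (rule wn1_limit[OF w lim])+
  define z where "z k j = w k j - v j" for k j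
  have z1: "inW 1 (z k)" for k unfolding z_def by (rule inW_diff[OF w(1) v(1)])
  have zb: "wn 1 (z k) \<le> 2 * C" for k
  proof -
    have "wn 1 (\<lambda>j. w k j + (- 1) * v j) \<le> wn 1 (w k) + wn 1 (\<lambda>j. (- 1) * v j)"
      by (intro wn_add w(1) inW_scale v(1))
    then show ?thesis using w(2)[of k] v(2) unfolding wn_scale[OF v(1)] by (simp add: z_def[abs_def])
  qed
  have est: "(wn 0 (z k))\<^sup>2 \<le> (\<Sum>j<R. (cmod (z k j))\<^sup>2) + (2 * C)\<^sup>2 / (1 + real R)" for k R
  proof -
    have "(\<Sum>j<n. (cmod (z k j))\<^sup>2) \<le> (\<Sum>j<R. (cmod (z k j))\<^sup>2) + (2 * C)\<^sup>2 / (1 + real R)" for n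
    proof -
      have "(\<Sum>j<n. (cmod (z k j))\<^sup>2) \<le> (\<Sum>j<n. (if j < R then (cmod (z k j))\<^sup>2 else 0) + (1 + real j) powr 1 * (cmod (z k j))\<^sup>2 / (1 + real R))"
      proof (rule sum_mono)
        fix j
        show "(cmod (z k j))\<^sup>2 \<le> (if j < R then (cmod (z k j))\<^sup>2 else 0) + (1 + real j) powr 1 * (cmod (z k j))\<^sup>2 / (1 + real R)"
        proof (cases "j < R")
          case False
          then have "(1 + real R) * (cmod (z k j))\<^sup>2 \<le> (1 + real j) * (cmod (z k j))\<^sup>2" by (intro mult_right_mono) auto
          then show ?thesis using False by (simp add: pos_le_divide_eq mult.commute)
        qed simp
      qed
      also have "\<dots> = (\<Sum>j<n. if j < R then (cmod (z k j))\<^sup>2 else 0) + (\<Sum>j<n. (1 + real j) powr 1 * (cmod (z k j))\<^sup>2) / (1 + real R)"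
        unfolding sum.distrib sum_divide_distrib ..
      also have "\<dots> \<le> (\<Sum>j<R. (cmod (z k j))\<^sup>2) + (2 * C)\<^sup>2 / (1 + real R)"
      proof (intro add_mono divide_right_mono)
        have "(\<Sum>j<n. if j < R then (cmod (z k j))\<^sup>2 else 0) = (\<Sum>j\<in>{..<n} \<inter> {..<R}. (cmod (z k j))\<^sup>2)"
          by (simp add: sum.inter_restrict)
        also have "\<dots> \<le> (\<Sum>j<R. (cmod (z k j))\<^sup>2)" by (rule sum_mono2) auto
        finally show "(\<Sum>j<n. if j < R then (cmod (z k j))\<^sup>2 else 0) \<le> (\<Sum>j<R. (cmod (z k j))\<^sup>2)" .
        show "(\<Sum>j<n. (1 + real j) powr 1 * (cmod (z k j))\<^sup>2) \<le> (2 * C)\<^sup>2"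
          using wn_partial[OF z1[of k], of "{..<n}"] power_mono[OF zb[of k] wn_nonneg[OF z1], of 2] by simp
      qed simp
      finally show ?thesis .
    qed
    then show ?thesis
      using suminf_le_const[OF sums_summable[OF wn0_sums[OF inW_10[OF z1[of k]]]]] sums_unique[OF wn0_sums[OF inW_10[OF z1[of k]]]]
      by simp
  qed
  have "(\<lambda>k. (wn 0 (z k))\<^sup>2) \<longlonglongrightarrow> 0"
  proof (rule LIMSEQ_I)
    fix e :: real assume e: "0 < e"
    obtain R :: nat where R: "2 * (2 * C)\<^sup>2 / e < real R" using reals_Archimedean2 by blast
    have "(2 * C)\<^sup>2 / (1 + real R) < e / 2"
    proof -
      have "2 * (2 * C)\<^sup>2 < e * (1 + real R)" using R e by (simp add: field_simps)
      then show ?thesis using e by (simp add: field_simps)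
    qed
    moreover have "(\<lambda>k. \<Sum>j<R. (cmod (z k j))\<^sup>2) \<longlonglongrightarrow> (\<Sum>j<R. (cmod (v j - v j))\<^sup>2)"
      unfolding z_def by (intro tendsto_sum tendsto_power tendsto_norm tendsto_diff lim tendsto_const)
    then have "\<forall>\<^sub>F k in sequentially. (\<Sum>j<R. (cmod (z k j))\<^sup>2) < e / 2"
      using e by (intro order_tendstoD(2)) auto
    then obtain k0 where "\<And>k. k0 \<le> k \<Longrightarrow> (\<Sum>j<R. (cmod (z k j))\<^sup>2) < e / 2"
      by (auto simp: eventually_sequentially)
    ultimately have "norm ((wn 0 (z k))\<^sup>2 - 0) < e" if "k0 \<le> k" for k using est[of k R] that by fastforce
    then show "\<exists>k0. \<forall>k\<ge>k0. norm ((wn 0 (z k))\<^sup>2 - 0) < e" by blast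
  qed
  then have "(\<lambda>k. sqrt ((wn 0 (z k))\<^sup>2)) \<longlonglongrightarrow> sqrt 0" by (rule tendsto_real_sqrt)
  then show ?thesis
    unfolding real_sqrt_abs real_sqrt_zero abs_of_nonneg[OF wn_nonneg[OF inW_10[OF z1]]] by (simp add: z_def[abs_def])
qed

lemma Hank_weak:
  assumes w: "\<And>k. inW 1 (w k)" "\<And>k. wn 1 (w k) \<le> C" and lim: "\<And>j. (\<lambda>k. w k j) \<longlonglongrightarrow> v j"
    and h: "\<And>k. inW 0 (h k)" "\<And>k. wn 0 (h k) \<le> C'" and hl: "\<And>j. (\<lambda>k. h k j) \<longlonglongrightarrow> g j" and g: "inW 0 g"
  shows "(\<lambda>k. Hank (w k) (h k) n) \<longlonglongrightarrow> Hank v g n"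
proof -
  have v: "inW 1 v" by (rule wn1_limit(1)[OF w lim])
  have s0: "inW 0 (sh n v)" "inW 0 (sh n (w k))" for k by (intro inW_sh inW_10 v w(1))+
  have "(\<lambda>k. ip (h k) (sh n (w k))) \<longlonglongrightarrow> ip g (sh n v)"
  proof (rule tendsto_ip[of h C'])
    show "\<forall>\<^sub>F k in sequentially. inW 0 (h k) \<and> wn 0 (h k) \<le> C'" by (intro always_eventually allI conjI h)
    show "(\<lambda>k. wn 0 (\<lambda>j. sh n (w k) j - sh n v j)) \<longlonglongrightarrow> 0"
    proof (rule tendsto_sandwich[OF _ _ tendsto_const wn0_strong[OF w lim]])
      have "wn 0 (sh n f) \<le> wn 0 f" if f: "inW 0 f" for f
      proof (rule inWI(2))
        fix m
        have "(\<Sum>k<m. (1 + real k) powr 0 * (cmod (sh n f k))\<^sup>2) = (\<Sum>k\<in>(\<lambda>k. n + k) ` {..<m}. (cmod (f k))\<^sup>2)"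
          by (subst sum.reindex) (auto simp: sh_def inj_on_def)
        also have "\<dots> \<le> (wn 0 f)\<^sup>2" using wn_partial[OF f, of "(\<lambda>k. n + k) ` {..<m}"] by simp
        finally show "(\<Sum>k<m. (1 + real k) powr 0 * (cmod (sh n f k))\<^sup>2) \<le> (wn 0 f)\<^sup>2" .
      qed (rule wn_nonneg[OF f])
      from this[OF inW_diff[OF inW_10[OF w(1)] inW_10[OF v]]]
      show "\<forall>\<^sub>F k in sequentially. wn 0 (\<lambda>j. sh n (w k) j - sh n v j) \<le> wn 0 (\<lambda>j. w k j - v j)"
        by (simp add: sh_def)
      show "\<forall>\<^sub>F k in sequentially. 0 \<le> wn 0 (\<lambda>j. sh n (w k) j - sh n v j)"
        by (intro always_eventually allI wn_nonneg inW_diff s0)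
    qed
  qed (use hl g s0 in auto)
  then have "(\<lambda>k. cnj (ip (h k) (sh n (w k)))) \<longlonglongrightarrow> cnj (ip g (sh n v))" by (rule tendsto_cnj)
  then show ?thesis unfolding Hank_ip ip_cnj[OF h(1) s0(2)] ip_cnj[OF g s0(1)] .
qed

text \<open>Induction on the power of H. By \<open>wn0_strong\<close> the rows converge strongly in
  L^2, so \<open>Hank_weak\<close> passes to the limit although its argument converges only
  weakly.\<close>

lemma Jfun_weak:
  assumes w: "\<And>k. inW 1 (w k)" "\<And>k. wn 1 (w k) \<le> C" and lim: "\<And>j. (\<lambda>k. w k j) \<longlonglongrightarrow> v j"
  shows "(\<lambda>k. Jfun n (w k)) \<longlonglongrightarrow> Jfun n v"
proof -
  have v: "inW 1 v" by (rule wn1_limit(1)[OF w lim])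
  have C: "0 \<le> C" using wn_nonneg[OF w(1)[of 0]] w(2)[of 0] by linarith
  have bd: "wn 0 (Hp (w k) q) \<le> C ^ q * wn 0 one_seq" for k q
  proof (induction q)
    case (Suc q)
    have "wn 0 (Hp (w k) (Suc q)) \<le> wn 1 (w k) * wn 0 (Hp (w k) q)"
      using Hank_bound(2)[OF w(1)[of k] Hp_0[OF w(1)[of k], of q]] by simp
    also have "\<dots> \<le> C * (C ^ q * wn 0 one_seq)"
      by (intro mult_mono w(2) Suc C wn_nonneg Hp_0 w(1))
    finally show ?case by (simp add: mult.assoc)
  qed simp
  have "(\<lambda>k. Hp (w k) q j) \<longlonglongrightarrow> Hp v q j" for q j
  proof (induction q arbitrary: j)
    case (Suc q)
    have "(\<lambda>k. Hank (w k) (Hp (w k) q) j) \<longlonglongrightarrow> Hank v (Hp v q) j"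
      by (rule Hank_weak[OF w lim Hp_0[OF w(1)] bd Suc Hp_0[OF v]])
    then show ?case by simp
  qed simp
  then show ?thesis unfolding Jfun_def .
qed

text \<open>Weak convergence plus convergence of norms. The squared tail of \<open>w k\<close> is at
  most b k minus its head, which tends to the squared tail of v and is therefore uniformly small; an
  upper bound for the norms suffices.\<close>

lemma H12_strong:
  assumes w: "\<And>k. inW 1 (w k)" and v: "inW 1 v" and lim: "\<And>j. (\<lambda>k. w k j) \<longlonglongrightarrow> v j"
    and b: "\<And>k. (wn 1 (w k))\<^sup>2 \<le> b k" "b \<longlonglongrightarrow> (wn 1 v)\<^sup>2"
  shows "(\<lambda>k. wn 1 (\<lambda>j. w k j - v j)) \<longlonglongrightarrow> 0"
proof -
  define S where "S R f = (\<Sum>j<R. (1 + real j) powr 1 * (cmod (f j))\<^sup>2)" for R :: nat and f :: "nat \<Rightarrow> complex"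
  have z1: "inW 1 (\<lambda>j. w k j - v j)" for k by (rule inW_diff[OF w v])
  have mono: "S R f \<le> S n f" if "R \<le> n" for R n f
    unfolding S_def by (rule sum_mono2) (use that in auto)
  have Sle: "S n f \<le> (wn 1 f)\<^sup>2" if "inW 1 f" for n f
    unfolding S_def by (rule wn_partial[OF that]) simp
  have est: "(wn 1 (\<lambda>j. w k j - v j))\<^sup>2 \<le> S R (\<lambda>j. w k j - v j) + 2 * (b k - S R (w k)) + 2 * ((wn 1 v)\<^sup>2 - S R v)" for k R
  proof -
    let ?z = "\<lambda>j. w k j - v j"
    have nb: "S n ?z \<le> S R ?z + 2 * (b k - S R (w k)) + 2 * ((wn 1 v)\<^sup>2 - S R v)" if n: "R \<le> n" for n
    proof -
      have split: "S n f = S R f + (\<Sum>j=R..<n. (1 + real j) powr 1 * (cmod (f j))\<^sup>2)" for f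
        unfolding S_def lessThan_atLeast0 by (rule sum.atLeastLessThan_concat[symmetric]) (use n in auto)
      have "(\<Sum>j=R..<n. (1 + real j) powr 1 * (cmod (?z j))\<^sup>2)
        \<le> (\<Sum>j=R..<n. 2 * ((1 + real j) powr 1 * (cmod (w k j))\<^sup>2) + 2 * ((1 + real j) powr 1 * (cmod (v j))\<^sup>2))"
      proof (rule sum_mono)
        fix j
        have "(cmod (?z j))\<^sup>2 \<le> (cmod (w k j) + cmod (v j))\<^sup>2"
          by (rule power_mono[OF norm_triangle_ineq4]) simp
        also have "\<dots> \<le> 2 * (cmod (w k j))\<^sup>2 + 2 * (cmod (v j))\<^sup>2"
          using zero_le_power2[of "cmod (w k j) - cmod (v j)"] by (simp add: power2_eq_square algebra_simps)
        finally have "(1 + real j) powr 1 * (cmod (?z j))\<^sup>2 \<le> (1 + real j) powr 1 * (2 * (cmod (w k j))\<^sup>2 + 2 * (cmod (v j))\<^sup>2)"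
          by (rule mult_left_mono) simp
        then show "(1 + real j) powr 1 * (cmod (?z j))\<^sup>2 \<le> 2 * ((1 + real j) powr 1 * (cmod (w k j))\<^sup>2) + 2 * ((1 + real j) powr 1 * (cmod (v j))\<^sup>2)"
          by (simp only: distrib_left mult.left_commute)
      qed
      also have "\<dots> = 2 * (S n (w k) - S R (w k)) + 2 * (S n v - S R v)"
        unfolding split sum.distrib sum_distrib_left[symmetric] by simp
      finally show ?thesis
        using split[of ?z] Sle[OF w[of k], of n] Sle[OF v, of n] b(1)[of k] by simp
    qed
    have "S n ?z \<le> S R ?z + 2 * (b k - S R (w k)) + 2 * ((wn 1 v)\<^sup>2 - S R v)" for n
      using nb[of "max R n"] mono[of n "max R n" ?z] by simp
    then have "wsq 1 ?z \<le> S R ?z + 2 * (b k - S R (w k)) + 2 * ((wn 1 v)\<^sup>2 - S R v)"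
      unfolding wsq_def S_def using z1[of k] by (intro suminf_le_const) (auto simp: inW_def)
    then show ?thesis unfolding wn_sq[OF z1] .
  qed
  have Sl: "(\<lambda>R. S R v) \<longlonglongrightarrow> (wn 1 v)\<^sup>2"
    unfolding S_def wn_sq[OF v] wsq_def using v unfolding inW_def by (rule summable_LIMSEQ)
  have "(\<lambda>k. (wn 1 (\<lambda>j. w k j - v j))\<^sup>2) \<longlonglongrightarrow> 0"
  proof (rule LIMSEQ_I)
    fix e :: real assume e: "0 < e"
    have "\<forall>\<^sub>F R in sequentially. (wn 1 v)\<^sup>2 - e / 4 < S R v"
      by (rule order_tendstoD(1)[OF Sl]) (use e in simp)
    then obtain R where R: "(wn 1 v)\<^sup>2 - e / 4 < S R v" by (auto simp: eventually_sequentially)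
    have "(\<lambda>k. S R (\<lambda>j. w k j - v j) + 2 * (b k - S R (w k)) + 2 * ((wn 1 v)\<^sup>2 - S R v))
      \<longlonglongrightarrow> S R (\<lambda>j. v j - v j) + 2 * ((wn 1 v)\<^sup>2 - S R v) + 2 * ((wn 1 v)\<^sup>2 - S R v)"
      unfolding S_def
      by (intro tendsto_add tendsto_mult tendsto_diff tendsto_sum tendsto_power tendsto_norm lim b(2) tendsto_const)
    moreover have "S R (\<lambda>j. v j - v j) + 2 * ((wn 1 v)\<^sup>2 - S R v) + 2 * ((wn 1 v)\<^sup>2 - S R v) < e"
    proof -
      have "S R (\<lambda>j. v j - v j) = 0" by (simp add: S_def)
      then show ?thesis using R by (simp only: ) (simp add: field_simps)
    qed
    ultimately have "\<forall>\<^sub>F k in sequentially. S R (\<lambda>j. w k j - v j) + 2 * (b k - S R (w k)) + 2 * ((wn 1 v)\<^sup>2 - S R v) < e"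
      by (rule order_tendstoD(2))
    then obtain k0 where k0: "\<And>k. k0 \<le> k \<Longrightarrow> S R (\<lambda>j. w k j - v j) + 2 * (b k - S R (w k)) + 2 * ((wn 1 v)\<^sup>2 - S R v) < e"
      by (auto simp: eventually_sequentially)
    have "norm ((wn 1 (\<lambda>j. w k j - v j))\<^sup>2 - 0) < e" if "k0 \<le> k" for k
      using est[of k R] k0[OF that] by simp
    then show "\<exists>k0. \<forall>k\<ge>k0. norm ((wn 1 (\<lambda>j. w k j - v j))\<^sup>2 - 0) < e" by blast
  qed
  then have "(\<lambda>k. sqrt ((wn 1 (\<lambda>j. w k j - v j))\<^sup>2)) \<longlonglongrightarrow> sqrt 0" by (rule tendsto_real_sqrt)
  then show ?thesis by (simp add: wn_nonneg[OF z1])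
qed

lemma wn0_J:
  assumes "inW 1 u"
  shows "(wn 0 u)\<^sup>2 = Re (Jfun 1 u)"
proof -
  have "complex_of_real ((wn 0 u)\<^sup>2) = Jfun 1 u"
    using J_gram[OF assms, of 0 0] ip_self[OF inW_10[OF assms]] by simp
  then show ?thesis by (metis Re_complex_of_real)
qed

context interlaced
begin

text \<open>\<open>spec_exists\<close> enters here: without an admissible function of momentum
  \<open>m0\<close>, a minimiser need not satisfy the equality case of the lower bound.\<close>

lemma minimiser_iff: "(\<exists>E. spec u E) \<longleftrightarrow> admissible u \<and> (\<forall>v. admissible v \<longrightarrow> Mfun u \<le> Mfun v)"
proof
  assume "\<exists>E. spec u E"
  then show "admissible u \<and> (\<forall>v. admissible v \<longrightarrow> Mfun u \<le> Mfun v)"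
    using spec_admissible spec_M admissible_lower(1) by auto
next
  assume a: "admissible u \<and> (\<forall>v. admissible v \<longrightarrow> Mfun u \<le> Mfun v)"
  obtain v E where v: "spec v E" using spec_exists by blast
  have "Mfun u \<le> m0" using a spec_admissible[OF v] spec_M[OF v] by metis
  then show "\<exists>E. spec u E" using admissible_lower(2) a by blast
qed

text \<open>The weak limit is admissible by \<open>Jfun_weak\<close> and has momentum at most
  \<open>m0\<close> by lower semicontinuity, hence lies in the torus. Its norm is then the limit of
  the upper bounds \<open>b\<close>, so the convergence is strong.\<close>

lemma minimising_sequence:
  assumes w: "\<And>k. inW 1 (w k)"
    and J: "\<And>n. n \<in> {1..2*N} \<Longrightarrow> (\<lambda>k. Jfun n (w k)) \<longlonglongrightarrow> (\<Sum>j=1..N. nu j * x j ^ (n - 1))"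
    and M: "\<And>k. Mfun (w k) \<le> m k" "m \<longlonglongrightarrow> m0"
  shows "\<exists>r v. strict_mono r \<and> (\<exists>E. spec v E) \<and> (\<lambda>k. wn 1 (\<lambda>j. w (r k) j - v j)) \<longlonglongrightarrow> 0"
proof -
  define b where "b k = m k + Re (Jfun 1 (w k))" for k
  have bb: "(wn 1 (w k))\<^sup>2 \<le> b k" for k
    using Mfun_wn[OF w[of k]] wn0_J[OF w[of k]] M(1)[of k] by (simp add: b_def)
  have J1: "(\<lambda>k. Re (Jfun 1 (w k))) \<longlonglongrightarrow> (\<Sum>j=1..N. nu j)"
    using tendsto_Re[OF J[of 1]] N1 by simp
  then have bl: "b \<longlonglongrightarrow> m0 + (\<Sum>j=1..N. nu j)"
    unfolding b_def by (intro tendsto_add M(2))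
  then have "Bseq b" by (rule convergent_imp_Bseq[OF convergentI])
  then obtain B where B: "0 < B" "\<And>k. norm (b k) \<le> B" by (auto simp: Bseq_def)
  have wb: "wn 1 (w k) \<le> sqrt B" for k
    using bb[of k] B(2)[of k] by (intro real_le_rsqrt) (auto intro: order_trans abs_ge_self)
  have "cmod (w k j) \<le> sqrt B" for k j
    using coeff_le_wn[OF w[of k], of j] wb[of k] by simp
  then obtain r v where r: "strict_mono r" "\<And>j. (\<lambda>k. w (r k) j) \<longlonglongrightarrow> v j"
    using pointwise_subseq[of w "\<lambda>_. sqrt B"] by blast
  have v: "inW 1 v" by (rule wn1_limit(1)[OF w wb r(2)])
  have Jv: "Jfun n v = (\<Sum>j=1..N. nu j * x j ^ (n - 1))" if n: "n \<in> {1..2*N}" for n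
  proof (rule LIMSEQ_unique)
    show "(\<lambda>k. Jfun n (w (r k))) \<longlonglongrightarrow> Jfun n v" by (rule Jfun_weak[OF w wb r(2)])
    show "(\<lambda>k. Jfun n (w (r k))) \<longlonglongrightarrow> (\<Sum>j=1..N. nu j * x j ^ (n - 1))"
      using LIMSEQ_subseq_LIMSEQ[OF J[OF n] r(1)] by (simp add: o_def)
  qed
  then have adm: "admissible v" using v by (simp add: admissible_def)
  have ml: "(\<lambda>k. m (r k)) \<longlonglongrightarrow> m0" using LIMSEQ_subseq_LIMSEQ[OF M(2) r(1)] by (simp add: o_def)
  have "(\<Sum>n<R. real n * (cmod (v n))\<^sup>2) \<le> m0" for R
  proof (rule LIMSEQ_le[OF _ ml])
    show "(\<lambda>k. \<Sum>n<R. real n * (cmod (w (r k) n))\<^sup>2) \<longlonglongrightarrow> (\<Sum>n<R. real n * (cmod (v n))\<^sup>2)"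
      by (intro tendsto_sum tendsto_mult tendsto_const tendsto_power tendsto_norm r(2))
    have "(\<Sum>n<R. real n * (cmod (w k n))\<^sup>2) \<le> Mfun (w k)" for k
      unfolding Mfun_def by (rule sum_le_suminf[OF Mfun_summable[OF w]]) auto
    then show "\<exists>k0. \<forall>k\<ge>k0. (\<Sum>n<R. real n * (cmod (w (r k) n))\<^sup>2) \<le> m (r k)"
      using M(1) order_trans by blast
  qed
  then have "Mfun v \<le> m0" unfolding Mfun_def by (rule suminf_le_const[OF Mfun_summable[OF v]])
  then obtain E where E: "spec v E" using admissible_lower(2)[OF adm] by blast
  have "(wn 1 v)\<^sup>2 = m0 + (\<Sum>j=1..N. nu j)"
    using Mfun_wn[OF v] wn0_J[OF v] spec_M[OF E] Jv[of 1] N1 by simp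
  then have "(\<lambda>k. b (r k)) \<longlonglongrightarrow> (wn 1 v)\<^sup>2" using LIMSEQ_subseq_LIMSEQ[OF bl r(1)] by (simp add: o_def)
  then have "(\<lambda>k. wn 1 (\<lambda>j. w (r k) j - v j)) \<longlonglongrightarrow> 0"
    by (rule H12_strong[OF w v r(2) bb])
  then show ?thesis using r(1) E by blast
qed

lemma spec_norms:
  assumes "spec v E"
  shows "wn 1 v = sqrt (m0 + (\<Sum>j=1..N. nu j))" "wn 0 v = sqrt (\<Sum>j=1..N. nu j)"
proof -
  have v: "inW 1 v" using assms by (simp add: spec_def)
  have n0: "(wn 0 v)\<^sup>2 = (\<Sum>j=1..N. nu j)" using wn0_J[OF v] spec_J[OF assms, of 0] by simp
  then show "wn 0 v = sqrt (\<Sum>j=1..N. nu j)"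
    using real_sqrt_unique[OF _ wn_nonneg[OF inW_10[OF v]]] by metis
  have "(wn 1 v)\<^sup>2 = m0 + (\<Sum>j=1..N. nu j)" using Mfun_wn[OF v] spec_M[OF assms] n0 by simp
  then show "wn 1 v = sqrt (m0 + (\<Sum>j=1..N. nu j))"
    using real_sqrt_unique[OF _ wn_nonneg[OF v]] by metis
qed

text \<open>A contradiction argument: initial data approach the torus while the solutions at times
  t_k stay away from it. The latter form a minimising sequence by the conservation of J and the
  monotonicity of M, so a subsequence converges to the torus after all.\<close>

lemma stability:
  assumes "0 < \<epsilon>"
  shows "\<exists>\<delta>>0. \<forall>u. szego_sol u \<and> (INF v\<in>{v. \<exists>E. spec v E}. h12norm (u 0 - v)) \<le> \<delta>
    \<longrightarrow> (\<forall>t. (INF v\<in>{v. \<exists>E. spec v E}. h12norm (u t - v)) \<le> \<epsilon>)"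
proof (rule ccontr)
  let ?T = "{v. \<exists>E. spec v E}"
  have hn: "h12norm (f - g) = wn 1 (\<lambda>k. f k - g k)" for f g by (simp add: wn_1 fun_diff_def)
  have T1: "inW 1 v" if "v \<in> ?T" for v using that by (auto simp: spec_def)
  have bdd: "bdd_below ((\<lambda>v. h12norm (f - v)) ` ?T)" if f: "inW 1 f" for f
    unfolding hn by (rule bdd_belowI2[of _ 0]) (rule wn_nonneg[OF inW_diff[OF f T1]])
  have ne: "?T \<noteq> {}" using spec_exists by blast
  assume "\<not> ?thesis"
  then have "\<forall>\<delta>>0. \<exists>u t. szego_sol u \<and> (INF v\<in>?T. h12norm (u 0 - v)) \<le> \<delta> \<and> \<epsilon> < (INF v\<in>?T. h12norm (u t - v))"
    by (auto simp: not_le)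
  then have "\<exists>u t. szego_sol u \<and> (INF v\<in>?T. h12norm (u 0 - v)) \<le> 1 / real (Suc k) \<and> \<epsilon> < (INF v\<in>?T. h12norm (u t - v))" for k
    by simp
  then obtain U t where U: "\<And>k. szego_sol (U k)" "\<And>k. (INF v\<in>?T. h12norm (U k 0 - v)) \<le> 1 / real (Suc k)"
    "\<And>k. \<epsilon> < (INF v\<in>?T. h12norm (U k (t k) - v))"
    by metis
  have U1: "inW 1 (U k s)" for k s by (rule szegoD(1)[OF U(1)])
  have "\<exists>v\<in>?T. h12norm (U k 0 - v) < 2 / real (Suc k)" for k
  proof -
    have "(INF v\<in>?T. h12norm (U k 0 - v)) < 2 / real (Suc k)"
      using U(2)[of k] by (rule le_less_trans) (simp add: divide_strict_right_mono)
    then show ?thesis using cINF_less_iff[OF ne bdd[OF U1]] by blast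
  qed
  then obtain V where V: "\<And>k. V k \<in> ?T" "\<And>k. h12norm (U k 0 - V k) < 2 / real (Suc k)" by metis
  define a where "a k = U k 0" for k
  have a1: "inW 1 (a k)" for k unfolding a_def by (rule U1)
  have V1: "inW 1 (V k)" for k by (rule T1[OF V(1)])
  have two: "(\<lambda>k. 2 / real (Suc k)) \<longlonglongrightarrow> 0" by (rule LIMSEQ_Suc[OF lim_const_over_n])
  have d1: "(\<lambda>k. wn 1 (\<lambda>j. a k j - V k j)) \<longlonglongrightarrow> 0"
  proof (rule tendsto_sandwich[OF _ _ tendsto_const two])
    show "\<forall>\<^sub>F k in sequentially. wn 1 (\<lambda>j. a k j - V k j) \<le> 2 / real (Suc k)"
      using V(2) by (intro always_eventually allI) (simp add: hn a_def less_imp_le)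
    show "\<forall>\<^sub>F k in sequentially. 0 \<le> wn 1 (\<lambda>j. a k j - V k j)"
      by (intro always_eventually allI wn_nonneg inW_diff a1 V1)
  qed
  have conv: "(\<lambda>k. wn s (a k)) \<longlonglongrightarrow> c" if s: "s \<le> 1" and c: "\<And>k. wn s (V k) = c" for s c
  proof -
    have "(\<lambda>k. wn s (a k) - c) \<longlonglongrightarrow> 0"
    proof (rule tendsto_rabs_zero_cancel, rule tendsto_sandwich[OF _ _ tendsto_const d1])
      have "\<bar>wn s (a k) - c\<bar> \<le> wn 1 (\<lambda>j. a k j - V k j)" for k
        using wn_diff_triangle[OF inW_mono[OF a1 s] inW_mono[OF V1 s], of k k] c[of k]
          wn_mono[OF inW_diff[OF a1 V1] s, of k k] by simp
      then show "\<forall>\<^sub>F k in sequentially. \<bar>wn s (a k) - c\<bar> \<le> wn 1 (\<lambda>j. a k j - V k j)" by simp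
    qed auto
    then show ?thesis using LIM_zero_iff by blast
  qed
  have Vn: "wn 1 (V k) = sqrt (m0 + (\<Sum>j=1..N. nu j))" "wn 0 (V k) = sqrt (\<Sum>j=1..N. nu j)" for k
    using V(1)[of k] spec_norms by auto
  have a1l: "(\<lambda>k. wn 1 (a k)) \<longlonglongrightarrow> sqrt (m0 + (\<Sum>j=1..N. nu j))" by (rule conv[OF _ Vn(1)]) simp
  have a0l: "(\<lambda>k. wn 0 (a k)) \<longlonglongrightarrow> sqrt (\<Sum>j=1..N. nu j)" by (rule conv[OF _ Vn(2)]) simp
  have Ma: "(\<lambda>k. Mfun (a k)) \<longlonglongrightarrow> m0"
  proof -
    have s0: "0 \<le> (\<Sum>j=1..N. nu j)" by (intro sum_nonneg) (use nu_pos in \<open>auto simp: less_imp_le\<close>)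
    obtain v E where v: "spec v E" using spec_exists by blast
    have vv: "inW 1 v" using v by (simp add: spec_def)
    have m0: "0 \<le> m0"
      unfolding spec_M[OF v, symmetric] Mfun_def by (rule suminf_nonneg[OF Mfun_summable[OF vv]]) simp
    have "(\<lambda>k. (wn 1 (a k))\<^sup>2 - (wn 0 (a k))\<^sup>2) \<longlonglongrightarrow> (sqrt (m0 + (\<Sum>j=1..N. nu j)))\<^sup>2 - (sqrt (\<Sum>j=1..N. nu j))\<^sup>2"
      by (intro tendsto_diff tendsto_power a1l a0l)
    then show ?thesis using Mfun_wn[OF a1] s0 m0 by simp
  qed
  have VJ: "Jfun n (V k) = (\<Sum>j=1..N. nu j * x j ^ (n - 1))" if "n \<in> {1..2*N}" for n k
    using V(1)[of k] spec_admissible that by (auto simp: admissible_def)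
  \<comment> \<open>First use of compactness, for the torus itself: the nearby points
    \<open>V k\<close> vary with k, and \<open>Jfun_weak\<close> yields limits of J at the initial
    data only along a coefficientwise convergent subsequence.\<close>
  obtain r v where r: "strict_mono r" and v: "\<exists>E. spec v E" and rl: "(\<lambda>k. wn 1 (\<lambda>j. V (r k) j - v j)) \<longlonglongrightarrow> 0"
  proof -
    have "\<exists>r v. strict_mono r \<and> (\<exists>E. spec v E) \<and> (\<lambda>k. wn 1 (\<lambda>j. V (r k) j - v j)) \<longlonglongrightarrow> 0"
    proof (rule minimising_sequence[OF V1])
      show "(\<lambda>k. Jfun n (V k)) \<longlonglongrightarrow> (\<Sum>j=1..N. nu j * x j ^ (n - 1))" if "n \<in> {1..2*N}" for n
        using VJ[OF that] by simp
      show "Mfun (V k) \<le> m0" for k using V(1)[of k] spec_M by auto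
    qed simp
    then show ?thesis using that by blast
  qed
  have vW: "inW 1 v" using v by (auto simp: spec_def)
  have vJ: "Jfun n v = (\<Sum>j=1..N. nu j * x j ^ (n - 1))" if "n \<in> {1..2*N}" for n
    using v spec_admissible that by (auto simp: admissible_def)
  have pt: "(\<lambda>k. a (r k) j) \<longlonglongrightarrow> v j" for j
  proof -
    have z: "(\<lambda>k. wn 1 (\<lambda>j. a (r k) j - V (r k) j) + wn 1 (\<lambda>j. V (r k) j - v j)) \<longlonglongrightarrow> 0 + 0"
      using LIMSEQ_subseq_LIMSEQ[OF d1 r] rl by (intro tendsto_add) (auto simp: o_def)
    have "(\<lambda>k. a (r k) j - v j) \<longlonglongrightarrow> 0"
    proof (rule tendsto_norm_zero_cancel, rule tendsto_sandwich[OF _ _ tendsto_const])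
      have "norm (a (r k) j - v j) \<le> wn 1 (\<lambda>j. a (r k) j - V (r k) j) + wn 1 (\<lambda>j. V (r k) j - v j)" for k
        using norm_triangle_ineq[of "a (r k) j - V (r k) j" "V (r k) j - v j"]
          coeff_le_wn[OF inW_diff[OF a1[of "r k"] V1[of "r k"]], of j] coeff_le_wn[OF inW_diff[OF V1[of "r k"] vW], of j] by simp
      then show "\<forall>\<^sub>F k in sequentially. norm (a (r k) j - v j) \<le> wn 1 (\<lambda>j. a (r k) j - V (r k) j) + wn 1 (\<lambda>j. V (r k) j - v j)"
        by simp
      show "(\<lambda>k. wn 1 (\<lambda>j. a (r k) j - V (r k) j) + wn 1 (\<lambda>j. V (r k) j - v j)) \<longlonglongrightarrow> 0" using z by simp
    qed auto
    then show ?thesis using LIM_zero_iff by blast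
  qed
  have "Bseq (\<lambda>k. wn 1 (a k))" by (rule convergent_imp_Bseq[OF convergentI[OF a1l]])
  then obtain B where "\<And>k. norm (wn 1 (a k)) \<le> B" by (auto simp: Bseq_def)
  then have B: "wn 1 (a k) \<le> B" for k by (metis abs_ge_self order_trans real_norm_def)
  define w where "w k = U (r k) (t (r k))" for k
  have w1: "inW 1 (w k)" for k unfolding w_def by (rule U1)
  \<comment> \<open>Second use, for the solutions at the times at which they are far from the
    torus.\<close>
  obtain r' v' where r': "strict_mono r'" and v': "v' \<in> ?T" and lim: "(\<lambda>k. wn 1 (\<lambda>j. w (r' k) j - v' j)) \<longlonglongrightarrow> 0"
  proof -
    have "\<exists>r v. strict_mono r \<and> (\<exists>E. spec v E) \<and> (\<lambda>k. wn 1 (\<lambda>j. w (r k) j - v j)) \<longlonglongrightarrow> 0"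
    proof (rule minimising_sequence[OF w1])
      fix n assume n: "n \<in> {1..2*N}"
      have "Jfun n (w k) = Jfun n (a (r k))" for k unfolding w_def a_def by (rule J_conserved[OF U(1)])
      moreover have "(\<lambda>k. Jfun n (a (r k))) \<longlonglongrightarrow> Jfun n v" by (rule Jfun_weak[OF a1 B pt])
      ultimately show "(\<lambda>k. Jfun n (w k)) \<longlonglongrightarrow> (\<Sum>j=1..N. nu j * x j ^ (n - 1))" using vJ[OF n] by simp
    next
      show "Mfun (w k) \<le> Mfun (a (r k))" for k unfolding w_def a_def by (rule momentum_nonincreasing[OF U(1)])
      show "(\<lambda>k. Mfun (a (r k))) \<longlonglongrightarrow> m0" using LIMSEQ_subseq_LIMSEQ[OF Ma r] by (simp add: o_def)
    qed
    then show ?thesis using that by blast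
  qed
  have "\<forall>\<^sub>F k in sequentially. wn 1 (\<lambda>j. w (r' k) j - v' j) < \<epsilon>"
    by (rule order_tendstoD(2)[OF lim assms])
  then obtain k where k: "wn 1 (\<lambda>j. w (r' k) j - v' j) < \<epsilon>" by (auto simp: eventually_sequentially)
  have "(INF v\<in>?T. h12norm (w (r' k) - v)) \<le> h12norm (w (r' k) - v')"
    by (rule cINF_lower[OF bdd[OF w1] v'])
  then show False using U(3)[of "r (r' k)"] k unfolding hn w_def by simp
qed

end

theorem theorem3:
  fixes N :: nat and I L :: "nat \<Rightarrow> real"
  assumes "N \<ge> 1" and "OmegaN N I L"
  shows "Tset N I L =
           {u. H12 u \<and> (\<forall>n\<in>{1..2*N}. Jfun n u = complex_of_real (jval N I L n)) \<and>
               (\<forall>v. H12 v \<and> (\<forall>n\<in>{1..2*N}. Jfun n v = complex_of_real (jval N I L n))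
                    \<longrightarrow> Mfun u \<le> Mfun v)}
       \<and> (\<forall>\<epsilon>>0. \<exists>\<delta>>0. \<forall>u. szego_sol u \<and>
              (INF v\<in>Tset N I L. h12norm (u 0 - v)) \<le> \<delta>
              \<longrightarrow> (\<forall>t. (INF v\<in>Tset N I L. h12norm (u t - v)) \<le> \<epsilon>))"
proof -
  \<comment> \<open>The halves turn the actions I_j and L_m into the eigenvalues lambda_j^2 and
    mu_m^2.\<close>
  interpret interlaced N "\<lambda>j. I j / 2" "\<lambda>j. L j / 2"
    using assms by unfold_locales (auto simp: OmegaN_def)
  have T: "Tset N I L = {u. \<exists>E. spec u E}" using Tset_iff_spec by auto
  have adm: "admissible u \<longleftrightarrow> H12 u \<and> (\<forall>n\<in>{1..2*N}. Jfun n u = complex_of_real (jval N I L n))" for u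
  proof -
    have "complex_of_real (jval N I L n) = (\<Sum>j=1..N. nu j * (I j / 2) ^ (n - 1))" if "n \<in> {1..2*N}" for n
      using jval_nu[of n] that by simp
    then show ?thesis unfolding admissible_def inW_1 by auto
  qed
  show ?thesis
  proof (intro conjI)
    show "Tset N I L = {u. H12 u \<and> (\<forall>n\<in>{1..2*N}. Jfun n u = complex_of_real (jval N I L n)) \<and>
               (\<forall>v. H12 v \<and> (\<forall>n\<in>{1..2*N}. Jfun n v = complex_of_real (jval N I L n))
                    \<longrightarrow> Mfun u \<le> Mfun v)}"
      unfolding T minimiser_iff adm by blast
    show "\<forall>\<epsilon>>0. \<exists>\<delta>>0. \<forall>u. szego_sol u \<and>
              (INF v\<in>Tset N I L. h12norm (u 0 - v)) \<le> \<delta>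
              \<longrightarrow> (\<forall>t. (INF v\<in>Tset N I L. h12norm (u t - v)) \<le> \<epsilon>)"
      unfolding T using stability by blast
  qed
qed

end
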